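(* Let $r\ge2$ and let $\vec F_{2,r}$ be an anti-directed orientation of $F_{2,r}$. Then for all sufficiently large $n$, $$D(n,\vec F_{2,r})=2^{\mathrm{ex}(n,F_{2,r})}=2^{t(n,r-1)+1}.$$
   Context: The $(k,r)$-fan $F_{k,r}$ consists of $k$ copies of $K_r$ sharing exactly one common vertex (the center). An orientation of $F_{k,r}$ is anti-directed if each copy of $K_r$ contains at least one edge directed into the center and at least one edge directed out of the center. For a directed graph $\vec H$, $D(n,\vec H)$ is the maximum, over all $n$-vertex graphs $G$, of the number of orientations of $G$ containing no copy of $\vec H$. $\mathrm{ex}(n,F)$ is the Turán number of $F$, and $t(n,p)$ is the number of edges of the complete balanced $p$-partite graph on $n$ vertices. *)

theory Defs
  imports Main
begin

definition all_edges :: "nat \<Rightarrow> nat set set" where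
  "all_edges n = {{u, v} | u v. u \<noteq> v \<and> u < n \<and> v < n}"

definition is_orientation :: "'a set set \<Rightarrow> ('a \<times> 'a) set \<Rightarrow> bool" where
  "is_orientation E Or \<longleftrightarrow>
     (\<forall>(u, v) \<in> Or. {u, v} \<in> E \<and> u \<noteq> v) \<and>
     (\<forall>u v. u \<noteq> v \<longrightarrow> {u, v} \<in> E \<longrightarrow> ((u, v) \<in> Or \<longleftrightarrow> (v, u) \<notin> Or))"

definition contains_dicopy :: "nat \<Rightarrow> ('a set \<times> ('a \<times> 'a) set) \<Rightarrow> (nat \<times> nat) set \<Rightarrow> bool" where
  "contains_dicopy n H Or \<longleftrightarrow>
     (\<exists>f. inj_on f (fst H) \<and> f ` fst H \<subseteq> {..<n} \<and>
          (\<forall>(x, y) \<in> snd H. (f x, f y) \<in> Or))"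

definition contains_copy :: "nat \<Rightarrow> ('a set \<times> 'a set set) \<Rightarrow> nat set set \<Rightarrow> bool" where
  "contains_copy n F E \<longleftrightarrow>
     (\<exists>f. inj_on f (fst F) \<and> f ` fst F \<subseteq> {..<n} \<and> (\<forall>e \<in> snd F. f ` e \<in> E))"

definition D :: "nat \<Rightarrow> ('a set \<times> ('a \<times> 'a) set) \<Rightarrow> nat" where
  "D n H = Max {card {Or. is_orientation E Or \<and> \<not> contains_dicopy n H Or} | E. E \<subseteq> all_edges n}"

definition ex :: "nat \<Rightarrow> ('a set \<times> 'a set set) \<Rightarrow> nat" where
  "ex n F = Max {card E | E. E \<subseteq> all_edges n \<and> \<not> contains_copy n F E}"

text \<open>t(n,p): number of edges of the complete balanced p-partite graph on {0..<n},
  with parts given by residues mod p (part sizes differ by at most one).\<close>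

definition turan_num :: "nat \<Rightarrow> nat \<Rightarrow> nat" where
  "turan_num n p = card {{u, v} | u v. u < n \<and> v < n \<and> u mod p \<noteq> v mod p}"

text \<open>The (k,r)-fan: center 0, and for i < k the block
  B_i = {1 + i(r-1) .. (i+1)(r-1)} of r-1 vertices; each {0} \<union> B_i spans a K_r.\<close>

definition fan_block :: "nat \<Rightarrow> nat \<Rightarrow> nat set" where
  "fan_block r i = {1 + i * (r - 1) .. (i + 1) * (r - 1)}"

definition fan_vertices :: "nat \<Rightarrow> nat \<Rightarrow> nat set" where
  "fan_vertices k r = {0 ..< k * (r - 1) + 1}"

definition fan_edges :: "nat \<Rightarrow> nat \<Rightarrow> nat set set" where
  "fan_edges k r = {{u, v} | u v i. i < k \<and> u \<noteq> v \<and>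
                      u \<in> insert 0 (fan_block r i) \<and> v \<in> insert 0 (fan_block r i)}"

definition fan :: "nat \<Rightarrow> nat \<Rightarrow> nat set \<times> nat set set" where
  "fan k r = (fan_vertices k r, fan_edges k r)"

definition anti_directed :: "nat \<Rightarrow> nat \<Rightarrow> (nat \<times> nat) set \<Rightarrow> bool" where
  "anti_directed k r A \<longleftrightarrow>
     is_orientation (fan_edges k r) A \<and>
     (\<forall>S. S \<subseteq> fan_vertices k r \<and> card S = r \<and>
          (\<forall>u\<in>S. \<forall>v\<in>S. u \<noteq> v \<longrightarrow> {u, v} \<in> fan_edges k r) \<longrightarrow>
          (\<exists>v\<in>S. (v, 0) \<in> A) \<and> (\<exists>v\<in>S. (0, v) \<in> A))"

end

(*
An orientation of a graph E is encoded by the set S of those edges that are directed upwards, so a family of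
orientations is a family of subsets of E and Pajor's inequality (#F <= number of sets shattered by F) applies.

Write p = r - 1. Progressive induction: it suffices to refute a large graph with more than 2 ^ (t(n,p) + 1) fan-free
orientations for which deleting any boundedly large vertex set divides this number by about the amount that the
Turan graph predicts.

Few graphs contain no complete p-partite graph with parts of a fixed large size (an Erdos-Kleitman-Rothschild type
recursion), so by Pajor some such p-partite subgraph of E carries all its patterns, in particular one in which every
oriented K_p occurs on any large subsets of the parts, in a non-negligible share of the orientations. As every block
of the fan has both an in- and an out-neighbour of the centre, vertices seeing all parts, and pairs of disjoint edges
among vertices missing the same part, have exponentially fewer ways to be joined to this subgraph. Hence, by the
criticality, there are few of them, and E is p-partite after deleting few vertices.

The same comparison, now with linear-sized parts, extends the partition to all vertices and shows that for any four
vertices most orientations realise every joint pattern many times. Two edges inside the parts then complete a fan,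
except if p = 2 and each part contains exactly one edge, where 24 of the 64 orientations of a K_4 remain.
*)

theory Submission
  imports Defs Complex_Main "HOL-Library.FuncSet"
begin

section \<open>Counting set families\<close>

text \<open>The obstacle is that a graph with many fan-free orientations may itself contain many
  fans, so stability of fan-free graphs says nothing about it; structure has to come from the family
  of orientations. Pajor's inequality bounds this family by the number of its shattered sets, which
  is why blow-up-free graphs are counted and not merely their edges. The count yields parts of
  bounded size \<open>s\<close> only, and fixing their place costs a factor
  \<open>2 ^ (p * n)\<close>. This is affordable because every vertex or quadruple of the wrong kind
  saves \<open>s / 25\<close> binary digits and \<open>s\<close> is large compared with
  \<open>p\<close>. Parts of linear size become available once the graph is almost
  \<open>p\<close>-partite. Universality speaks of \<open>2 * p\<close> slots, two per part: a fan
  has \<open>2 * p + 1\<close> vertices, each block uses a part at most once, and at least one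
  vertex is always placed by hand. Four vertices are tested at a time since two disjoint edges span
  four. The slack factor 2 in criticality is the potential of the progressive induction. For
  \<open>r = 2\<close> no anti-directed orientation exists, so \<open>p = r - 1\<close> is at least
  2 throughout.\<close>

lemma card_le_split:
  assumes "\<And>S. S \<in> F \<Longrightarrow> S \<subseteq> E1 \<union> E2" "\<And>S. S \<in> F \<Longrightarrow> S \<inter> E1 \<in> P"
    "\<And>S. S \<in> F \<Longrightarrow> S \<inter> E2 \<in> Q" "finite P" "finite Q"
  shows "card F \<le> card P * card Q"
proof -
  have "inj_on (\<lambda>S. (S \<inter> E1, S \<inter> E2)) F"
    by (rule inj_onI) (metis Pair_inject assms(1) inf.orderE Int_Un_distrib)
  moreover have "(\<lambda>S. (S \<inter> E1, S \<inter> E2)) ` F \<subseteq> P \<times> Q" using assms by auto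
  ultimately have "card F \<le> card (P \<times> Q)"
    using card_inj_on_le assms(4,5) by blast
  then show ?thesis by (simp add: card_cartesian_product)
qed

lemma card_le_prod:
  assumes "finite I" "\<And>S. S \<in> F \<Longrightarrow> S \<subseteq> (\<Union>i\<in>I. T i)"
    "\<And>S i. S \<in> F \<Longrightarrow> i \<in> I \<Longrightarrow> S \<inter> T i \<in> P i" "\<And>i. i \<in> I \<Longrightarrow> finite (P i)"
  shows "card F \<le> (\<Prod>i\<in>I. card (P i))"
proof -
  let ?f = "\<lambda>S. \<lambda>i\<in>I. S \<inter> T i"
  have "inj_on ?f F"
  proof (rule inj_onI)
    fix S S' assume a: "S \<in> F" "S' \<in> F" "?f S = ?f S'"
    have "S \<inter> T i = S' \<inter> T i" if "i \<in> I" for i using fun_cong[OF a(3), of i] that by simp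
    then show "S = S'" using assms(2)[OF a(1)] assms(2)[OF a(2)] by blast
  qed
  moreover have "?f ` F \<subseteq> PiE I P" using assms by auto
  moreover have "finite (PiE I P)" using assms by (simp add: finite_PiE)
  ultimately have "card F \<le> card (PiE I P)" using card_inj_on_le by blast
  then show ?thesis using assms(1) by (simp add: card_PiE)
qed

text \<open>The test sets are disjoint, so the traces on them are independent: each loses one of its
  at most \<open>2 ^ K\<close> values and hence a factor \<open>1 - 1 / 2 ^ K\<close>, while the
  remaining edges are free.\<close>

lemma card_pattern_avoiding:
  assumes "finite E" "finite I" "\<And>i. i \<in> I \<Longrightarrow> T i \<subseteq> E" "\<And>i. i \<in> I \<Longrightarrow> B i \<subseteq> T i"
    "\<And>i. i \<in> I \<Longrightarrow> card (T i) \<le> K" "\<And>i j. i \<in> I \<Longrightarrow> j \<in> I \<Longrightarrow> i \<noteq> j \<Longrightarrow> T i \<inter> T j = {}"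
  shows "real (card {S. S \<subseteq> E \<and> (\<forall>i\<in>I. S \<inter> T i \<noteq> B i)}) \<le> 2 ^ card E * (1 - 1 / 2 ^ K) ^ card I"
proof -
  let ?F = "{S. S \<subseteq> E \<and> (\<forall>i\<in>I. S \<inter> T i \<noteq> B i)}" and ?U = "\<Union>i\<in>I. T i"
  have finT: "finite (T i)" if "i \<in> I" for i using assms that finite_subset by metis
  have "card ?F \<le> card ((\<lambda>S. S \<inter> ?U) ` ?F) * card (Pow (E - ?U))"
    by (rule card_le_split[where ?E1.0 = ?U and ?E2.0 = "E - ?U"]) (use assms in auto)
  also have "card ((\<lambda>S. S \<inter> ?U) ` ?F) \<le> (\<Prod>i\<in>I. card (Pow (T i) - {B i}))"
  proof (rule card_le_prod[where T = T])
    fix S' i assume a: "S' \<in> (\<lambda>S. S \<inter> ?U) ` ?F" "i \<in> I"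
    then obtain S where S: "S \<in> ?F" "S' = S \<inter> ?U" by blast
    have "S' \<inter> T i = S \<inter> T i" using S(2) a(2) by blast
    moreover have "S \<inter> T i \<noteq> B i" using S(1) a(2) by blast
    ultimately show "S' \<inter> T i \<in> Pow (T i) - {B i}" by simp
  qed (use assms(2) finT in auto)
  also have "(\<Prod>i\<in>I. card (Pow (T i) - {B i})) = (\<Prod>i\<in>I. 2 ^ card (T i) - 1)"
    by (rule prod.cong) (use assms(4) finT in \<open>auto simp: card_Pow\<close>)
  finally have 1: "card ?F \<le> (\<Prod>i\<in>I. 2 ^ card (T i) - 1) * 2 ^ card (E - ?U)"
    using assms(1) by (simp add: card_Pow)
  have "real (\<Prod>i\<in>I. 2 ^ card (T i) - 1) \<le> (\<Prod>i\<in>I. 2 ^ card (T i) * (1 - 1 / 2 ^ K))"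
    unfolding of_nat_prod
  proof (rule prod_mono, safe)
    fix i assume i: "i \<in> I"
    have "(2::real) ^ card (T i) \<le> 2 ^ K" using assms(5)[OF i] by (simp add: power_increasing)
    then have "(1::real) - 1 / 2 ^ card (T i) \<le> 1 - 1 / 2 ^ K" by (simp add: field_simps)
    then have "2 ^ card (T i) * ((1::real) - 1 / 2 ^ card (T i)) \<le> 2 ^ card (T i) * (1 - 1 / 2 ^ K)"
      by (intro mult_left_mono) auto
    then show "real (2 ^ card (T i) - 1) \<le> 2 ^ card (T i) * (1 - 1 / 2 ^ K)"
      by (simp add: field_simps of_nat_diff)
  qed simp
  also have "\<dots> = 2 ^ (\<Sum>i\<in>I. card (T i)) * (1 - 1 / 2 ^ K) ^ card I"
    by (simp add: prod.distrib power_sum)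
  also have "(\<Sum>i\<in>I. card (T i)) = card ?U"
    by (rule card_UN_disjoint[symmetric]) (use assms finT in auto)
  finally have 2: "real (\<Prod>i\<in>I. 2 ^ card (T i) - 1) \<le> 2 ^ card ?U * (1 - 1 / 2 ^ K) ^ card I" .
  have U: "card E = card ?U + card (E - ?U)"
    using assms(1,3) by (metis UN_least card_Diff_subset card_mono finite_subset le_add_diff_inverse)
  have "real (card ?F) \<le> real (\<Prod>i\<in>I. 2 ^ card (T i) - 1) * 2 ^ card (E - ?U)"
    using 1 by (metis (mono_tags, lifting) of_nat_le_iff of_nat_mult of_nat_numeral of_nat_power)
  also have "\<dots> \<le> 2 ^ card ?U * (1 - 1 / 2 ^ K) ^ card I * 2 ^ card (E - ?U)"
    using 2 by (intro mult_right_mono) auto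
  also have "\<dots> = 2 ^ card E * (1 - 1 / 2 ^ K) ^ card I" unfolding U by (simp add: power_add)
  finally show ?thesis .
qed

section \<open>Entropy bound for small subsets\<close>

definition small_subsets :: "'a set \<Rightarrow> nat \<Rightarrow> 'a set set" where
  "small_subsets A c = {Z. Z \<subseteq> A \<and> card Z < c}"

lemma finite_small_subsets [simp]: "finite A \<Longrightarrow> finite (small_subsets A c)"
  unfolding small_subsets_def by simp

lemma sum_Pow_power_card:
  fixes x :: real
  assumes "finite A"
  shows "(\<Sum>Z\<in>Pow A. x ^ card Z) = (1 + x) ^ card A"
  using assms
proof induction
  case (insert a A)
  have "(\<Sum>Z\<in>Pow (insert a A). x ^ card Z) = (\<Sum>Z\<in>Pow A. x ^ card Z) + (\<Sum>Z\<in>insert a ` Pow A. x ^ card Z)"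
    unfolding Pow_insert by (rule sum.union_disjoint) (use insert in auto)
  also have "(\<Sum>Z\<in>insert a ` Pow A. x ^ card Z) = (\<Sum>Z\<in>Pow A. x ^ card (insert a Z))"
    by (subst sum.reindex) (use insert in \<open>auto simp: inj_on_def\<close>)
  also have "\<dots> = (\<Sum>Z\<in>Pow A. x * x ^ card Z)"
    by (rule sum.cong) (use insert in \<open>auto simp: card_insert_if finite_subset\<close>)
  finally show ?case using insert by (simp add: sum_distrib_left[symmetric] algebra_simps)
qed simp

text \<open>Exponential moment: weighting a subset \<open>Z\<close> by \<open>x ^ card Z\<close>
  with \<open>x < 1\<close> gives total weight at most \<open>(1 + x) ^ n\<close>, and every subset
  counted weighs at least \<open>x ^ c\<close>. Such subsets are the witness sets of patterns that
  occur too rarely, and the bound makes it cheap to name them.\<close>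

lemma card_small_subsets:
  assumes "\<delta> > (0::real)"
  shows "\<exists>\<kappa>>0. \<forall>(A::nat set) n c. finite A \<longrightarrow> card A \<le> n \<longrightarrow> real c \<le> \<kappa> * real n \<longrightarrow>
     real (card (small_subsets A c)) \<le> 2 powr (\<delta> * real n)"
proof -
  \<comment> \<open>The second entry spends half of the allowed exponent on \<open>1 + x\<close>;
    the cap \<open>1/2\<close> keeps \<open>x < 1\<close> and hence \<open>L\<close> positive. The
    other half pays for \<open>x ^ c = 2 powr (- L * c)\<close>, which leads to the constant
    \<open>\<delta> / (2 * L)\<close>.\<close>
  define x :: real where "x = min (1/2) (2 powr (\<delta>/2) - 1)"
  have "(2::real) powr 0 < 2 powr (\<delta>/2)" using assms by (subst powr_less_cancel_iff) auto
  then have x: "0 < x" "x < 1" "1 + x \<le> 2 powr (\<delta>/2)" unfolding x_def by auto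
  define L where "L = - log 2 x"
  have L: "L > 0" unfolding L_def using x by (simp)
  have xL: "x = 2 powr (-L)" unfolding L_def using x by simp
  show ?thesis
  proof (intro exI[of _ "\<delta> / (2 * L)"] conjI allI impI)
    show "0 < \<delta> / (2 * L)" using assms L by simp
    fix A :: "nat set" and n c
    assume A: "finite A" "card A \<le> n" and c: "real c \<le> \<delta> / (2 * L) * real n"
    have "real (card (small_subsets A c)) * x ^ c = (\<Sum>Z\<in>small_subsets A c. x ^ c)" by simp
    also have "\<dots> \<le> (\<Sum>Z\<in>small_subsets A c. x ^ card Z)"
      by (rule sum_mono) (use x in \<open>auto simp: small_subsets_def intro!: power_decreasing\<close>)
    also have "\<dots> \<le> (\<Sum>Z\<in>Pow A. x ^ card Z)"
      by (rule sum_mono2) (use x A in \<open>auto simp: small_subsets_def\<close>)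
    also have "\<dots> = (1 + x) ^ card A" by (rule sum_Pow_power_card[OF A(1)])
    also have "\<dots> \<le> (1 + x) ^ n" using x A by (intro power_increasing) auto
    also have "\<dots> \<le> (2 powr (\<delta>/2)) ^ n" using x by (intro power_mono) auto
    also have "\<dots> = 2 powr (\<delta>/2 * real n)" by (simp add: powr_realpow[symmetric] powr_powr)
    finally have 1: "real (card (small_subsets A c)) * x ^ c \<le> 2 powr (\<delta>/2 * real n)" .
    have "L * real c \<le> \<delta>/2 * real n" using c L by (simp add: field_simps)
    then have "2 powr (- (\<delta>/2 * real n)) \<le> 2 powr (- (L * real c))" by simp
    also have "\<dots> = x ^ c" unfolding xL by (simp add: powr_realpow[symmetric] powr_powr)
    finally have "real (card (small_subsets A c)) * 2 powr (- (\<delta>/2 * real n)) \<le>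
      real (card (small_subsets A c)) * x ^ c" by (intro mult_left_mono) auto
    also note 1
    finally have "real (card (small_subsets A c)) * 2 powr (- (\<delta>/2 * real n)) * 2 powr (\<delta>/2 * real n)
      \<le> 2 powr (\<delta>/2 * real n) * 2 powr (\<delta>/2 * real n)" by (intro mult_right_mono) auto
    moreover have "real (card (small_subsets A c)) * 2 powr (- (\<delta>/2 * real n)) * 2 powr (\<delta>/2 * real n)
       = real (card (small_subsets A c))" by (simp add: mult.assoc powr_add[symmetric])
    moreover have "2 powr (\<delta>/2 * real n) * 2 powr (\<delta>/2 * real n) = 2 powr (\<delta> * real n)"
      by (simp add: powr_add[symmetric] field_simps)
    ultimately show "real (card (small_subsets A c)) \<le> 2 powr (\<delta> * real n)" by (simp only:)
  qed
qed

section \<open>Pajor's inequality for shattered sets\<close>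

definition shattered :: "'a set set \<Rightarrow> 'a set \<Rightarrow> bool" where
  "shattered F S \<longleftrightarrow> (\<forall>B\<subseteq>S. \<exists>T\<in>F. T \<inter> S = B)"

text \<open>Induction on the ground set. Let \<open>F0\<close> be the members without
  \<open>x\<close> and \<open>F1\<close> the members with \<open>x\<close>, after removing it; then
  \<open>card F\<close> is the sum for \<open>F0 \<union> F1\<close> and
  \<open>F0 \<inter> F1\<close>. A set shattered by the union is shattered by \<open>F\<close>, and
  a set shattered by the intersection stays shattered when \<open>x\<close> is added, so the two
  kinds of shattered sets are distinct.\<close>

lemma pajor:
  assumes "finite E" "F \<subseteq> Pow E"
  shows "card F \<le> card {S \<in> Pow E. shattered F S}"
  using assms
proof (induction E arbitrary: F rule: finite_induct)
  case empty
  show ?case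
  proof (cases "F = {}")
    case False
    then have F: "F = {{}}" using empty by (metis Pow_empty subset_singletonD)
    have "{S \<in> Pow {}. shattered F S} = {{}}" unfolding F shattered_def by fastforce
    then show ?thesis unfolding F by simp
  qed simp
next
  case (insert x E)
  let ?sh = "\<lambda>E F. {S \<in> Pow E. shattered F S}"
  define F0 where "F0 = {T \<in> F. x \<notin> T}"
  define F1 where "F1 = (\<lambda>T. T - {x}) ` {T \<in> F. x \<in> T}"
  have F0: "F0 \<subseteq> Pow E" and F1: "F1 \<subseteq> Pow E" unfolding F0_def F1_def using insert.prems by auto
  have fin: "finite F" using insert.hyps insert.prems by (meson finite_Pow_iff finite_insert finite_subset)
  have fin01: "finite F0" "finite F1" unfolding F0_def F1_def using fin by auto
  have "F = F0 \<union> {T \<in> F. x \<in> T}" unfolding F0_def by blast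
  then have "card F = card (F0 \<union> {T \<in> F. x \<in> T})" by simp
  also have "\<dots> = card F0 + card {T \<in> F. x \<in> T}"
    by (rule card_Un_disjoint) (use fin in \<open>auto simp: F0_def\<close>)
  also have "card {T \<in> F. x \<in> T} = card F1"
    unfolding F1_def by (rule card_image[symmetric]) (auto simp: inj_on_def)
  finally have "card F = card (F0 \<union> F1) + card (F0 \<inter> F1)" using card_Un_Int[OF fin01] by simp
  also have "\<dots> \<le> card (?sh E (F0 \<union> F1)) + card (?sh E (F0 \<inter> F1))"
    by (intro add_mono insert.IH) (use F0 F1 in blast)+
  also have "card (?sh E (F0 \<inter> F1)) = card (insert x ` ?sh E (F0 \<inter> F1))"
    by (rule card_image[symmetric]) (use insert(2) in \<open>auto simp: inj_on_def\<close>)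
  also have "card (?sh E (F0 \<union> F1)) + \<dots> = card (?sh E (F0 \<union> F1) \<union> insert x ` ?sh E (F0 \<inter> F1))"
    by (rule card_Un_disjoint[symmetric]) (use insert(1,2) in auto)
  also have "\<dots> \<le> card (?sh (insert x E) F)"
  proof (rule card_mono)
    show "finite (?sh (insert x E) F)" using insert(1) by simp
    have "shattered F S" if S: "S \<subseteq> E" "shattered (F0 \<union> F1) S" for S
      unfolding shattered_def
    proof (intro allI impI)
      fix B assume "B \<subseteq> S"
      then obtain T where T: "T \<in> F0 \<union> F1" "T \<inter> S = B" using S(2) unfolding shattered_def by blast
      have "x \<notin> S" using S insert(2) by blast
      then show "\<exists>T\<in>F. T \<inter> S = B" using T unfolding F0_def F1_def by blast
    qed
    moreover have "shattered F (insert x S)" if S: "S \<subseteq> E" "shattered (F0 \<inter> F1) S" for S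
      unfolding shattered_def
    proof (intro allI impI)
      fix B assume B: "B \<subseteq> insert x S"
      have xS: "x \<notin> S" using S insert(2) by blast
      have "B - {x} \<subseteq> S" using B by blast
      then obtain T where T: "T \<in> F0" "T \<in> F1" "T \<inter> S = B - {x}" using S(2) unfolding shattered_def by blast
      show "\<exists>T\<in>F. T \<inter> insert x S = B"
      proof (cases "x \<in> B")
        case True
        obtain T' where T': "T' \<in> F" "x \<in> T'" "T = T' - {x}" using T unfolding F1_def by blast
        have "T' \<inter> insert x S = B" using True T(3) xS T' by blast
        then show ?thesis using T' by blast
      next
        case False
        have "T \<in> F" "x \<notin> T" using T unfolding F0_def by blast+
        then have "T \<inter> insert x S = B" using T(3) False by blast
        then show ?thesis using \<open>T \<in> F\<close> by blast
      qed
    qed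
    ultimately show "?sh E (F0 \<union> F1) \<union> insert x ` ?sh E (F0 \<inter> F1) \<subseteq> ?sh (insert x E) F" by blast
  qed
  finally show ?case .
qed

section \<open>Universal orientations\<close>

definition edges_on :: "nat set \<Rightarrow> nat set set" where
  "edges_on V = {{u, v} | u v. u \<in> V \<and> v \<in> V \<and> u \<noteq> v}"

lemma edges_on_subset_image: "edges_on V \<subseteq> (\<lambda>(u, v). {u, v}) ` (V \<times> V)"
  unfolding edges_on_def by auto

lemma finite_edges_on [simp]: "finite V \<Longrightarrow> finite (edges_on V)"
  by (rule finite_subset[OF edges_on_subset_image]) auto

lemma card_edges_on_le: "finite V \<Longrightarrow> card (edges_on V) \<le> (card V)\<^sup>2"
  by (rule order.trans[OF card_mono[OF _ edges_on_subset_image]])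
     (auto intro: order.trans[OF card_image_le] simp: card_cartesian_product power2_eq_square)

definition arc :: "nat set set \<Rightarrow> nat set set \<Rightarrow> nat \<Rightarrow> nat \<Rightarrow> bool" where
  "arc E S u v \<longleftrightarrow> u \<noteq> v \<and> {u, v} \<in> E \<and> ({u, v} \<in> S \<longleftrightarrow> u < v)"

text \<open>Slots \<open>k\<close> and \<open>k + p\<close> both draw from part
  \<open>k mod p\<close>; a pair of slots is read with \<open>k < l\<close>, and
  \<open>\<tau>\<close> prescribes which pairs point forwards. Slots of the same part carry no
  condition, since nothing is known about edges inside a part. Quantifying over all disjoint
  \<open>X\<close> allows the slots to be restricted to neighbourhoods of vertices that are already
  placed.\<close>

definition universal ::
    "nat \<Rightarrow> nat \<Rightarrow> nat set set \<Rightarrow> nat set set \<Rightarrow> (nat \<Rightarrow> nat set) \<Rightarrow> bool" where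
  "universal p c E S V \<longleftrightarrow>
     (\<forall>X \<tau>. (\<forall>k<2*p. X k \<subseteq> V (k mod p) \<and> c \<le> card (X k)) \<longrightarrow>
        (\<forall>k<2*p. \<forall>l<2*p. k \<noteq> l \<longrightarrow> X k \<inter> X l = {}) \<longrightarrow>
        (\<exists>x. (\<forall>k<2*p. x k \<in> X k) \<and>
             (\<forall>k l. k < l \<longrightarrow> l < 2*p \<longrightarrow> k mod p \<noteq> l mod p \<longrightarrow>
                (if (k, l) \<in> \<tau> then arc E S (x k) (x l) else arc E S (x l) (x k)))))"

text \<open>A line is determined by its values at two places; this makes distinct transversals of
  the next lemma share at most one vertex.\<close>

lemma linear_forms_inj:
  fixes a b a' b' k l :: nat
  assumes "a + k * b = a' + k * b'" "a + l * b = a' + l * b'" "k \<noteq> l"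
  shows "a = a' \<and> b = b'"
proof -
  have "int a + int k * int b = int a' + int k * int b'" "int a + int l * int b = int a' + int l * int b'"
    using assms(1,2) by (metis of_nat_add of_nat_mult)+
  then have "(int k - int l) * (int b - int b') = 0" by algebra
  then have "b = b'" using assms(3) by auto
  then show ?thesis using assms(1) by simp
qed

text \<open>Arrange \<open>m\<^sup>2\<close> transversals as lines \<open>a + k * b\<close>. Two of
  them meet in at most one slot, so their edge sets are disjoint and the pattern is tested on
  disjoint sets of at most \<open>4 * p\<^sup>2\<close> edges. A missing pair lies on at most one
  line, so at least \<open>m\<^sup>2 - M\<close> lines lie completely in \<open>E\<close>.\<close>

lemma card_avoiding_transversals:
  fixes X :: "nat \<Rightarrow> nat set"
  assumes p: "p \<ge> 1" and E: "finite E"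
    and X: "\<And>k. k < 2*p \<Longrightarrow> X k \<subseteq> V (k mod p)" "\<And>k. k < 2*p \<Longrightarrow> c \<le> card (X k)" "\<And>k. k < 2*p \<Longrightarrow> finite (X k)"
    and Xd: "\<And>k l. k < 2*p \<Longrightarrow> l < 2*p \<Longrightarrow> k \<noteq> l \<Longrightarrow> X k \<inter> X l = {}"
    and Mf: "finite Mis" "card Mis \<le> M"
    and M: "\<And>i j u v. i < p \<Longrightarrow> j < p \<Longrightarrow> i \<noteq> j \<Longrightarrow> u \<in> V i \<Longrightarrow> v \<in> V j \<Longrightarrow> {u, v} \<notin> E \<Longrightarrow> {u, v} \<in> Mis"
  shows "real (card {S. S \<subseteq> E \<and> \<not> (\<exists>x. (\<forall>k<2*p. x k \<in> X k) \<and>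
             (\<forall>k l. k < l \<longrightarrow> l < 2*p \<longrightarrow> k mod p \<noteq> l mod p \<longrightarrow>
                (if (k, l) \<in> \<tau> then arc E S (x k) (x l) else arc E S (x l) (x k))))})
       \<le> 2 ^ card E * (1 - 1 / 2 ^ (4 * p^2)) ^ ((c div (2*p))^2 - M)" (is "real (card ?F) \<le> _")
proof -
  have "\<exists>g. bij_betw g {0..<card (X k)} (X k)" if "k < 2*p" for k
    using ex_bij_betw_nat_finite[OF X(3)[OF that]] by blast
  then obtain g where g: "\<And>k. k < 2*p \<Longrightarrow> bij_betw (g k) {0..<card (X k)} (X k)" by metis
  \<comment> \<open>For \<open>a, b < m\<close> and \<open>k < 2 * p\<close> the index
    \<open>a + k * b\<close> is at most \<open>2 * p * (m - 1) < c\<close>, so it addresses an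
    element of every \<open>X k\<close>.\<close>
  define m where "m = c div (2*p)"
  define x where "x = (\<lambda>ab k. g k (fst ab + k * snd ab))"
  have bound: "a + k * b < card (X k)" if "a < m" "b < m" "k < 2*p" for a b k
  proof -
    have "k * b \<le> (2*p - 1) * (m - 1)" using that by (intro mult_le_mono) auto
    then have "a + k * b \<le> (m - 1) + (2*p - 1) * (m - 1)" using that by linarith
    also have "\<dots> = 2*p * (m - 1)" using p by (cases p) auto
    also have "\<dots> < 2*p * m" using that p by simp
    also have "\<dots> \<le> c" unfolding m_def by simp
    finally show ?thesis using X(2)[OF that(3)] by simp
  qed
  let ?J = "{..<m} \<times> {..<m}"
  have xX: "x ab k \<in> X k" if "ab \<in> ?J" "k < 2*p" for ab k
    unfolding x_def using g[OF that(2)] bound[of "fst ab" "snd ab" k] that by (auto simp: bij_betw_def)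
  have same: "k = k'" if "x ab k = x ab' k'" "ab \<in> ?J" "ab' \<in> ?J" "k < 2*p" "k' < 2*p" for ab ab' k k'
    using xX[of ab k] xX[of ab' k'] Xd[of k k'] that by (metis disjoint_iff)
  have eqv: "fst ab + k * snd ab = fst ab' + k * snd ab'"
    if "x ab k = x ab' k" "ab \<in> ?J" "ab' \<in> ?J" "k < 2*p" for ab ab' k
  proof -
    have "inj_on (g k) {0..<card (X k)}" using g[OF that(4)] by (simp add: bij_betw_def)
    then show ?thesis using that bound[of "fst ab" "snd ab" k] bound[of "fst ab'" "snd ab'" k]
      unfolding x_def by (auto dest!: inj_onD)
  qed
  define Q where "Q = {(k, l). k < l \<and> l < 2*p \<and> k mod p \<noteq> l mod p}"
  have Qsub: "Q \<subseteq> {..<2*p} \<times> {..<2*p}" unfolding Q_def by auto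
  define T where "T = (\<lambda>ab. (\<lambda>(k, l). {x ab k, x ab l}) ` Q)"
  \<comment> \<open>The trace on the line that realises \<open>\<tau>\<close>. Membership in
    \<open>S\<close> means upwards, so the required bit compares \<open>\<tau>\<close> with the
    order of the two vertices.\<close>
  define B where "B = (\<lambda>ab. (\<lambda>(k, l). {x ab k, x ab l}) ` {(k, l) \<in> Q. ((k, l) \<in> \<tau>) = (x ab k < x ab l)})"
  have pairs: "k = k' \<and> l = l' \<and> x ab k = x ab' k \<and> x ab l = x ab' l"
    if "{x ab k, x ab l} = {x ab' k', x ab' l'}" "ab \<in> ?J" "ab' \<in> ?J" "(k, l) \<in> Q" "(k', l') \<in> Q" for ab ab' k l k' l'
  proof -
    have lt: "k < l" "k' < l'" "l < 2*p" "l' < 2*p" "k < 2*p" "k' < 2*p" using that unfolding Q_def by auto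
    from that(1) consider "x ab k = x ab' k'" "x ab l = x ab' l'" | "x ab k = x ab' l'" "x ab l = x ab' k'"
      by (auto simp: doubleton_eq_iff)
    then show ?thesis
    proof cases
      case 1
      then show ?thesis using same[of ab k ab' k'] same[of ab l ab' l'] that lt by auto
    next
      case 2
      then show ?thesis using same[of ab k ab' l'] same[of ab l ab' k'] that lt by auto
    qed
  qed
  have disj: "ab = ab'" if e: "e \<in> T ab" "e \<in> T ab'" and "ab \<in> ?J" "ab' \<in> ?J" for e ab ab'
  proof -
    obtain k l where kl1: "(k, l) \<in> Q" "e = {x ab k, x ab l}" using e(1) unfolding T_def by auto
    obtain k' l' where kl2: "(k', l') \<in> Q" "e = {x ab' k', x ab' l'}" using e(2) unfolding T_def by auto
    note kl = kl1(1) kl2(1) kl1(2) kl2(2)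
    have "x ab k = x ab' k \<and> x ab l = x ab' l" using pairs[of ab k l ab' k' l'] kl that by metis
    moreover have "k < 2*p" "l < 2*p" "k \<noteq> l" using kl unfolding Q_def by auto
    ultimately have "fst ab = fst ab' \<and> snd ab = snd ab'" using eqv[of ab k ab'] eqv[of ab l ab'] that
      linear_forms_inj[of "fst ab" k "snd ab" "fst ab'" "snd ab'" l] by blast
    then show ?thesis by (simp add: prod_eq_iff)
  qed
  define I where "I = {ab \<in> ?J. T ab \<subseteq> E}"
  \<comment> \<open>Every line not contained in \<open>E\<close> is charged to one of its missing
    pairs; disjointness of the lines makes the charge injective.\<close>
  have "\<exists>e. e \<in> T ab \<and> e \<in> Mis" if "ab \<in> ?J - I" for ab
  proof -
    have "\<not> T ab \<subseteq> E" using that unfolding I_def by blast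
    then obtain k l where kl: "(k, l) \<in> Q" "{x ab k, x ab l} \<notin> E" unfolding T_def by auto
    then have lt: "k < 2*p" "l < 2*p" "k mod p \<noteq> l mod p" unfolding Q_def by auto
    have "{x ab k, x ab l} \<in> Mis"
      by (rule M[of "k mod p" "l mod p"]) (use lt xX[of ab k] xX[of ab l] X(1)[of k] X(1)[of l] that p kl in auto)
    then show ?thesis using kl unfolding T_def by force
  qed
  then obtain e where e: "\<And>ab. ab \<in> ?J - I \<Longrightarrow> e ab \<in> T ab \<and> e ab \<in> Mis" by metis
  have "inj_on e (?J - I)" by (rule inj_onI) (metis DiffD1 disj e)
  moreover have "e ` (?J - I) \<subseteq> Mis" using e by auto
  ultimately have "card (?J - I) \<le> M" using card_inj_on_le Mf by (metis order.trans)
  moreover have "card (?J - I) = card ?J - card I" by (rule card_Diff_subset) (auto simp: I_def)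
  ultimately have cI: "m^2 - M \<le> card I" by (simp add: card_cartesian_product power2_eq_square)
  have B_iff: "{x ab k, x ab l} \<in> B ab \<longleftrightarrow> ((k, l) \<in> \<tau>) = (x ab k < x ab l)" if "ab \<in> ?J" "(k, l) \<in> Q" for ab k l
  proof
    assume "{x ab k, x ab l} \<in> B ab"
    then obtain k' l' where "(k', l') \<in> Q" "((k', l') \<in> \<tau>) = (x ab k' < x ab l')" "{x ab k, x ab l} = {x ab k', x ab l'}"
      unfolding B_def by auto
    then show "((k, l) \<in> \<tau>) = (x ab k < x ab l)" using pairs[of ab k l ab k' l'] that by auto
  next
    assume "((k, l) \<in> \<tau>) = (x ab k < x ab l)"
    then show "{x ab k, x ab l} \<in> B ab" using that unfolding B_def by force
  qed
  have sub: "?F \<subseteq> {S. S \<subseteq> E \<and> (\<forall>ab\<in>I. S \<inter> T ab \<noteq> B ab)}"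
  proof safe
    fix S ab assume S: "S \<subseteq> E" and ab: "ab \<in> I" and eq: "S \<inter> T ab = B ab"
      and no: "\<nexists>x. (\<forall>k<2*p. x k \<in> X k) \<and>
             (\<forall>k l. k < l \<longrightarrow> l < 2*p \<longrightarrow> k mod p \<noteq> l mod p \<longrightarrow>
                (if (k, l) \<in> \<tau> then arc E S (x k) (x l) else arc E S (x l) (x k)))"
    have abJ: "ab \<in> ?J" and TE: "T ab \<subseteq> E" using ab unfolding I_def by auto
    have "(if (k, l) \<in> \<tau> then arc E S (x ab k) (x ab l) else arc E S (x ab l) (x ab k))"
      if "k < l" "l < 2*p" "k mod p \<noteq> l mod p" for k l
    proof -
      have Q: "(k, l) \<in> Q" using that unfolding Q_def by auto
      then have T: "{x ab k, x ab l} \<in> T ab" unfolding T_def by force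
      have ne: "x ab k \<noteq> x ab l" using same[OF _ abJ abJ, of k l] that by auto
      have "{x ab k, x ab l} \<in> S \<longleftrightarrow> ((k, l) \<in> \<tau>) = (x ab k < x ab l)"
        using B_iff[OF abJ Q] eq T by blast
      then show ?thesis using T TE ne unfolding arc_def by (auto simp: insert_commute)
    qed
    then show False using no xX[OF abJ] by blast
  qed
  have "real (card ?F) \<le> real (card {S. S \<subseteq> E \<and> (\<forall>ab\<in>I. S \<inter> T ab \<noteq> B ab)})"
    using sub E by (intro of_nat_mono card_mono) auto
  also have "\<dots> \<le> 2 ^ card E * (1 - 1 / 2 ^ (4 * p^2)) ^ card I"
  proof (rule card_pattern_avoiding)
    fix ab assume "ab \<in> I"
    have "card (T ab) \<le> card Q" unfolding T_def by (rule card_image_le) (use Qsub finite_subset in blast)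
    also have "\<dots> \<le> card ({..<2*p} \<times> {..<2*p})" by (rule card_mono) (use Qsub in auto)
    also have "\<dots> = 4 * p^2" by (simp add: card_cartesian_product power2_eq_square)
    finally show "card (T ab) \<le> 4 * p^2" .
  next
    fix ab ab' assume "ab \<in> I" "ab' \<in> I" "ab \<noteq> ab'"
    then show "T ab \<inter> T ab' = {}" using disj[of _ ab ab'] unfolding I_def by blast
  qed (use E in \<open>auto simp: I_def T_def B_def\<close>)
  also have "\<dots> \<le> 2 ^ card E * (1 - 1 / 2 ^ (4 * p^2)) ^ (m^2 - M)"
    using cI by (intro mult_left_mono power_decreasing) auto
  finally show ?thesis unfolding m_def .
qed

text \<open>Union bound over the sets \<open>X\<close> and the pattern \<open>\<tau>\<close>. The
  logarithm of their number is linear in \<open>n\<close>, while the saving has an exponent of order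
  \<open>c\<^sup>2\<close>, so universality is typical once \<open>c\<close> is linear in
  \<open>n\<close> and few pairs are missing.\<close>

lemma card_nonuniversal:
  assumes p: "p \<ge> 1" and E: "finite E"
    and V: "\<And>i. i < p \<Longrightarrow> finite (V i)" "\<And>i. i < p \<Longrightarrow> card (V i) \<le> n"
    and Mf: "finite Mis" "card Mis \<le> M"
    and M: "\<And>i j u v. i < p \<Longrightarrow> j < p \<Longrightarrow> i \<noteq> j \<Longrightarrow> u \<in> V i \<Longrightarrow> v \<in> V j \<Longrightarrow> {u, v} \<notin> E \<Longrightarrow> {u, v} \<in> Mis"
  shows "real (card {S. S \<subseteq> E \<and> \<not> universal p c E S V})
       \<le> 2 ^ (2*p*n + 4*p^2) * (2 ^ card E * (1 - 1 / 2 ^ (4 * p^2)) ^ ((c div (2*p))^2 - M))"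
proof -
  let ?P = "\<lambda>X \<tau> S. \<exists>x. (\<forall>k<2*p. x k \<in> X k) \<and>
             (\<forall>k l. k < l \<longrightarrow> l < 2*p \<longrightarrow> k mod p \<noteq> l mod p \<longrightarrow>
                (if (k, l) \<in> \<tau> then arc E S (x k) (x l) else arc E S (x l) (x k)))"
  define G where "G = {X \<in> PiE {..<2*p} (\<lambda>k. Pow (V (k mod p))). (\<forall>k<2*p. c \<le> card (X k)) \<and>
     (\<forall>k<2*p. \<forall>l<2*p. k \<noteq> l \<longrightarrow> X k \<inter> X l = {})}"
  define H where "H = G \<times> Pow ({..<2*p} \<times> {..<2*p})"
  have finPi: "finite (PiE {..<2*p} (\<lambda>k. Pow (V (k mod p))))" by (intro finite_PiE finite_Pow_iff[THEN iffD2] V(1)) (use p in auto)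
  then have finH: "finite H" unfolding H_def G_def by auto
  have "card G \<le> card (PiE {..<2*p} (\<lambda>k. Pow (V (k mod p))))"
    by (rule card_mono[OF finPi]) (auto simp: G_def)
  also have "\<dots> = (\<Prod>k<2*p. 2 ^ card (V (k mod p)))" 
    unfolding card_PiE[OF finite_lessThan] by (intro prod.cong refl card_Pow V(1)) (use p in simp)
  also have "\<dots> \<le> (\<Prod>k<2*p. 2 ^ n)" 
    by (intro prod_mono conjI power_increasing V(2)) (use p in auto)
  also have "\<dots> = 2 ^ (2*p*n)" by (simp add: power_mult[symmetric] mult.commute)
  finally have "card H \<le> 2 ^ (2*p*n) * 2 ^ (4*p^2)" unfolding H_def
    by (simp add: card_cartesian_product card_Pow power2_eq_square)
  then have cH: "real (card H) \<le> 2 ^ (2*p*n + 4*p^2)"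
    by (metis of_nat_le_iff of_nat_numeral of_nat_power power_add)
  have sub: "{S. S \<subseteq> E \<and> \<not> universal p c E S V} \<subseteq> (\<Union>(X, \<tau>)\<in>H. {S. S \<subseteq> E \<and> \<not> ?P X \<tau> S})"
  proof
    fix S assume "S \<in> {S. S \<subseteq> E \<and> \<not> universal p c E S V}"
    then obtain X \<tau> where S: "S \<subseteq> E" and X: "\<forall>k<2*p. X k \<subseteq> V (k mod p) \<and> c \<le> card (X k)"
      "\<forall>k<2*p. \<forall>l<2*p. k \<noteq> l \<longrightarrow> X k \<inter> X l = {}" and no: "\<not> ?P X \<tau> S"
      unfolding universal_def by blast
    \<comment> \<open>\<open>X\<close> and \<open>\<tau>\<close> are arbitrary outside the slots;
      cutting them down to \<open>{..<2*p}\<close> leaves finitely many candidates.\<close>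
    define X' where "X' = restrict X {..<2*p}"
    define \<tau>' where "\<tau>' = \<tau> \<inter> {..<2*p} \<times> {..<2*p}"
    have "X' \<in> G" unfolding G_def X'_def using X by auto
    then have "(X', \<tau>') \<in> H" unfolding H_def \<tau>'_def by auto
    moreover have "\<not> ?P X' \<tau>' S"
    proof
      assume "?P X' \<tau>' S"
      then obtain x where x: "\<forall>k<2*p. x k \<in> X' k" "\<forall>k l. k < l \<longrightarrow> l < 2*p \<longrightarrow> k mod p \<noteq> l mod p \<longrightarrow>
                (if (k, l) \<in> \<tau>' then arc E S (x k) (x l) else arc E S (x l) (x k))" by blast
      have "?P X \<tau> S" by (rule exI[of _ x]) (use x in \<open>auto simp: X'_def \<tau>'_def\<close>)
      then show False using no by blast
    qed
    ultimately show "S \<in> (\<Union>(X, \<tau>)\<in>H. {S. S \<subseteq> E \<and> \<not> ?P X \<tau> S})" using S by blast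
  qed
  let ?b = "2 ^ card E * (1 - 1 / 2 ^ (4 * p^2)) ^ ((c div (2*p))^2 - M) :: real"
  have "card {S. S \<subseteq> E \<and> \<not> universal p c E S V} \<le> card (\<Union>(X, \<tau>)\<in>H. {S. S \<subseteq> E \<and> \<not> ?P X \<tau> S})"
    by (rule card_mono[OF _ sub]) (use finH E in auto)
  also have "\<dots> \<le> (\<Sum>h\<in>H. card (case h of (X, \<tau>) \<Rightarrow> {S. S \<subseteq> E \<and> \<not> ?P X \<tau> S}))"
    by (rule card_UN_le[OF finH])
  finally have "real (card {S. S \<subseteq> E \<and> \<not> universal p c E S V}) \<le>
     (\<Sum>h\<in>H. real (card (case h of (X, \<tau>) \<Rightarrow> {S. S \<subseteq> E \<and> \<not> ?P X \<tau> S})))"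
    unfolding of_nat_sum[symmetric] of_nat_le_iff .
  also have "\<dots> \<le> (\<Sum>h\<in>H. ?b)"
  proof (rule sum_mono)
    fix h assume h: "h \<in> H"
    obtain X \<tau> where hh: "h = (X, \<tau>)" by force
    have X: "X \<in> G" using h unfolding hh H_def by auto
    have XV: "X k \<subseteq> V (k mod p)" "c \<le> card (X k)" "finite (X k)" if "k < 2*p" for k
      using X that V(1)[of "k mod p"] p unfolding G_def by (auto simp: PiE_iff intro: finite_subset)
    have "real (card {S. S \<subseteq> E \<and> \<not> ?P X \<tau> S}) \<le> ?b"
    proof (rule card_avoiding_transversals[where V = V and Mis = Mis])
      show "X k \<inter> X l = {}" if "k < 2*p" "l < 2*p" "k \<noteq> l" for k l using X that unfolding G_def by blast
    qed (fact p E XV Mf M)+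
    then show "real (card (case h of (X, \<tau>) \<Rightarrow> {S. S \<subseteq> E \<and> \<not> ?P X \<tau> S})) \<le> ?b" unfolding hh by simp
  qed
  also have "\<dots> = real (card H) * ?b" by simp
  also have "\<dots> \<le> 2 ^ (2*p*n + 4*p^2) * ?b" by (intro mult_right_mono cH) auto
  finally show ?thesis .
qed

section \<open>Graphs without large complete multipartite blow-ups\<close>

definition blowup :: "nat \<Rightarrow> nat \<Rightarrow> nat set set \<Rightarrow> nat set \<Rightarrow> (nat \<Rightarrow> nat set) \<Rightarrow> bool" where
  "blowup q s S V A \<longleftrightarrow> (\<forall>i<q. A i \<subseteq> V \<and> card (A i) = s) \<and>
     (\<forall>i<q. \<forall>j<q. i \<noteq> j \<longrightarrow> A i \<inter> A j = {} \<and> (\<forall>u\<in>A i. \<forall>v\<in>A j. {u, v} \<in> S))"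

definition blowup_free :: "nat \<Rightarrow> nat \<Rightarrow> nat set \<Rightarrow> nat set set set" where
  "blowup_free q s V = {S \<in> Pow (edges_on V). \<nexists>A. blowup q s S V A}"

lemma finite_blowup_free [simp]: "finite V \<Longrightarrow> finite (blowup_free q s V)"
  unfolding blowup_free_def by simp

definition star :: "nat set \<Rightarrow> nat \<Rightarrow> nat set set" where
  "star W v = (\<lambda>u. {u, v}) ` W"

lemma inj_star: "inj_on (\<lambda>u. {u, v}) W"
  by (auto simp: inj_on_def doubleton_eq_iff)

lemma card_small_star:
  assumes W: "finite W" and A: "A \<subseteq> W" and b: "card (small_subsets A s) \<le> b"
  shows "card {T. T \<subseteq> star W v \<and> card {u \<in> A. {u, v} \<in> T} < s} \<le> b * 2 ^ (card W - card A)"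
proof -
  have "card {T. T \<subseteq> star W v \<and> card {u \<in> A. {u, v} \<in> T} < s}
     \<le> card ((\<lambda>Z. (\<lambda>u. {u, v}) ` Z) ` small_subsets A s) * card (Pow (star (W - A) v))"
  proof (rule card_le_split)
    fix S assume S: "S \<in> {T. T \<subseteq> star W v \<and> card {u \<in> A. {u, v} \<in> T} < s}"
    show "S \<subseteq> star A v \<union> star (W - A) v" using S A unfolding star_def by blast
    have "S \<inter> star A v = (\<lambda>u. {u, v}) ` {u \<in> A. {u, v} \<in> S}" unfolding star_def by auto
    moreover have "{u \<in> A. {u, v} \<in> S} \<in> small_subsets A s" using S unfolding small_subsets_def by auto
    ultimately show "S \<inter> star A v \<in> (\<lambda>Z. (\<lambda>u. {u, v}) ` Z) ` small_subsets A s" by blast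
  qed (use W A in \<open>auto simp: star_def finite_subset\<close>)
  also have "\<dots> \<le> b * 2 ^ (card W - card A)"
  proof (rule mult_le_mono)
    show "card ((\<lambda>Z. (\<lambda>u. {u, v}) ` Z) ` small_subsets A s) \<le> b"
      using b card_image_le[of "small_subsets A s"] W A by (meson finite_small_subsets finite_subset order.trans)
    have "card (Pow (star (W - A) v)) = 2 ^ card (star (W - A) v)"
      using W by (intro card_Pow) (auto simp: star_def)
    also have "card (star (W - A) v) = card W - card A"
      unfolding star_def using card_image[OF inj_star, of v "W - A"] card_Diff_subset[of A W] W A
      by (simp add: finite_subset)
    finally show "card (Pow (star (W - A) v)) \<le> 2 ^ (card W - card A)" by simp
  qed
  finally show ?thesis .
qed

text \<open>Pigeonhole on the neighbourhoods in \<open>W\<close>: too many such vertices would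
  include \<open>s\<close> with the same neighbourhood. These form a new part, joined completely to
  \<open>s\<close> common neighbours in each \<open>A i\<close>, and give a blow-up with
  \<open>Suc Q\<close> parts.\<close>

lemma card_blowup_bad_vertices:
  assumes A: "blowup Q s' S V A" and fV: "finite V" and s: "s \<ge> 1"
    and free: "\<nexists>A. blowup (Suc Q) s S V A"
  defines "W \<equiv> \<Union>i<Q. A i"
  defines "R \<equiv> {v \<in> V - W. \<forall>i<Q. s \<le> card {u \<in> A i. {u, v} \<in> S}}"
  shows "card R \<le> s * 2 ^ card W"
proof (rule ccontr)
  assume big: "\<not> ?thesis"
  have WV: "W \<subseteq> V" using A unfolding blowup_def W_def by auto
  have fW: "finite W" and fR: "finite R" using WV fV finite_subset unfolding R_def by auto
  let ?f = "\<lambda>v. {u \<in> W. {u, v} \<in> S}"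
  have "\<exists>N\<in>Pow W. s < card {v \<in> R. ?f v = N}"
  proof (rule ccontr)
    assume "\<not> ?thesis"
    then have le: "\<And>N. N \<in> Pow W \<Longrightarrow> card {v \<in> R. ?f v = N} \<le> s" by (meson not_less)
    have "R \<subseteq> (\<Union>N\<in>Pow W. {v \<in> R. ?f v = N})"
    proof
      fix v assume "v \<in> R"
      then show "v \<in> (\<Union>N\<in>Pow W. {v \<in> R. ?f v = N})" by (intro UN_I[of "?f v"]) simp_all
    qed
    then have "card R \<le> card (\<Union>N\<in>Pow W. {v \<in> R. ?f v = N})"
      by (rule card_mono[rotated]) (use fR fW in simp)
    also have "\<dots> \<le> (\<Sum>N\<in>Pow W. card {v \<in> R. ?f v = N})"
      by (rule card_UN_le) (use fW in simp)
    also have "\<dots> \<le> (\<Sum>N\<in>Pow W. s)" by (rule sum_mono) (rule le)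
    also have "\<dots> = s * 2 ^ card W" using fW by (simp add: card_Pow)
    finally show False using big by simp
  qed
  then obtain N where N: "s < card {v \<in> R. ?f v = N}" by blast
  obtain Z where Z: "Z \<subseteq> {v \<in> R. ?f v = N}" "card Z = s"
    using N obtain_subset_with_card_n[of s] by (meson less_imp_le)
  obtain z where z: "z \<in> Z" using Z s by (metis One_nat_def card_eq_0_iff equals0I not_less_eq_eq zero_le)
  have zR: "z \<in> R" "?f z = N" using z Z by auto
  have "\<exists>B. B \<subseteq> {u \<in> A i. {u, z} \<in> S} \<and> card B = s" if "i < Q" for i
  proof -
    have "s \<le> card {u \<in> A i. {u, z} \<in> S}" using zR(1) that unfolding R_def by blast
    then show ?thesis by (meson obtain_subset_with_card_n)
  qed
  then obtain B where B: "\<And>i. i < Q \<Longrightarrow> B i \<subseteq> {u \<in> A i. {u, z} \<in> S}" "\<And>i. i < Q \<Longrightarrow> card (B i) = s" by metis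
  have ZB: "{u, v} \<in> S" if "i < Q" "u \<in> B i" "v \<in> Z" for i u v
  proof -
    have "u \<in> W" "{u, z} \<in> S" using B(1)[OF that(1)] that unfolding W_def by auto
    then have "u \<in> N" using zR(2) by blast
    moreover have "?f v = N" using Z that(3) by blast
    ultimately show ?thesis by blast
  qed
  have ZW: "Z \<inter> A i = {}" if "i < Q" for i using Z that unfolding R_def W_def by blast
  have BA: "B i \<subseteq> A i" if "i < Q" for i using B(1)[OF that] by blast
  define A' where "A' = (\<lambda>i. if i < Q then B i else Z)"
  have Ad: "A i \<inter> A j = {}" "\<forall>u\<in>A i. \<forall>v\<in>A j. {u, v} \<in> S" if "i < Q" "j < Q" "i \<noteq> j" for i j
    using A that unfolding blowup_def by blast+
  have "blowup (Suc Q) s S V A'"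
    unfolding blowup_def
  proof (intro conjI allI impI)
    fix i assume i: "i < Suc Q"
    have "A i \<subseteq> V" if "i < Q" using A that unfolding blowup_def by blast
    then show "A' i \<subseteq> V" using BA[of i] Z unfolding A'_def R_def by (cases "i < Q") auto
    show "card (A' i) = s" using B(2)[of i] Z unfolding A'_def by auto
    fix j assume j: "j < Suc Q" and ij: "i \<noteq> j"
    show "A' i \<inter> A' j = {}"
    proof (cases "i < Q"; cases "j < Q")
      assume "i < Q" "j < Q"
      then show ?thesis using BA[of i] BA[of j] Ad[of i j] ij unfolding A'_def by auto
    next
      assume "i < Q" "\<not> j < Q"
      then show ?thesis using BA[of i] ZW[of i] unfolding A'_def by auto
    next
      assume "\<not> i < Q" "j < Q"
      then show ?thesis using BA[of j] ZW[of j] unfolding A'_def by auto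
    qed (use i j ij in auto)
    show "\<forall>u\<in>A' i. \<forall>v\<in>A' j. {u, v} \<in> S"
    proof (cases "i < Q"; cases "j < Q")
      assume "i < Q" "j < Q"
      then show ?thesis using BA[of i] BA[of j] Ad(2)[of i j] ij unfolding A'_def by (simp add: subset_iff)
    next
      assume "i < Q" "\<not> j < Q"
      then show ?thesis using ZB[of i] unfolding A'_def by auto
    next
      assume "\<not> i < Q" "j < Q"
      then have "{v, u} \<in> S" if "u \<in> A' i" "v \<in> A' j" for u v using ZB[of j v u] that unfolding A'_def by simp
      then show ?thesis by (metis insert_commute)
    qed (use i j ij in auto)
  qed
  then show False using free by blast
qed

lemma blowup_mono_vertices: "blowup q s S V A \<Longrightarrow> V \<subseteq> V' \<Longrightarrow> S \<subseteq> S' \<Longrightarrow> blowup q s S' V' A"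
  unfolding blowup_def by (meson order.trans subsetD)

text \<open>The edges split into those avoiding \<open>W\<close>, those inside \<open>W\<close>, and
  the stars from outside vertices to \<open>W\<close>. A vertex outside \<open>R\<close> has fewer
  than \<open>s\<close> neighbours in some \<open>A i\<close>, so its star is nearly determined on
  \<open>s'\<close> of the \<open>card W\<close> places; the factor \<open>Q\<close> chooses
  \<open>i\<close>. The vertices of \<open>R\<close> are few and are granted their full
  stars.\<close>

lemma card_blowup_located_fixed_bad:
  assumes fV: "finite V" and A: "\<And>i. i < Q \<Longrightarrow> A i \<subseteq> V" "\<And>i. i < Q \<Longrightarrow> card (A i) = s'"
    and Q: "Q \<ge> 1" and Wdef: "W = (\<Union>i<Q. A i)" and R: "R \<subseteq> V - W" "card R \<le> K"
    and b: "\<And>i. i < Q \<Longrightarrow> card (small_subsets (A i) s) \<le> b" "b \<ge> 1"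
  shows "card {S \<in> blowup_free q s V. {v \<in> V - W. \<forall>i<Q. s \<le> card {u \<in> A i. {u, v} \<in> S}} = R}
    \<le> card (blowup_free q s (V - W)) * (2 ^ (card W)\<^sup>2 * ((2 ^ card W) ^ K * (Q * (b * 2 ^ (card W - s'))) ^ card V))"
    (is "card ?F \<le> _")
proof -
  have WV: "W \<subseteq> V" using A unfolding Wdef by auto
  have fW: "finite W" using WV fV finite_subset by auto
  define F where "F = ?F"
  define T where "T = edges_on V - edges_on (V - W)"
  define St where "St = (\<Union>v\<in>V - W. star W v)"
  define N where "N = (\<lambda>v. if v \<in> R then Pow (star W v) else {T. T \<subseteq> star W v \<and> (\<exists>i<Q. card {u \<in> A i. {u, v} \<in> T} < s)})"
  have star_fin: "finite (star W v)" for v using fW unfolding star_def by simp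
  have fN: "finite (N v)" for v using star_fin[of v] unfolding N_def by simp
  have star_card: "card (star W v) \<le> card W" for v unfolding star_def by (rule card_image_le[OF fW])
  have FE: "S \<subseteq> edges_on V" "\<nexists>B. blowup q s S V B" if "S \<in> F" for S using that unfolding F_def blowup_free_def by auto
  have fF: "finite F" using fV unfolding F_def by simp
  have "card F \<le> card (blowup_free q s (V - W)) * card ((\<lambda>S. S \<inter> T) ` F)"
  proof (rule card_le_split[where ?E1.0 = "edges_on (V - W)" and ?E2.0 = "T"])
    fix S assume S: "S \<in> F"
    show "S \<subseteq> edges_on (V - W) \<union> T" using FE(1)[OF S] unfolding T_def by auto
    have "\<nexists>B. blowup q s (S \<inter> edges_on (V - W)) (V - W) B"
    proof
      assume "\<exists>B. blowup q s (S \<inter> edges_on (V - W)) (V - W) B"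
      then obtain B where "blowup q s (S \<inter> edges_on (V - W)) (V - W) B" by blast
      then have "blowup q s S V B" by (rule blowup_mono_vertices) auto
      then show False using FE(2)[OF S] by blast
    qed
    then show "S \<inter> edges_on (V - W) \<in> blowup_free q s (V - W)" unfolding blowup_free_def by blast
    show "S \<inter> T \<in> (\<lambda>S. S \<inter> T) ` F" using S by blast
  qed (use fV fF in auto)
  also have "card ((\<lambda>S. S \<inter> T) ` F) \<le> card (Pow (edges_on W)) * card ((\<lambda>S. S \<inter> St) ` F)"
  proof (rule card_le_split[where ?E1.0 = "edges_on W" and ?E2.0 = "St"])
    fix S' assume "S' \<in> (\<lambda>S. S \<inter> T) ` F"
    then obtain S where S: "S \<in> F" "S' = S \<inter> T" by blast
    show "S' \<subseteq> edges_on W \<union> St"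
    proof
      fix e assume "e \<in> S'"
      then have "e \<in> edges_on V" "e \<notin> edges_on (V - W)" using S FE(1)[OF S(1)] unfolding T_def by auto
      then obtain u v where e: "e = {u, v}" "u \<in> V" "v \<in> V" "u \<noteq> v" "u \<in> W \<or> v \<in> W" unfolding edges_on_def by auto
      then consider "u \<in> W" "v \<in> W" | "u \<in> W" "v \<in> V - W" | "v \<in> W" "u \<in> V - W" by blast
      then show "e \<in> edges_on W \<union> St"
      proof cases
        case 1 then show ?thesis using e unfolding edges_on_def by blast
      next
        case 2 then show ?thesis using e unfolding St_def star_def by blast
      next
        case 3
        have "e = {v, u}" using e by auto
        then show ?thesis using 3 unfolding St_def star_def by blast
      qed
    qed
    have "St \<subseteq> T"
    proof
      fix e assume "e \<in> St"
      then obtain u v where e: "e = {u, v}" "u \<in> W" "v \<in> V - W" unfolding St_def star_def by auto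
      then show "e \<in> T" using WV unfolding T_def edges_on_def by (auto simp: doubleton_eq_iff)
    qed
    then have "S' \<inter> St = S \<inter> St" using S(2) by blast
    then show "S' \<inter> St \<in> (\<lambda>S. S \<inter> St) ` F" using S(1) by blast
  qed (use fF fW in auto)
  also have "card ((\<lambda>S. S \<inter> St) ` F) \<le> (\<Prod>v\<in>V - W. card (N v))"
  proof (rule card_le_prod[where T = "star W"])
    fix S' v assume "S' \<in> (\<lambda>S. S \<inter> St) ` F" and v: "v \<in> V - W"
    then obtain S where S: "S \<in> F" "S' = S \<inter> St" by blast
    have eq: "S' \<inter> star W v = S \<inter> star W v" using S(2) v unfolding St_def by blast
    show "S' \<inter> star W v \<in> N v"
    proof (cases "v \<in> R")
      case True
      then show ?thesis unfolding N_def by simp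
    next
      case False
      have "{v \<in> V - W. \<forall>i<Q. s \<le> card {u \<in> A i. {u, v} \<in> S}} = R" using S(1) unfolding F_def by blast
      then obtain i where i: "i < Q" "\<not> s \<le> card {u \<in> A i. {u, v} \<in> S}" using False v by blast
      have "{u \<in> A i. {u, v} \<in> S \<inter> star W v} = {u \<in> A i. {u, v} \<in> S}"
        using i(1) unfolding star_def Wdef by auto
      then have "card {u \<in> A i. {u, v} \<in> S \<inter> star W v} < s" using i(2) by simp
      then show ?thesis using False i(1) unfolding eq N_def by auto
    qed
  qed (use fV fN in \<open>auto simp: St_def\<close>)
  also have "(\<Prod>v\<in>V - W. card (N v)) \<le> (\<Prod>v\<in>V - W. (if v \<in> R then 2 ^ card W else 1) * (Q * (b * 2 ^ (card W - s'))))"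
  proof (rule prod_mono, rule conjI, simp)
    fix v assume v: "v \<in> V - W"
    have pos: "1 \<le> Q * (b * 2 ^ (card W - s'))" using Q b(2) by (simp add: Suc_le_eq)
    show "card (N v) \<le> (if v \<in> R then 2 ^ card W else 1) * (Q * (b * 2 ^ (card W - s')))"
    proof (cases "v \<in> R")
      case True
      have "card (Pow (star W v)) \<le> 2 ^ card W"
        using star_card star_fin by (simp add: card_Pow)
      also have "\<dots> \<le> 2 ^ card W * (Q * (b * 2 ^ (card W - s')))" using pos by simp
      finally show ?thesis using True unfolding N_def by simp
    next
      case False
      have "N v \<subseteq> (\<Union>i<Q. {T. T \<subseteq> star W v \<and> card {u \<in> A i. {u, v} \<in> T} < s})" using False unfolding N_def by auto
      then have "card (N v) \<le> card (\<Union>i<Q. {T. T \<subseteq> star W v \<and> card {u \<in> A i. {u, v} \<in> T} < s})"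
        by (intro card_mono) (use star_fin in auto)
      also have "\<dots> \<le> (\<Sum>i<Q. card {T. T \<subseteq> star W v \<and> card {u \<in> A i. {u, v} \<in> T} < s})"
        by (rule card_UN_le) simp
      also have "\<dots> \<le> (\<Sum>i<Q. b * 2 ^ (card W - s'))"
      proof (rule sum_mono)
        fix i assume i: "i \<in> {..<Q}"
        then have "A i \<subseteq> W" unfolding Wdef by auto
        then show "card {T. T \<subseteq> star W v \<and> card {u \<in> A i. {u, v} \<in> T} < s} \<le> b * 2 ^ (card W - s')"
          using card_small_star[OF fW, of "A i" s b v] b(1)[of i] A(2)[of i] i by simp
      qed
      finally show ?thesis using False by simp
    qed
  qed
  also have "\<dots> = (\<Prod>v\<in>V - W. if v \<in> R then 2 ^ card W else 1) * (Q * (b * 2 ^ (card W - s'))) ^ card (V - W)"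
    by (simp add: prod.distrib)
  also have "(\<Prod>v\<in>V - W. if v \<in> R then 2 ^ card W else 1) = ((2::nat) ^ card W) ^ card R"
    using fV R(1) by (simp add: prod.If_cases Int_absorb1)
  also have "(2 ^ card W) ^ card R * (Q * (b * 2 ^ (card W - s'))) ^ card (V - W) \<le>
      (2 ^ card W) ^ K * (Q * (b * 2 ^ (card W - s'))) ^ card V"
    using R(2) fV Q b(2) by (intro mult_le_mono power_increasing) (auto intro: card_mono simp: Suc_le_eq)
  also have "card (Pow (edges_on W)) \<le> 2 ^ (card W)\<^sup>2"
    using fW card_edges_on_le[OF fW] by (simp add: card_Pow)
  finally show ?thesis unfolding F_def by (simp add: mult.assoc)
qed

text \<open>Sum over the possible sets \<open>R\<close> of vertices dense to all parts. The
  pigeonhole bound makes the cost of their full stars independent of \<open>card V\<close>, and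
  naming \<open>R\<close> costs at most \<open>2 ^ card V\<close>.\<close>

lemma card_blowup_located:
  assumes fV: "finite V" and A: "\<And>i. i < Q \<Longrightarrow> A i \<subseteq> V" "\<And>i. i < Q \<Longrightarrow> card (A i) = s'"
    and Q: "Q \<ge> 1" and Wdef: "W = (\<Union>i<Q. A i)" and s: "s \<ge> 1"
    and b: "\<And>i. i < Q \<Longrightarrow> card (small_subsets (A i) s) \<le> b" "b \<ge> 1"
  shows "card {S \<in> blowup_free (Suc Q) s V. blowup Q s' S V A}
    \<le> 2 ^ card V * (card (blowup_free (Suc Q) s (V - W)) *
        (2 ^ (card W)\<^sup>2 * ((2 ^ card W) ^ (s * 2 ^ card W) * (Q * (b * 2 ^ (card W - s'))) ^ card V)))"
    (is "card ?F \<le> 2 ^ card V * ?b")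
proof -
  define bad where "bad = (\<lambda>S. {v \<in> V - W. \<forall>i<Q. s \<le> card {u \<in> A i. {u, v} \<in> S}})"
  define I where "I = {R \<in> Pow (V - W). card R \<le> s * 2 ^ card W}"
  have fI: "finite I" using fV unfolding I_def by auto
  have "?F \<subseteq> (\<Union>R\<in>I. {S \<in> blowup_free (Suc Q) s V. bad S = R})"
  proof
    fix S assume S: "S \<in> ?F"
    have "card (bad S) \<le> s * 2 ^ card W"
      unfolding Wdef bad_def by (rule card_blowup_bad_vertices) (use S fV s in \<open>auto simp: blowup_free_def\<close>)
    then have "bad S \<in> I" unfolding I_def bad_def by blast
    then show "S \<in> (\<Union>R\<in>I. {S \<in> blowup_free (Suc Q) s V. bad S = R})" using S by blast
  qed
  then have "card ?F \<le> card (\<Union>R\<in>I. {S \<in> blowup_free (Suc Q) s V. bad S = R})"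
    by (rule card_mono[rotated]) (use fV fI in auto)
  also have "\<dots> \<le> (\<Sum>R\<in>I. card {S \<in> blowup_free (Suc Q) s V. bad S = R})" by (rule card_UN_le[OF fI])
  also have "\<dots> \<le> (\<Sum>R\<in>I. ?b)"
  proof (rule sum_mono)
    fix R assume "R \<in> I"
    then show "card {S \<in> blowup_free (Suc Q) s V. bad S = R} \<le> ?b"
      unfolding bad_def I_def by (intro card_blowup_located_fixed_bad[OF fV A Q Wdef _ _ b]) auto
  qed
  also have "\<dots> = card I * ?b" by simp
  also have "card I \<le> card (Pow (V - W))" using fV unfolding I_def by (intro card_mono) auto
  also have "card (Pow (V - W)) \<le> 2 ^ card V" using fV by (simp add: card_Pow card_mono)
  finally show ?thesis by simp
qed

text \<open>The limit of \<open>turan_num n q / n\<^sup>2\<close>. For \<open>q = 0\<close> division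
  by zero makes it 0, the value at which the recursion for blow-up-free graphs starts.\<close>

definition turan_density :: "nat \<Rightarrow> real" where
  "turan_density q = (real q - 1) / (2 * real q)"

text \<open>One step of the recursion on the number of parts: either no blow-up with
  \<open>Q\<close> parts of the larger size \<open>s'\<close> occurs, or one of at most
  \<open>2 ^ (Q * card V)\<close> places carries it.\<close>

lemma card_le_split_blowup:
  assumes fV: "finite V" and Q: "Q \<ge> 1" and s: "s \<ge> 1"
    and b: "\<And>A. A \<subseteq> V \<Longrightarrow> card A = s' \<Longrightarrow> card (small_subsets A s) \<le> b" "b \<ge> 1"
    and f: "\<And>W. W \<subseteq> V \<Longrightarrow> card W = Q * s' \<Longrightarrow> card (blowup_free (Suc Q) s (V - W)) \<le> f"
  shows "card (blowup_free (Suc Q) s V) \<le> card (blowup_free Q s' V) +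
    2 ^ (Q * card V) * (2 ^ card V * (f *
        (2 ^ (Q * s')\<^sup>2 * ((2 ^ (Q * s')) ^ (s * 2 ^ (Q * s')) * (Q * (b * 2 ^ (Q * s' - s'))) ^ card V))))"
    (is "_ \<le> _ + _ * ?M")
proof -
  define P where "P = PiE {..<Q} (\<lambda>_. Pow V)"
  have fP: "finite P" unfolding P_def using fV by (intro finite_PiE) auto
  let ?G = "\<lambda>A. {S \<in> blowup_free (Suc Q) s V. blowup Q s' S V A}"
  have "blowup_free (Suc Q) s V \<subseteq> blowup_free Q s' V \<union> (\<Union>A\<in>P. ?G A)"
  proof
    fix S assume S: "S \<in> blowup_free (Suc Q) s V"
    show "S \<in> blowup_free Q s' V \<union> (\<Union>A\<in>P. ?G A)"
    proof (cases "\<exists>A. blowup Q s' S V A")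
      case True
      then obtain A where A: "blowup Q s' S V A" by blast
      have "blowup Q s' S V (restrict A {..<Q})" using A unfolding blowup_def by simp
      moreover have "restrict A {..<Q} \<in> P" using A unfolding P_def blowup_def by auto
      ultimately show ?thesis using S by blast
    qed (use S in \<open>auto simp: blowup_free_def\<close>)
  qed
  then have "card (blowup_free (Suc Q) s V) \<le> card (blowup_free Q s' V \<union> (\<Union>A\<in>P. ?G A))"
    by (rule card_mono[rotated]) (use fV fP in auto)
  also have "\<dots> \<le> card (blowup_free Q s' V) + card (\<Union>A\<in>P. ?G A)" by (rule card_Un_le)
  also have "card (\<Union>A\<in>P. ?G A) \<le> (\<Sum>A\<in>P. card (?G A))" by (rule card_UN_le[OF fP])
  also have "(\<Sum>A\<in>P. card (?G A)) \<le> (\<Sum>A\<in>P. ?M)"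
  proof (rule sum_mono)
    fix A assume "A \<in> P"
    show "card (?G A) \<le> ?M"
    proof (cases "?G A = {}")
      case False
      then obtain S where S: "blowup Q s' S V A" by blast
      have A: "A i \<subseteq> V" "card (A i) = s'" if "i < Q" for i using S that unfolding blowup_def by auto
      define W where "W = (\<Union>i<Q. A i)"
      have "card W = (\<Sum>i<Q. card (A i))" unfolding W_def
        by (rule card_UN_disjoint) (use S fV finite_subset in \<open>auto simp: blowup_def\<close>)
      then have cW: "card W = Q * s'" using A by simp
      have "W \<subseteq> V" using A unfolding W_def by auto
      from card_blowup_located[OF fV A Q W_def s b(1)[OF A] b(2)]
      have "card (?G A) \<le> 2 ^ card V * (card (blowup_free (Suc Q) s (V - W)) *
        (2 ^ (card W)\<^sup>2 * ((2 ^ card W) ^ (s * 2 ^ card W) * (Q * (b * 2 ^ (card W - s'))) ^ card V)))" by blast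
      also have "\<dots> \<le> ?M" unfolding cW by (intro mult_le_mono f) (use \<open>W \<subseteq> V\<close> cW in auto)
      finally show ?thesis .
    next
      case True
      then have "card (?G A) = 0" by (metis card.empty)
      then show ?thesis by (metis zero_le)
    qed
  qed
  also have "(\<Sum>A\<in>P. ?M) = card P * ?M" by simp
  also have "card P = (2 ^ card V) ^ Q" unfolding P_def using fV by (simp add: card_PiE card_Pow)
  also have "((2::nat) ^ card V) ^ Q = 2 ^ (Q * card V)" by (simp add: power_mult[symmetric] mult.commute)
  finally show ?thesis by simp
qed

text \<open>Outer induction on the number of parts, inner induction on \<open>card V\<close>.
  Deleting a blow-up with \<open>Q\<close> parts of size \<open>s'\<close> removes
  \<open>h = Q * s'\<close> vertices, and each outside vertex has about \<open>2 ^ (h - s')\<close>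
  ways to be joined to it. Since \<open>2 * turan_density Q * h = h - s'\<close>, the main term
  drops by exactly this amount, and the surplus \<open>2 * \<epsilon> * h * n\<close> pays for the
  errors.\<close>

lemma card_blowup_free:
  assumes "\<epsilon> > 0" "s \<ge> 1"
  shows "\<exists>C\<ge>0. \<forall>V. finite V \<longrightarrow>
    real (card (blowup_free (Suc q) s V)) \<le> 2 powr ((turan_density q + \<epsilon>) * (real (card V))\<^sup>2 + C)"
  using assms(2)
proof (induction q arbitrary: s)
  case 0
  \<comment> \<open>With a single part any \<open>s\<close> vertices already form a blow-up, so the
    family is empty unless \<open>card V < s\<close>, where a constant suffices.\<close>
  have "real (card (blowup_free (Suc 0) s V)) \<le> 2 powr ((turan_density 0 + \<epsilon>) * (real (card V))\<^sup>2 + (real s)\<^sup>2)"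
    if fV: "finite V" for V
  proof (cases "s \<le> card V")
    case True
    then obtain B where B: "B \<subseteq> V" "card B = s" by (meson obtain_subset_with_card_n)
    then have "\<forall>S. blowup (Suc 0) s S V (\<lambda>_. B)" unfolding blowup_def by auto
    then have "blowup_free (Suc 0) s V = {}" unfolding blowup_free_def by blast
    then show ?thesis by simp
  next
    case False
    have "card (blowup_free (Suc 0) s V) \<le> card (Pow (edges_on V))"
      by (rule card_mono) (use fV in \<open>auto simp: blowup_free_def\<close>)
    also have "\<dots> = 2 ^ card (edges_on V)" using fV by (simp add: card_Pow)
    also have "\<dots> \<le> 2 ^ (card V)\<^sup>2" using card_edges_on_le[OF fV] by simp
    finally have "real (card (blowup_free (Suc 0) s V)) \<le> real (2 ^ (card V)\<^sup>2)" by (rule of_nat_mono)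
    also have "\<dots> = 2 powr (real (card V))\<^sup>2" by (simp add: powr_realpow[symmetric])
    also have "\<dots> \<le> 2 powr ((turan_density 0 + \<epsilon>) * (real (card V))\<^sup>2 + (real s)\<^sup>2)"
    proof -
      have "(real (card V))\<^sup>2 \<le> (real s)\<^sup>2" using False by (intro power_mono) auto
      moreover have "0 \<le> \<epsilon> * (real (card V))\<^sup>2" using assms by simp
      ultimately have "(real (card V))\<^sup>2 \<le> \<epsilon> * (real (card V))\<^sup>2 + (real s)\<^sup>2" by linarith
      moreover have "turan_density 0 = 0" by (simp add: turan_density_def)
      ultimately show ?thesis by (simp only: add_0) (rule powr_mono, auto)
    qed
    finally show ?thesis .
  qed
  then show ?case by (intro exI[of _ "(real s)\<^sup>2"]) auto
next
  case (Suc q)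
  define Q where "Q = Suc q"
  have Q1: "Q \<ge> 1" unfolding Q_def by simp
  obtain \<kappa> where \<kappa>: "\<kappa> > 0" "\<And>(A::nat set) n c. finite A \<Longrightarrow> card A \<le> n \<Longrightarrow> real c \<le> \<kappa> * real n \<Longrightarrow>
     real (card (small_subsets A c)) \<le> 2 powr (\<epsilon> * real n)" using card_small_subsets[OF assms(1)] by blast
  \<comment> \<open>The first summand makes subsets of a part with fewer than \<open>s\<close>
    elements rare, at most \<open>2 powr (\<epsilon> * s')\<close> many. The second makes
    \<open>\<epsilon> * s'\<close> exceed the linear costs \<open>2 * Q + 1\<close> per vertex, with
    2 to spare for the constants.\<close>
  define s' where "s' = nat \<lceil>real s / \<kappa>\<rceil> + nat \<lceil>(2 * real Q + 3) / \<epsilon>\<rceil> + 1"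
  have s'1: "real s \<le> \<kappa> * real s'"
  proof -
    have "real s / \<kappa> \<le> real s'" unfolding s'_def by linarith
    then show ?thesis using \<kappa>(1) by (simp add: field_simps)
  qed
  have s'2: "2 * real Q + 3 \<le> \<epsilon> * real s'"
  proof -
    have "(2 * real Q + 3) / \<epsilon> \<le> real s'" unfolding s'_def by linarith
    then show ?thesis using assms(1) by (simp add: field_simps)
  qed
  have "s' \<ge> 1" unfolding s'_def by simp
  then obtain C' where C': "C' \<ge> 0" "\<And>V. finite V \<Longrightarrow>
    real (card (blowup_free Q s' V)) \<le> 2 powr ((turan_density q + \<epsilon>) * (real (card V))\<^sup>2 + C')"
    using Suc.IH[of s'] unfolding Q_def by blast
  define \<theta> where "\<theta> = turan_density Q"
  have \<theta>q: "turan_density q \<le> \<theta>" and \<theta>0: "\<theta> \<ge> 0" and \<theta>Q: "2 * \<theta> * real Q = real Q - 1"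
    unfolding \<theta>_def turan_density_def Q_def by (cases "q = 0"; simp add: field_simps)+
  define h where "h = Q * s'"
  \<comment> \<open>The terms of the recursion that do not depend on \<open>n\<close>; for
    \<open>n \<ge> Kc\<close> the spare linear term absorbs them.\<close>
  define Kc where "Kc = (real h)\<^sup>2 + real h * real (s * 2 ^ h) + (\<theta> + \<epsilon>) * (real h)\<^sup>2 + 1"
  have Kc: "Kc \<ge> 0" unfolding Kc_def using \<theta>0 assms(1) by simp
  define n0 where "n0 = h + nat \<lceil>Kc\<rceil>"
  \<comment> \<open>\<open>C' + 1\<close> makes each of the two families of the recursion at most
    half of the bound; \<open>n0\<^sup>2\<close> covers vertex sets too small for the
    recursion.\<close>
  define C where "C = C' + 1 + (real n0)\<^sup>2"
  have C0: "C \<ge> 0" unfolding C_def using C'(1) by simp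
  define b where "b = nat \<lfloor>2 powr (\<epsilon> * real s')\<rfloor>"
  have "(2::real) powr 0 \<le> 2 powr (\<epsilon> * real s')" using assms(1) by (intro powr_mono) auto
  then have b1: "b \<ge> 1" unfolding b_def by (intro le_nat_floor) simp
  have b2: "real b \<le> 2 powr (\<epsilon> * real s')" unfolding b_def by simp
  have "real (card (blowup_free (Suc Q) s V)) \<le> 2 powr ((\<theta> + \<epsilon>) * (real (card V))\<^sup>2 + C)"
    if "finite V" for V
    using that
  proof (induction "card V" arbitrary: V rule: less_induct)
    case less
    define n where "n = card V"
    show ?case
    proof (cases "n \<ge> n0")
      case False
      have "card (blowup_free (Suc Q) s V) \<le> card (Pow (edges_on V))"
        by (rule card_mono) (use less in \<open>auto simp: blowup_free_def\<close>)
      also have "\<dots> = 2 ^ card (edges_on V)" using less by (simp add: card_Pow)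
      also have "\<dots> \<le> 2 ^ n\<^sup>2" using card_edges_on_le[of V] less unfolding n_def by simp
      finally have "real (card (blowup_free (Suc Q) s V)) \<le> real (2 ^ n\<^sup>2)" by (rule of_nat_mono)
      also have "\<dots> = 2 powr (real n)\<^sup>2" by (simp add: powr_realpow[symmetric])
      also have "\<dots> \<le> 2 powr ((\<theta> + \<epsilon>) * (real n)\<^sup>2 + C)"
      proof -
        have "(real n)\<^sup>2 \<le> (real n0)\<^sup>2" using False by (intro power_mono) auto
        moreover have "0 \<le> (\<theta> + \<epsilon>) * (real n)\<^sup>2" using assms(1) \<theta>0 by simp
        ultimately have "(real n)\<^sup>2 \<le> (\<theta> + \<epsilon>) * (real n)\<^sup>2 + C" using C'(1) unfolding C_def by linarith
        then show ?thesis by (rule powr_mono) simp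
      qed
      finally show ?thesis unfolding n_def .
    next
      case True
      have hn: "h \<le> n" and Kn: "Kc \<le> real n" using True unfolding n0_def by linarith+
      define f where "f = nat \<lfloor>2 powr ((\<theta> + \<epsilon>) * (real (n - h))\<^sup>2 + C)\<rfloor>"
      have f: "card (blowup_free (Suc Q) s (V - W)) \<le> f" if W: "W \<subseteq> V" "card W = Q * s'" for W
      proof -
        have c: "card (V - W) = n - h" using W less.prems unfolding n_def h_def
          by (simp add: card_Diff_subset finite_subset)
        have "h > 0" unfolding h_def using Q1 \<open>s' \<ge> 1\<close> by simp
        then have "card (V - W) < card V" using c hn unfolding n_def by linarith
        then have "real (card (blowup_free (Suc Q) s (V - W))) \<le> 2 powr ((\<theta> + \<epsilon>) * (real (n - h))\<^sup>2 + C)"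
          using less.hyps[of "V - W"] less.prems unfolding c by simp
        then show ?thesis unfolding f_def by (simp add: le_nat_floor)
      qed
      have bb: "card (small_subsets A s) \<le> b" if A: "A \<subseteq> V" "card A = s'" for A
      proof -
        have "real (card (small_subsets A s)) \<le> 2 powr (\<epsilon> * real s')"
          using \<kappa>(2)[of A s' s] A s'1 less.prems finite_subset by auto
        then show ?thesis unfolding b_def by (simp add: le_nat_floor)
      qed
      have fr: "real f \<le> 2 powr ((\<theta> + \<epsilon>) * (real n - real h)\<^sup>2 + C)"
        unfolding f_def using hn by (simp add: of_nat_diff)
      define X where "X = 2 ^ (Q * n) * (2 ^ n * (f *
        (2 ^ h\<^sup>2 * ((2 ^ h) ^ (s * 2 ^ h) * (Q * (b * 2 ^ (h - s'))) ^ n))))"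
      have 1: "card (blowup_free (Suc Q) s V) \<le> card (blowup_free Q s' V) + X"
        unfolding X_def n_def h_def
        by (rule card_le_split_blowup) (use less.prems Q1 Suc.prems bb b1 f in auto)
      have "real Q \<le> 2 powr real Q" by (simp add: powr_realpow less_imp_le)
      have "s' \<le> h" unfolding h_def using Q1 by simp
      then have hs: "(2::real) ^ (h - s') = 2 powr (real h - real s')" by (simp add: powr_realpow[symmetric] of_nat_diff)
      have "real (Q * (b * 2 ^ (h - s'))) \<le> 2 powr real Q * (2 powr (\<epsilon> * real s') * 2 powr (real h - real s'))"
        unfolding of_nat_mult of_nat_power of_nat_numeral hs
        by (intro mult_mono \<open>real Q \<le> _\<close> b2) auto
      also have "\<dots> = 2 powr (real Q + \<epsilon> * real s' + real h - real s')" by (simp add: powr_add[symmetric] algebra_simps)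
      finally have "real (Q * (b * 2 ^ (h - s'))) ^ n \<le> (2 powr (real Q + \<epsilon> * real s' + real h - real s')) ^ n"
        by (intro power_mono) auto
      also have "\<dots> = 2 powr (real n * (real Q + \<epsilon> * real s' + real h - real s'))"
        by (simp add: powr_realpow[symmetric] powr_powr mult.commute)
      finally have pw: "real (Q * (b * 2 ^ (h - s'))) ^ n \<le> 2 powr (real n * (real Q + \<epsilon> * real s' + real h - real s'))" .
      have "real X \<le> 2 powr (real Q * real n) * (2 powr real n * (2 powr ((\<theta> + \<epsilon>) * (real n - real h)\<^sup>2 + C) *
         (2 powr (real h)\<^sup>2 * (2 powr (real h * real (s * 2 ^ h)) * 2 powr (real n * (real Q + \<epsilon> * real s' + real h - real s'))))))"
      proof -
        have e1: "real (2 ^ (Q * n)) = 2 powr (real Q * real n)" "real (2 ^ n) = 2 powr real n"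
          "real (2 ^ h\<^sup>2) = 2 powr (real h)\<^sup>2" "real ((2 ^ h) ^ (s * 2 ^ h)) = 2 powr (real h * real (s * 2 ^ h))"
          by (simp_all add: powr_realpow[symmetric] power_mult[symmetric])
        have "real X = 2 powr (real Q * real n) * (2 powr real n * (real f *
         (2 powr (real h)\<^sup>2 * (2 powr (real h * real (s * 2 ^ h)) * real (Q * (b * 2 ^ (h - s'))) ^ n))))"
          unfolding X_def e1[symmetric] by (simp only: of_nat_mult of_nat_power)
        also have "\<dots> \<le> 2 powr (real Q * real n) * (2 powr real n * (2 powr ((\<theta> + \<epsilon>) * (real n - real h)\<^sup>2 + C) *
         (2 powr (real h)\<^sup>2 * (2 powr (real h * real (s * 2 ^ h)) * 2 powr (real n * (real Q + \<epsilon> * real s' + real h - real s'))))))"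
          by (intro mult_mono mult_left_mono fr pw order.refl) auto
        finally show ?thesis .
      qed
      also have "\<dots> = 2 powr (real Q * real n + real n + ((\<theta> + \<epsilon>) * (real n - real h)\<^sup>2 + C) +
         (real h)\<^sup>2 + real h * real (s * 2 ^ h) + real n * (real Q + \<epsilon> * real s' + real h - real s'))"
        by (simp only: powr_add[symmetric] add.assoc)
      also have "\<dots> \<le> 2 powr ((\<theta> + \<epsilon>) * (real n)\<^sup>2 + C - 1)"
      proof (rule powr_mono)
        have rh: "real h = real Q * real s'" unfolding h_def by simp
        have "2 * \<theta> * real h = real h - real s'"
          using \<theta>Q unfolding rh by (metis mult.assoc left_diff_distrib mult_1)
        then have t: "2 * \<theta> * real h * real n = (real h - real s') * real n" by simp
        have sq: "(\<theta> + \<epsilon>) * (real n - real h)\<^sup>2 = (\<theta> + \<epsilon>) * (real n)\<^sup>2 - 2 * \<theta> * real h * real n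
            - 2 * (\<epsilon> * real h * real n) + (\<theta> + \<epsilon>) * (real h)\<^sup>2" by (simp add: power2_eq_square algebra_simps)
        have "real s' \<le> real h" using \<open>s' \<le> h\<close> by simp
        then have e: "\<epsilon> * real s' * real n \<le> \<epsilon> * real h * real n" using assms(1) by (intro mult_right_mono mult_left_mono) auto
        have e2: "(2 * real Q + 3) * real n \<le> \<epsilon> * real s' * real n" using s'2 by (intro mult_right_mono) auto
        show "real Q * real n + real n + ((\<theta> + \<epsilon>) * (real n - real h)\<^sup>2 + C) +
         (real h)\<^sup>2 + real h * real (s * 2 ^ h) + real n * (real Q + \<epsilon> * real s' + real h - real s')
           \<le> (\<theta> + \<epsilon>) * (real n)\<^sup>2 + C - 1"
          unfolding sq t using Kn e e2 unfolding Kc_def by (simp add: algebra_simps)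
      qed simp
      finally have X: "real X \<le> 2 powr ((\<theta> + \<epsilon>) * (real n)\<^sup>2 + C - 1)" .
      have "real (card (blowup_free Q s' V)) \<le> 2 powr ((turan_density q + \<epsilon>) * (real n)\<^sup>2 + C')"
        using C'(2) less.prems unfolding n_def by simp
      also have "\<dots> \<le> 2 powr ((\<theta> + \<epsilon>) * (real n)\<^sup>2 + C - 1)"
      proof (rule powr_mono)
        have "(turan_density q + \<epsilon>) * (real n)\<^sup>2 \<le> (\<theta> + \<epsilon>) * (real n)\<^sup>2" using \<theta>q by (intro mult_right_mono) auto
        moreover have "C' \<le> C - 1" unfolding C_def by simp
        ultimately show "(turan_density q + \<epsilon>) * (real n)\<^sup>2 + C' \<le> (\<theta> + \<epsilon>) * (real n)\<^sup>2 + C - 1" by linarith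
      qed simp
      finally have Y: "real (card (blowup_free Q s' V)) \<le> 2 powr ((\<theta> + \<epsilon>) * (real n)\<^sup>2 + C - 1)" .
      have "real (card (blowup_free (Suc Q) s V)) \<le> real (card (blowup_free Q s' V)) + real X"
        using 1 by linarith
      also have "\<dots> \<le> 2 * 2 powr ((\<theta> + \<epsilon>) * (real n)\<^sup>2 + C - 1)" using X Y by simp
      also have "\<dots> = 2 powr ((\<theta> + \<epsilon>) * (real n)\<^sup>2 + C)" by (simp add: powr_diff)
      finally show ?thesis unfolding n_def .
    qed
  qed
  then show ?case using C0 unfolding \<theta>_def Q_def by blast
qed

section \<open>Embedding fans into universal orientations\<close>

text \<open>Local counterpart of \<open>universal\<close>: it lets a few fixed vertices be joined to
  a part with any prescribed directions.\<close>

definition rich :: "nat set set \<Rightarrow> nat set set \<Rightarrow> nat set \<Rightarrow> nat set \<Rightarrow> nat \<Rightarrow> bool" where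
  "rich E S Y W c \<longleftrightarrow>
     (\<forall>\<sigma>\<subseteq>Y. c \<le> card {a \<in> W. \<forall>y\<in>Y. if y \<in> \<sigma> then arc E S y a else arc E S a y})"

lemma rich_subset:
  assumes "rich E S Y W c" "Y' \<subseteq> Y" "finite W"
  shows "rich E S Y' W c"
  unfolding rich_def
proof (intro allI impI)
  fix \<sigma> assume \<sigma>: "\<sigma> \<subseteq> Y'"
  have "c \<le> card {a \<in> W. \<forall>y\<in>Y. if y \<in> \<sigma> then arc E S y a else arc E S a y}"
    using assms \<sigma> unfolding rich_def by blast
  also have "\<dots> \<le> card {a \<in> W. \<forall>y\<in>Y'. if y \<in> \<sigma> then arc E S y a else arc E S a y}"
    by (rule card_mono) (use assms in auto)
  finally show "c \<le> card {a \<in> W. \<forall>y\<in>Y'. if y \<in> \<sigma> then arc E S y a else arc E S a y}" .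
qed

lemma arc_cases: "{x, y} \<in> E \<Longrightarrow> x \<noteq> y \<Longrightarrow> arc E S x y \<longleftrightarrow> \<not> arc E S y x"
  unfolding arc_def by (auto simp: insert_commute)

abbreviation blk :: "nat \<Rightarrow> nat \<Rightarrow> nat set" where
  "blk p a \<equiv> {a * p<..a * p + p}"

definition fan_adj :: "nat \<Rightarrow> nat \<Rightarrow> nat \<Rightarrow> bool" where
  "fan_adj p x y \<longleftrightarrow> x \<noteq> y \<and> (\<exists>a<2. x \<in> insert 0 (blk p a) \<and> y \<in> insert 0 (blk p a))"

text \<open>The anti-directed fan with blocks of size \<open>p = r - 1\<close>, in the form used for
  embeddings: the clique condition at the centre 0 is expressed by an in- and an out-neighbour in
  each block.\<close>

locale anti_fan =
  fixes p :: nat and A :: "(nat \<times> nat) set"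
  assumes p2: "2 \<le> p"
    and A_adj: "(x, y) \<in> A \<Longrightarrow> fan_adj p x y"
    and A_orient: "fan_adj p x y \<Longrightarrow> (x, y) \<in> A \<longleftrightarrow> (y, x) \<notin> A"
    and A_in: "a < 2 \<Longrightarrow> \<exists>v\<in>blk p a. (v, 0) \<in> A"
    and A_out: "a < 2 \<Longrightarrow> \<exists>v\<in>blk p a. (0, v) \<in> A"
begin

definition fan_in :: "nat set set \<Rightarrow> nat set set \<Rightarrow> bool" where
  "fan_in E S \<longleftrightarrow> (\<exists>f. inj_on f {..2*p} \<and> (\<forall>x y. (x, y) \<in> A \<longrightarrow> arc E S (f x) (f y)))"

lemma fan_adj_le: "fan_adj p x y \<Longrightarrow> x \<le> 2*p \<and> y \<le> 2*p"
proof -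
  assume "fan_adj p x y"
  then obtain a where a: "a < 2" "x \<in> insert 0 (blk p a)" "y \<in> insert 0 (blk p a)" unfolding fan_adj_def by blast
  from a(1) have "a = 0 \<or> a = 1" by auto
  then show ?thesis using a by auto
qed

text \<open>The vertices in \<open>P\<close> are placed by hand through \<open>g\<close>. Every
  other vertex gets a slot and is restricted there to vertices joined to the placed ones in the
  right directions; universality then fills all slots at once. Of the \<open>2 * c + 4\<close>
  candidates \<open>2 * c\<close> remain after removing the at most four placed vertices, enough for
  disjoint sets of size \<open>c\<close> for the two slots of a part.\<close>

lemma embed:
  assumes univ: "universal p c E S V"
    and V: "\<And>i. i < p \<Longrightarrow> finite (V i)" "\<And>i. i < p \<Longrightarrow> 2 * c \<le> card (V i)"
      "\<And>i j. i < p \<Longrightarrow> j < p \<Longrightarrow> i \<noteq> j \<Longrightarrow> V i \<inter> V j = {}"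
    and P: "P \<subseteq> {..2*p}" "card P \<le> 4" "inj_on g P"
    and sl: "inj_on sl ({..2*p} - P)" "\<And>b. b \<in> {..2*p} - P \<Longrightarrow> sl b < 2*p"
    and proper: "\<And>b b'. b \<notin> P \<Longrightarrow> b' \<notin> P \<Longrightarrow> (b, b') \<in> A \<Longrightarrow> sl b mod p \<noteq> sl b' mod p"
    and pin: "\<And>b b'. b \<in> P \<Longrightarrow> b' \<in> P \<Longrightarrow> (b, b') \<in> A \<Longrightarrow> arc E S (g b) (g b')"
    and Z: "\<And>b. b \<in> {..2*p} - P \<Longrightarrow> 2 * c + 4 \<le> card {v \<in> V (sl b mod p). \<forall>q\<in>P.
        ((b, q) \<in> A \<longrightarrow> arc E S v (g q)) \<and> ((q, b) \<in> A \<longrightarrow> arc E S (g q) v)}"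
  shows "fan_in E S"
proof -
  define N where "N = {..2*p} - P"
  define Zs where "Zs = (\<lambda>b. {v \<in> V (sl b mod p). \<forall>q\<in>P.
        ((b, q) \<in> A \<longrightarrow> arc E S v (g q)) \<and> ((q, b) \<in> A \<longrightarrow> arc E S (g q) v)})"
  define inv where "inv = the_inv_into N sl"
  have inv: "inv (sl b) = b" if "b \<in> N" for b
    unfolding inv_def using sl(1) that unfolding N_def by (simp add: the_inv_into_f_f)
  \<comment> \<open>Slots occupied by no fan vertex must be filled as well and are offered the whole
    part.\<close>
  define Y where "Y = (\<lambda>k. if k \<in> sl ` N then Zs (inv k) - g ` P else V (k mod p))"
  have fP: "finite P" using P(1) finite_subset by blast
  have p0: "k mod p < p" for k using p2 by simp
  have YV: "Y k \<subseteq> V (k mod p)" for k unfolding Y_def Zs_def using inv by auto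
  have Yc: "2 * c \<le> card (Y k)" if "k < 2*p" for k
  proof (cases "k \<in> sl ` N")
    case True
    then obtain b where b: "b \<in> N" "k = sl b" by blast
    have "card (g ` P) \<le> 4" using P(2) card_image_le[OF fP, of g] by linarith
    moreover have "2 * c + 4 \<le> card (Zs b)" using Z b(1) unfolding N_def Zs_def by blast
    moreover have "card (Zs b) - card (g ` P) \<le> card (Zs b - g ` P)"
      by (rule diff_card_le_card_Diff) (use fP in simp)
    moreover have "card (Y k) = card (Zs b - g ` P)" unfolding Y_def using True inv b by simp
    ultimately show ?thesis by linarith
  next
    case False
    then show ?thesis unfolding Y_def using V(2)[OF p0] by simp
  qed
  have "\<exists>B. B \<subseteq> Y k \<and> card B = c" if "k < 2*p" for k
    using Yc[OF that] obtain_subset_with_card_n[of c "Y k"] by (metis le_add1 mult_2 order.trans)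
  then obtain B where B: "\<And>k. k < 2*p \<Longrightarrow> B k \<subseteq> Y k" "\<And>k. k < 2*p \<Longrightarrow> card (B k) = c" by metis
  have fY: "finite (Y k)" for k using YV V(1)[OF p0] finite_subset by blast
  have "\<exists>B'. B' \<subseteq> Y (p + k) - B k \<and> card B' = c" if "k < p" for k
  proof -
    have "finite (B k)" using B(1)[of k] fY[of k] that finite_subset by auto
    then have "card (Y (p + k)) - card (B k) \<le> card (Y (p + k) - B k)" by (rule diff_card_le_card_Diff)
    then have "c \<le> card (Y (p + k) - B k)" using Yc[of "p + k"] B(2)[of k] that by linarith
    then show ?thesis by (meson obtain_subset_with_card_n)
  qed
  then obtain B' where B': "\<And>k. k < p \<Longrightarrow> B' k \<subseteq> Y (p + k) - B k" "\<And>k. k < p \<Longrightarrow> card (B' k) = c" by metis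
  define X where "X = (\<lambda>k. if k < p then B k else B' (k - p))"
  have XY: "X k \<subseteq> Y k" if "k < 2*p" for k
  proof (cases "k < p")
    case False
    then have "k - p < p" using that by linarith
    then show ?thesis using B'(1)[of "k - p"] False unfolding X_def by auto
  qed (use B(1)[OF that] in \<open>simp add: X_def\<close>)
  have Xc: "card (X k) = c" if "k < 2*p" for k
  proof (cases "k < p")
    case False
    then have "k - p < p" using that by linarith
    then show ?thesis using B'(2)[of "k - p"] False unfolding X_def by auto
  qed (use B(2)[OF that] in \<open>simp add: X_def\<close>)
  have Xd': "X k \<inter> X l = {}" if "k < l" "l < 2*p" for k l
  proof (cases "k mod p = l mod p")
    case False
    then show ?thesis using XY[of k] XY[of l] YV[of k] YV[of l] V(3)[OF p0 p0, of k l] that by fastforce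
  next
    case True
    have "k < p \<and> l = p + k"
    proof (cases "k < p")
      case k: True
      then have "\<not> l < p" using True that by auto
      moreover have "l mod p = l - p" using \<open>\<not> l < p\<close> that by (simp add: mod_if)
      ultimately show ?thesis using True k by simp
    next
      case False
      then have "k mod p = k - p" "l mod p = l - p" using that by (simp_all add: mod_if)
      then show ?thesis using True False that by linarith
    qed
    then show ?thesis using B'(1)[of k] unfolding X_def by auto
  qed
  then have Xd: "X k \<inter> X l = {}" if "k < 2*p" "l < 2*p" "k \<noteq> l" for k l
    using that by (metis Int_commute linorder_neq_iff)
  define \<tau> where "\<tau> = {(k, l). (inv k, inv l) \<in> A}"
  obtain x where x: "\<forall>k<2*p. x k \<in> X k" and xa: "\<forall>k l. k < l \<longrightarrow> l < 2*p \<longrightarrow> k mod p \<noteq> l mod p \<longrightarrow>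
                (if (k, l) \<in> \<tau> then arc E S (x k) (x l) else arc E S (x l) (x k))"
  proof -
    have "\<forall>k<2*p. X k \<subseteq> V (k mod p) \<and> c \<le> card (X k)" using XY YV Xc by (metis order.refl order.trans)
    moreover have "\<forall>k<2*p. \<forall>l<2*p. k \<noteq> l \<longrightarrow> X k \<inter> X l = {}" using Xd by blast
    ultimately show ?thesis using univ unfolding universal_def using that by blast
  qed
  define f where "f = (\<lambda>b. if b \<in> P then g b else x (sl b))"
  have xZ: "x (sl b) \<in> Zs b - g ` P" if "b \<in> N" for b
  proof -
    have "sl b < 2*p" using sl(2) that unfolding N_def by blast
    then have "x (sl b) \<in> Y (sl b)" using x XY by blast
    then show ?thesis unfolding Y_def using that inv by auto
  qed
  have "inj_on f {..2*p}"
  proof (rule inj_onI)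
    fix b b' assume b: "b \<in> {..2*p}" "b' \<in> {..2*p}" "f b = f b'"
    consider "b \<in> P" "b' \<in> P" | "b \<in> P" "b' \<in> N" | "b \<in> N" "b' \<in> P" | "b \<in> N" "b' \<in> N"
      using b unfolding N_def by blast
    then show "b = b'"
    proof cases
      case 1 then show ?thesis using b(3) P(3) unfolding f_def by (simp add: inj_onD)
    next
      case 2
      then have "f b \<in> g ` P" "f b' \<notin> g ` P" using xZ[of b'] unfolding f_def N_def by simp_all
      then show ?thesis using b(3) by simp
    next
      case 3
      then have "f b' \<in> g ` P" "f b \<notin> g ` P" using xZ[of b] unfolding f_def N_def by simp_all
      then show ?thesis using b(3) by simp
    next
      case 4
      then have "x (sl b) = x (sl b')" "sl b < 2*p" "sl b' < 2*p" using b(3) sl(2) unfolding f_def N_def by auto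
      then have "sl b = sl b'" using x Xd[of "sl b" "sl b'"] by (metis disjoint_iff)
      then show ?thesis using 4 inv by metis
    qed
  qed
  moreover have "arc E S (f b) (f b')" if bA: "(b, b') \<in> A" for b b'
  proof -
    have le: "b \<le> 2*p" "b' \<le> 2*p" using fan_adj_le[OF A_adj[OF bA]] by auto
    have nA: "(b', b) \<notin> A" using A_orient[OF A_adj[OF bA]] bA by blast
    consider "b \<in> P" "b' \<in> P" | "b \<in> P" "b' \<in> N" | "b \<in> N" "b' \<in> P" | "b \<in> N" "b' \<in> N"
      using le unfolding N_def by blast
    then show ?thesis
    proof cases
      case 1 then show ?thesis using pin bA unfolding f_def by simp
    next
      case 2 then show ?thesis using xZ[of b'] bA unfolding f_def N_def Zs_def by auto
    next
      case 3 then show ?thesis using xZ[of b] bA unfolding f_def N_def Zs_def by auto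
    next
      case 4
      then have f: "f b = x (sl b)" "f b' = x (sl b')" unfolding f_def N_def by auto
      have s: "sl b < 2*p" "sl b' < 2*p" using 4 sl(2) unfolding N_def by auto
      have m: "sl b mod p \<noteq> sl b' mod p" using proper[of b b'] bA 4 unfolding N_def by blast
      have \<tau>: "(sl b, sl b') \<in> \<tau>" "(sl b', sl b) \<notin> \<tau>" using bA nA inv 4 unfolding \<tau>_def by auto
      consider "sl b < sl b'" | "sl b' < sl b" using m by fastforce
      then show ?thesis
      proof cases
        case 1 then show ?thesis using xa s m \<tau> f by fastforce
      next
        case 2 then show ?thesis using xa s m \<tau> f by fastforce
      qed
    qed
  qed
  ultimately show ?thesis unfolding fan_in_def by blast
qed

text \<open>Richness supplies the candidates for \<open>b\<close>: take for \<open>\<sigma>\<close>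
  the images of the placed vertices that point to \<open>b\<close>. Injectivity of \<open>g\<close>
  excludes conflicting demands on one image.\<close>

lemma embed_rich:
  assumes "universal p c E S V"
    and "\<And>i. i < p \<Longrightarrow> finite (V i)" "\<And>i. i < p \<Longrightarrow> 2 * c \<le> card (V i)"
      "\<And>i j. i < p \<Longrightarrow> j < p \<Longrightarrow> i \<noteq> j \<Longrightarrow> V i \<inter> V j = {}"
    and P: "P \<subseteq> {..2*p}" "card P \<le> 4" "inj_on g P"
    and "inj_on sl ({..2*p} - P)" "\<And>b. b \<in> {..2*p} - P \<Longrightarrow> sl b < 2*p"
    and "\<And>b b'. b \<notin> P \<Longrightarrow> b' \<notin> P \<Longrightarrow> (b, b') \<in> A \<Longrightarrow> sl b mod p \<noteq> sl b' mod p"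
    and "\<And>b b'. b \<in> P \<Longrightarrow> b' \<in> P \<Longrightarrow> (b, b') \<in> A \<Longrightarrow> arc E S (g b) (g b')"
    and Z: "\<And>b. b \<in> {..2*p} - P \<Longrightarrow> \<exists>Y. rich E S Y (V (sl b mod p)) (2 * c + 4) \<and>
        (\<forall>q\<in>P. fan_adj p b q \<longrightarrow> g q \<in> Y)"
  shows "fan_in E S"
proof (rule embed[OF assms(1-11)])
  fix b assume b: "b \<in> {..2*p} - P"
  obtain Y where Y: "rich E S Y (V (sl b mod p)) (2 * c + 4)" "\<forall>q\<in>P. fan_adj p b q \<longrightarrow> g q \<in> Y"
    using Z[OF b] by blast
  define \<sigma> where "\<sigma> = {y \<in> Y. \<exists>q\<in>P. g q = y \<and> (q, b) \<in> A}"
  have "2 * c + 4 \<le> card {a \<in> V (sl b mod p). \<forall>y\<in>Y. if y \<in> \<sigma> then arc E S y a else arc E S a y}"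
  proof -
    have "\<sigma> \<subseteq> Y" unfolding \<sigma>_def by simp
    then show ?thesis using Y(1) unfolding rich_def by simp
  qed
  also have "\<dots> \<le> card {v \<in> V (sl b mod p). \<forall>q\<in>P.
        ((b, q) \<in> A \<longrightarrow> arc E S v (g q)) \<and> ((q, b) \<in> A \<longrightarrow> arc E S (g q) v)}"
  proof (rule card_mono)
    show "finite {v \<in> V (sl b mod p). \<forall>q\<in>P. ((b, q) \<in> A \<longrightarrow> arc E S v (g q)) \<and> ((q, b) \<in> A \<longrightarrow> arc E S (g q) v)}"
      by (rule rev_finite_subset[OF assms(2)[of "sl b mod p"]]) (use p2 in auto)
    show "{a \<in> V (sl b mod p). \<forall>y\<in>Y. if y \<in> \<sigma> then arc E S y a else arc E S a y} \<subseteq>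
      {v \<in> V (sl b mod p). \<forall>q\<in>P. ((b, q) \<in> A \<longrightarrow> arc E S v (g q)) \<and> ((q, b) \<in> A \<longrightarrow> arc E S (g q) v)}"
    proof (intro subsetI CollectI conjI ballI impI)
      fix v q assume v: "v \<in> {a \<in> V (sl b mod p). \<forall>y\<in>Y. if y \<in> \<sigma> then arc E S y a else arc E S a y}" and q: "q \<in> P"
      {
        assume bq: "(b, q) \<in> A"
        have adj: "fan_adj p b q" by (rule A_adj[OF bq])
        have "g q \<in> Y" using Y(2) q adj by blast
        moreover have "g q \<notin> \<sigma>"
        proof
          assume "g q \<in> \<sigma>"
          then obtain q' where "q' \<in> P" "g q' = g q" "(q', b) \<in> A" unfolding \<sigma>_def by blast
          then have "(q, b) \<in> A" using P(3) q by (metis inj_onD)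
          then show False using A_orient[OF adj] bq by blast
        qed
        ultimately show "arc E S v (g q)" using v by auto
      next
        assume qb: "(q, b) \<in> A"
        then have "fan_adj p b q" using A_adj[OF qb] unfolding fan_adj_def by auto
        then have "g q \<in> Y" using Y(2) q by blast
        then have "g q \<in> \<sigma>" using q qb unfolding \<sigma>_def by blast
        then show "arc E S (g q) v" using v \<open>g q \<in> Y\<close> by auto
      }
    qed auto
  qed
  finally show "2 * c + 4 \<le> card {v \<in> V (sl b mod p). \<forall>q\<in>P.
        ((b, q) \<in> A \<longrightarrow> arc E S v (g q)) \<and> ((q, b) \<in> A \<longrightarrow> arc E S (g q) v)}" .
qed

lemma verts_eq: "{..2*p} = insert 0 (blk p 0 \<union> blk p 1)"
  by auto

lemma blk_adj: "fan_adj p b b' \<Longrightarrow> b \<noteq> 0 \<Longrightarrow> b' \<noteq> 0 \<Longrightarrow>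
    (b \<in> blk p 0 \<and> b' \<in> blk p 0 \<or> b \<in> blk p 1 \<and> b' \<in> blk p 1) \<and> b \<noteq> b'"
proof -
  assume a: "fan_adj p b b'" "b \<noteq> 0" "b' \<noteq> 0"
  then obtain a where "a < 2" "b \<in> blk p a" "b' \<in> blk p a" unfolding fan_adj_def by blast
  moreover have "a = 0 \<or> a = 1" using \<open>a < 2\<close> by auto
  ultimately show ?thesis using a(1) unfolding fan_adj_def by blast
qed

text \<open>Vertices of different blocks are not adjacent and may share a part; therefore each block
  has its own half of the slots.\<close>

definition slotting :: "(nat \<Rightarrow> nat) \<Rightarrow> nat set \<Rightarrow> nat set \<Rightarrow> nat set \<Rightarrow> nat set \<Rightarrow> bool" where
  "slotting sl B0 B1 C0 C1 \<longleftrightarrow> inj_on sl (B0 \<union> B1) \<and>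
     (\<forall>b\<in>B0. sl b \<in> C0 \<and> sl b mod p \<in> C0) \<and> (\<forall>b\<in>B1. sl b \<in> (+) p ` C1 \<and> sl b mod p \<in> C1) \<and>
     (\<forall>b\<in>B0 \<union> B1. sl b < 2*p) \<and>
     (\<forall>b\<in>B0. \<forall>b'\<in>B0. b \<noteq> b' \<longrightarrow> sl b mod p \<noteq> sl b' mod p) \<and>
     (\<forall>b\<in>B1. \<forall>b'\<in>B1. b \<noteq> b' \<longrightarrow> sl b mod p \<noteq> sl b' mod p)"

lemma slottingD:
  assumes "slotting sl B0 B1 C0 C1"
  shows "inj_on sl (B0 \<union> B1)" "\<And>b. b \<in> B0 \<Longrightarrow> sl b \<in> C0" "\<And>b. b \<in> B1 \<Longrightarrow> sl b \<in> (+) p ` C1"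
    "\<And>b. b \<in> B0 \<union> B1 \<Longrightarrow> sl b < 2*p" "\<And>b. b \<in> B0 \<Longrightarrow> sl b mod p \<in> C0" "\<And>b. b \<in> B1 \<Longrightarrow> sl b mod p \<in> C1"
    "\<And>b b'. b \<in> B0 \<Longrightarrow> b' \<in> B0 \<Longrightarrow> b \<noteq> b' \<Longrightarrow> sl b mod p \<noteq> sl b' mod p"
    "\<And>b b'. b \<in> B1 \<Longrightarrow> b' \<in> B1 \<Longrightarrow> b \<noteq> b' \<Longrightarrow> sl b mod p \<noteq> sl b' mod p"
  using assms unfolding slotting_def by blast+

lemma slots:
  assumes "B0 \<subseteq> blk p 0" "B1 \<subseteq> blk p 1" "C0 \<subseteq> {..<p}" "C1 \<subseteq> {..<p}" "card B0 = card C0" "card B1 = card C1"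
  obtains sl where "slotting sl B0 B1 C0 C1"
proof -
  have fin: "finite B0" "finite B1" "finite C0" "finite C1"
    using assms(1-4) by (meson finite_greaterThanAtMost finite_lessThan finite_subset)+
  obtain s0 where s0: "bij_betw s0 B0 C0" using finite_same_card_bij[OF fin(1,3) assms(5)] by blast
  obtain s1 where s1: "bij_betw s1 B1 C1" using finite_same_card_bij[OF fin(2,4) assms(6)] by blast
  define sl where "sl = (\<lambda>b. if b \<in> B0 then s0 b else p + s1 b)"
  have disj: "b \<notin> B0" if "b \<in> B1" for b using assms(1,2) that by force
  have 0: "sl b = s0 b" "s0 b \<in> C0" "s0 b < p" if "b \<in> B0" for b
    using that s0 assms(3) unfolding sl_def bij_betw_def by auto
  have 1: "sl b = p + s1 b" "s1 b \<in> C1" "s1 b < p" if "b \<in> B1" for b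
    using that s1 assms(4) disj[OF that] unfolding sl_def bij_betw_def by auto
  have i0: "s0 b = s0 b' \<Longrightarrow> b = b'" if "b \<in> B0" "b' \<in> B0" for b b'
    using s0 that unfolding bij_betw_def by (meson inj_onD)
  have i1: "s1 b = s1 b' \<Longrightarrow> b = b'" if "b \<in> B1" "b' \<in> B1" for b b'
    using s1 that unfolding bij_betw_def by (meson inj_onD)
  show ?thesis
  proof (rule that[of sl], unfold slotting_def, intro conjI ballI impI)
    show "inj_on sl (B0 \<union> B1)"
    proof (rule inj_onI)
      fix b b' assume b: "b \<in> B0 \<union> B1" "b' \<in> B0 \<union> B1" "sl b = sl b'"
      consider "b \<in> B0" "b' \<in> B0" | "b \<in> B0" "b' \<in> B1" | "b \<in> B1" "b' \<in> B0" | "b \<in> B1" "b' \<in> B1" using b by blast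
      then show "b = b'"
      proof cases
        case 1 then show ?thesis using 0 i0 b(3) by metis
      next
        case 2 then show ?thesis using 0[of b] 1[of b'] b(3) by linarith
      next
        case 3 then show ?thesis using 0[of b'] 1[of b] b(3) by linarith
      next
        case 4
        then have "p + s1 b = p + s1 b'" using b(3) 1(1) by metis
        then show ?thesis using i1 4 by simp
      qed
    qed
    show "sl b < 2*p" if "b \<in> B0 \<union> B1" for b using that 0[of b] 1[of b] by auto
    show "sl b mod p \<noteq> sl b' mod p" if "b \<in> B0" "b' \<in> B0" "b \<noteq> b'" for b b'
      by (metis 0(1) 0(3) i0 mod_less that)
    show "sl b mod p \<noteq> sl b' mod p" if "b \<in> B1" "b' \<in> B1" "b \<noteq> b'" for b b'
      by (metis 1(1) 1(3) i1 mod_add_self1 mod_less that)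
  qed (use 0 1 in auto)
qed

end

section \<open>Fans forced by one vertex, by two edges, and by a triangle\<close>

locale universal_host = anti_fan +
  fixes c :: nat and E S :: "nat set set" and V :: "nat \<Rightarrow> nat set"
  assumes univ: "universal p c E S V"
    and V_finite: "\<And>i. i < p \<Longrightarrow> finite (V i)"
    and V_card: "\<And>i. i < p \<Longrightarrow> 2 * c \<le> card (V i)"
    and V_disjoint: "\<And>i j. i < p \<Longrightarrow> j < p \<Longrightarrow> i \<noteq> j \<Longrightarrow> V i \<inter> V j = {}"
begin

text \<open>This is where anti-directedness enters. In part \<open>j\<close> possibly only one
  direction is plentiful at \<open>v\<close>; since each block has both an in- and an out-neighbour
  of the centre, one vertex of each block can be chosen with that direction, and both go to part
  \<open>j\<close>. The rest of each block uses the other parts, where all directions are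
  available.\<close>

lemma center_fan:
  assumes j: "j < p" and rich: "\<And>i. i < p \<Longrightarrow> i \<noteq> j \<Longrightarrow> rich E S {v} (V i) (2*c+4)"
    and dir: "2*c+4 \<le> card {a \<in> V j. arc E S v a} \<or> 2*c+4 \<le> card {a \<in> V j. arc E S a v}"
  shows "fan_in E S"
proof -
  define out where "out = (2*c+4 \<le> card {a \<in> V j. arc E S v a})"
  have "\<exists>b\<in>blk p a. ((0, b) \<in> A \<longleftrightarrow> out) \<and> ((b, 0) \<in> A \<longleftrightarrow> \<not> out)" if a: "a < 2" for a
  proof -
    obtain b where b: "b \<in> blk p a" "(if out then (0, b) \<in> A else (b, 0) \<in> A)" using A_in[OF a] A_out[OF a] by (cases out) auto
    then have "fan_adj p 0 b" unfolding fan_adj_def using a by auto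
    then show ?thesis using A_orient b by (intro bexI[of _ b]) (auto split: if_splits)
  qed
  note ex = this
  obtain b0 where b0: "b0 \<in> blk p 0" "(0, b0) \<in> A \<longleftrightarrow> out" "(b0, 0) \<in> A \<longleftrightarrow> \<not> out" using ex[of 0] by (metis (no_types) pos2)
  obtain b1 where b1: "b1 \<in> blk p 1" "(0, b1) \<in> A \<longleftrightarrow> out" "(b1, 0) \<in> A \<longleftrightarrow> \<not> out" using ex[of 1] by (metis (no_types) one_less_numeral_iff semiring_norm(76))
  define B0 where "B0 = blk p 0 - {b0}"
  define B1 where "B1 = blk p 1 - {b1}"
  have sub: "B0 \<subseteq> blk p 0" "B1 \<subseteq> blk p 1" and sub': "{..<p} - {j} \<subseteq> {..<p}" unfolding B0_def B1_def by blast+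
  have cBC: "card B0 = card ({..<p} - {j})" "card B1 = card ({..<p} - {j})"
    using b0(1) b1(1) j unfolding B0_def B1_def by (simp_all add: card_Diff_subset)
  obtain sl where slot: "slotting sl B0 B1 ({..<p} - {j}) ({..<p} - {j})"
    by (rule slots[OF sub sub' sub' cBC])
  note sl = slottingD[OF slot]
  have ne: "b0 \<noteq> b1" "b0 \<noteq> 0" "b1 \<noteq> 0" "b0 \<notin> B0 \<union> B1" "b1 \<notin> B0 \<union> B1" using b0(1) b1(1) unfolding B0_def B1_def by auto
  have N: "{..2*p} - {0} = insert b0 (insert b1 (B0 \<union> B1))" unfolding verts_eq B0_def B1_def using b0(1) b1(1) by auto
  \<comment> \<open>The two chosen vertices occupy the two slots of part \<open>j\<close>.\<close>
  define sl' where "sl' = sl(b0 := j, b1 := p + j)"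
  have sl'[simp]: "sl' b0 = j" "sl' b1 = p + j" "\<And>b. b \<in> B0 \<union> B1 \<Longrightarrow> sl' b = sl b"
    unfolding sl'_def using ne by auto
  have j': "j \<notin> sl ` (B0 \<union> B1)" "p + j \<notin> sl ` (B0 \<union> B1)" using sl(2,3) j by force+
  show ?thesis
  proof (rule embed[OF univ V_finite V_card V_disjoint, where P = "{0}" and g = "\<lambda>_. v" and sl = sl'])
    have "sl' ` (B0 \<union> B1) = sl ` (B0 \<union> B1)" by (rule image_cong) auto
    moreover have "inj_on sl' (B0 \<union> B1)" using sl(1) sl'(3) by (metis (no_types, lifting) inj_on_cong)
    ultimately show "inj_on sl' ({..2*p} - {0})" unfolding N using j' ne p2 by (auto simp: inj_on_insert)
    show "sl' b < 2*p" if "b \<in> {..2*p} - {0}" for b using that j sl(4)[of b] unfolding N by auto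
    show "sl' b mod p \<noteq> sl' b' mod p" if b: "b \<notin> {0}" "b' \<notin> {0}" "(b, b') \<in> A" for b b'
    proof -
      have "(b \<in> blk p 0 \<and> b' \<in> blk p 0 \<or> b \<in> blk p 1 \<and> b' \<in> blk p 1) \<and> b \<noteq> b'"
        using blk_adj[OF A_adj[OF b(3)]] b(1,2) by auto
      then consider "b \<in> insert b0 B0" "b' \<in> insert b0 B0" "b \<noteq> b'" | "b \<in> insert b1 B1" "b' \<in> insert b1 B1" "b \<noteq> b'"
        unfolding B0_def B1_def by auto
      then show ?thesis
      proof cases
        case 1
        then consider "b = b0" "b' \<in> B0" | "b \<in> B0" "b' = b0" | "b \<in> B0" "b' \<in> B0" by auto
        then show ?thesis using sl(5)[of b] sl(5)[of b'] sl(7)[of b b'] 1(3) j by cases auto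
      next
        case 2
        then consider "b = b1" "b' \<in> B1" | "b \<in> B1" "b' = b1" | "b \<in> B1" "b' \<in> B1" by auto
        then show ?thesis using sl(6)[of b] sl(6)[of b'] sl(8)[of b b'] 2(3) j by cases auto
      qed
    qed
    show "arc E S v v" if "b \<in> {0}" "b' \<in> {0}" "(b, b') \<in> A" for b b' using A_adj[OF that(3)] that unfolding fan_adj_def by auto
    fix b assume b: "b \<in> {..2*p} - {0}"
    define Zs where "Zs = {a \<in> V (sl' b mod p). \<forall>q\<in>{0}. ((b, q) \<in> A \<longrightarrow> arc E S a v) \<and> ((q, b) \<in> A \<longrightarrow> arc E S v a)}"
    have fZ: "finite Zs" unfolding Zs_def by (rule rev_finite_subset[OF V_finite[of "sl' b mod p"]]) (use j in auto)
    have "2*c+4 \<le> card Zs"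
    proof (cases "b \<in> {b0, b1}")
      case True
      then have "sl' b mod p = j" using j by auto
      moreover have "(0, b) \<in> A \<longleftrightarrow> out" "(b, 0) \<in> A \<longleftrightarrow> \<not> out" using True b0 b1 by auto
      ultimately have "Zs = (if out then {a \<in> V j. arc E S v a} else {a \<in> V j. arc E S a v})" unfolding Zs_def by auto
      then show ?thesis using dir unfolding out_def by auto
    next
      case False
      then have bB: "b \<in> B0 \<union> B1" using b unfolding N by blast
      then have m: "sl' b mod p < p" "sl' b mod p \<noteq> j" using sl(5)[of b] sl(6)[of b] by auto
      have adj: "(0, b) \<in> A \<longrightarrow> (b, 0) \<notin> A" using A_orient A_adj by blast
      define \<sigma> where "\<sigma> = (if (0, b) \<in> A then {v} else {})"
      have "2*c+4 \<le> card {a \<in> V (sl' b mod p). \<forall>y\<in>{v}. if y \<in> \<sigma> then arc E S y a else arc E S a y}"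
        using rich[OF m] unfolding rich_def \<sigma>_def by (simp split: if_splits)
      also have "\<dots> \<le> card Zs" by (rule card_mono[OF fZ]) (use adj in \<open>auto simp: Zs_def \<sigma>_def\<close>)
      finally show ?thesis .
    qed
    then show "2*c+4 \<le> card {a \<in> V (sl' b mod p). \<forall>q\<in>{0}. ((b, q) \<in> A \<longrightarrow> arc E S a v) \<and> ((q, b) \<in> A \<longrightarrow> arc E S v a)}"
      unfolding Zs_def .
  qed auto
qed

text \<open>Lets an edge whose direction is not under control serve as an edge at the centre in
  either block.\<close>

lemma ex_block_vertex:
  assumes "{x, y} \<in> E" "x \<noteq> y" "a < 2"
  obtains b where "b \<in> blk p a" "(0, b) \<in> A \<longleftrightarrow> arc E S x y" "(b, 0) \<in> A \<longleftrightarrow> arc E S y x"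
proof -
  obtain b where b: "b \<in> blk p a" "(if arc E S x y then (0, b) \<in> A else (b, 0) \<in> A)"
    using A_in[OF assms(3)] A_out[OF assms(3)] by (cases "arc E S x y") auto
  then have "fan_adj p 0 b" unfolding fan_adj_def using assms(3) by auto
  then show ?thesis using A_orient b arc_cases[OF assms(1,2)] that by (metis (full_types))
qed

text \<open>\<open>x\<close> becomes the centre, and \<open>y\<close> and \<open>z\<close> become
  one vertex of each block, chosen to match the directions of the two edges. The remaining
  \<open>p - 1\<close> vertices of each block go to the \<open>p - 1\<close> parts other than
  \<open>i\<close>.\<close>

lemma star_fan:
  assumes d: "distinct [x, y, z]" and i: "i < p" and e: "{x, y} \<in> E" "{x, z} \<in> E"
    and rich: "\<And>j. j < p \<Longrightarrow> j \<noteq> i \<Longrightarrow> rich E S {x, y, z} (V j) (2*c+4)"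
  shows "fan_in E S"
proof -
  have xy: "x \<noteq> y" "x \<noteq> z" "y \<noteq> z" using d by auto
  obtain b0 where b0: "b0 \<in> blk p 0" "(0, b0) \<in> A \<longleftrightarrow> arc E S x y" "(b0, 0) \<in> A \<longleftrightarrow> arc E S y x"
    by (rule ex_block_vertex[OF e(1) xy(1), of 0]) auto
  obtain b1 where b1: "b1 \<in> blk p 1" "(0, b1) \<in> A \<longleftrightarrow> arc E S x z" "(b1, 0) \<in> A \<longleftrightarrow> arc E S z x"
    by (rule ex_block_vertex[OF e(2) xy(2), of 1]) auto
  define B0 where "B0 = blk p 0 - {b0}"
  define B1 where "B1 = blk p 1 - {b1}"
  have sub: "B0 \<subseteq> blk p 0" "B1 \<subseteq> blk p 1" and sub': "{..<p} - {i} \<subseteq> {..<p}" unfolding B0_def B1_def by blast+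
  have cBC: "card B0 = card ({..<p} - {i})" "card B1 = card ({..<p} - {i})"
    using b0(1) b1(1) i unfolding B0_def B1_def by (simp_all add: card_Diff_subset)
  obtain sl where slot: "slotting sl B0 B1 ({..<p} - {i}) ({..<p} - {i})"
    by (rule slots[OF sub sub' sub' cBC])
  note sl = slottingD[OF slot]
  have ne: "b0 \<noteq> b1" "b0 \<noteq> 0" "b1 \<noteq> 0" using b0(1) b1(1) by auto
  let ?P = "{0, b0, b1}"
  have N: "{..2*p} - ?P = B0 \<union> B1" unfolding verts_eq B0_def B1_def using b0(1) b1(1) by auto
  define g where "g = (\<lambda>_. x)(b0 := y, b1 := z)"
  have g: "g 0 = x" "g b0 = y" "g b1 = z" unfolding g_def using ne by auto
  have nadj: "\<not> fan_adj p b0 b1" "\<not> fan_adj p b1 b0"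
    using blk_adj[of b0 b1] blk_adj[of b1 b0] ne b0(1) b1(1) by auto
  show ?thesis
  proof (rule embed_rich[OF univ V_finite V_card V_disjoint, where P = ?P and g = g and sl = sl])
    show "?P \<subseteq> {..2*p}" using b0(1) b1(1) by auto
    show "card ?P \<le> 4" using ne by simp
    show "inj_on g ?P" using g ne xy by (auto simp: inj_on_def)
    show "inj_on sl ({..2*p} - ?P)" unfolding N by (rule sl(1))
    show "sl b < 2*p" if "b \<in> {..2*p} - ?P" for b using that sl(4) unfolding N by blast
    show "sl b mod p \<noteq> sl b' mod p" if b: "b \<notin> ?P" "b' \<notin> ?P" "(b, b') \<in> A" for b b'
      using blk_adj[OF A_adj[OF b(3)]] sl(7,8) b unfolding B0_def B1_def by auto
    show "arc E S (g b) (g b')" if b: "b \<in> ?P" "b' \<in> ?P" "(b, b') \<in> A" for b b'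
      using A_adj[OF b(3)] nadj b b0 b1 g unfolding fan_adj_def by auto
    show "\<exists>Y. rich E S Y (V (sl b mod p)) (2*c+4) \<and> (\<forall>q\<in>?P. fan_adj p b q \<longrightarrow> g q \<in> Y)" if "b \<in> {..2*p} - ?P" for b
    proof -
      have "sl b mod p < p" "sl b mod p \<noteq> i" using that sl(5)[of b] sl(6)[of b] unfolding N by auto
      then show ?thesis using rich g by (intro exI[of _ "{x, y, z}"]) auto
    qed
  qed auto
qed

text \<open>Here the given edges lie opposite the centre: they become one edge of each block, and
  the centre is found in part \<open>j\<close>. The \<open>p - 2\<close> further vertices of a block
  come from the parts other than its own one and \<open>j\<close>, so \<open>j\<close> must differ
  from \<open>i\<close> and \<open>k\<close>. For \<open>p = 2\<close> and
  \<open>i \<noteq> k\<close> no such \<open>j\<close> exists, which is the source of the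
  exceptional case.\<close>

lemma matching_fan:
  assumes d: "distinct [x, y, z, w]" and i: "i < p" "k < p" "j < p" "j \<noteq> i" "j \<noteq> k"
    and e: "{x, y} \<in> E" "{z, w} \<in> E"
    and richj: "rich E S {x, y, z, w} (V j) (2*c+4)"
    and richi: "\<And>l. l < p \<Longrightarrow> l \<noteq> i \<Longrightarrow> rich E S {x, y} (V l) (2*c+4)"
    and richk: "\<And>l. l < p \<Longrightarrow> l \<noteq> k \<Longrightarrow> rich E S {z, w} (V l) (2*c+4)"
  shows "fan_in E S"
proof -
  \<comment> \<open>The ends of an edge are named so that its direction becomes that of the given
    fan edge.\<close>
  have orient: "\<exists>u v. {u, v} = {x, y} \<and> (arc E S u v \<longleftrightarrow> (b, b') \<in> A) \<and> (arc E S v u \<longleftrightarrow> (b', b) \<in> A)"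
    if "{x, y} \<in> E" "x \<noteq> y" "fan_adj p b b'" for x y b b'
    using arc_cases[OF that(1,2), of S] A_orient[OF that(3)] by (cases "arc E S x y = ((b, b') \<in> A)") auto
  have adj1: "fan_adj p 1 2" unfolding fan_adj_def using p2 by (intro conjI exI[of _ 0]) auto
  have adj2: "fan_adj p (p+1) (p+2)" unfolding fan_adj_def using p2 by (intro conjI exI[of _ 1]) auto
  obtain x' y' where xy: "{x', y'} = {x, y}" "arc E S x' y' \<longleftrightarrow> (1, 2) \<in> A" "arc E S y' x' \<longleftrightarrow> (2, 1) \<in> A"
    using orient[OF e(1) _ adj1] d by auto
  obtain z' w' where zw: "{z', w'} = {z, w}" "arc E S z' w' \<longleftrightarrow> (p+1, p+2) \<in> A" "arc E S w' z' \<longleftrightarrow> (p+2, p+1) \<in> A"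
    using orient[OF e(2) _ adj2] d by auto
  have d': "distinct [x', y', z', w']" using d xy(1) zw(1) by (auto simp: doubleton_eq_iff)
  define B0 where "B0 = blk p 0 - {1, 2}"
  define B1 where "B1 = blk p 1 - {p+1, p+2}"
  have cB: "card B0 = p - 2" "card B1 = p - 2" unfolding B0_def B1_def using p2 by (simp_all add: card_Diff_subset)
  have cC: "card ({..<p} - {i, j}) = p - 2" "card ({..<p} - {k, j}) = p - 2"
    using i by (simp_all add: card_Diff_subset)
  have sub: "B0 \<subseteq> blk p 0" "B1 \<subseteq> blk p 1" "{..<p} - {i, j} \<subseteq> {..<p}" "{..<p} - {k, j} \<subseteq> {..<p}"
    unfolding B0_def B1_def by blast+
  have cBC: "card B0 = card ({..<p} - {i, j})" "card B1 = card ({..<p} - {k, j})" using cB cC by simp_all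
  obtain sl where slot: "slotting sl B0 B1 ({..<p} - {i, j}) ({..<p} - {k, j})"
    by (rule slots[OF sub cBC])
  note sl = slottingD[OF slot]
  let ?P = "{1, 2, p+1, p+2}"
  have nB: "0 \<notin> B0 \<union> B1" unfolding B0_def B1_def by auto
  have N: "{..2*p} - ?P = insert 0 (B0 \<union> B1)" unfolding verts_eq B0_def B1_def using p2 by auto
  define g where "g = (\<lambda>_. x')(2 := y', p+1 := z', p+2 := w')"
  have g: "g 1 = x'" "g 2 = y'" "g (p+1) = z'" "g (p+2) = w'" unfolding g_def using p2 by auto
  \<comment> \<open>The centre takes the first slot of part \<open>j\<close>, which both blocks
    avoid.\<close>
  define sl' where "sl' = sl(0 := j)"
  have sl': "sl' 0 = j" "\<And>b. b \<in> B0 \<union> B1 \<Longrightarrow> sl' b = sl b" unfolding sl'_def using nB by auto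
  have j': "j \<notin> sl ` (B0 \<union> B1)" using sl(2,3) i by force
  have bP: "b \<in> {1, 2}" if "b \<in> ?P" "b \<in> blk p 0" for b using that by auto
  have bP': "b \<in> {p+1, p+2}" if "b \<in> ?P" "b \<in> blk p 1" for b using that p2 by auto
  show ?thesis
  proof (rule embed_rich[OF univ V_finite V_card V_disjoint, where P = ?P and g = g and sl = sl'])
    show "?P \<subseteq> {..2*p}" using p2 by auto
    show "card ?P \<le> 4" by (simp add: card_insert_if)
    show "inj_on g ?P" using g d' p2 by (auto simp: inj_on_def)
    have "sl' ` (B0 \<union> B1) = sl ` (B0 \<union> B1)" by (rule image_cong) (use sl' in auto)
    moreover have "inj_on sl' (B0 \<union> B1)" using sl(1) sl'(2) by (metis (no_types, lifting) inj_on_cong)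
    ultimately show "inj_on sl' ({..2*p} - ?P)" unfolding N using j' nB sl'(1) by (simp add: inj_on_insert)
    show "sl' b < 2*p" if "b \<in> {..2*p} - ?P" for b using that i sl(4)[of b] sl' unfolding N by auto
    show "sl' b mod p \<noteq> sl' b' mod p" if b: "b \<notin> ?P" "b' \<notin> ?P" "(b, b') \<in> A" for b b'
    proof -
      have "b \<in> insert 0 (B0 \<union> B1)" "b' \<in> insert 0 (B0 \<union> B1)" "b \<noteq> b'"
        using fan_adj_le[OF A_adj[OF b(3)]] A_adj[OF b(3)] b(1,2) unfolding N[symmetric] fan_adj_def by auto
      then consider "b = 0" "b' \<in> B0 \<union> B1" | "b' = 0" "b \<in> B0 \<union> B1" | "b \<in> B0 \<union> B1" "b' \<in> B0 \<union> B1" "b \<noteq> 0" "b' \<noteq> 0" using nB by blast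
      then show ?thesis
      proof cases
        case 1 then show ?thesis using sl' sl(5)[of b'] sl(6)[of b'] i by auto
      next
        case 2 then show ?thesis using sl' sl(5)[of b] sl(6)[of b] i by auto
      next
        case 3
        have "(b \<in> blk p 0 \<and> b' \<in> blk p 0 \<or> b \<in> blk p 1 \<and> b' \<in> blk p 1) \<and> b \<noteq> b'"
          by (rule blk_adj[OF A_adj[OF b(3)] 3(3,4)])
        moreover have "blk p 0 \<inter> blk p 1 = {}" by auto
        ultimately have "b \<in> B0 \<and> b' \<in> B0 \<or> b \<in> B1 \<and> b' \<in> B1" "b \<noteq> b'" using 3 unfolding B0_def B1_def by blast+
        then show ?thesis using 3 sl' sl(7,8) by auto
      qed
    qed
    show "arc E S (g b) (g b')" if b: "b \<in> ?P" "b' \<in> ?P" "(b, b') \<in> A" for b b'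
    proof -
      have "b \<noteq> 0" "b' \<noteq> 0" using b by auto
      then have "(b \<in> blk p 0 \<and> b' \<in> blk p 0 \<or> b \<in> blk p 1 \<and> b' \<in> blk p 1) \<and> b \<noteq> b'"
        using blk_adj[OF A_adj[OF b(3)]] by blast
      then have "b \<in> {1,2} \<and> b' \<in> {1,2} \<or> b \<in> {p+1,p+2} \<and> b' \<in> {p+1,p+2}" "b \<noteq> b'" using bP bP' b by blast+
      then consider "b = 1" "b' = 2" | "b = 2" "b' = 1" | "b = p+1" "b' = p+2" | "b = p+2" "b' = p+1" by auto
      then show ?thesis using xy zw g b(3) by cases auto
    qed
    show "\<exists>Y. rich E S Y (V (sl' b mod p)) (2*c+4) \<and> (\<forall>q\<in>?P. fan_adj p b q \<longrightarrow> g q \<in> Y)" if b: "b \<in> {..2*p} - ?P" for b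
    proof -
      from b consider "b = 0" | "b \<in> B0" | "b \<in> B1" unfolding N by blast
      then show ?thesis
      proof cases
        case 1
        have "g q \<in> {x, y, z, w}" if "q \<in> ?P" for q using g xy(1) zw(1) that by auto
        then show ?thesis using richj 1 sl' i by (intro exI[of _ "{x, y, z, w}"]) auto
      next
        case 2
        have "g q \<in> {x, y}" if q: "q \<in> ?P" "fan_adj p b q" for q
        proof -
          have "b \<in> blk p 0" "b \<noteq> 0" "b \<notin> blk p 1" "q \<noteq> 0" using 2 q unfolding B0_def by auto
          then have "q \<in> blk p 0" using blk_adj[OF q(2)] by blast
          then show ?thesis using bP[OF q(1)] g xy(1) by auto
        qed
        moreover have "rich E S {x, y} (V (sl' b mod p)) (2*c+4)" using richi sl(5)[OF 2] sl'(2)[of b] 2 by simp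
        ultimately show ?thesis by blast
      next
        case 3
        have "g q \<in> {z, w}" if q: "q \<in> ?P" "fan_adj p b q" for q
        proof -
          have "b \<in> blk p 1" "b \<noteq> 0" "b \<notin> blk p 0" "q \<noteq> 0" using 3 q unfolding B1_def by auto
          then have "q \<in> blk p 1" using blk_adj[OF q(2)] by blast
          then show ?thesis using bP'[OF q(1)] g zw(1) by auto
        qed
        moreover have "rich E S {z, w} (V (sl' b mod p)) (2*c+4)" using richk sl(6)[OF 3] sl'(2)[of b] 3 by simp
        ultimately show ?thesis by blast
      qed
    qed
  qed auto
qed

text \<open>A triangle at \<open>x\<close> with suitable directions serves as the first block with
  its centre, and \<open>{x, y}\<close> as an edge at the centre in the second. Only one vertex,
  joined to \<open>x\<close> and \<open>y\<close>, remains to be found in part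
  \<open>i\<close>.\<close>

lemma triangle_fan:
  assumes p: "p = 2" and d: "distinct [x, y, u, v]" and i: "i < 2" and e: "{x, y} \<in> E"
    and rich: "rich E S {x, y} (V i) (2*c+4)"
    and ab: "{a, b} = {1, 2}" "(a, 0) \<in> A" "(0, b) \<in> A"
    and arcs: "arc E S u x" "arc E S x v" "(a, b) \<in> A \<Longrightarrow> arc E S u v" "(b, a) \<in> A \<Longrightarrow> arc E S v u"
  shows "fan_in E S"
proof -
  have xy: "x \<noteq> y" using d by auto
  obtain b1 where b1: "b1 \<in> blk p 1" "(0, b1) \<in> A \<longleftrightarrow> arc E S x y" "(b1, 0) \<in> A \<longleftrightarrow> arc E S y x"
    by (rule ex_block_vertex[OF e xy, of 1]) auto
  have b1': "b1 = 3 \<or> b1 = 4" using b1(1) p by auto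
  have ab': "a = 1 \<and> b = 2 \<or> a = 2 \<and> b = 1" using ab(1) by (auto simp: doubleton_eq_iff)
  let ?P = "{0, a, b, b1}"
  \<comment> \<open>The second block is \<open>{3, 4}\<close>, so \<open>7 - b1\<close> is its
    vertex other than \<open>b1\<close>.\<close>
  have N: "{..2*p} - ?P = {7 - b1}"
  proof -
    have "{..2*p} = {0, 1, 2, 3, 4}" using p by auto
    then show ?thesis using b1' ab' by auto
  qed
  have nadj: "\<not> fan_adj p a b1" "\<not> fan_adj p b1 a" "\<not> fan_adj p b b1" "\<not> fan_adj p b1 b"
    using blk_adj[of a b1] blk_adj[of b1 a] blk_adj[of b b1] blk_adj[of b1 b] ab' b1' p by auto
  have nadj': "\<not> fan_adj p (7 - b1) a" "\<not> fan_adj p (7 - b1) b"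
    using blk_adj[of "7 - b1" a] blk_adj[of "7 - b1" b] ab' b1' p by auto
  have n1: "(0, a) \<notin> A" "(b, 0) \<notin> A" using ab A_orient A_adj by blast+
  define g where "g = (\<lambda>_. x)(a := u, b := v, b1 := y)"
  have g: "g 0 = x" "g a = u" "g b = v" "g b1 = y" unfolding g_def using ab' b1' by auto
  show ?thesis
  proof (rule embed_rich[OF univ V_finite V_card V_disjoint, where P = ?P and g = g and sl = "\<lambda>_. i"])
    show "?P \<subseteq> {..2*p}" using ab' b1' p by auto
    show "card ?P \<le> 4" by (simp add: card_insert_if)
    show "inj_on g ?P" using g d ab' b1' by (auto simp: inj_on_def)
    show "inj_on (\<lambda>_. i) ({..2*p} - ?P)" unfolding N by simp
    show "i < 2*p" if "q \<in> {..2*p} - ?P" for q using i p by simp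
    show "i mod p \<noteq> i mod p" if q: "q \<notin> ?P" "q' \<notin> ?P" "(q, q') \<in> A" for q q'
    proof -
      have "q \<in> {..2*p} - ?P" "q' \<in> {..2*p} - ?P" "q \<noteq> q'"
        using fan_adj_le[OF A_adj[OF q(3)]] A_adj[OF q(3)] q(1,2) unfolding fan_adj_def by auto
      then show ?thesis unfolding N by blast
    qed
    show "arc E S (g q) (g q')" if q: "q \<in> ?P" "q' \<in> ?P" "(q, q') \<in> A" for q q'
    proof -
      have "q \<noteq> q'" "fan_adj p q q'" using A_adj[OF q(3)] unfolding fan_adj_def by auto
      then have "(q, q') \<in> {(0,a),(a,0),(0,b),(b,0),(0,b1),(b1,0),(a,b),(b,a)}" using q(1,2) nadj by blast
      then consider "q = a" "q' = 0" | "q = 0" "q' = b" | "q = 0" "q' = b1" | "q = b1" "q' = 0" | "q = a" "q' = b" | "q = b" "q' = a"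
        using q(3) n1 by blast
      then show ?thesis using q(3) arcs g b1 by cases simp_all
    qed
    show "\<exists>Y. rich E S Y (V (i mod p)) (2*c+4) \<and> (\<forall>q\<in>?P. fan_adj p b' q \<longrightarrow> g q \<in> Y)" if "b' \<in> {..2*p} - ?P" for b'
    proof -
      have "b' = 7 - b1" using that unfolding N by simp
      then have "\<forall>q\<in>?P. fan_adj p b' q \<longrightarrow> g q \<in> {x, y}" using nadj' g by auto
      then show ?thesis using rich i p by (intro exI[of _ "{x, y}"]) simp
    qed
  qed auto
qed

end

section \<open>Counting extensions of orientations\<close>

definition del :: "nat set set \<Rightarrow> nat set \<Rightarrow> nat set set" where
  "del E W = {e \<in> E. e \<inter> W = {}}"

definition touch :: "nat set set \<Rightarrow> nat set \<Rightarrow> nat set set" where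
  "touch E W = {e \<in> E. e \<inter> W \<noteq> {}}"

definition between :: "nat set set \<Rightarrow> nat set \<Rightarrow> nat set \<Rightarrow> nat set set" where
  "between E Y W = {e \<in> E. \<exists>y\<in>Y. \<exists>a\<in>W. e = {y, a}}"

lemma arc_restrict: "arc E' (S \<inter> E') u v \<Longrightarrow> E' \<subseteq> E \<Longrightarrow> arc E S u v"
  unfolding arc_def by auto

lemma universal_restrict:
  assumes "universal p c E' (S \<inter> E') V" "E' \<subseteq> E"
  shows "universal p c E S V"
  unfolding universal_def
proof (intro allI impI)
  fix X \<tau> assume X: "\<forall>k<2*p. X k \<subseteq> V (k mod p) \<and> c \<le> card (X k)" "\<forall>k<2*p. \<forall>l<2*p. k \<noteq> l \<longrightarrow> X k \<inter> X l = {}"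
  obtain x where x: "\<forall>k<2*p. x k \<in> X k" "\<forall>k l. k < l \<longrightarrow> l < 2*p \<longrightarrow> k mod p \<noteq> l mod p \<longrightarrow>
     (if (k, l) \<in> \<tau> then arc E' (S \<inter> E') (x k) (x l) else arc E' (S \<inter> E') (x l) (x k))"
    using mp[OF mp[OF spec[OF spec[OF assms(1)[unfolded universal_def], of X], of \<tau>] X(1)] X(2)] by blast
  show "\<exists>x. (\<forall>k<2*p. x k \<in> X k) \<and> (\<forall>k l. k < l \<longrightarrow> l < 2*p \<longrightarrow> k mod p \<noteq> l mod p \<longrightarrow>
     (if (k, l) \<in> \<tau> then arc E S (x k) (x l) else arc E S (x l) (x k)))"
  proof (intro exI[of _ x] conjI x(1) allI impI)
    fix k l assume "k < l" "l < 2*p" "k mod p \<noteq> l mod p"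
    with x(2) have "if (k, l) \<in> \<tau> then arc E' (S \<inter> E') (x k) (x l) else arc E' (S \<inter> E') (x l) (x k)" by blast
    then show "if (k, l) \<in> \<tau> then arc E S (x k) (x l) else arc E S (x l) (x k)"
      using arc_restrict[OF _ assms(2)] by (cases "(k, l) \<in> \<tau>") auto
  qed
qed

lemma rich_restrict:
  assumes "between E Y W \<subseteq> T"
  shows "rich E (S \<inter> T) Y W c \<longleftrightarrow> rich E S Y W c"
proof -
  have "arc E (S \<inter> T) y a \<longleftrightarrow> arc E S y a" "arc E (S \<inter> T) a y \<longleftrightarrow> arc E S a y" if "y \<in> Y" "a \<in> W" for y a
  proof -
    have "{y, a} \<in> E \<Longrightarrow> {y, a} \<in> T" using assms that unfolding between_def by blast
    then show "arc E (S \<inter> T) y a \<longleftrightarrow> arc E S y a" "arc E (S \<inter> T) a y \<longleftrightarrow> arc E S a y"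
      unfolding arc_def by (auto simp: insert_commute)
  qed
  then have "{a \<in> W. \<forall>y\<in>Y. if y \<in> \<sigma> then arc E (S \<inter> T) y a else arc E (S \<inter> T) a y} =
     {a \<in> W. \<forall>y\<in>Y. if y \<in> \<sigma> then arc E S y a else arc E S a y}" for \<sigma> by auto
  then show ?thesis unfolding rich_def by simp
qed

text \<open>Name the pattern \<open>\<sigma>\<close> that occurs too rarely, at most
  \<open>2 ^ card Y\<close> ways, and the small set \<open>Z\<close> of vertices realising it, at
  most \<open>b\<close> ways. Every vertex of \<open>W\<close> outside \<open>Z\<close> is then left
  with at most \<open>2 ^ card Y - 1\<close> of its traces; the fewer than \<open>c\<close> vertices
  of \<open>Z\<close> are compensated by \<open>2 ^ (card Y * c)\<close>.\<close>

lemma card_not_rich: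
  assumes E0: "finite E" "E \<subseteq> E0" "between E0 Y W \<subseteq> E" and W: "finite W" and Y: "finite Y" "Y \<noteq> {}" "Y \<inter> W = {}"
    and b: "card (small_subsets W c) \<le> b"
  shows "card {S. S \<subseteq> E \<and> \<not> rich E0 S Y W c} \<le>
    2 ^ (card E - card (between E0 Y W)) * (2 ^ card Y * (b * (2 ^ (card Y * c) * (2 ^ card Y - 1) ^ card W)))"
    (is "_ \<le> ?e * (_ * (_ * ?m))")
proof -
  define k where "k = card Y"
  have k: "k \<ge> 1" unfolding k_def using Y by (simp add: Suc_le_eq card_gt_0_iff)
  define T where "T = (\<lambda>a. {e \<in> E0. \<exists>y\<in>Y. e = {y, a}})"
  define R where "R = (\<lambda>\<sigma> S. {a \<in> W. \<forall>y\<in>Y. if y \<in> \<sigma> then arc E0 S y a else arc E0 S a y})"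
  have T_sub: "T a \<subseteq> (\<lambda>y. {y, a}) ` Y" for a unfolding T_def by auto
  have T_fin: "finite (T a)" for a using T_sub Y(1) by (meson finite_imageI finite_subset)
  have T_card: "card (T a) \<le> k" for a
  proof -
    have "card (T a) \<le> card ((\<lambda>y. {y, a}) ` Y)" using T_sub Y(1) by (intro card_mono) auto
    also have "\<dots> \<le> k" unfolding k_def by (rule card_image_le[OF Y(1)])
    finally show ?thesis .
  qed
  have T_un: "between E0 Y W = (\<Union>a\<in>W. T a)" unfolding between_def T_def by auto
  have fixed: "card {S. S \<subseteq> E \<and> R \<sigma> S = Z} \<le> ?e * ?m" if \<sigma>: "\<sigma> \<subseteq> Y" and Z: "Z \<in> small_subsets W c" for \<sigma> Z
  proof -
    have ZW: "Z \<subseteq> W" "card Z < c" using Z unfolding small_subsets_def by auto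
    define U where "U = (\<lambda>a. {e \<in> T a. \<exists>y\<in>Y. e = {y, a} \<and> ((y \<in> \<sigma>) = (y < a))})"
    \<comment> \<open>For \<open>a\<close> outside \<open>Z\<close> the trace \<open>U a\<close>,
      which realises \<open>\<sigma>\<close>, is excluded. If some edge from \<open>a\<close> to
      \<open>Y\<close> is missing, there are at most \<open>2 ^ (k - 1)\<close> traces, again no
      more than \<open>2 ^ k - 1\<close>.\<close>
    define P where "P = (\<lambda>a. if a \<in> Z \<or> card (T a) < k then Pow (T a) else Pow (T a) - {U a})"
    let ?F = "{S. S \<subseteq> E \<and> R \<sigma> S = Z}"
    have "card ?F \<le> card (Pow (E - between E0 Y W)) * card ((\<lambda>S. S \<inter> between E0 Y W) ` ?F)"
      by (rule card_le_split[where ?E1.0 = "E - between E0 Y W" and ?E2.0 = "between E0 Y W"]) (use E0 in auto)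
    also have "card ((\<lambda>S. S \<inter> between E0 Y W) ` ?F) \<le> (\<Prod>a\<in>W. card (P a))"
    proof (rule card_le_prod[where T = T])
      fix S' a assume "S' \<in> (\<lambda>S. S \<inter> between E0 Y W) ` ?F" and a: "a \<in> W"
      then obtain S where S: "S \<subseteq> E" "R \<sigma> S = Z" "S' = S \<inter> between E0 Y W" by blast
      have eq: "S' \<inter> T a = S \<inter> T a" unfolding S(3) T_un using a by blast
      have "S \<inter> T a \<noteq> U a" if az: "a \<notin> Z" and ck: "\<not> card (T a) < k"
      proof
        assume SU: "S \<inter> T a = U a"
        have TY: "T a = (\<lambda>y. {y, a}) ` Y"
          by (rule card_subset_eq) (use T_sub Y(1) ck card_image_le[OF Y(1), of "\<lambda>y. {y, a}"] card_mono[OF _ T_sub[of a]] in \<open>auto simp: k_def\<close>)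
        have "if y \<in> \<sigma> then arc E0 S y a else arc E0 S a y" if y: "y \<in> Y" for y
        proof -
          have ya: "y \<noteq> a" using Y(3) y a by blast
          have yT: "{y, a} \<in> T a" using TY y by blast
          have "{y, a} \<in> S \<longleftrightarrow> {y, a} \<in> U a" using SU yT by blast
          also have "\<dots> \<longleftrightarrow> (y \<in> \<sigma>) = (y < a)" unfolding U_def using yT y by (auto simp: doubleton_eq_iff)
          finally have "{y, a} \<in> S \<longleftrightarrow> (y \<in> \<sigma>) = (y < a)" .
          moreover have "{y, a} \<in> E0" using yT unfolding T_def by blast
          ultimately show ?thesis using ya unfolding arc_def by (auto simp: insert_commute)
        qed
        then have "a \<in> R \<sigma> S" unfolding R_def using a by blast
        then show False using S(2) az by blast
      qed
      then show "S' \<inter> T a \<in> P a" unfolding eq P_def by auto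
    qed (use W T_un T_fin in \<open>auto simp: P_def\<close>)
    also have "(\<Prod>a\<in>W. card (P a)) \<le> (\<Prod>a\<in>W. (if a \<in> Z then 2 ^ k else 1) * (2 ^ k - 1))"
    proof (rule prod_mono, rule conjI, simp)
      fix a assume a: "a \<in> W"
      have P: "card (Pow (T a)) = 2 ^ card (T a)" by (rule card_Pow[OF T_fin])
      have k2: "(2::nat) \<le> 2 ^ k" using k by (metis power_increasing power_one_right one_le_numeral)
      have le: "card (P a) \<le> 2 ^ k - 1" if "a \<notin> Z"
      proof (cases "card (T a) < k")
        case True
        then have "card (T a) \<le> k - 1" by simp
        then have "(2::nat) ^ card (T a) \<le> 2 ^ (k - 1)" by (intro power_increasing) auto
        moreover have "(2::nat) ^ k = 2 * 2 ^ (k - 1)" using k by (cases k) auto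
        moreover have "(1::nat) \<le> 2 ^ (k - 1)" by simp
        ultimately have "(2::nat) ^ card (T a) \<le> 2 ^ k - 1" by linarith
        then show ?thesis using True P unfolding P_def by simp
      next
        case False
        then have "card (T a) = k" using T_card[of a] by simp
        moreover have "U a \<in> Pow (T a)" unfolding U_def by blast
        ultimately show ?thesis using that False P T_fin[of a] unfolding P_def by (simp add: card_Diff_singleton)
      qed
      have "card (P a) \<le> 2 ^ k" if "a \<in> Z"
      proof -
        have "card (P a) = 2 ^ card (T a)" using that P unfolding P_def by simp
        also have "\<dots> \<le> 2 ^ k" using T_card[of a] by (intro power_increasing) auto
        finally show ?thesis .
      qed
      then show "card (P a) \<le> (if a \<in> Z then 2 ^ k else 1) * (2 ^ k - 1)"
      proof (cases "a \<in> Z")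
        case True
        have "card (P a) \<le> 2 ^ k * 1" using \<open>a \<in> Z \<Longrightarrow> _\<close> True by simp
        also have "\<dots> \<le> 2 ^ k * (2 ^ k - 1)" using k2 by (intro mult_le_mono) auto
        finally show ?thesis using True by simp
      qed (use le in simp)
    qed
    also have "\<dots> = (\<Prod>a\<in>W. if a \<in> Z then 2 ^ k else 1) * (2 ^ k - 1) ^ card W" by (simp add: prod.distrib)
    also have "(\<Prod>a\<in>W. if a \<in> Z then 2 ^ k else 1) = ((2::nat) ^ k) ^ card Z"
      using W ZW(1) by (simp add: prod.If_cases Int_absorb1)
    also have "((2::nat) ^ k) ^ card Z \<le> 2 ^ (k * c)" using ZW(2) by (simp add: power_mult[symmetric])
    also have "card (Pow (E - between E0 Y W)) = ?e"
      using E0 by (subst card_Pow) (auto simp: card_Diff_subset finite_subset)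
    finally show ?thesis unfolding k_def by simp
  qed
  let ?I = "Pow Y \<times> small_subsets W c"
  have fI: "finite ?I" using Y W by simp
  have "{S. S \<subseteq> E \<and> \<not> rich E0 S Y W c} \<subseteq> (\<Union>h\<in>?I. {S. S \<subseteq> E \<and> R (fst h) S = snd h})"
  proof
    fix S assume "S \<in> {S. S \<subseteq> E \<and> \<not> rich E0 S Y W c}"
    then obtain \<sigma> where S: "S \<subseteq> E" "\<sigma> \<subseteq> Y" "card (R \<sigma> S) < c" unfolding rich_def R_def by auto
    have "R \<sigma> S \<in> small_subsets W c" using S(3) unfolding small_subsets_def R_def by auto
    then show "S \<in> (\<Union>h\<in>?I. {S. S \<subseteq> E \<and> R (fst h) S = snd h})" using S by (intro UN_I[of "(\<sigma>, R \<sigma> S)"]) auto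
  qed
  then have "card {S. S \<subseteq> E \<and> \<not> rich E0 S Y W c} \<le> card (\<Union>h\<in>?I. {S. S \<subseteq> E \<and> R (fst h) S = snd h})"
    by (rule card_mono[rotated]) (use fI E0 in auto)
  also have "\<dots> \<le> (\<Sum>h\<in>?I. card {S. S \<subseteq> E \<and> R (fst h) S = snd h})" by (rule card_UN_le[OF fI])
  also have "\<dots> \<le> (\<Sum>h\<in>?I. ?e * ?m)" by (rule sum_mono) (use fixed in auto)
  also have "\<dots> = card ?I * (?e * ?m)" by simp
  also have "card ?I \<le> 2 ^ card Y * b" using Y b by (simp add: card_cartesian_product card_Pow)
  finally show ?thesis by (simp add: mult_ac)
qed

text \<open>For a single vertex \<open>2 ^ card Y - 1 = 1\<close>, so failing to be rich to a part
  determines the star to it up to a small witness set. Two such parts contribute almost nothing, and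
  only \<open>R\<close> edges remain free.\<close>

lemma card_not_rich_twice:
  assumes E: "finite E" "E \<subseteq> E0"
    and W: "\<And>i. i < p \<Longrightarrow> finite (W i)" "\<And>i. i < p \<Longrightarrow> v \<notin> W i" "\<And>i. i < p \<Longrightarrow> between E0 {v} (W i) \<subseteq> E"
    and Wd: "\<And>i j. i < p \<Longrightarrow> j < p \<Longrightarrow> i \<noteq> j \<Longrightarrow> W i \<inter> W j = {}"
    and b: "\<And>i. i < p \<Longrightarrow> card (small_subsets (W i) c) \<le> b"
    and R: "\<And>i j. i < p \<Longrightarrow> j < p \<Longrightarrow> i \<noteq> j \<Longrightarrow> card (E - between E0 {v} (W i) - between E0 {v} (W j)) \<le> R"
  shows "card {S. S \<subseteq> E \<and> (\<exists>i<p. \<exists>j<p. i \<noteq> j \<and> \<not> rich E0 S {v} (W i) c \<and> \<not> rich E0 S {v} (W j) c)}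
     \<le> p\<^sup>2 * (2 ^ R * (2 * (b * 2 ^ c))\<^sup>2)"
proof -
  let ?I = "{ij \<in> {..<p} \<times> {..<p}. fst ij \<noteq> snd ij}"
  let ?G = "\<lambda>ij. {S. S \<subseteq> E \<and> \<not> rich E0 S {v} (W (fst ij)) c \<and> \<not> rich E0 S {v} (W (snd ij)) c}"
  have "{S. S \<subseteq> E \<and> (\<exists>i<p. \<exists>j<p. i \<noteq> j \<and> \<not> rich E0 S {v} (W i) c \<and> \<not> rich E0 S {v} (W j) c)} \<subseteq> (\<Union>ij\<in>?I. ?G ij)"
    by force
  then have "card {S. S \<subseteq> E \<and> (\<exists>i<p. \<exists>j<p. i \<noteq> j \<and> \<not> rich E0 S {v} (W i) c \<and> \<not> rich E0 S {v} (W j) c)} \<le> card (\<Union>ij\<in>?I. ?G ij)"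
    by (rule card_mono[rotated]) (use E in auto)
  also have "\<dots> \<le> (\<Sum>ij\<in>?I. card (?G ij))" by (rule card_UN_le) simp
  also have "\<dots> \<le> (\<Sum>ij\<in>?I. 2 ^ R * (2 * (b * 2 ^ c))\<^sup>2)"
  proof (rule sum_mono)
    fix ij assume ij: "ij \<in> ?I"
    obtain i j where eq: "ij = (i, j)" by force
    have i: "i < p" "j < p" "i \<noteq> j" using ij eq by auto
    define Bi where "Bi = between E0 {v} (W i)"
    define Bj where "Bj = between E0 {v} (W j)"
    have disj: "Bj \<inter> Bi = {}" unfolding Bi_def Bj_def between_def using Wd[OF i] W(2)[OF i(1)] W(2)[OF i(2)]
      by (auto simp: doubleton_eq_iff)
    have sub: "Bi \<subseteq> E" "Bj \<subseteq> E - Bi" using W(3) i disj unfolding Bi_def Bj_def by blast+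
    have fin: "finite Bi" "finite (E - Bi)" using E(1) sub(1) finite_subset by auto
    have "card (?G ij) \<le> card {T. T \<subseteq> Bi \<and> \<not> rich E0 T {v} (W i) c} * card {T. T \<subseteq> E - Bi \<and> \<not> rich E0 T {v} (W j) c}"
    proof (rule card_le_split[where ?E1.0 = Bi and ?E2.0 = "E - Bi"])
      fix S assume S: "S \<in> ?G ij"
      show "S \<subseteq> Bi \<union> (E - Bi)" using S by auto
      show "S \<inter> Bi \<in> {T. T \<subseteq> Bi \<and> \<not> rich E0 T {v} (W i) c}"
        using S rich_restrict[of E0 "{v}" "W i" Bi S c] unfolding eq Bi_def by auto
      show "S \<inter> (E - Bi) \<in> {T. T \<subseteq> E - Bi \<and> \<not> rich E0 T {v} (W j) c}"
        using S rich_restrict[of E0 "{v}" "W j" "E - Bi" S c] sub(2) unfolding eq Bj_def by auto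
    qed (use fin in simp_all)
    also have "card {T. T \<subseteq> Bi \<and> \<not> rich E0 T {v} (W i) c} \<le> 2 * (b * 2 ^ c)"
    proof -
      have "card {T. T \<subseteq> Bi \<and> \<not> rich E0 T {v} (W i) c} \<le> 2 ^ (card Bi - card (between E0 {v} (W i))) *
         (2 ^ card {v} * (b * (2 ^ (card {v} * c) * (2 ^ card {v} - 1) ^ card (W i))))"
        by (rule card_not_rich[OF fin(1) _ _ W(1)[OF i(1)] _ _ _ b[OF i(1)]])
           (use E(2) sub(1) W(2)[OF i(1)] in \<open>auto simp: Bi_def\<close>)
      then show ?thesis unfolding Bi_def by simp
    qed
    also have "card {T. T \<subseteq> E - Bi \<and> \<not> rich E0 T {v} (W j) c} \<le> 2 ^ R * (2 * (b * 2 ^ c))"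
    proof -
      have "card {T. T \<subseteq> E - Bi \<and> \<not> rich E0 T {v} (W j) c} \<le> 2 ^ (card (E - Bi) - card (between E0 {v} (W j))) *
         (2 ^ card {v} * (b * (2 ^ (card {v} * c) * (2 ^ card {v} - 1) ^ card (W j))))"
        by (rule card_not_rich[OF fin(2) _ _ W(1)[OF i(2)] _ _ _ b[OF i(2)]])
           (use E(2) sub(2) W(2)[OF i(2)] in \<open>auto simp: Bj_def\<close>)
      also have "card (E - Bi) - card (between E0 {v} (W j)) = card (E - Bi - Bj)"
        using sub(2) E(1) unfolding Bj_def[symmetric] by (metis card_Diff_subset finite_Diff finite_subset)
      also have "(2::nat) ^ card (E - Bi - Bj) \<le> 2 ^ R" using R[OF i] unfolding Bi_def Bj_def by simp
      finally show ?thesis by simp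
    qed
    finally show "card (?G ij) \<le> 2 ^ R * (2 * (b * 2 ^ c))\<^sup>2" by (simp add: power2_eq_square mult_ac)
  qed
  also have "\<dots> = card ?I * (2 ^ R * (2 * (b * 2 ^ c))\<^sup>2)" by simp
  also have "card ?I \<le> card ({..<p} \<times> {..<p})" by (rule card_mono) auto
  also have "\<dots> = p\<^sup>2" by (simp add: card_cartesian_product power2_eq_square)
  finally show ?thesis by simp
qed

section \<open>Asymptotic form of the universality count\<close>

lemma quadratic_dominates:
  assumes "\<xi> > (0::real)"
  shows "\<exists>s0. \<forall>s::nat. s \<ge> s0 \<longrightarrow> a * real s + b < \<xi> * (real s)\<^sup>2"
proof (intro exI allI impI)
  fix s assume s: "nat \<lceil>(\<bar>a\<bar> + \<bar>b\<bar>) / \<xi>\<rceil> + 1 \<le> s"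
  then have "(\<bar>a\<bar> + \<bar>b\<bar>) / \<xi> < real s" and s1: "1 \<le> real s" by linarith+
  then have "\<bar>a\<bar> + \<bar>b\<bar> < \<xi> * real s" using assms by (simp add: field_simps)
  then have "(\<bar>a\<bar> + \<bar>b\<bar>) * real s < \<xi> * real s * real s" using s1 by (intro mult_strict_right_mono) auto
  moreover have "\<bar>b\<bar> * 1 \<le> \<bar>b\<bar> * real s" using s1 by (intro mult_left_mono) auto
  moreover have "a * real s \<le> \<bar>a\<bar> * real s" using s1 by (intro mult_right_mono) auto
  ultimately show "a * real s + b < \<xi> * (real s)\<^sup>2" by (simp add: power2_eq_square algebra_simps)
qed

text \<open>Binary digits lost per transversal: the factor of \<open>card_pattern_avoiding\<close>
  with \<open>K = 4 * p\<^sup>2\<close>, written as a power of 2.\<close>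

definition pattern_rate :: "nat \<Rightarrow> real" where
  "pattern_rate p = - log 2 (1 - 1 / 2 ^ (4 * p^2))"

lemma pattern_rate:
  assumes "p \<ge> 1"
  shows "pattern_rate p > 0" "(1 - 1 / 2 ^ (4 * p^2)) ^ k = 2 powr (- pattern_rate p * real k)"
proof -
  have "(2::real) ^ 1 \<le> 2 ^ (4 * p^2)" using assms by (intro power_increasing) (auto simp: Suc_le_eq)
  then have "(1::real) - 1 / 2 ^ (4 * p^2) > 0" "(1::real) - 1 / 2 ^ (4 * p^2) < 1" by (simp_all add: field_simps)
  then show "pattern_rate p > 0" "(1 - 1 / 2 ^ (4 * p^2)) ^ k = 2 powr (- pattern_rate p * real k)"
    unfolding pattern_rate_def by (simp_all add: powr_powr[symmetric] powr_realpow)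
qed

lemma card_nonuniversal_powr:
  assumes "p \<ge> 1" "finite E"
    and "\<And>i. i < p \<Longrightarrow> finite (V i)" "\<And>i. i < p \<Longrightarrow> card (V i) \<le> n"
    and "finite Mis" "card Mis \<le> M"
    and "\<And>i j u v. i < p \<Longrightarrow> j < p \<Longrightarrow> i \<noteq> j \<Longrightarrow> u \<in> V i \<Longrightarrow> v \<in> V j \<Longrightarrow> {u, v} \<notin> E \<Longrightarrow> {u, v} \<in> Mis"
  shows "real (card {S. S \<subseteq> E \<and> \<not> universal p c E S V}) \<le>
    2 powr (real (2*p*n + 4*p^2) + real (card E) - pattern_rate p * (real ((c div (2*p))^2) - real M))"
proof -
  let ?m = "c div (2*p)"
  have "real (card {S. S \<subseteq> E \<and> \<not> universal p c E S V}) \<le>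
    2 ^ (2*p*n + 4*p^2) * (2 ^ card E * (1 - 1 / 2 ^ (4 * p^2)) ^ (?m^2 - M))"
    by (rule card_nonuniversal) (fact assms)+
  also have "\<dots> = 2 powr (real (2*p*n + 4*p^2) + real (card E) + - pattern_rate p * real (?m^2 - M))"
    unfolding pattern_rate(2)[OF assms(1)] by (simp only: powr_add powr_realpow zero_less_numeral mult.assoc)
  also have "\<dots> \<le> 2 powr (real (2*p*n + 4*p^2) + real (card E) - pattern_rate p * (real (?m^2) - real M))"
  proof (rule powr_mono)
    have "real (?m^2) - real M \<le> real (?m^2 - M)" by linarith
    then have "pattern_rate p * (real (?m^2) - real M) \<le> pattern_rate p * real (?m^2 - M)"
      using pattern_rate(1)[OF assms(1)] by (intro mult_left_mono) auto
    then show "real (2*p*n + 4*p^2) + real (card E) + - pattern_rate p * real (?m^2 - M) \<le>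
       real (2*p*n + 4*p^2) + real (card E) - pattern_rate p * (real (?m^2) - real M)" by linarith
  qed simp
  finally show ?thesis .
qed

text \<open>As \<open>4 * p \<le> \<kappa> * s\<close>, rounding down the quotient by
  \<open>2 * p\<close> costs at most half, whence the denominator \<open>4 * p\<close>.\<close>

lemma div_ge_real:
  assumes "\<kappa> * real s \<le> real c" "p \<ge> 1" "\<kappa> > 0" "4 * real p \<le> \<kappa> * real s"
  shows "\<kappa> / (4 * real p) * real s \<le> real (c div (2*p))"
proof -
  have "c < 2*p * (c div (2*p)) + 2*p" using dividend_less_times_div[of "2*p" c] assms(2) by simp
  then have "real c < 2 * real p * real (c div (2*p)) + 2 * real p"
    by (metis (mono_tags) of_nat_add of_nat_less_iff of_nat_mult of_nat_numeral)
  then have "\<kappa> * real s \<le> 4 * real p * real (c div (2*p))" using assms(1,4) by argo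
  then show ?thesis using assms(2) by (simp add: field_simps)
qed

definition complete_multipartite :: "nat \<Rightarrow> (nat \<Rightarrow> nat set) \<Rightarrow> nat set set" where
  "complete_multipartite p A = {e. \<exists>i<p. \<exists>j<p. i \<noteq> j \<and> (\<exists>u\<in>A i. \<exists>v\<in>A j. e = {u, v})}"

text \<open>Existence by counting: between the parts of a complete multipartite graph no pair is
  missing, so for large \<open>s\<close> the quadratic saving beats the linear cost of the union
  bound and not all subsets can be non-universal.\<close>

lemma ex_universal_pattern:
  assumes p: "p \<ge> 1" and \<kappa>: "\<kappa> > 0"
  shows "\<exists>s0. \<forall>s\<ge>s0. \<forall>c A. \<kappa> * real s \<le> real c \<longrightarrow> (\<forall>i<p. finite (A i) \<and> card (A i) = s) \<longrightarrow>
     (\<exists>B\<subseteq>complete_multipartite p A. universal p c (complete_multipartite p A) B A)"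
proof -
  define \<kappa>' where "\<kappa>' = \<kappa> / (4 * real p)"
  have \<kappa>': "\<kappa>' > 0" unfolding \<kappa>'_def using assms by simp
  have "pattern_rate p * \<kappa>'\<^sup>2 > 0" using pattern_rate(1)[OF p] \<kappa>' by simp
  then obtain s1 where s1: "\<And>s::nat. s \<ge> s1 \<Longrightarrow> 2 * real p * real s + 4 * (real p)^2 < pattern_rate p * \<kappa>'\<^sup>2 * (real s)\<^sup>2"
    using quadratic_dominates by blast
  show ?thesis
  proof (intro exI[of _ "s1 + nat \<lceil>4 * real p / \<kappa>\<rceil>"] allI impI)
    fix s c and A :: "nat \<Rightarrow> nat set"
    assume s: "s1 + nat \<lceil>4 * real p / \<kappa>\<rceil> \<le> s" and c: "\<kappa> * real s \<le> real c" and A: "\<forall>i<p. finite (A i) \<and> card (A i) = s"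
    let ?E = "complete_multipartite p A"
    have "?E \<subseteq> (\<lambda>(u, v). {u, v}) ` ((\<Union>i<p. A i) \<times> (\<Union>i<p. A i))" unfolding complete_multipartite_def by force
    moreover have "finite (\<Union>i<p. A i)" using A by simp
    ultimately have fE: "finite ?E" by (meson finite_SigmaI finite_imageI finite_subset)
    have "4 * real p / \<kappa> \<le> real s" using s by linarith
    then have "4 * real p \<le> \<kappa> * real s" using \<kappa> by (simp add: field_simps)
    then have m: "\<kappa>' * real s \<le> real (c div (2*p))" unfolding \<kappa>'_def using div_ge_real[OF c p \<kappa>] by simp
    then have "(\<kappa>' * real s)\<^sup>2 \<le> (real (c div (2*p)))\<^sup>2" using \<kappa>' by (intro power_mono) auto
    then have m2: "pattern_rate p * (\<kappa>' * real s)\<^sup>2 \<le> pattern_rate p * real ((c div (2*p))\<^sup>2)"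
      unfolding of_nat_power using pattern_rate(1)[OF p] by (intro mult_left_mono) auto
    have "real (card {S. S \<subseteq> ?E \<and> \<not> universal p c ?E S A}) \<le>
      2 powr (real (2*p*s + 4*p^2) + real (card ?E) - pattern_rate p * (real ((c div (2*p))^2) - real 0))"
    proof (rule card_nonuniversal_powr[where Mis = "{}"])
      show "\<And>i j u v. i < p \<Longrightarrow> j < p \<Longrightarrow> i \<noteq> j \<Longrightarrow> u \<in> A i \<Longrightarrow> v \<in> A j \<Longrightarrow> {u, v} \<notin> ?E \<Longrightarrow> {u, v} \<in> {}"
        unfolding complete_multipartite_def by blast
    qed (use p fE A in simp_all)
    also have "\<dots> < 2 powr real (card ?E)"
    proof (rule powr_less_mono)
      have "2 * real p * real s + 4 * (real p)^2 < pattern_rate p * \<kappa>'\<^sup>2 * (real s)\<^sup>2" using s1[of s] s by simp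
      also have "\<dots> = pattern_rate p * (\<kappa>' * real s)\<^sup>2" by (simp add: power_mult_distrib)
      finally show "real (2*p*s + 4*p^2) + real (card ?E) - pattern_rate p * (real ((c div (2*p))^2) - real 0) < real (card ?E)"
        using m2 by simp
    qed simp
    also have "\<dots> = real (card (Pow ?E))" using fE by (simp add: card_Pow powr_realpow)
    finally have "card {S. S \<subseteq> ?E \<and> \<not> universal p c ?E S A} < card (Pow ?E)" by simp
    then have "{S. S \<subseteq> ?E \<and> \<not> universal p c ?E S A} \<noteq> Pow ?E" by auto
    then show "\<exists>B\<subseteq>?E. universal p c ?E B A" by blast
  qed
qed

section \<open>Locating a universal blow-up by Pajor's inequality\<close>

context anti_fan
begin

definition FF :: "nat set set \<Rightarrow> nat set set set" where
  "FF E = {S \<in> Pow E. \<not> fan_in E S}"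

lemma finite_FF [simp]: "finite E \<Longrightarrow> finite (FF E)"
  unfolding FF_def by simp

lemma fan_in_restrict: "fan_in E' (S \<inter> E') \<Longrightarrow> E' \<subseteq> E \<Longrightarrow> fan_in E S"
  unfolding fan_in_def using arc_restrict by meson

text \<open>Deleting vertices creates no fan, so the edges missing \<open>W\<close> again carry a
  fan-free orientation. The edges at \<open>W\<close> are bounded by whatever property
  \<open>P'\<close> can be read off from them; all later savings enter through
  \<open>P'\<close>.\<close>

lemma card_FF_split:
  assumes "finite E" "\<And>S. S \<in> FF E \<Longrightarrow> P S \<Longrightarrow> P' (S \<inter> touch E W)"
  shows "card {S \<in> FF E. P S} \<le> card (FF (del E W)) * card {T. T \<subseteq> touch E W \<and> P' T}"
proof (rule card_le_split[where ?E1.0 = "del E W" and ?E2.0 = "touch E W"])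
  fix S assume S: "S \<in> {S \<in> FF E. P S}"
  then have "S \<subseteq> E" unfolding FF_def by auto
  then show "S \<subseteq> del E W \<union> touch E W" unfolding del_def touch_def by auto
  have "\<not> fan_in (del E W) (S \<inter> del E W)"
    using fan_in_restrict[of "del E W" S E] S unfolding FF_def del_def by blast
  then show "S \<inter> del E W \<in> FF (del E W)" unfolding FF_def by blast
  show "S \<inter> touch E W \<in> {T. T \<subseteq> touch E W \<and> P' T}" using S assms(2) by blast
qed (use assms(1) in \<open>auto simp: del_def touch_def\<close>)

text \<open>Suppose every blow-up in \<open>E\<close> has too few universal orientations, and
  discard all of these; at least half of \<open>FF E\<close> remains. No set shattered by the
  remainder contains a blow-up, for otherwise a universal pattern would be realised on it. By Pajor
  the remainder is at most the number of blow-up-free graphs, which has a smaller quadratic exponent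
  than the assumed lower bound.\<close>

lemma universal_location:
  assumes \<kappa>: "\<kappa> > 0"
  shows "\<exists>s0. \<forall>s\<ge>s0. \<forall>c. \<kappa> * real s \<le> real c \<longrightarrow> (\<exists>n0. \<forall>V E. finite V \<longrightarrow> n0 \<le> card V \<longrightarrow> E \<subseteq> edges_on V \<longrightarrow>
     2 powr (turan_density p * (real (card V) * (real (card V) - 1))) \<le> real (card (FF E)) \<longrightarrow>
     (\<exists>A. blowup p s E V A \<and> card (FF E) \<le> 2 ^ (p * card V + 1) * card {S \<in> FF E. universal p c E S A}))"
proof -
  have p1: "p \<ge> 1" using p2 by simp
  obtain s1 where s1: "\<And>s c A. s \<ge> s1 \<Longrightarrow> \<kappa> * real s \<le> real c \<Longrightarrow> (\<forall>i<p. finite (A i) \<and> card (A i) = s) \<Longrightarrow>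
     (\<exists>B\<subseteq>complete_multipartite p A. universal p c (complete_multipartite p A) B A)"
    using ex_universal_pattern[OF p1 \<kappa>] by metis
  define q where "q = p - 2"
  have pq: "p = Suc (Suc q)" unfolding q_def using p2 by simp
  \<comment> \<open>Excluding \<open>p\<close>-partite blow-ups leaves the density of
    \<open>p - 1\<close> parts, while \<open>FF E\<close> has at least the density of
    \<open>p\<close> parts. Half of the gap is given to the error term of the count.\<close>
  define gap where "gap = turan_density p - turan_density (Suc q)"
  have gap: "gap > 0" unfolding gap_def turan_density_def pq by (simp add: field_simps add_pos_nonneg)
  show ?thesis
  proof (rule exI[of _ "Suc s1"], intro allI impI)
    fix s c assume s: "Suc s1 \<le> s" and c: "\<kappa> * real s \<le> real c"
    obtain C where C: "\<And>V. finite V \<Longrightarrow> real (card (blowup_free p s V)) \<le>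
        2 powr ((turan_density (Suc q) + gap / 2) * (real (card V))\<^sup>2 + C)"
      using card_blowup_free[of "gap / 2" s "Suc q"] gap s unfolding pq by auto
    obtain n0 where n0: "\<And>n::nat. n \<ge> n0 \<Longrightarrow> turan_density p * real n + (C + 1) < gap / 2 * (real n)\<^sup>2"
      using quadratic_dominates[OF half_gt_zero[OF gap]] by blast
    show "\<exists>n0. \<forall>V E. finite V \<longrightarrow> n0 \<le> card V \<longrightarrow> E \<subseteq> edges_on V \<longrightarrow>
     2 powr (turan_density p * (real (card V) * (real (card V) - 1))) \<le> real (card (FF E)) \<longrightarrow>
     (\<exists>A. blowup p s E V A \<and> card (FF E) \<le> 2 ^ (p * card V + 1) * card {S \<in> FF E. universal p c E S A})"
    proof (rule exI[of _ n0], intro allI impI)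
      fix V :: "nat set" and E assume fV: "finite V" and n: "n0 \<le> card V" and E: "E \<subseteq> edges_on V"
        and big: "2 powr (turan_density p * (real (card V) * (real (card V) - 1))) \<le> real (card (FF E))"
      have fE: "finite E" by (rule finite_subset[OF E finite_edges_on[OF fV]])
      define \<A> where "\<A> = {A \<in> PiE {..<p} (\<lambda>_. Pow V). blowup p s E V A}"
      have fPi: "finite (PiE {..<p} (\<lambda>_. Pow V))" using fV by (intro finite_PiE) auto
      then have fA: "finite \<A>" unfolding \<A>_def by simp
      have "card \<A> \<le> card (PiE {..<p} (\<lambda>_. Pow V))" unfolding \<A>_def by (rule card_mono[OF fPi]) auto
      also have "\<dots> = (2 ^ card V) ^ p" using fV by (simp add: card_PiE card_Pow)
      also have "\<dots> = 2 ^ (p * card V)" by (simp add: power_mult[symmetric] mult.commute)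
      finally have cA: "card \<A> \<le> 2 ^ (p * card V)" .
      define G where "G = (\<lambda>A. {S \<in> FF E. universal p c E S A})"
      show "\<exists>A. blowup p s E V A \<and> card (FF E) \<le> 2 ^ (p * card V + 1) * card {S \<in> FF E. universal p c E S A}"
      proof (rule ccontr)
        assume "\<not> ?thesis"
        then have small: "2 ^ (p * card V + 1) * card (G A) \<le> card (FF E)" if "A \<in> \<A>" for A
          using that unfolding \<A>_def G_def by (metis (lifting) mem_Collect_eq nat_le_linear)
        have "2 * (2 ^ (p * card V) * card (\<Union>A\<in>\<A>. G A)) \<le> 2 * (2 ^ (p * card V) * (\<Sum>A\<in>\<A>. card (G A)))"
          using card_UN_le[OF fA, of G] by simp
        also have "\<dots> = (\<Sum>A\<in>\<A>. 2 ^ (p * card V + 1) * card (G A))" by (simp add: sum_distrib_left mult.assoc)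
        also have "\<dots> \<le> (\<Sum>A\<in>\<A>. card (FF E))" by (rule sum_mono) (rule small)
        also have "\<dots> \<le> 2 ^ (p * card V) * card (FF E)" using cA by simp
        finally have half: "2 * card (\<Union>A\<in>\<A>. G A) \<le> card (FF E)" by simp
        \<comment> \<open>The universal orientations of all blow-ups together make up at most half
          of \<open>FF E\<close>; what remains is universal on no blow-up in
          \<open>E\<close>.\<close>
        define F' where "F' = FF E - (\<Union>A\<in>\<A>. G A)"
        have "card (FF E) - card (\<Union>A\<in>\<A>. G A) \<le> card F'" unfolding F'_def
          by (rule diff_card_le_card_Diff) (use fA fE in \<open>auto simp: G_def\<close>)
        then have F'half: "card (FF E) \<le> 2 * card F'" using half by linarith
        have "F' \<subseteq> Pow E" unfolding F'_def FF_def by blast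
        then have "card F' \<le> card {S \<in> Pow E. shattered F' S}" by (rule pajor[OF fE])
        also have "\<dots> \<le> card (blowup_free p s V)"
        proof (rule card_mono)
          show "{S \<in> Pow E. shattered F' S} \<subseteq> blowup_free p s V"
          proof
            fix S assume S: "S \<in> {S \<in> Pow E. shattered F' S}"
            have "\<nexists>A. blowup p s S V A"
            proof
              assume "\<exists>A. blowup p s S V A"
              then obtain A0 where A0: "blowup p s S V A0" by blast
              define A where "A = restrict A0 {..<p}"
              have bA: "blowup p s S V A" using A0 unfolding A_def blowup_def by simp
              then have "blowup p s E V A" by (rule blowup_mono_vertices) (use S in auto)
              moreover have "A \<in> PiE {..<p} (\<lambda>_. Pow V)" using A0 unfolding A_def blowup_def by auto
              ultimately have A: "A \<in> \<A>" unfolding \<A>_def by blast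
              have "\<forall>i<p. finite (A i) \<and> card (A i) = s" using bA fV finite_subset unfolding blowup_def by metis
              then obtain B where B: "B \<subseteq> complete_multipartite p A" "universal p c (complete_multipartite p A) B A"
                using s1[of s c A] s c by auto
              have sub: "complete_multipartite p A \<subseteq> S" using bA unfolding blowup_def complete_multipartite_def by blast
              then have "B \<subseteq> S" using B(1) by blast
              \<comment> \<open>Shattering realises the trace \<open>B\<close> on \<open>S\<close>.
                Its restriction to the blow-up makes \<open>T\<close> universal for
                \<open>A\<close>, although such orientations were discarded.\<close>
              then obtain T where T: "T \<in> F'" "T \<inter> S = B" using S unfolding shattered_def by blast
              have "T \<inter> complete_multipartite p A = B" using T(2) sub B(1) by blast
              then have "universal p c E T A"
                using universal_restrict[of p c "complete_multipartite p A" T A E] B(2) sub S by auto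
              then have "T \<in> G A" using T(1) unfolding G_def F'_def by blast
              then show False using T(1) A unfolding F'_def by blast
            qed
            then show "S \<in> blowup_free p s V" using S E unfolding blowup_free_def by blast
          qed
        qed (use fV in simp)
        finally have "real (card F') \<le> 2 powr ((turan_density (Suc q) + gap / 2) * (real (card V))\<^sup>2 + C)"
          using C[OF fV] by linarith
        then have "real (card (FF E)) \<le> 2 * 2 powr ((turan_density (Suc q) + gap / 2) * (real (card V))\<^sup>2 + C)"
          using F'half by linarith
        also have "\<dots> = 2 powr ((turan_density (Suc q) + gap / 2) * (real (card V))\<^sup>2 + (C + 1))"
          by (simp add: powr_add)
        also have "\<dots> < 2 powr (turan_density p * (real (card V) * (real (card V) - 1)))"
        proof (rule powr_less_mono)
          have "turan_density p = turan_density (Suc q) + gap" unfolding gap_def by simp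
          then show "(turan_density (Suc q) + gap / 2) * (real (card V))\<^sup>2 + (C + 1) <
             turan_density p * (real (card V) * (real (card V) - 1))"
            using n0[OF n] by (simp add: algebra_simps power2_eq_square)
        qed simp
        finally show False using big by simp
      qed
    qed
  qed
qed

end

section \<open>Removing a blown-up clique\<close>

lemma ex_maximal_disjoint_subfamily:
  assumes "finite \<X>" "\<And>X. X \<in> \<X> \<Longrightarrow> X \<noteq> {}"
  shows "\<exists>\<Q>\<subseteq>\<X>. (\<forall>X\<in>\<Q>. \<forall>Y\<in>\<Q>. X \<noteq> Y \<longrightarrow> X \<inter> Y = {}) \<and> (\<forall>X\<in>\<X>. \<exists>Y\<in>\<Q>. X \<inter> Y \<noteq> {})"
  using assms
proof (induction \<X> rule: finite_induct)
  case (insert X \<X>)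
  then obtain \<Q> where Q: "\<Q> \<subseteq> \<X>" "\<forall>X\<in>\<Q>. \<forall>Y\<in>\<Q>. X \<noteq> Y \<longrightarrow> X \<inter> Y = {}" "\<forall>X\<in>\<X>. \<exists>Y\<in>\<Q>. X \<inter> Y \<noteq> {}" by blast
  show ?case
  proof (cases "\<exists>Y\<in>\<Q>. X \<inter> Y \<noteq> {}")
    case True
    then show ?thesis using Q by (intro exI[of _ \<Q>]) auto
  next
    case False
    then show ?thesis using Q insert.prems[of X] by (intro exI[of _ "insert X \<Q>"]) auto
  qed
qed simp

lemma card_between_le:
  assumes "finite Y" "finite X"
  shows "card (between E Y X) \<le> (\<Sum>y\<in>Y. card {u \<in> X. {u, y} \<in> E})"
proof -
  have "between E Y X \<subseteq> (\<Union>y\<in>Y. (\<lambda>u. {u, y}) ` {u \<in> X. {u, y} \<in> E})"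
    unfolding between_def by (auto simp: insert_commute)
  then have "card (between E Y X) \<le> card (\<Union>y\<in>Y. (\<lambda>u. {u, y}) ` {u \<in> X. {u, y} \<in> E})"
    by (rule card_mono[rotated]) (use assms in auto)
  also have "\<dots> \<le> (\<Sum>y\<in>Y. card ((\<lambda>u. {u, y}) ` {u \<in> X. {u, y} \<in> E}))" by (rule card_UN_le[OF assms(1)])
  also have "\<dots> \<le> (\<Sum>y\<in>Y. card {u \<in> X. {u, y} \<in> E})" by (rule sum_mono) (rule card_image_le, use assms in simp)
  finally show ?thesis .
qed

lemma between_UN: "between E Y (\<Union>i\<in>I. X i) = (\<Union>i\<in>I. between E Y (X i))"
  unfolding between_def by blast

lemma between_mono: "X \<subseteq> X' \<Longrightarrow> Y \<subseteq> Y' \<Longrightarrow> between E Y X \<subseteq> between E Y' X'"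
  unfolding between_def by blast

lemma between_subset: "between E Y X \<subseteq> E"
  unfolding between_def by blast

locale blown_up =
  fixes p s :: nat and E :: "nat set set" and V :: "nat set" and A :: "nat \<Rightarrow> nat set"
  assumes p2: "p \<ge> 2" and A: "blowup p s E V A" and fV: "finite V" and E: "E \<subseteq> edges_on V"
begin

definition W where "W = (\<Union>i<p. A i)"

lemma A_sub: "i < p \<Longrightarrow> A i \<subseteq> W" unfolding W_def by auto
lemma W_sub: "W \<subseteq> V" using A unfolding W_def blowup_def by auto
lemma fin_W: "finite W" using W_sub fV finite_subset by auto
lemma fin_A: "i < p \<Longrightarrow> finite (A i)" using A_sub fin_W finite_subset by metis
lemma card_A: "i < p \<Longrightarrow> card (A i) = s" using A unfolding blowup_def by blast
lemma A_disj: "i < p \<Longrightarrow> j < p \<Longrightarrow> i \<noteq> j \<Longrightarrow> A i \<inter> A j = {}" using A unfolding blowup_def by blast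

lemma card_W: "card W = p * s"
proof -
  have "card W = (\<Sum>i<p. card (A i))" unfolding W_def
    by (rule card_UN_disjoint) (use fin_A A_disj in auto)
  then show ?thesis using card_A by simp
qed

lemma fin_E: "finite E" by (rule finite_subset[OF E finite_edges_on[OF fV]])

lemma fin_between: "finite (between E Y X)" using between_subset fin_E finite_subset by metis

lemma card_between_A:
  assumes "i < p" "finite Y" "card Y \<le> k"
  shows "card (between E Y (A i)) \<le> k * s"
proof -
  have "card (between E Y (A i)) \<le> (\<Sum>y\<in>Y. card {u \<in> A i. {u, y} \<in> E})"
    by (rule card_between_le[OF assms(2) fin_A[OF assms(1)]])
  also have "\<dots> \<le> (\<Sum>y\<in>Y. s)"
    by (rule sum_mono) (metis (no_types, lifting) assms(1) card_A card_mono fin_A mem_Collect_eq subsetI)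
  also have "\<dots> \<le> k * s" using assms(3) by simp
  finally show ?thesis .
qed

lemma card_between_A_sparse:
  assumes "i < p" "finite Y" "card Y \<le> k" "\<And>y. y \<in> Y \<Longrightarrow> card {u \<in> A i. {u, y} \<in> E} \<le> d"
  shows "card (between E Y (A i)) \<le> k * d"
proof -
  have "card (between E Y (A i)) \<le> (\<Sum>y\<in>Y. card {u \<in> A i. {u, y} \<in> E})"
    by (rule card_between_le[OF assms(2) fin_A[OF assms(1)]])
  also have "\<dots> \<le> (\<Sum>y\<in>Y. d)" by (rule sum_mono) (rule assms(4))
  also have "\<dots> \<le> k * d" using assms(3) by simp
  finally show ?thesis .
qed

lemma card_between_W_minus:
  assumes "finite Y" "card Y \<le> k" "J \<subseteq> {..<p}" "card J \<le> m"
    and "between E Y W - X \<subseteq> (\<Union>i\<in>J. between E Y (A i))"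
  shows "card (between E Y W - X) \<le> m * (k * s)"
proof -
  have fJ: "finite J" using assms(3) finite_subset by blast
  have "card (between E Y W - X) \<le> card (\<Union>i\<in>J. between E Y (A i))"
    by (rule card_mono[OF _ assms(5)]) (use fJ fin_between in auto)
  also have "\<dots> \<le> (\<Sum>i\<in>J. card (between E Y (A i)))" by (rule card_UN_le[OF fJ])
  also have "\<dots> \<le> (\<Sum>i\<in>J. k * s)" by (rule sum_mono) (rule card_between_A, use assms in auto)
  also have "\<dots> \<le> m * (k * s)" using assms(4) by simp
  finally show ?thesis .
qed

lemma between_W: "between E Y W = (\<Union>i<p. between E Y (A i))"
  unfolding W_def between_UN ..

text \<open>One part contributes at most \<open>d\<close> edges, the other \<open>p - 1\<close> at
  most \<open>s\<close> each. This is the baseline against which savings are measured.\<close>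

lemma card_sparse_vertex:
  assumes i: "i < p" and d: "card {u \<in> A i. {u, v} \<in> E} \<le> d"
  shows "card (between E {v} W) \<le> (p - 1) * s + d"
proof -
  have "between E {v} W = (between E {v} W - between E {v} (A i)) \<union> between E {v} (A i)"
    using between_mono[OF A_sub[OF i], of "{v}" "{v}" E] by blast
  then have "card (between E {v} W) \<le> card (between E {v} W - between E {v} (A i)) + card (between E {v} (A i))"
    by (metis card_Un_le)
  also have "card (between E {v} W - between E {v} (A i)) \<le> (p - 1) * (1 * s)"
    by (rule card_between_W_minus[where J = "{..<p} - {i}"]) (use i in \<open>auto simp: between_W\<close>)
  also have "card (between E {v} (A i)) \<le> 1 * d"
    by (rule card_between_A_sparse[OF i]) (use d in auto)
  finally show ?thesis by simp
qed

text \<open>With nearly determined stars to two parts only \<open>p - 2\<close> parts are free, one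
  fewer than for a sparse vertex.\<close>

lemma card_dense_vertex:
  assumes v: "v \<notin> W" and b: "\<And>i. i < p \<Longrightarrow> card (small_subsets (A i) c) \<le> b"
  shows "card {S. S \<subseteq> between E {v} W \<and> (\<exists>i<p. \<exists>j<p. i \<noteq> j \<and> \<not> rich E S {v} (A i) c \<and> \<not> rich E S {v} (A j) c)}
     \<le> p\<^sup>2 * (2 ^ ((p - 2) * s) * (2 * (b * 2 ^ c))\<^sup>2)"
proof (rule card_not_rich_twice[OF fin_between between_subset fin_A _ _ A_disj b])
  show "between E {v} (A i) \<subseteq> between E {v} W" if "i < p" for i using between_mono[OF A_sub[OF that]] by blast
  fix i j assume ij: "i < p" "j < p" "i \<noteq> j"
  have "card (between E {v} W - (between E {v} (A i) \<union> between E {v} (A j))) \<le> (p - 2) * (1 * s)"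
    by (rule card_between_W_minus[where J = "{..<p} - {i, j}"]) (use ij in \<open>auto simp: between_W card_Diff_subset\<close>)
  moreover have "between E {v} W - between E {v} (A i) - between E {v} (A j) =
    between E {v} W - (between E {v} (A i) \<union> between E {v} (A j))" by blast
  ultimately show "card (between E {v} W - between E {v} (A i) - between E {v} (A j)) \<le> (p - 2) * s"
    by simp
qed (use v A_sub in auto)

text \<open>Four vertices sparse to the same part have about \<open>4 * (p - 1) * s\<close> free
  edges; lack of richness to another part \<open>j\<close> replaces \<open>16 ^ s\<close> by
  \<open>15 ^ s\<close> there.\<close>

lemma card_quad:
  assumes Y: "Y \<subseteq> V - W" "card Y = 4" and i: "i < p" and d: "\<And>y. y \<in> Y \<Longrightarrow> card {u \<in> A i. {u, y} \<in> E} \<le> d"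
    and b: "\<And>i. i < p \<Longrightarrow> card (small_subsets (A i) c) \<le> b"
  shows "card {S. S \<subseteq> between E Y W \<and> (\<exists>j<p. j \<noteq> i \<and> \<not> rich E S Y (A j) c)}
     \<le> p * (2 ^ ((p - 2) * (4 * s) + 4 * d) * (2 ^ 4 * (b * (2 ^ (4 * c) * 15 ^ s))))"
proof -
  have fY: "finite Y" using Y(2) by (metis card.infinite zero_neq_numeral)
  let ?J = "{..<p} - {i}"
  let ?G = "\<lambda>j. {S. S \<subseteq> between E Y W \<and> \<not> rich E S Y (A j) c}"
  have "{S. S \<subseteq> between E Y W \<and> (\<exists>j<p. j \<noteq> i \<and> \<not> rich E S Y (A j) c)} \<subseteq> (\<Union>j\<in>?J. ?G j)" by auto
  then have "card {S. S \<subseteq> between E Y W \<and> (\<exists>j<p. j \<noteq> i \<and> \<not> rich E S Y (A j) c)} \<le> card (\<Union>j\<in>?J. ?G j)"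
    by (rule card_mono[rotated]) (use fin_between in auto)
  also have "\<dots> \<le> (\<Sum>j\<in>?J. card (?G j))" by (rule card_UN_le) simp
  also have "\<dots> \<le> (\<Sum>j\<in>?J. 2 ^ ((p - 2) * (4 * s) + 4 * d) * (2 ^ 4 * (b * (2 ^ (4 * c) * 15 ^ s))))"
  proof (rule sum_mono)
    fix j assume "j \<in> ?J"
    then have j: "j < p" "j \<noteq> i" by auto
    have "card (?G j) \<le> 2 ^ (card (between E Y W) - card (between E Y (A j))) *
       (2 ^ card Y * (b * (2 ^ (card Y * c) * (2 ^ card Y - 1) ^ card (A j))))"
    proof (rule card_not_rich[OF fin_between between_subset _ fin_A[OF j(1)] fY _ _ b[OF j(1)]])
      show "between E Y (A j) \<subseteq> between E Y W" using between_mono[OF A_sub[OF j(1)]] by blast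
      show "Y \<noteq> {}" using Y(2) by auto
      show "Y \<inter> A j = {}" using Y(1) A_sub[OF j(1)] by blast
    qed
    also have "card (between E Y W) - card (between E Y (A j)) = card (between E Y W - between E Y (A j))"
      using between_mono[OF A_sub[OF j(1)], of Y Y E] by (simp add: card_Diff_subset fin_between)
    also have "2 ^ card (between E Y W - between E Y (A j)) \<le> (2::nat) ^ ((p - 2) * (4 * s) + 4 * d)"
    proof (rule power_increasing)
      have sub: "between E Y W - between E Y (A j) \<subseteq> (between E Y W - (between E Y (A i) \<union> between E Y (A j))) \<union> between E Y (A i)" by blast
      have "card (between E Y W - between E Y (A j)) \<le> card ((between E Y W - (between E Y (A i) \<union> between E Y (A j))) \<union> between E Y (A i))"
        by (rule card_mono[OF _ sub]) (use fin_between in auto)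
      also have "\<dots> \<le> card (between E Y W - (between E Y (A i) \<union> between E Y (A j))) + card (between E Y (A i))"
        by (rule card_Un_le)
      also have "card (between E Y W - (between E Y (A i) \<union> between E Y (A j))) \<le> (p - 2) * (4 * s)"
        by (rule card_between_W_minus[where J = "{..<p} - {i, j}"]) (use i j Y fY in \<open>auto simp: between_W card_Diff_subset\<close>)
      also have "card (between E Y (A i)) \<le> 4 * d" by (rule card_between_A_sparse[OF i fY]) (use Y d in auto)
      finally show "card (between E Y W - between E Y (A j)) \<le> (p - 2) * (4 * s) + 4 * d" by simp
    qed simp
    finally show "card (?G j) \<le> 2 ^ ((p - 2) * (4 * s) + 4 * d) * (2 ^ 4 * (b * (2 ^ (4 * c) * 15 ^ s)))"
      using Y(2) card_A[OF j(1)] by simp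
  qed
  also have "\<dots> = card ?J * (2 ^ ((p - 2) * (4 * s) + 4 * d) * (2 ^ 4 * (b * (2 ^ (4 * c) * 15 ^ s))))" by simp
  also have "card ?J \<le> p" using card_Diff1_le[of "{..<p}" i] by simp
  finally show ?thesis by simp
qed

text \<open>Cells partitioning the outside vertices have disjoint sets of edges to \<open>W\<close>,
  so their constraints multiply; the edges inside \<open>W\<close> cost a factor independent of
  \<open>V\<close>.\<close>

lemma card_touch_product:
  assumes \<P>: "\<Union>\<P> = V - W" "finite \<P>" and N: "\<And>Y. Y \<in> \<P> \<Longrightarrow> finite (N Y)"
    and F: "\<And>S Y. S \<in> F \<Longrightarrow> Y \<in> \<P> \<Longrightarrow> S \<inter> between E Y W \<in> N Y" "\<And>S. S \<in> F \<Longrightarrow> S \<subseteq> touch E W"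
  shows "card F \<le> 2 ^ (p * s)\<^sup>2 * (\<Prod>Y\<in>\<P>. card (N Y))"
proof -
  let ?S = "\<Union>Y\<in>\<P>. between E Y W"
  have fF: "finite F"
  proof (rule finite_subset[of _ "Pow E"])
    show "F \<subseteq> Pow E" using F(2) unfolding touch_def by blast
  qed (use fin_E in simp)
  have "card F \<le> card (Pow (edges_on W)) * card ((\<lambda>S. S \<inter> ?S) ` F)"
  proof (rule card_le_split[where ?E1.0 = "edges_on W" and ?E2.0 = ?S])
    fix S assume S: "S \<in> F"
    show "S \<subseteq> edges_on W \<union> ?S"
    proof
      fix e assume "e \<in> S"
      then have e: "e \<in> E" "e \<inter> W \<noteq> {}" using F(2)[OF S] unfolding touch_def by auto
      then obtain u v where uv: "e = {u, v}" "u \<in> V" "v \<in> V" "u \<noteq> v" using E unfolding edges_on_def by blast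
      have sym: "e \<in> edges_on W \<union> ?S" if uv: "e = {u, v}" "u \<in> W" "v \<in> V" "u \<noteq> v" for u v
      proof (cases "v \<in> W")
        case True
        then show ?thesis using that unfolding edges_on_def by blast
      next
        case False
        then obtain Y where Y: "Y \<in> \<P>" "v \<in> Y" using \<P>(1) uv(3) by blast
        have "e = {v, u}" using that(1) by (simp add: insert_commute)
        then have "e \<in> between E Y W" using that(2) Y(2) e(1) unfolding between_def by blast
        then show ?thesis using Y(1) by blast
      qed
      have "u \<in> W \<or> v \<in> W" using e(2) uv(1) by blast
      then show "e \<in> edges_on W \<union> ?S"
      proof
        assume "v \<in> W"
        moreover have "e = {v, u}" using uv(1) by (simp add: insert_commute)
        ultimately show ?thesis using sym[of v u] uv by blast
      qed (use sym uv in blast)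
    qed
  qed (use fF fin_W in auto)
  also have "card ((\<lambda>S. S \<inter> ?S) ` F) \<le> (\<Prod>Y\<in>\<P>. card (N Y))"
  proof (rule card_le_prod[where T = "\<lambda>Y. between E Y W"])
    fix S' Y assume "S' \<in> (\<lambda>S. S \<inter> ?S) ` F" and Y: "Y \<in> \<P>"
    then obtain S where S: "S \<in> F" "S' = S \<inter> ?S" by blast
    have "S' \<inter> between E Y W = S \<inter> between E Y W" using S(2) Y by blast
    then show "S' \<inter> between E Y W \<in> N Y" using F(1)[OF S(1) Y] by simp
  qed (use \<P> N in auto)
  also have "card (Pow (edges_on W)) = 2 ^ card (edges_on W)" using fin_W by (simp add: card_Pow)
  also have "\<dots> \<le> 2 ^ (p * s)\<^sup>2" using card_edges_on_le[OF fin_W] unfolding card_W by (intro power_increasing) auto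
  finally show ?thesis by simp
qed

end

context universal_host
begin

text \<open>Contraposition of \<open>matching_fan\<close> with \<open>i = k\<close>: the centre may
  then lie in any other part, and one exists since \<open>2 \<le> p\<close>.\<close>

lemma ex_not_rich_quad:
  assumes free: "\<not> fan_in E S" and "distinct [x, y, z, w]" "i < p" "{x, y} \<in> E" "{z, w} \<in> E"
  shows "\<exists>j<p. j \<noteq> i \<and> \<not> rich E S {x, y, z, w} (V j) (2*c+4)"
proof (rule ccontr)
  assume "\<not> ?thesis"
  then have r: "\<And>j. j < p \<Longrightarrow> j \<noteq> i \<Longrightarrow> rich E S {x, y, z, w} (V j) (2*c+4)" by blast
  obtain j where j: "j < p" "j \<noteq> i" 
  proof
    show "(if i = 0 then 1 else 0) < p" "(if i = 0 then 1 else 0) \<noteq> i" using p2 by auto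
  qed
  have "rich E S {x, y} (V l) (2*c+4)" "rich E S {z, w} (V l) (2*c+4)" if "l < p" "l \<noteq> i" for l
    using rich_subset[OF r[OF that]] V_finite[OF that(1)] by auto
  then have "fan_in E S" using matching_fan[OF assms(2,3,3) j(1) j(2) j(2) assms(4,5) r[OF j]] by blast
  then show False using free by blast
qed

text \<open>If at most one part failed to be rich, \<open>v\<close> would still have many neighbours
  there, at least half of them in one direction, and \<open>center_fan\<close> would apply. Hence
  the factor 2 in the degree hypothesis.\<close>

lemma ex_two_not_rich:
  assumes free: "\<not> fan_in E S" and v: "\<And>i. i < p \<Longrightarrow> v \<notin> V i"
    and d: "\<And>i. i < p \<Longrightarrow> 2 * (2*c+4) \<le> card {a \<in> V i. {a, v} \<in> E}"
  shows "\<exists>i<p. \<exists>j<p. i \<noteq> j \<and> \<not> rich E S {v} (V i) (2*c+4) \<and> \<not> rich E S {v} (V j) (2*c+4)"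
proof (rule ccontr)
  assume no: "\<not> ?thesis"
  have "\<exists>j. j < p \<and> (\<forall>i<p. i \<noteq> j \<longrightarrow> rich E S {v} (V i) (2*c+4))"
  proof (cases "\<exists>i<p. \<not> rich E S {v} (V i) (2*c+4)")
    case True
    then show ?thesis using no by metis
  next
    case False
    then show ?thesis using p2 by (intro exI[of _ 0]) auto
  qed
  then obtain j where j: "j < p \<and> (\<forall>i<p. i \<noteq> j \<longrightarrow> rich E S {v} (V i) (2*c+4))" by blast
  define Out where "Out = {a \<in> V j. arc E S v a}"
  define In where "In = {a \<in> V j. arc E S a v}"
  have fin: "finite (Out \<union> In)" using V_finite[of j] j unfolding Out_def In_def by simp
  have "{a \<in> V j. {a, v} \<in> E} \<subseteq> Out \<union> In"
  proof
    fix a assume a: "a \<in> {a \<in> V j. {a, v} \<in> E}"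
    then have "a \<noteq> v" using v j by blast
    then show "a \<in> Out \<union> In" using a arc_cases[of a v E S] unfolding Out_def In_def by blast
  qed
  from card_mono[OF fin this] have "card {a \<in> V j. {a, v} \<in> E} \<le> card Out + card In"
    using card_Un_le order.trans by blast
  moreover have "2 * (2*c+4) \<le> card {a \<in> V j. {a, v} \<in> E}" using d j by blast
  ultimately have "2*c+4 \<le> card Out \<or> 2*c+4 \<le> card In" by arith
  then have "2*c+4 \<le> card {a \<in> V j. arc E S v a} \<or> 2*c+4 \<le> card {a \<in> V j. arc E S a v}"
    unfolding Out_def In_def .
  then have "fan_in E S" using center_fan[of j v] j by blast
  then show False using free by blast
qed

end

text \<open>The rate \<open>2 / 25\<close> is a rational number slightly below
  \<open>log 2 (16/15)\<close>; taking 25th powers reduces the comparison to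
  \<open>(15/16) ^ 25 < 1/4\<close>.\<close>

lemma fifteen_sixteenths: "(15 / 16 :: real) ^ k \<le> 2 powr (- (2 / 25) * real k)"
proof -
  have e: "(2 powr (- (2 / 25)) :: real) ^ 25 = 1 / 4"
  proof -
    have "(2 powr (- (2 / 25)) :: real) ^ 25 = 2 powr (real 25 * (- (2 / 25)))" by (simp add: powr_power)
    also have "\<dots> = 2 powr (- 2)" by simp
    also have "\<dots> = 1 / 4" by (simp add: powr_minus)
    finally show ?thesis .
  qed
  have "(15 / 16 :: real) \<le> 2 powr (- (2 / 25))"
  proof (rule ccontr)
    assume "\<not> ?thesis"
    then have "(2 powr (- (2 / 25)) :: real) ^ 25 \<le> (15 / 16) ^ 25" by (intro power_mono) auto
    moreover have "(15 / 16 :: real) ^ 25 < 1 / 4" by (simp add: power_divide)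
    ultimately show False using e by linarith
  qed
  then have "(15 / 16 :: real) ^ k \<le> (2 powr (- (2 / 25))) ^ k" by (intro power_mono) auto
  also have "\<dots> = 2 powr (- (2 / 25) * real k)" by (simp add: powr_realpow[symmetric] powr_powr)
  finally show ?thesis .
qed

lemma real_le_two_powr: "real k \<le> 2 powr real k"
  by (simp add: powr_realpow less_imp_le)

section \<open>Savings in binary digits for outside vertices and quadruples\<close>

context blown_up
begin

text \<open>The true saving over the baseline \<open>(p - 1) * s + 2 * c\<close> is nearly a whole
  part \<open>s\<close>; it is stated as \<open>s / 25\<close> to agree with the saving for
  quadruples.\<close>

lemma card_dense_vertex_powr:
  assumes v: "v \<notin> W" and b: "\<And>i. i < p \<Longrightarrow> card (small_subsets (A i) c) \<le> b" "real b \<le> 2 powr (real s / 100)"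
    and s: "100 * (real p + 5) \<le> real s"
  shows "real (card {S. S \<subseteq> between E {v} W \<and> (\<exists>i<p. \<exists>j<p. i \<noteq> j \<and> \<not> rich E S {v} (A i) c \<and> \<not> rich E S {v} (A j) c)})
     \<le> 2 powr ((real p - 1) * real s + 2 * real c - real s / 25)"
proof -
  have "real (card {S. S \<subseteq> between E {v} W \<and> (\<exists>i<p. \<exists>j<p. i \<noteq> j \<and> \<not> rich E S {v} (A i) c \<and> \<not> rich E S {v} (A j) c)})
     \<le> real (p\<^sup>2 * (2 ^ ((p - 2) * s) * (2 * (b * 2 ^ c))\<^sup>2))"
    by (intro of_nat_mono card_dense_vertex v b)
  also have "\<dots> = real p * real p * (2 ^ ((p - 2) * s) * ((2 * (real b * 2 ^ c)) * (2 * (real b * 2 ^ c))))"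
    by (simp add: power2_eq_square)
  also have "\<dots> \<le> 2 powr real p * 2 powr real p * (2 powr ((real p - 2) * real s) *
     ((2 powr 1 * (2 powr (real s / 100) * 2 powr real c)) * (2 powr 1 * (2 powr (real s / 100) * 2 powr real c))))"
  proof -
    have "(2::real) ^ ((p - 2) * s) = 2 powr ((real p - 2) * real s)" "(2::real) ^ c = 2 powr real c"
      using p2 by (simp_all add: powr_realpow[symmetric] of_nat_diff)
    then show ?thesis using b(2) by (intro mult_mono real_le_two_powr) auto
  qed
  also have "\<dots> = 2 powr (real p + real p + ((real p - 2) * real s + ((1 + (real s / 100 + real c)) + (1 + (real s / 100 + real c)))))"
    by (simp only: powr_add[symmetric])
  also have "\<dots> \<le> 2 powr ((real p - 1) * real s + 2 * real c - real s / 25)"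
    by (rule powr_mono) (use s in \<open>auto simp: algebra_simps\<close>)
  finally show ?thesis .
qed

text \<open>Half of the gain \<open>2 / 25 * s\<close> survives: \<open>s / 100\<close> pays for
  \<open>b\<close>, \<open>4 * c \<le> s / 50\<close> for the witnesses, and
  \<open>p + 4 \<le> s / 100\<close> for the choice of the part and of the pattern.\<close>

lemma card_quad_powr:
  assumes Y: "Y \<subseteq> V - W" "card Y = 4" and i: "i < p" and d: "\<And>y. y \<in> Y \<Longrightarrow> card {u \<in> A i. {u, y} \<in> E} \<le> 2 * c"
    and b: "\<And>i. i < p \<Longrightarrow> card (small_subsets (A i) c) \<le> b" "real b \<le> 2 powr (real s / 100)"
    and s: "100 * (real p + 5) \<le> real s" "200 * real c \<le> real s"
  shows "real (card {S. S \<subseteq> between E Y W \<and> (\<exists>j<p. j \<noteq> i \<and> \<not> rich E S Y (A j) c)})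
     \<le> 2 powr (4 * ((real p - 1) * real s + 2 * real c) - real s / 25)"
proof -
  have "real (card {S. S \<subseteq> between E Y W \<and> (\<exists>j<p. j \<noteq> i \<and> \<not> rich E S Y (A j) c)})
     \<le> real (p * (2 ^ ((p - 2) * (4 * s) + 4 * (2 * c)) * (2 ^ 4 * (b * (2 ^ (4 * c) * 15 ^ s)))))"
    by (intro of_nat_mono card_quad Y i d b)
  also have "\<dots> = real p * (2 ^ ((p - 2) * (4 * s) + 4 * (2 * c)) * (2 ^ 4 * (real b * (2 ^ (4 * c) * 15 ^ s))))" by simp
  also have "\<dots> \<le> 2 powr real p * (2 powr ((real p - 2) * (4 * real s) + 8 * real c) * (2 powr 4 *
     (2 powr (real s / 100) * (2 powr (4 * real c) * 2 powr (4 * real s - 2 / 25 * real s)))))"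
  proof -
    have "real ((p - 2) * (4 * s) + 4 * (2 * c)) = (real p - 2) * (4 * real s) + 8 * real c" using p2 by (simp add: of_nat_diff)
    then have 1: "(2::real) ^ ((p - 2) * (4 * s) + 4 * (2 * c)) = 2 powr ((real p - 2) * (4 * real s) + 8 * real c)"
      by (metis powr_realpow zero_less_numeral)
    have 2: "(2::real) ^ (4 * c) = 2 powr (4 * real c)" by (simp add: powr_realpow[symmetric])
    have "(15::real) ^ s = 16 ^ s * (15 / 16) ^ s" by (simp add: power_mult_distrib[symmetric])
    also have "\<dots> \<le> 16 ^ s * 2 powr (- (2 / 25) * real s)" by (intro mult_left_mono fifteen_sixteenths) auto
    also have "(16::real) ^ s = 2 powr (4 * real s)"
    proof -
      have "(16::real) ^ s = (2 ^ 4) ^ s" by simp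
      also have "\<dots> = 2 ^ (4 * s)" by (rule power_mult[symmetric])
      also have "\<dots> = 2 powr (4 * real s)" by (simp add: powr_realpow[symmetric])
      finally show ?thesis .
    qed
    also have "2 powr (4 * real s) * 2 powr (- (2 / 25) * real s) = 2 powr (4 * real s - 2 / 25 * real s)"
      by (simp add: powr_add[symmetric])
    finally have 3: "(15::real) ^ s \<le> 2 powr (4 * real s - 2 / 25 * real s)" .
    have 4: "(2::real) ^ 4 \<le> 2 powr 4" by simp
    show ?thesis unfolding 1 2 by (intro mult_mono real_le_two_powr order.refl 3 4 b(2)) auto
  qed
  also have "\<dots> = 2 powr (real p + ((real p - 2) * (4 * real s) + 8 * real c + (4 + (real s / 100 + (4 * real c + (4 * real s - 2 / 25 * real s))))))"
    by (simp only: powr_add[symmetric])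
  also have "\<dots> \<le> 2 powr (4 * ((real p - 1) * real s + 2 * real c) - real s / 25)"
    by (rule powr_mono) (use s in \<open>auto simp: algebra_simps\<close>)
  finally show ?thesis .
qed

lemma card_sparse_vertex_powr:
  assumes i: "i < p" and d: "card {u \<in> A i. {u, v} \<in> E} \<le> 2 * c"
  shows "real (card (Pow (between E {v} W))) \<le> 2 powr ((real p - 1) * real s + 2 * real c)"
proof -
  have "real (card (between E {v} W)) \<le> (real p - 1) * real s + 2 * real c"
  proof -
    have "real (card (between E {v} W)) \<le> real ((p - 1) * s + 2 * c)" by (rule of_nat_mono[OF card_sparse_vertex[OF i d]])
    then show ?thesis using p2 by (simp add: of_nat_diff)
  qed
  then have "2 powr real (card (between E {v} W)) \<le> 2 powr ((real p - 1) * real s + 2 * real c)" by (rule powr_mono) simp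
  then show ?thesis using fin_between by (simp add: card_Pow powr_realpow)
qed

end

context anti_fan
begin

text \<open>The cells are the quadruples in \<open>\<Q>\<close> and the remaining single vertices.
  Every outside vertex carries the baseline exponent, and every vertex of \<open>B\<close> and every
  quadruple saves \<open>s / 25\<close>, because in a fan-free universal orientation dense vertices
  and quadruples fail to be rich.\<close>

lemma card_universal_extensions:
  assumes bl: "blown_up p s E V L" and b: "\<And>i. i < p \<Longrightarrow> card (small_subsets (L i) (2*c+4)) \<le> b" "real b \<le> 2 powr (real s / 100)"
    and s: "100 * (real p + 5) \<le> real s" "200 * real (2*c+4) \<le> real s"
    and W: "W = (\<Union>i<p. L i)"
    and B: "B \<subseteq> V - W" "\<And>v i. v \<in> B \<Longrightarrow> i < p \<Longrightarrow> 2 * (2*c+4) \<le> card {u \<in> L i. {u, v} \<in> E}"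
    and rest: "\<And>v. v \<in> V - W - B \<Longrightarrow> \<exists>i<p. card {u \<in> L i. {u, v} \<in> E} \<le> 2 * (2*c+4)"
    and Qsub: "\<And>Y. Y \<in> \<Q> \<Longrightarrow> Y \<subseteq> V - W - B"
    and Qdis: "\<And>Y Z. Y \<in> \<Q> \<Longrightarrow> Z \<in> \<Q> \<Longrightarrow> Y \<noteq> Z \<Longrightarrow> Y \<inter> Z = {}"
    and Q: "\<And>Y. Y \<in> \<Q> \<Longrightarrow> \<exists>x y z w i. Y = {x, y, z, w} \<and> distinct [x, y, z, w] \<and> i < p \<and> {x, y} \<in> E \<and> {z, w} \<in> E \<and>
       (\<forall>y\<in>Y. card {u \<in> L i. {u, y} \<in> E} \<le> 2 * (2*c+4))"
  shows "real (card {S \<in> FF E. universal p c E S L}) \<le> real (card (FF (del E W))) *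
    2 powr (real ((p * s)\<^sup>2) + ((real p - 1) * real s + 2 * real (2*c+4)) * (real (card V) - real (p * s))
       - real s / 25 * (real (card B) + real (card \<Q>)))"
proof -
  interpret bl: blown_up p s E V L by (rule bl)
  define c2 where "c2 = 2*c+4"
  define \<alpha> where "\<alpha> = (real p - 1) * real s + 2 * real c2"
  have Wb: "bl.W = W" unfolding bl.W_def W ..
  note fW = bl.fin_W[unfolded Wb] and WV = bl.W_sub[unfolded Wb] and cW = bl.card_W[unfolded Wb]
  have fV: "finite V" by (rule bl.fV)
  have fQ: "finite \<Q>"
  proof (rule finite_subset[of _ "Pow V"])
    show "\<Q> \<subseteq> Pow V" using Qsub by blast
  qed (use fV in simp)
  have "\<exists>iq. \<forall>Y\<in>\<Q>. iq Y < p \<and> (\<forall>y\<in>Y. card {u \<in> L (iq Y). {u, y} \<in> E} \<le> 2 * c2) \<and>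
      (\<exists>x y z w. Y = {x, y, z, w} \<and> distinct [x, y, z, w] \<and> {x, y} \<in> E \<and> {z, w} \<in> E)"
  proof (rule bchoice, rule ballI)
    fix Y assume "Y \<in> \<Q>"
    from Q[OF this] show "\<exists>i. i < p \<and> (\<forall>y\<in>Y. card {u \<in> L i. {u, y} \<in> E} \<le> 2 * c2) \<and>
      (\<exists>x y z w. Y = {x, y, z, w} \<and> distinct [x, y, z, w] \<and> {x, y} \<in> E \<and> {z, w} \<in> E)" unfolding c2_def by blast
  qed
  then obtain iq where iq0: "\<forall>Y\<in>\<Q>. iq Y < p \<and> (\<forall>y\<in>Y. card {u \<in> L (iq Y). {u, y} \<in> E} \<le> 2 * c2) \<and>
      (\<exists>x y z w. Y = {x, y, z, w} \<and> distinct [x, y, z, w] \<and> {x, y} \<in> E \<and> {z, w} \<in> E)" by (rule exE)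
  have iq: "iq Y < p" "\<And>y. y \<in> Y \<Longrightarrow> card {u \<in> L (iq Y). {u, y} \<in> E} \<le> 2 * c2"
    "\<exists>x y z w. Y = {x, y, z, w} \<and> distinct [x, y, z, w] \<and> {x, y} \<in> E \<and> {z, w} \<in> E" if "Y \<in> \<Q>" for Y
    using bspec[OF iq0 that] by simp_all
  have Q4: "card Y = 4" if Y: "Y \<in> \<Q>" for Y
  proof -
    obtain x y z w where "Y = {x, y, z, w}" "distinct [x, y, z, w]" using iq(3)[OF Y] by blast
    then show ?thesis by simp
  qed
  define two where "two = (\<lambda>Y T. \<exists>i<p. \<exists>j<p. i \<noteq> j \<and> \<not> rich E T Y (L i) c2 \<and> \<not> rich E T Y (L j) c2)"
  define one where "one = (\<lambda>Y T. \<exists>j<p. j \<noteq> iq Y \<and> \<not> rich E T Y (L j) c2)"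
  define P' where "P' = (\<lambda>T. (\<forall>v\<in>B. two {v} T) \<and> (\<forall>Y\<in>\<Q>. one Y T))"
  have res: "rich E (S \<inter> T) Y (L i) c2 \<longleftrightarrow> rich E S Y (L i) c2" if "between E Y W \<subseteq> T" "i < p" for S T Y i
    by (rule rich_restrict) (use that between_mono[OF bl.A_sub[OF that(2)], of Y Y E] in \<open>auto simp: Wb\<close>)
  have two_res: "two Y (S \<inter> T) \<longleftrightarrow> two Y S" and one_res: "one Y (S \<inter> T) \<longleftrightarrow> one Y S"
    if "between E Y W \<subseteq> T" for S T Y
    unfolding two_def one_def by (simp_all add: res[OF that] cong: conj_cong)
  have bt: "between E Y W \<subseteq> touch E W" for Y unfolding between_def touch_def by auto
  have "card {S \<in> FF E. universal p c E S L} \<le> card (FF (del E W)) * card {T. T \<subseteq> touch E W \<and> P' T}"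
  proof (rule card_FF_split[OF bl.fin_E])
    fix S assume S: "S \<in> FF E" "universal p c E S L"
    have free: "\<not> fan_in E S" using S(1) unfolding FF_def by blast
    interpret h: universal_host p A c E S L
    proof
      show "universal p c E S L" by (rule S(2))
      show "finite (L i)" if "i < p" for i by (rule bl.fin_A[OF that])
      show "2 * c \<le> card (L i)" if "i < p" for i using bl.card_A[OF that] s(2) by simp
      show "L i \<inter> L j = {}" if "i < p" "j < p" "i \<noteq> j" for i j by (rule bl.A_disj[OF that])
    qed
    have "two {v} S" if v: "v \<in> B" for v
      unfolding two_def c2_def
    proof (rule h.ex_two_not_rich[OF free])
      show "v \<notin> L i" if "i < p" for i using v B(1) that W by blast
      show "2 * (2*c+4) \<le> card {a \<in> L i. {a, v} \<in> E}" if "i < p" for i by (rule B(2)[OF v that])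
    qed
    moreover have "one Y S" if Y: "Y \<in> \<Q>" for Y
    proof -
      obtain x y z w where xy: "Y = {x, y, z, w}" "distinct [x, y, z, w]" "{x, y} \<in> E" "{z, w} \<in> E" using iq(3)[OF Y] by blast
      show ?thesis unfolding one_def c2_def xy(1)
        by (rule h.ex_not_rich_quad[OF free xy(2) iq(1)[OF Y, unfolded xy(1)] xy(3,4)])
    qed
    ultimately show "P' (S \<inter> touch E W)" unfolding P'_def two_res[OF bt] one_res[OF bt] by blast
  qed
  from of_nat_mono[OF this, where ?'a = real]
  have 1: "real (card {S \<in> FF E. universal p c E S L}) \<le> real (card (FF (del E W))) * real (card {T. T \<subseteq> touch E W \<and> P' T})"
    unfolding of_nat_mult .
  define R where "R = V - W - \<Union>\<Q>"
  define \<P> where "\<P> = \<Q> \<union> (\<lambda>v. {v}) ` R"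
  define N where "N = (\<lambda>Y. if Y \<in> \<Q> then {T. T \<subseteq> between E Y W \<and> one Y T}
      else if Y \<subseteq> B then {T. T \<subseteq> between E Y W \<and> two Y T} else Pow (between E Y W))"
  define sp where "sp = (\<lambda>Y. Y \<in> \<Q> \<or> Y \<subseteq> B)"
  have fP: "finite \<P>" unfolding \<P>_def R_def using fQ fV by simp
  have PV: "\<Union>\<P> = V - W" unfolding \<P>_def R_def using Qsub by blast
  have fN: "finite (N Y)" for Y unfolding N_def using bl.fin_between[of Y W] by simp
  have "card {T. T \<subseteq> touch E W \<and> P' T} \<le> 2 ^ (p * s)\<^sup>2 * (\<Prod>Y\<in>\<P>. card (N Y))"
  proof (rule bl.card_touch_product[unfolded Wb, OF PV fP fN])
    fix S Y assume S: "S \<in> {T. T \<subseteq> touch E W \<and> P' T}" and Y: "Y \<in> \<P>"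
    show "S \<inter> between E Y W \<in> N Y"
    proof (cases "Y \<in> \<Q>")
      case True
      then have "one Y S" using S unfolding P'_def by blast
      then have "one Y (S \<inter> between E Y W)" unfolding one_res[OF order.refl] .
      then show ?thesis using True unfolding N_def by simp
    next
      case False
      then obtain v where v: "Y = {v}" using Y unfolding \<P>_def by blast
      show ?thesis
      proof (cases "Y \<subseteq> B")
        case True
        then have "two Y S" using S v unfolding P'_def by blast
        then have "two Y (S \<inter> between E Y W)" unfolding two_res[OF order.refl] .
        then show ?thesis using True False unfolding N_def by simp
      qed (use False in \<open>simp add: N_def\<close>)
    qed
  qed auto
  then have "real (card {T. T \<subseteq> touch E W \<and> P' T}) \<le> real (2 ^ (p * s)\<^sup>2 * (\<Prod>Y\<in>\<P>. card (N Y)))" by (rule of_nat_mono)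
  also have "\<dots> = 2 powr real ((p * s)\<^sup>2) * (\<Prod>Y\<in>\<P>. real (card (N Y)))"
    by (simp add: powr_realpow[symmetric])
  also have "(\<Prod>Y\<in>\<P>. real (card (N Y))) \<le> (\<Prod>Y\<in>\<P>. 2 powr (\<alpha> * real (card Y) - real s / 25 * (if sp Y then 1 else 0)))"
  proof (rule prod_mono, rule conjI, simp)
    fix Y assume Y: "Y \<in> \<P>"
    show "real (card (N Y)) \<le> 2 powr (\<alpha> * real (card Y) - real s / 25 * (if sp Y then 1 else 0))"
    proof (cases "Y \<in> \<Q>")
      case True
      have "real (card {T. T \<subseteq> between E Y bl.W \<and> (\<exists>j<p. j \<noteq> iq Y \<and> \<not> rich E T Y (L j) c2)})
        \<le> 2 powr (4 * ((real p - 1) * real s + 2 * real c2) - real s / 25)"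
      proof (rule bl.card_quad_powr[OF _ Q4[OF True] iq(1)[OF True] iq(2)[OF True] b[folded c2_def] s[folded c2_def]])
        show "Y \<subseteq> V - bl.W" unfolding Wb using Qsub[OF True] by blast
      qed
      then show ?thesis using True Q4[OF True] unfolding N_def one_def \<alpha>_def Wb sp_def by (simp add: mult.commute)
    next
      case False
      then obtain v where v: "Y = {v}" "v \<in> R" using Y unfolding \<P>_def by blast
      show ?thesis
      proof (cases "v \<in> B")
        case True
        have "real (card {S. S \<subseteq> between E {v} bl.W \<and> (\<exists>i<p. \<exists>j<p. i \<noteq> j \<and> \<not> rich E S {v} (L i) c2 \<and> \<not> rich E S {v} (L j) c2)})
           \<le> 2 powr ((real p - 1) * real s + 2 * real c2 - real s / 25)"
          by (rule bl.card_dense_vertex_powr[OF _ b[folded c2_def] s(1)]) (use True B(1) Wb in auto)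
        then show ?thesis using True False v unfolding N_def two_def \<alpha>_def Wb sp_def by simp
      next
        case nB: False
        have "v \<in> V - W - B" using v(2) nB unfolding R_def by blast
        then obtain i where i: "i < p" "card {u \<in> L i. {u, v} \<in> E} \<le> 2 * c2" using rest unfolding c2_def by blast
        have "real (card (Pow (between E {v} bl.W))) \<le> 2 powr ((real p - 1) * real s + 2 * real c2)"
          by (rule bl.card_sparse_vertex_powr[OF i])
        then show ?thesis using nB False v unfolding N_def \<alpha>_def Wb sp_def by simp
      qed
    qed
  qed
  also have "(\<Prod>Y\<in>\<P>. 2 powr (\<alpha> * real (card Y) - real s / 25 * (if sp Y then 1 else 0))) =
      2 powr (\<Sum>Y\<in>\<P>. \<alpha> * real (card Y) - real s / 25 * (if sp Y then 1 else 0))"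
    by (rule powr_sum[symmetric]) (use fP in auto)
  also have "(\<Sum>Y\<in>\<P>. \<alpha> * real (card Y) - real s / 25 * (if sp Y then 1 else 0)) =
      \<alpha> * real (\<Sum>Y\<in>\<P>. card Y) - real s / 25 * real (card {Y \<in> \<P>. sp Y})"
  proof -
    have "(\<Sum>Y\<in>\<P>. (if sp Y then 1 else 0::real)) = real (card {Y \<in> \<P>. sp Y})"
      using sum.inter_filter[OF fP, of "\<lambda>_. 1::real" sp] by simp
    then show ?thesis unfolding sum_subtractf sum_distrib_left[symmetric] of_nat_sum by simp
  qed
  also have "(\<Sum>Y\<in>\<P>. card Y) = card (\<Union>\<P>)"
  proof (rule card_Union_disjoint[symmetric])
    show "pairwise disjnt \<P>"
    proof (rule pairwiseI, unfold disjnt_def)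
      fix Y Z assume YZ: "Y \<in> \<P>" "Z \<in> \<P>" "Y \<noteq> Z"
      then consider "Y \<in> \<Q>" "Z \<in> \<Q>" | v where "Y = {v}" "v \<in> R" "Z \<in> \<Q>" | v where "Z = {v}" "v \<in> R" "Y \<in> \<Q>"
        | v w where "Y = {v}" "Z = {w}" unfolding \<P>_def by blast
      then show "Y \<inter> Z = {}"
      proof cases
        case 1 then show ?thesis using Qdis YZ(3) by blast
      next
        case 2 then show ?thesis unfolding R_def by blast
      next
        case 3 then show ?thesis unfolding R_def by blast
      next
        case 4 then show ?thesis using YZ(3) by blast
      qed
    qed
    show "finite Y" if "Y \<in> \<P>" for Y using that PV fV by (metis Sup_upper finite_Diff finite_subset)
  qed
  also have "card (\<Union>\<P>) = card V - p * s" unfolding PV using card_Diff_subset[OF fW WV] cW by simp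
  also have "2 powr (\<alpha> * real (card V - p * s) - real s / 25 * real (card {Y \<in> \<P>. sp Y})) \<le>
     2 powr (\<alpha> * (real (card V) - real (p * s)) - real s / 25 * (real (card B) + real (card \<Q>)))"
  proof (rule powr_mono)
    have le: "p * s \<le> card V" using card_mono[OF fV WV] cW by simp
    have "card B = card ((\<lambda>v. {v}) ` B)" by (rule card_image[symmetric]) (simp add: inj_on_def)
    moreover have "(\<lambda>v. {v}) ` B \<inter> \<Q> = {}" using Q4 by fastforce
    moreover have "finite B" using B(1) fV finite_subset by blast
    ultimately have "card B + card \<Q> = card ((\<lambda>v. {v}) ` B \<union> \<Q>)"
      using card_Un_disjoint[of "(\<lambda>v. {v}) ` B" \<Q>] fQ by simp
    also have "\<dots> \<le> card {Y \<in> \<P>. sp Y}"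
    proof (rule card_mono)
      show "(\<lambda>v. {v}) ` B \<union> \<Q> \<subseteq> {Y \<in> \<P>. sp Y}"
        unfolding \<P>_def R_def sp_def using B(1) Qsub by blast
    qed (use fP in simp)
    finally have "real s / 25 * (real (card B) + real (card \<Q>)) \<le> real s / 25 * real (card {Y \<in> \<P>. sp Y})"
      by (intro mult_left_mono) auto
    then show "\<alpha> * real (card V - p * s) - real s / 25 * real (card {Y \<in> \<P>. sp Y}) \<le>
      \<alpha> * (real (card V) - real (p * s)) - real s / 25 * (real (card B) + real (card \<Q>))" using le by (simp add: of_nat_diff)
  qed simp
  finally have 2: "real (card {T. T \<subseteq> touch E W \<and> P' T}) \<le> 2 powr real ((p * s)\<^sup>2) *
     2 powr (\<alpha> * (real (card V) - real (p * s)) - real s / 25 * (real (card B) + real (card \<Q>)))" by simp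
  have "real (card {S \<in> FF E. universal p c E S L}) \<le> real (card (FF (del E W))) * (2 powr real ((p * s)\<^sup>2) *
     2 powr (\<alpha> * (real (card V) - real (p * s)) - real s / 25 * (real (card B) + real (card \<Q>))))"
    by (rule order.trans[OF 1 mult_left_mono[OF 2]]) simp
  also have "2 powr real ((p * s)\<^sup>2) * 2 powr (\<alpha> * (real (card V) - real (p * s)) - real s / 25 * (real (card B) + real (card \<Q>))) =
     2 powr (real ((p * s)\<^sup>2) + ((real p - 1) * real s + 2 * real (2*c+4)) * (real (card V) - real (p * s))
       - real s / 25 * (real (card B) + real (card \<Q>)))"
    unfolding \<alpha>_def c2_def by (simp only: powr_add[symmetric] add_diff_eq)
  finally show ?thesis .
qed

end

text \<open>Take a maximal disjoint family of such quadruples. Among the remaining vertices no class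
  contains two disjoint edges, so removing both ends of one edge per class makes every class
  independent.\<close>

lemma ex_disjoint_quads:
  fixes cl :: "nat \<Rightarrow> nat"
  assumes fR: "finite R" and loop: "\<And>u. {u, u} \<notin> E"
  obtains \<Q> L where "\<forall>Y\<in>\<Q>. Y \<subseteq> R \<and> (\<exists>x y z w i. Y = {x, y, z, w} \<and> distinct [x, y, z, w] \<and> i < p \<and>
       {x, y} \<in> E \<and> {z, w} \<in> E \<and> (\<forall>y\<in>Y. cl y = i))"
     "\<forall>Y\<in>\<Q>. \<forall>Z\<in>\<Q>. Y \<noteq> Z \<longrightarrow> Y \<inter> Z = {}" "finite L" "card L \<le> 2 * p" "L \<subseteq> R"
     "\<forall>u\<in>R - \<Union>\<Q> - L. \<forall>v\<in>R - \<Union>\<Q> - L. {u, v} \<in> E \<longrightarrow> cl u < p \<longrightarrow> cl u \<noteq> cl v"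
proof -
  define good where "good = (\<lambda>Y. \<exists>x y z w i. Y = {x, y, z, w} \<and> distinct [x, y, z, w] \<and> i < p \<and>
       {x, y} \<in> E \<and> {z, w} \<in> E \<and> (\<forall>y\<in>Y. cl y = i))"
  have ne: "Y \<noteq> {}" if "good Y" for Y using that unfolding good_def by blast
  define XX where "XX = {Y \<in> Pow R. good Y}"
  have fX: "finite XX" using fR unfolding XX_def by simp
  have "\<exists>\<Q>\<subseteq>XX. (\<forall>X\<in>\<Q>. \<forall>Y\<in>\<Q>. X \<noteq> Y \<longrightarrow> X \<inter> Y = {}) \<and> (\<forall>X\<in>XX. \<exists>Y\<in>\<Q>. X \<inter> Y \<noteq> {})"
    by (rule ex_maximal_disjoint_subfamily[OF fX]) (simp add: XX_def ne)
  then obtain \<Q> where Q: "\<Q> \<subseteq> XX" "\<forall>X\<in>\<Q>. \<forall>Y\<in>\<Q>. X \<noteq> Y \<longrightarrow> X \<inter> Y = {}"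
    "\<forall>X\<in>XX. \<exists>Y\<in>\<Q>. X \<inter> Y \<noteq> {}" by (elim exE conjE)
  define R' where "R' = R - \<Union>\<Q>"
  have "\<exists>M. M \<subseteq> R' \<and> finite M \<and> card M \<le> 2 \<and> (\<forall>u\<in>R' - M. \<forall>v\<in>R' - M. {u, v} \<in> E \<longrightarrow> \<not> (cl u = i \<and> cl v = i))"
    if i: "i < p" for i
  proof (cases "\<exists>x\<in>R'. \<exists>y\<in>R'. {x, y} \<in> E \<and> cl x = i \<and> cl y = i")
    case False
    have "\<forall>u\<in>R' - {}. \<forall>v\<in>R' - {}. {u, v} \<in> E \<longrightarrow> \<not> (cl u = i \<and> cl v = i)"
    proof (intro ballI impI notI)
      fix u v assume uv: "u \<in> R' - {}" "v \<in> R' - {}" "{u, v} \<in> E" "cl u = i \<and> cl v = i"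
      have "\<exists>x\<in>R'. \<exists>y\<in>R'. {x, y} \<in> E \<and> cl x = i \<and> cl y = i"
        by (rule bexI[of _ u], rule bexI[of _ v]) (use uv in simp_all)
      then show False by (rule notE[OF False])
    qed
    then show ?thesis by (intro exI[of _ "{}"] conjI) simp_all
  next
    case True
    then obtain x y where xy: "x \<in> R'" "y \<in> R'" "{x, y} \<in> E" "cl x = i" "cl y = i" by blast
    have "\<not> ({u, v} \<in> E \<and> cl u = i \<and> cl v = i)" if uv: "u \<in> R' - {x, y}" "v \<in> R' - {x, y}" for u v
    proof
      assume a: "{u, v} \<in> E \<and> cl u = i \<and> cl v = i"
      have d: "distinct [x, y, u, v]" using uv loop[of x] loop[of u] xy(3) a by auto
      have ci: "\<forall>y\<in>{x, y, u, v}. cl y = i" using xy a by simp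
      have "good {x, y, u, v}" unfolding good_def
        by (intro exI conjI, rule refl, rule d, rule i, rule xy(3), rule conjunct1[OF a], rule ci)
      moreover have "{x, y, u, v} \<subseteq> R'" using xy uv by blast
      ultimately have "{x, y, u, v} \<in> XX" unfolding XX_def R'_def by blast
      then have "\<exists>Y\<in>\<Q>. {x, y, u, v} \<inter> Y \<noteq> {}" by (rule bspec[OF Q(3)])
      then show False using \<open>{x, y, u, v} \<subseteq> R'\<close> unfolding R'_def by blast
    qed
    then have "\<forall>u\<in>R' - {x, y}. \<forall>v\<in>R' - {x, y}. {u, v} \<in> E \<longrightarrow> \<not> (cl u = i \<and> cl v = i)" by blast
    moreover have "{x, y} \<subseteq> R'" "finite {x, y}" "card {x, y} \<le> 2" using xy(1,2) by (simp_all add: card_insert_if)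
    ultimately show ?thesis by (intro exI[of _ "{x, y}"] conjI)
  qed
  then have "\<forall>i\<in>{..<p}. \<exists>M. M \<subseteq> R' \<and> finite M \<and> card M \<le> 2 \<and> (\<forall>u\<in>R' - M. \<forall>v\<in>R' - M. {u, v} \<in> E \<longrightarrow> \<not> (cl u = i \<and> cl v = i))"
    by simp
  from bchoice[OF this] obtain M where M0: "\<forall>i\<in>{..<p}. M i \<subseteq> R' \<and> finite (M i) \<and> card (M i) \<le> 2 \<and>
     (\<forall>u\<in>R' - M i. \<forall>v\<in>R' - M i. {u, v} \<in> E \<longrightarrow> \<not> (cl u = i \<and> cl v = i))" by (rule exE)
  have M: "M i \<subseteq> R'" "finite (M i)" "card (M i) \<le> 2"
    "\<forall>u\<in>R' - M i. \<forall>v\<in>R' - M i. {u, v} \<in> E \<longrightarrow> \<not> (cl u = i \<and> cl v = i)" if "i < p" for i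
    using M0 that by simp_all
  define L where "L = (\<Union>i<p. M i)"
  have "card L \<le> (\<Sum>i<p. card (M i))" unfolding L_def by (rule card_UN_le) simp
  also have "\<dots> \<le> (\<Sum>i<p. 2)" by (rule sum_mono) (use M(3) in simp)
  finally have L2: "card L \<le> 2 * p" by simp
  have Lf: "finite L" unfolding L_def using M(2) by simp
  have LR: "L \<subseteq> R" using M(1) unfolding L_def R'_def by blast
  have sep: "\<forall>u\<in>R - \<Union>\<Q> - L. \<forall>v\<in>R - \<Union>\<Q> - L. {u, v} \<in> E \<longrightarrow> cl u < p \<longrightarrow> cl u \<noteq> cl v"
  proof (intro ballI impI)
    fix u v assume u: "u \<in> R - \<Union>\<Q> - L" "v \<in> R - \<Union>\<Q> - L" "{u, v} \<in> E" "cl u < p"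
    have "u \<in> R' - M (cl u)" "v \<in> R' - M (cl u)" using u unfolding R'_def L_def by blast+
    then have "\<not> (cl u = cl u \<and> cl v = cl u)" using M(4)[OF u(4)] u(3) by blast
    then show "cl u \<noteq> cl v" by simp
  qed
  have "\<forall>Y\<in>\<Q>. Y \<subseteq> R \<and> good Y" using Q(1) unfolding XX_def by blast
  from that[OF this[unfolded good_def] Q(2) Lf L2 LR sep] show ?thesis .
qed

section \<open>Critical graphs are nearly multipartite\<close>

context anti_fan
begin

text \<open>With \<open>h\<close> deleted vertices the exponent is a lower bound for the number of
  edges that the Turan graph loses. If a deletion violates the condition, the ratio of the number of
  orientations to the expected one more than doubles, which is the measure of progress of the
  induction.\<close>

definition crit :: "nat \<Rightarrow> nat set \<Rightarrow> nat set set \<Rightarrow> bool" where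
  "crit C V E \<longleftrightarrow> (\<forall>X\<subseteq>V. X \<noteq> {} \<longrightarrow> card X \<le> C \<longrightarrow>
     real (card (FF (del E X))) \<le> 2 * real (card (FF E)) *
       2 powr (- (2 * turan_density p * (real (card X) * (real (card V) - real (card X))))))"

lemma crit_mono: "crit C V E \<Longrightarrow> C' \<le> C \<Longrightarrow> crit C' V E"
  unfolding crit_def by (meson order.trans)

lemma two_turan_density: "2 * turan_density p * (real p * x) = (real p - 1) * x"
  unfolding turan_density_def using p2 by (simp add: field_simps)

text \<open>Two estimates are compared for the deletion of a blow-up \<open>W\<close>. By
  criticality the count drops by the factor of the Turan graph; extending back over \<open>W\<close>
  regains at most the baseline minus \<open>s / 25\<close> for each dense vertex and each quadruple.
  The difference consists of linear terms with coefficients small against \<open>s\<close>, so few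
  such vertices and quadruples can exist.\<close>

lemma nearly_multipartite:
  assumes \<epsilon>: "\<epsilon> > 0"
  shows "\<exists>C n0. \<forall>V E. finite V \<longrightarrow> n0 \<le> card V \<longrightarrow> E \<subseteq> edges_on V \<longrightarrow>
     2 powr (turan_density p * (real (card V) * (real (card V) - 1))) \<le> real (card (FF E)) \<longrightarrow> crit C V E \<longrightarrow>
     (\<exists>U cl. U \<subseteq> V \<and> real (card U) \<le> \<epsilon> * real (card V) \<and> (\<forall>v\<in>V - U. cl v < p) \<and>
        (\<forall>u\<in>V - U. \<forall>v\<in>V - U. {u, v} \<in> E \<longrightarrow> cl u \<noteq> cl v))"
proof -
  obtain \<kappa>0 where \<kappa>0: "\<kappa>0 > 0" "\<And>(A::nat set) n c. finite A \<Longrightarrow> card A \<le> n \<Longrightarrow> real c \<le> \<kappa>0 * real n \<Longrightarrow>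
     real (card (small_subsets A c)) \<le> 2 powr (1/100 * real n)" using card_small_subsets[of "1/100"] by auto
  \<comment> \<open>\<open>\<kappa>0\<close> keeps small witness sets rare, \<open>1/200\<close> is
    required by the saving for quadruples, and \<open>\<epsilon>/1000\<close> makes the edges that a
    vertex may send to its sparse part negligible.\<close>
  define \<kappa> where "\<kappa> = min \<kappa>0 (min (1/200) (\<epsilon>/1000))"
  have \<kappa>: "\<kappa> > 0" "\<kappa> \<le> \<kappa>0" "\<kappa> \<le> 1/200" "\<kappa> \<le> \<epsilon>/1000" unfolding \<kappa>_def using \<kappa>0 \<epsilon> by auto
  obtain s0 where s0: "\<forall>s\<ge>s0. \<forall>c. \<kappa>/8 * real s \<le> real c \<longrightarrow> (\<exists>n0. \<forall>V E. finite V \<longrightarrow> n0 \<le> card V \<longrightarrow> E \<subseteq> edges_on V \<longrightarrow>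
     2 powr (turan_density p * (real (card V) * (real (card V) - 1))) \<le> real (card (FF E)) \<longrightarrow>
     (\<exists>L. blowup p s E V L \<and> card (FF E) \<le> 2 ^ (p * card V + 1) * card {S \<in> FF E. universal p c E S L}))"
    using universal_location[of "\<kappa>/8"] \<kappa>(1) by auto
  \<comment> \<open>\<open>100 * (p + 5)\<close> serves the savings, \<open>8 / \<kappa>\<close>
    absorbs the rounding of \<open>c\<close>, and \<open>400 * p / \<epsilon>\<close> makes the cost
    \<open>p * n\<close> of locating the blow-up small after division by
    \<open>s / 25\<close>.\<close>
  define s where "s = s0 + nat \<lceil>100 * (real p + 5)\<rceil> + nat \<lceil>8 / \<kappa>\<rceil> + nat \<lceil>400 * real p / \<epsilon>\<rceil> + 1"
  have s1: "s \<ge> s0" "s > 0" unfolding s_def by auto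
  have s2: "100 * (real p + 5) \<le> real s" unfolding s_def by linarith
  have "8 / \<kappa> \<le> real s" "400 * real p / \<epsilon> \<le> real s" unfolding s_def by linarith+
  then have s3: "8 \<le> \<kappa> * real s" and s4: "400 * real p \<le> \<epsilon> * real s"
    using \<kappa>(1) \<epsilon> by (simp_all add: field_simps)
  \<comment> \<open>One eighth leaves room for \<open>2 * c + 4 \<le> \<kappa> * s\<close> after
    rounding up.\<close>
  define c where "c = nat \<lceil>\<kappa>/8 * real s\<rceil>"
  have c1: "\<kappa>/8 * real s \<le> real c" unfolding c_def by linarith
  have "0 \<le> \<kappa>/8 * real s" using \<kappa>(1) by simp
  then have "real c \<le> \<kappa>/8 * real s + 1" unfolding c_def by linarith
  then have c2: "real (2*c+4) \<le> \<kappa> * real s" using s3 by simp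
  have c3: "200 * real (2*c+4) \<le> real s"
  proof -
    have "real (2*c+4) \<le> 1/200 * real s" by (rule order.trans[OF c2 mult_right_mono[OF \<kappa>(3)]]) simp
    then show ?thesis by (simp add: field_simps)
  qed
  obtain n0 where n0: "\<And>V E. finite V \<Longrightarrow> n0 \<le> card V \<Longrightarrow> E \<subseteq> edges_on V \<Longrightarrow>
     2 powr (turan_density p * (real (card V) * (real (card V) - 1))) \<le> real (card (FF E)) \<Longrightarrow>
     \<exists>L. blowup p s E V L \<and> card (FF E) \<le> 2 ^ (p * card V + 1) * card {S \<in> FF E. universal p c E S L}"
    using s0 s1(1) c1 by blast
  define h where "h = p * s"
  \<comment> \<open>The bounded contributions to the exceptional set: the constant terms of the
    comparison, \<open>W\<close> itself, and two vertices per class.\<close>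
  define K where "K = 100 * (2 + (real h)\<^sup>2) / real s + real h + 2 * real p"
  define n1 where "n1 = n0 + nat \<lceil>2 * K / \<epsilon>\<rceil>"
  have "\<exists>U cl. U \<subseteq> V \<and> real (card U) \<le> \<epsilon> * real (card V) \<and> (\<forall>v\<in>V - U. cl v < p) \<and>
        (\<forall>u\<in>V - U. \<forall>v\<in>V - U. {u, v} \<in> E \<longrightarrow> cl u \<noteq> cl v)"
    if fV: "finite V" and n: "n1 \<le> card V" and E: "E \<subseteq> edges_on V"
      and big: "2 powr (turan_density p * (real (card V) * (real (card V) - 1))) \<le> real (card (FF E))" and cr: "crit h V E" for V E
  proof -
    have "n0 \<le> card V" using n unfolding n1_def by simp
    then obtain L where L: "blowup p s E V L" "card (FF E) \<le> 2 ^ (p * card V + 1) * card {S \<in> FF E. universal p c E S L}"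
      using n0[OF fV _ E big] by blast
    have bl: "blown_up p s E V L" by unfold_locales (use p2 L fV E in auto)
    interpret bl: blown_up p s E V L by (rule bl)
    define W where "W = (\<Union>i<p. L i)"
    have Wb: "bl.W = W" unfolding bl.W_def W_def ..
    note WV = bl.W_sub[unfolded Wb] and cW = bl.card_W[unfolded Wb]
    define B where "B = {v \<in> V - W. \<forall>i<p. 2 * (2*c+4) \<le> card {u \<in> L i. {u, v} \<in> E}}"
    define cl where "cl = (\<lambda>v. SOME i. i < p \<and> card {u \<in> L i. {u, v} \<in> E} \<le> 2 * (2*c+4))"
    have cl: "cl v < p \<and> card {u \<in> L (cl v). {u, v} \<in> E} \<le> 2 * (2*c+4)" if "v \<in> V - W - B" for v
    proof -
      have "\<exists>i. i < p \<and> card {u \<in> L i. {u, v} \<in> E} \<le> 2 * (2*c+4)" using that unfolding B_def by (auto simp: not_le less_imp_le)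
      then show ?thesis unfolding cl_def by (rule someI_ex)
    qed
    have loop: "{u, u} \<notin> E" for u using E unfolding edges_on_def by (auto simp: doubleton_eq_iff)
    have fR: "finite (V - W - B)" using fV by simp
    obtain \<Q> M where Q: "\<forall>Y\<in>\<Q>. Y \<subseteq> V - W - B \<and> (\<exists>x y z w i. Y = {x, y, z, w} \<and> distinct [x, y, z, w] \<and> i < p \<and>
       {x, y} \<in> E \<and> {z, w} \<in> E \<and> (\<forall>y\<in>Y. cl y = i))"
      "\<forall>Y\<in>\<Q>. \<forall>Z\<in>\<Q>. Y \<noteq> Z \<longrightarrow> Y \<inter> Z = {}" and M: "finite M" "card M \<le> 2 * p" "M \<subseteq> V - W - B"
      and fin: "\<forall>u\<in>V - W - B - \<Union>\<Q> - M. \<forall>v\<in>V - W - B - \<Union>\<Q> - M. {u, v} \<in> E \<longrightarrow> cl u < p \<longrightarrow> cl u \<noteq> cl v"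
      by (rule ex_disjoint_quads[OF fR loop])
    define q where "q = card B + card \<Q>"
    define b where "b = nat \<lfloor>2 powr (real s / 100)\<rfloor>"
    have b: "real b \<le> 2 powr (real s / 100)" unfolding b_def by simp
    have sb: "card (small_subsets (L i) (2*c+4)) \<le> b" if i: "i < p" for i
    proof -
      have "real (2*c+4) \<le> \<kappa>0 * real s" using c2 \<kappa>(2) by (meson mult_right_mono of_nat_0_le_iff order.trans)
      then have "real (card (small_subsets (L i) (2*c+4))) \<le> 2 powr (1/100 * real s)"
        using \<kappa>0(2)[OF bl.fin_A[OF i]] bl.card_A[OF i] by simp
      then show ?thesis unfolding b_def by (intro le_nat_floor) simp
    qed
    define \<beta> where "\<beta> = real (h\<^sup>2) + ((real p - 1) * real s + 2 * real (2*c+4)) * (real (card V) - real h) - real s / 25 * real q"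
    have "real (card {S \<in> FF E. universal p c E S L}) \<le> real (card (FF (del E W))) *
       2 powr (real ((p * s)\<^sup>2) + ((real p - 1) * real s + 2 * real (2*c+4)) * (real (card V) - real (p * s))
       - real s / 25 * (real (card B) + real (card \<Q>)))"
    proof (rule card_universal_extensions[OF bl sb b s2 c3 W_def])
      show "B \<subseteq> V - W" unfolding B_def by blast
      show "2 * (2*c+4) \<le> card {u \<in> L i. {u, v} \<in> E}" if "v \<in> B" "i < p" for v i using that unfolding B_def by blast
      show "\<exists>i<p. card {u \<in> L i. {u, v} \<in> E} \<le> 2 * (2*c+4)" if "v \<in> V - W - B" for v using cl[OF that] by blast
      show "Y \<subseteq> V - W - B" if "Y \<in> \<Q>" for Y using Q(1) that by blast
      show "Y \<inter> Z = {}" if "Y \<in> \<Q>" "Z \<in> \<Q>" "Y \<noteq> Z" for Y Z using Q(2) that by blast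
      show "\<exists>x y z w i. Y = {x, y, z, w} \<and> distinct [x, y, z, w] \<and> i < p \<and> {x, y} \<in> E \<and> {z, w} \<in> E \<and>
         (\<forall>y\<in>Y. card {u \<in> L i. {u, y} \<in> E} \<le> 2 * (2*c+4))" if Y: "Y \<in> \<Q>" for Y
      proof -
        obtain x y z w i where xy: "Y = {x, y, z, w}" "distinct [x, y, z, w]" "i < p" "{x, y} \<in> E" "{z, w} \<in> E" "\<forall>y\<in>Y. cl y = i"
          using conjunct2[OF bspec[OF Q(1) Y]] by (elim exE conjE) (rule that; assumption)
        have "card {u \<in> L i. {u, y} \<in> E} \<le> 2 * (2*c+4)" if "y \<in> Y" for y
        proof -
          have "y \<in> V - W - B" using Q(1) Y that by blast
          then show ?thesis using cl[of y] xy(6) that by simp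
        qed
        then show ?thesis using xy by blast
      qed
    qed
    then have c4: "real (card {S \<in> FF E. universal p c E S L}) \<le> real (card (FF (del E W))) * 2 powr \<beta>"
      unfolding \<beta>_def h_def q_def by simp
    have "W \<noteq> {}" using cW s1(2) p2 by auto
    have c5: "real (card (FF (del E W))) \<le> 2 * real (card (FF E)) * 2 powr (- ((real p - 1) * (real s * (real (card V) - real h))))"
    proof -
      have "2 * turan_density p * (real (card W) * (real (card V) - real (card W))) = (real p - 1) * (real s * (real (card V) - real h))"
        using two_turan_density[of "real s * (real (card V) - real h)"] by (simp only: cW h_def of_nat_mult mult.assoc)
      moreover have "real (card (FF (del E W))) \<le> 2 * real (card (FF E)) *
         2 powr (- (2 * turan_density p * (real (card W) * (real (card V) - real (card W)))))"
        by (rule cr[unfolded crit_def, rule_format, OF WV \<open>W \<noteq> {}\<close>]) (simp add: cW h_def)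
      ultimately show ?thesis by simp
    qed
    define N where "N = real (card (FF E))"
    have N0: "N > 0" unfolding N_def by (rule less_le_trans[OF _ big]) simp
    have "N \<le> 2 ^ (p * card V + 1) * real (card {S \<in> FF E. universal p c E S L})"
      using of_nat_mono[OF L(2), where ?'a = real] unfolding N_def by simp
    also have "\<dots> \<le> 2 ^ (p * card V + 1) * ((2 * N * 2 powr (- ((real p - 1) * (real s * (real (card V) - real h))))) * 2 powr \<beta>)"
    proof (rule mult_left_mono)
      show "real (card {S \<in> FF E. universal p c E S L}) \<le> (2 * N * 2 powr (- ((real p - 1) * (real s * (real (card V) - real h))))) * 2 powr \<beta>"
        using order.trans[OF c4 mult_right_mono[OF c5]] unfolding N_def by simp
    qed simp
    also have "(2::real) ^ (p * card V + 1) = 2 powr (real p * real (card V) + 1)"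
      by (simp add: powr_realpow[symmetric] powr_add)
    finally have "N * 1 \<le> N * (2 powr (real p * real (card V) + 1) * (2 powr 1 * 2 powr (- ((real p - 1) * (real s * (real (card V) - real h)))) * 2 powr \<beta>))"
      by (simp add: mult_ac)
    then have "1 \<le> 2 powr (real p * real (card V) + 1) * (2 powr 1 * 2 powr (- ((real p - 1) * (real s * (real (card V) - real h)))) * 2 powr \<beta>)"
      using N0 by (simp only: mult_le_cancel_left_pos)
    also have "\<dots> = 2 powr (real p * real (card V) + 1 + (1 + - ((real p - 1) * (real s * (real (card V) - real h))) + \<beta>))"
      by (simp only: powr_add[symmetric])
    finally have "2 powr 0 \<le> 2 powr (real p * real (card V) + 1 + (1 + - ((real p - 1) * (real s * (real (card V) - real h))) + \<beta>))" by simp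
    then have "0 \<le> real p * real (card V) + 1 + (1 + - ((real p - 1) * (real s * (real (card V) - real h))) + \<beta>)"
      by (subst (asm) powr_le_cancel_iff) auto
    then have "real s / 25 * real q \<le> real p * real (card V) + 2 + (real h)\<^sup>2 + 2 * real (2*c+4) * (real (card V) - real h)"
      unfolding \<beta>_def by (simp add: algebra_simps)
    also have "\<dots> \<le> real p * real (card V) + 2 + (real h)\<^sup>2 + 2 * real (2*c+4) * real (card V)"
      by (simp add: mult_left_mono)
    also have "\<dots> \<le> real p * real (card V) + 2 + (real h)\<^sup>2 + 2 * (\<kappa> * real s) * real (card V)"
      using c2 by (intro add_left_mono mult_right_mono mult_left_mono) auto
    finally have q1: "real s * (4 * real q) \<le> 100 * (real p * real (card V) + 2 + (real h)\<^sup>2 + 2 * (\<kappa> * real s) * real (card V))"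
      by simp
    have q2: "4 * real q \<le> 9/20 * \<epsilon> * real (card V) + 100 * (2 + (real h)\<^sup>2) / real s"
    proof -
      have a1: "100 * (real p * real (card V)) \<le> (\<epsilon> * real s / 4) * real (card V)"
        using mult_right_mono[OF s4, of "real (card V)"] by simp
      have a2: "200 * (\<kappa> * real s) * real (card V) \<le> 200 * (\<epsilon>/1000 * real s) * real (card V)"
        using \<kappa>(4) by (intro mult_right_mono mult_left_mono) auto
      have "real s * (4 * real q) \<le> real s * (9/20 * \<epsilon> * real (card V)) + 100 * (2 + (real h)\<^sup>2)"
        using q1 a1 a2 by (simp add: algebra_simps)
      also have "\<dots> = real s * (9/20 * \<epsilon> * real (card V) + 100 * (2 + (real h)\<^sup>2) / real s)"
        using s1(2) by (simp add: field_simps)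
      finally show ?thesis using s1(2) by simp
    qed
    define U where "U = W \<union> B \<union> \<Union>\<Q> \<union> M"
    have fQ: "finite \<Q>"
    proof (rule finite_subset[of _ "Pow V"])
      show "\<Q> \<subseteq> Pow V" using Q(1) by blast
    qed (use fV in simp)
    have "card (\<Union>\<Q>) \<le> (\<Sum>Y\<in>\<Q>. card Y)" by (rule card_Union_le_sum_card)
    also have "\<dots> \<le> (\<Sum>Y\<in>\<Q>. 4)"
    proof (rule sum_mono)
      fix Y assume Y: "Y \<in> \<Q>"
      obtain x y z w where "Y = {x, y, z, w}"
        using conjunct2[OF bspec[OF Q(1) Y]] by (elim exE conjE) (rule that; assumption)
      then show "card Y \<le> 4" by (simp add: card_insert_if)
    qed
    finally have "card (\<Union>\<Q>) \<le> 4 * card \<Q>" by simp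
    then have "card U \<le> h + card B + 4 * card \<Q> + 2 * p" unfolding U_def h_def
      using card_Un_le[of "W \<union> B \<union> \<Union>\<Q>" M] card_Un_le[of "W \<union> B" "\<Union>\<Q>"] card_Un_le[of W B] cW M(2) by linarith
    then have "real (card U) \<le> real (h + card B + 4 * card \<Q> + 2 * p)" by (rule of_nat_mono)
    also have "\<dots> \<le> 4 * real q + real h + 2 * real p" unfolding q_def by simp
    also have "\<dots> \<le> 9/20 * \<epsilon> * real (card V) + K" using q2 unfolding K_def by simp
    also have "K \<le> \<epsilon> / 2 * real (card V)"
    proof -
      have "2 * K / \<epsilon> \<le> real (card V)" using n unfolding n1_def by linarith
      then show ?thesis using \<epsilon> by (simp add: field_simps)
    qed
    also have "9/20 * \<epsilon> * real (card V) + \<epsilon> / 2 * real (card V) \<le> \<epsilon> * real (card V)" using \<epsilon> by (simp add: field_simps)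
    finally have "real (card U) \<le> \<epsilon> * real (card V)" by simp
    moreover have "U \<subseteq> V" unfolding U_def B_def using WV Q(1) M(3) by blast
    moreover have "V - U = V - W - B - \<Union>\<Q> - M" unfolding U_def by blast
    ultimately show ?thesis using fin cl by (intro exI[of _ U] exI[of _ cl]) auto
  qed
  then show ?thesis by blast
qed

end

section \<open>Edges of multipartite graphs\<close>

lemma card_residue_class:
  assumes "p > 0"
  shows "card {u. u < n \<and> u mod p = n mod p} = n div p"
proof -
  have "{u. u < n \<and> u mod p = n mod p} = (\<lambda>k. n mod p + p * k) ` {..<n div p}"
  proof (intro equalityI subsetI)
    fix u assume u: "u \<in> {u. u < n \<and> u mod p = n mod p}"
    have eq: "u = n mod p + p * (u div p)" using u by (metis (mono_tags) mem_Collect_eq mod_mult_div_eq)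
    have "p * (u div p) < p * (n div p)"
    proof -
      have "u < n" "u mod p = n mod p" using u by simp_all
      then show ?thesis using mod_mult_div_eq[of u p] mod_mult_div_eq[of n p] by linarith
    qed
    then have "u div p < n div p" by simp
    then show "u \<in> (\<lambda>k. n mod p + p * k) ` {..<n div p}" using eq by blast
  next
    fix u assume "u \<in> (\<lambda>k. n mod p + p * k) ` {..<n div p}"
    then obtain k where k: "k < n div p" "u = n mod p + p * k" by blast
    have "p * k < p * (n div p)" using k(1) assms by simp
    then have "u < n" using k(2) mod_mult_div_eq[of n p] by linarith
    then show "u \<in> {u. u < n \<and> u mod p = n mod p}" using k(2) by simp
  qed
  moreover have "inj_on (\<lambda>k. n mod p + p * k) {..<n div p}" using assms by (auto simp: inj_on_def)
  ultimately show ?thesis by (simp add: card_image)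
qed

text \<open>The new vertex \<open>n\<close> is joined to all earlier vertices except the
  \<open>n div p\<close> with the same residue.\<close>

lemma turan_num_Suc:
  assumes "p > 0"
  shows "turan_num (Suc n) p = turan_num n p + (n - n div p)"
proof -
  let ?E = "\<lambda>n. {{u, v} | u v. u < n \<and> v < n \<and> u mod p \<noteq> v mod p}"
  let ?N = "{u. u < n \<and> u mod p \<noteq> n mod p}"
  have eq: "?E (Suc n) = ?E n \<union> (\<lambda>u. {u, n}) ` ?N"
  proof (intro equalityI subsetI)
    fix e assume "e \<in> ?E (Suc n)"
    then obtain u v where uv: "e = {u, v}" "u < Suc n" "v < Suc n" "u mod p \<noteq> v mod p" by blast
    have star: "e \<in> (\<lambda>u. {u, n}) ` ?N" if "e = {x, n}" "x < n" "x mod p \<noteq> n mod p" for x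
      unfolding that(1) by (rule imageI) (use that in simp)
    consider "u < n" "v < n" | "u = n" "v < n" | "v = n" "u < n"
      using uv(2-4) less_antisym by blast
    then show "e \<in> ?E n \<union> (\<lambda>u. {u, n}) ` ?N"
    proof cases
      case 1
      then have "e \<in> ?E n" using uv by blast
      then show ?thesis by blast
    next
      case 2
      then have "e = {v, n}" "v mod p \<noteq> n mod p" using uv by auto
      then show ?thesis using star 2 by blast
    next
      case 3
      then have "e = {u, n}" "u mod p \<noteq> n mod p" using uv by auto
      then show ?thesis using star 3 by blast
    qed
  next
    fix e assume "e \<in> ?E n \<union> (\<lambda>u. {u, n}) ` ?N"
    then consider u v where "e = {u, v}" "u < n" "v < n" "u mod p \<noteq> v mod p" | u where "e = {u, n}" "u < n" "u mod p \<noteq> n mod p" by blast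
    then show "e \<in> ?E (Suc n)"
    proof cases
      case (1 u v) then show ?thesis by (intro CollectI exI[of _ u] exI[of _ v]) auto
    next
      case (2 u) then show ?thesis by (intro CollectI exI[of _ u] exI[of _ n]) auto
    qed
  qed
  have fin: "finite (?E n)"
    by (rule finite_subset[of _ "(\<lambda>(u, v). {u, v}) ` ({..<n} \<times> {..<n})"]) auto
  have "card (?E (Suc n)) = card (?E n) + card ((\<lambda>u. {u, n}) ` ?N)"
    unfolding eq by (rule card_Un_disjoint) (use fin in \<open>auto simp: doubleton_eq_iff\<close>)
  also have "card ((\<lambda>u. {u, n}) ` ?N) = card ?N"
    by (rule card_image) (auto simp: inj_on_def doubleton_eq_iff)
  also have "?N = {..<n} - {u. u < n \<and> u mod p = n mod p}" by auto
  also have "card \<dots> = n - n div p"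
    using card_residue_class[OF assms, of n] by (subst card_Diff_subset) auto
  finally show ?thesis unfolding turan_num_def .
qed

lemma turan_num_0 [simp]: "turan_num 0 p = 0"
  unfolding turan_num_def by simp

lemma turan_num_increment:
  assumes "p > 0"
  shows "2 * turan_density p * real n \<le> real (turan_num (Suc n) p) - real (turan_num n p)"
proof -
  have "real (n div p) \<le> real n / real p" by (metis of_nat_div_le_of_nat)
  have "n div p \<le> n" by simp
  then have "real (turan_num (Suc n) p) - real (turan_num n p) = real n - real (n div p)"
    unfolding turan_num_Suc[OF assms] of_nat_add of_nat_diff[OF \<open>n div p \<le> n\<close>] by simp
  moreover have "2 * turan_density p * real n = real n - real n / real p"
    using assms unfolding turan_density_def by (simp add: field_simps)
  ultimately show ?thesis using \<open>real (n div p) \<le> real n / real p\<close> by simp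
qed

text \<open>Each of the \<open>h\<close> successive losses is at least the last one, which is
  bounded below by \<open>2 * turan_density p\<close> times \<open>n - h\<close>.\<close>

lemma turan_num_difference:
  assumes "p > 0" "h \<le> n"
  shows "2 * turan_density p * (real h * (real n - real h)) \<le> real (turan_num n p) - real (turan_num (n - h) p)"
  using assms(2)
proof (induction h)
  case (Suc h)
  have td: "2 * turan_density p \<ge> 0" unfolding turan_density_def using assms by (simp add: field_simps)
  have e: "n - h = Suc (n - Suc h)" using Suc.prems by simp
  have "2 * turan_density p * (real (Suc h) * (real n - real (Suc h))) \<le>
     2 * turan_density p * (real h * (real n - real h)) + 2 * turan_density p * real (n - Suc h)"
    unfolding distrib_left[symmetric] by (rule mult_left_mono[OF _ td]) (use Suc.prems in \<open>simp add: of_nat_diff algebra_simps\<close>)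
  also have "\<dots> \<le> (real (turan_num n p) - real (turan_num (n - h) p)) + (real (turan_num (n - h) p) - real (turan_num (n - Suc h) p))"
    by (intro add_mono) (use Suc turan_num_increment[OF assms(1), of "n - Suc h"] e in auto)
  finally show ?case by simp
qed simp

lemma turan_num_lower:
  assumes "p > 0"
  shows "turan_density p * (real n * (real n - 1)) \<le> real (turan_num n p)"
proof (induction n)
  case (Suc n)
  have "turan_density p * (real (Suc n) * (real (Suc n) - 1)) = turan_density p * (real n * (real n - 1)) + 2 * turan_density p * real n"
    by (simp add: algebra_simps)
  also have "\<dots> \<le> real (turan_num (Suc n) p)" using Suc turan_num_increment[OF assms, of n] by linarith
  finally show ?case .
qed simp

text \<open>Among \<open>n + 1\<close> vertices some class has more than \<open>n div p\<close>
  elements. Deleting a vertex of that class loses at most \<open>n - n div p\<close> pairs, exactly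
  the increment of \<open>turan_num\<close>.\<close>

lemma multipartite_card_le_turan:
  assumes "p > 0" "finite V" "\<And>v. v \<in> V \<Longrightarrow> cl v < p"
  shows "card {{u, v} | u v. u \<in> V \<and> v \<in> V \<and> cl u \<noteq> cl v} \<le> turan_num (card V) p"
  using assms(2,3)
proof (induction "card V" arbitrary: V)
  case 0
  then show ?case by simp
next
  case (Suc n)
  let ?E = "\<lambda>V. {{u, v} | u v. u \<in> V \<and> v \<in> V \<and> cl u \<noteq> cl v}"
  have "\<exists>i<p. n div p < card {v \<in> V. cl v = i}"
  proof (rule ccontr)
    assume "\<not> ?thesis"
    then have le: "card {v \<in> V. cl v = i} \<le> n div p" if "i < p" for i using that by (meson not_le)
    have "V = (\<Union>i<p. {v \<in> V. cl v = i})" using Suc.prems(2) by blast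
    then have "card V \<le> (\<Sum>i<p. card {v \<in> V. cl v = i})" using card_UN_le[of "{..<p}" "\<lambda>i. {v \<in> V. cl v = i}"] by simp
    also have "\<dots> \<le> (\<Sum>i<p. n div p)" by (rule sum_mono) (use le in simp)
    also have "\<dots> \<le> n" by simp
    finally show False using Suc.hyps(2) by simp
  qed
  then obtain i where i: "i < p" "n div p < card {v \<in> V. cl v = i}" by blast
  then obtain w where w: "w \<in> V" "cl w = i" by (metis (mono_tags, lifting) card.empty empty_Collect_eq not_less_zero)
  define V' where "V' = V - {w}"
  have V': "card V' = n" "finite V'" using w Suc unfolding V'_def by auto
  have sub: "?E V \<subseteq> ?E V' \<union> (\<lambda>u. {u, w}) ` {u \<in> V. cl u \<noteq> i}"
  proof
    fix e assume "e \<in> ?E V"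
    then obtain u v where uv: "e = {u, v}" "u \<in> V" "v \<in> V" "cl u \<noteq> cl v" by blast
    then consider "u \<noteq> w" "v \<noteq> w" | "u = w" "cl v \<noteq> i" | "v = w" "cl u \<noteq> i" using w uv(4) by metis
    then show "e \<in> ?E V' \<union> (\<lambda>u. {u, w}) ` {u \<in> V. cl u \<noteq> i}"
    proof cases
      case 1 then show ?thesis using uv unfolding V'_def by auto
    next
      case 2
      then have "e = {v, w}" using uv by auto
      then show ?thesis using 2 uv by auto
    next
      case 3 then show ?thesis using uv by auto
    qed
  qed
  have fin: "finite (?E V')"
    by (rule finite_subset[of _ "(\<lambda>(u, v). {u, v}) ` (V' \<times> V')"]) (use V' in auto)
  have "card (?E V) \<le> card (?E V' \<union> (\<lambda>u. {u, w}) ` {u \<in> V. cl u \<noteq> i})"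
    by (rule card_mono[OF _ sub]) (use fin Suc.prems in auto)
  also have "\<dots> \<le> card (?E V') + card ((\<lambda>u. {u, w}) ` {u \<in> V. cl u \<noteq> i})" by (rule card_Un_le)
  also have "card ((\<lambda>u. {u, w}) ` {u \<in> V. cl u \<noteq> i}) \<le> card {u \<in> V. cl u \<noteq> i}"
    by (rule card_image_le) (use Suc.prems in simp)
  also have "{u \<in> V. cl u \<noteq> i} = V - {v \<in> V. cl v = i}" by blast
  also have "card (V - {v \<in> V. cl v = i}) = Suc n - card {v \<in> V. cl v = i}"
    using Suc.prems(1) Suc.hyps(2) by (subst card_Diff_subset) auto
  also have "Suc n - card {v \<in> V. cl v = i} \<le> n - n div p" using i(2) by linarith
  also have "card (?E V') \<le> turan_num n p" using Suc.hyps(1)[of V'] V' Suc.prems unfolding V'_def by simp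
  finally show ?case unfolding Suc.hyps(2)[symmetric] turan_num_Suc[OF assms(1)] by simp
qed

section \<open>Nearly extremal graphs\<close>

lemma edges_onE:
  assumes "e \<in> edges_on V"
  obtains a b where "e = {a, b}" "a \<in> V" "b \<in> V" "a \<noteq> b"
proof -
  have "\<exists>a b. e = {a, b} \<and> a \<in> V \<and> b \<in> V \<and> a \<noteq> b" using assms unfolding edges_on_def by simp
  then show ?thesis by (elim exE conjE) (rule that; assumption)
qed

lemma card_between_eq:
  assumes "finite Y" "finite X" "Y \<inter> X = {}"
  shows "card (between E Y X) = (\<Sum>y\<in>Y. card {u \<in> X. {u, y} \<in> E})"
proof -
  have "between E Y X = (\<Union>y\<in>Y. (\<lambda>u. {u, y}) ` {u \<in> X. {u, y} \<in> E})"
    unfolding between_def by (auto simp: insert_commute)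
  also have "card \<dots> = (\<Sum>y\<in>Y. card ((\<lambda>u. {u, y}) ` {u \<in> X. {u, y} \<in> E}))"
  proof (rule card_UN_disjoint[OF assms(1)])
    show "\<forall>y\<in>Y. \<forall>z\<in>Y. y \<noteq> z \<longrightarrow> (\<lambda>u. {u, y}) ` {u \<in> X. {u, y} \<in> E} \<inter> (\<lambda>u. {u, z}) ` {u \<in> X. {u, z} \<in> E} = {}"
    proof (intro ballI impI equals0I)
      fix y z e assume yz: "y \<in> Y" "z \<in> Y" "y \<noteq> z"
        and e: "e \<in> (\<lambda>u. {u, y}) ` {u \<in> X. {u, y} \<in> E} \<inter> (\<lambda>u. {u, z}) ` {u \<in> X. {u, z} \<in> E}"
      obtain u where u: "u \<in> X" "e = {u, y}" using IntD1[OF e] by auto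
      obtain u' where u': "e = {u', z}" using IntD2[OF e] by auto
      have "{u, y} = {u', z}" using u(2) u' by simp
      then have "u = u' \<and> y = z \<or> u = z \<and> y = u'" by (simp only: doubleton_eq_iff)
      then have "u = z" using yz(3) by simp
      then have "z \<in> Y \<inter> X" using u(1) yz(2) by simp
      then show False unfolding assms(3) by simp
    qed
  qed (use assms(2) in simp)
  also have "\<dots> = (\<Sum>y\<in>Y. card {u \<in> X. {u, y} \<in> E})"
    by (rule sum.cong[OF refl], rule card_image) (auto simp: inj_on_def doubleton_eq_iff)
  finally show ?thesis .
qed

lemma card_touch_singleton:
  assumes "E \<subseteq> edges_on V" "v \<in> V"
  shows "card (touch E {v}) = card {u \<in> V. {u, v} \<in> E}"
proof -
  have "touch E {v} = (\<lambda>u. {u, v}) ` {u \<in> V. {u, v} \<in> E}"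
  proof (intro equalityI subsetI)
    fix e assume "e \<in> touch E {v}"
    then have e: "e \<in> E" "v \<in> e" unfolding touch_def by auto
    obtain a b where ab: "e = {a, b}" "a \<in> V" "b \<in> V" "a \<noteq> b" by (rule edges_onE[OF subsetD[OF assms(1) e(1)]])
    then have "e = {a, v} \<or> e = {b, v}" using e(2) by (auto simp: insert_commute)
    then show "e \<in> (\<lambda>u. {u, v}) ` {u \<in> V. {u, v} \<in> E}"
    proof
      assume ev: "e = {a, v}"
      show ?thesis unfolding ev by (rule imageI) (use ab(2) e(1) ev in simp)
    next
      assume ev: "e = {b, v}"
      show ?thesis unfolding ev by (rule imageI) (use ab(3) e(1) ev in simp)
    qed
  next
    fix e assume "e \<in> (\<lambda>u. {u, v}) ` {u \<in> V. {u, v} \<in> E}"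
    then obtain u where "e = {u, v}" "{u, v} \<in> E" by auto
    then show "e \<in> touch E {v}" unfolding touch_def by simp
  qed
  moreover have "inj_on (\<lambda>u. {u, v}) {u \<in> V. {u, v} \<in> E}" by (auto simp: inj_on_def doubleton_eq_iff)
  ultimately show ?thesis by (simp add: card_image)
qed

lemma card_touch_le:
  assumes "finite Y" "finite E"
  shows "card (touch E Y) \<le> (\<Sum>y\<in>Y. card (touch E {y}))"
proof -
  have "touch E Y = (\<Union>y\<in>Y. touch E {y})" unfolding touch_def by auto
  then show ?thesis using card_UN_le[OF assms(1), of "\<lambda>y. touch E {y}"] by simp
qed

text \<open>The bits are the directions of \<open>xy\<close>, \<open>zw\<close>, \<open>xz\<close>,
  \<open>xw\<close>, \<open>yz\<close>, \<open>yw\<close>. The four lines take \<open>x\<close>,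
  \<open>y\<close>, \<open>z\<close>, \<open>w\<close> in turn as the centre of a triangle with the
  opposite pair and exclude both paths through it; \<open>ab\<close> tells whether the third arc of
  the fan triangle goes from the in-neighbour to the out-neighbour of the centre.\<close>

definition four_bits :: "bool \<Rightarrow> bool \<times> bool \<times> bool \<times> bool \<times> bool \<times> bool \<Rightarrow> bool" where
  "four_bits ab = (\<lambda>(e1, e2, f1, f2, f3, f4).
     \<not> (\<not> f1 \<and> f2 \<and> e2 = ab) \<and> \<not> (f1 \<and> \<not> f2 \<and> e2 \<noteq> ab) \<and>
     \<not> (\<not> f3 \<and> f4 \<and> e2 = ab) \<and> \<not> (f3 \<and> \<not> f4 \<and> e2 \<noteq> ab) \<and>
     \<not> (f1 \<and> \<not> f3 \<and> e1 = ab) \<and> \<not> (\<not> f1 \<and> f3 \<and> e1 \<noteq> ab) \<and>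
     \<not> (f2 \<and> \<not> f4 \<and> e1 = ab) \<and> \<not> (\<not> f2 \<and> f4 \<and> e1 \<noteq> ab))"

text \<open>Evaluated over all 64 tuples. The share is small enough: with two edges more than the
  Turan number \<open>t\<close> it allows \<open>3/8 * 2 ^ (t + 2) = 3/4 * 2 ^ (t + 1)\<close> good
  orientations, against the \<open>7/8\<close> provided by \<open>many_good\<close>.\<close>

lemma card_four_bits: "card {t. four_bits ab t} \<le> 24"
proof -
  let ?B = "[True, False]"
  let ?L = "List.product ?B (List.product ?B (List.product ?B (List.product ?B (List.product ?B ?B))))"
  have "set ?B = UNIV" by auto
  then have L: "set ?L = UNIV" by (simp only: set_product UNIV_Times_UNIV)
  have "{t. four_bits ab t} = set (filter (four_bits ab) ?L)" by (simp only: set_filter L UNIV_I simp_thms)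
  then have "card {t. four_bits ab t} = card (set (filter (four_bits ab) ?L))" by (rule arg_cong)
  also have "\<dots> \<le> length (filter (four_bits ab) ?L)" by (rule card_length)
  also have "\<dots> \<le> 24"
  proof (cases ab)
    case True
    have "length (filter (four_bits True) ?L) \<le> 24" by code_simp
    then show ?thesis using True by simp
  next
    case False
    have "length (filter (four_bits False) ?L) \<le> 24" by code_simp
    then show ?thesis using False by simp
  qed
  finally show ?thesis .
qed

lemma two_pow_minus_one_le:
  assumes "1 \<le> k" "k \<le> 4"
  shows "(2 ^ k - 1 :: real) ^ m \<le> 2 powr (real k * real m - 2 / 25 * real m)"
proof -
  have "(2::real) ^ k \<le> 2 ^ 4" using assms(2) by (intro power_increasing) auto
  then have "(2 ^ k - 1 :: real) \<le> 2 ^ k * (15 / 16)" by simp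
  moreover have "(1::real) \<le> 2 ^ k" by simp
  ultimately have "(2 ^ k - 1 :: real) ^ m \<le> (2 ^ k * (15 / 16)) ^ m" by (intro power_mono) auto
  also have "\<dots> = 2 powr (real k * real m) * (15 / 16) ^ m"
  proof -
    have "((2::real) ^ k) ^ m = 2 ^ (k * m)" by (rule power_mult[symmetric])
    also have "\<dots> = 2 powr real (k * m)" by (rule powr_realpow[symmetric]) simp
    finally show ?thesis by (simp only: power_mult_distrib of_nat_mult)
  qed
  also have "\<dots> \<le> 2 powr (real k * real m) * 2 powr (- (2 / 25) * real m)" by (intro mult_left_mono fifteen_sixteenths) auto
  also have "\<dots> = 2 powr (real k * real m - 2 / 25 * real m)" by (simp add: powr_add[symmetric])
  finally show ?thesis .
qed

text \<open>What is known about a supposed counterexample. \<open>cl\<close> gives a class to every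
  vertex, while \<open>Vp i\<close> may omit exceptional vertices of class \<open>i\<close>;
  sparsity and richness are measured against \<open>Vp\<close>. Criticality is recorded for up to
  four deleted vertices, the number spanned by two disjoint edges.\<close>

locale near_turan = anti_fan +
  fixes V :: "nat set" and E :: "nat set set" and Vp :: "nat \<Rightarrow> nat set" and cl :: "nat \<Rightarrow> nat"
    and c b :: nat and \<eta> :: real
  assumes fV: "finite V" and E: "E \<subseteq> edges_on V"
    and Vp_sub: "\<And>i. i < p \<Longrightarrow> Vp i \<subseteq> V" and Vp_cl: "\<And>i v. i < p \<Longrightarrow> v \<in> Vp i \<Longrightarrow> cl v = i"
    and cl: "\<And>v. v \<in> V \<Longrightarrow> cl v < p"
    and size: "\<And>i. i < p \<Longrightarrow> real (card V) / real p - \<eta> * real (card V) \<le> real (card (Vp i))"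
    and own: "\<And>v. v \<in> V \<Longrightarrow> card {a \<in> Vp (cl v). {a, v} \<in> E} \<le> 2 * (2*c+4)"
    and deg: "\<And>v. v \<in> V \<Longrightarrow> real (card V) - real (card V) / real p - 2 \<le> real (card (touch E {v}))"
    and c_small: "real (2*c+4) \<le> \<eta> * real (card V)"
    and bs: "\<And>i. i < p \<Longrightarrow> card (small_subsets (Vp i) (2*c+4)) \<le> b" "real b \<le> 2 powr (\<eta> * real (card V))"
    and \<eta>: "0 \<le> \<eta>" "\<eta> \<le> 1 / (1000 * real p)" and large: "40 * real p * (real p + 40) \<le> real (card V)"
    and crit4: "crit 4 V E"
    and nonuniv: "16 * card {S. S \<subseteq> E \<and> \<not> universal p c E S Vp} \<le> card (FF E)"
    and big: "2 ^ (turan_num (card V) p + 1) < card (FF E)"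
begin

abbreviation n where "n \<equiv> real (card V)"

lemma fE: "finite E" by (rule finite_subset[OF E finite_edges_on[OF fV]])

lemma loop: "{u, u} \<notin> E"
proof
  assume "{u, u} \<in> E"
  obtain a d where "{u, u} = {a, d}" "a \<in> V" "d \<in> V" "a \<noteq> d" by (rule edges_onE[OF subsetD[OF E \<open>{u, u} \<in> E\<close>]])
  then show False by (auto simp: doubleton_eq_iff)
qed

lemma Vp_fin: "i < p \<Longrightarrow> finite (Vp i)" using Vp_sub fV finite_subset by metis

lemma Vp_disj: "i < p \<Longrightarrow> j < p \<Longrightarrow> i \<noteq> j \<Longrightarrow> Vp i \<inter> Vp j = {}" using Vp_cl by blast

lemma p_pos: "real p > 0" using p2 by simp

lemma \<eta>n: "\<eta> * n \<le> n / (1000 * real p)"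
  using mult_right_mono[OF \<eta>(2), of n] by simp

lemma Vp_card: "i < p \<Longrightarrow> 2 * c \<le> card (Vp i)"
proof -
  assume i: "i < p"
  have "n / (1000 * real p) \<le> n / real p / 1000" by simp
  then have "2 * (\<eta> * n) \<le> n / real p" using \<eta>n p_pos by (simp add: field_simps)
  then have "real (2 * c) \<le> real (card (Vp i))" using size[OF i] c_small by linarith
  then show ?thesis by simp
qed

lemma degree_upper:
  assumes "v \<in> V"
  shows "real (card (touch E {v})) \<le> n - n / real p + 3 * (\<eta> * n)"
proof -
  have i: "cl v < p" by (rule cl[OF assms])
  have "{u \<in> V. {u, v} \<in> E} \<subseteq> (V - Vp (cl v)) \<union> {a \<in> Vp (cl v). {a, v} \<in> E}" by blast
  then have "card {u \<in> V. {u, v} \<in> E} \<le> card ((V - Vp (cl v)) \<union> {a \<in> Vp (cl v). {a, v} \<in> E})"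
    by (rule card_mono[rotated]) (use fV Vp_fin[OF i] in simp)
  also have "\<dots> \<le> card (V - Vp (cl v)) + card {a \<in> Vp (cl v). {a, v} \<in> E}" by (rule card_Un_le)
  also have "card (V - Vp (cl v)) = card V - card (Vp (cl v))" by (rule card_Diff_subset[OF Vp_fin[OF i] Vp_sub[OF i]])
  finally have "card (touch E {v}) \<le> card V - card (Vp (cl v)) + 2 * (2*c+4)"
    using own[OF assms] card_touch_singleton[OF E assms] by linarith
  moreover have "card (Vp (cl v)) \<le> card V" by (rule card_mono[OF fV Vp_sub[OF i]])
  ultimately have d: "real (card (touch E {v})) \<le> n - real (card (Vp (cl v))) + 2 * real (2*c+4)" by linarith
  have "d \<le> a - v + 2 * x \<Longrightarrow> q - e \<le> v \<Longrightarrow> x \<le> e \<Longrightarrow> d \<le> a - q + 3 * e" for d a v e q x :: real by linarith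
  from this[OF d size[OF i] c_small] show ?thesis .
qed

text \<open>The degree bound lets a vertex miss about \<open>n / p\<close> others, and its own part
  already accounts for nearly all of these.\<close>

lemma neighbours_lower:
  assumes v: "v \<in> V" and j: "j < p" "j \<noteq> cl v"
  shows "real (card (Vp j)) - (3 * (\<eta> * n) + 2) \<le> real (card {a \<in> Vp j. {a, v} \<in> E})"
proof -
  have i: "cl v < p" by (rule cl[OF v])
  let ?R = "V - (Vp (cl v) \<union> Vp j)"
  have "{u \<in> V. {u, v} \<in> E} \<subseteq> ?R \<union> ({a \<in> Vp (cl v). {a, v} \<in> E} \<union> {a \<in> Vp j. {a, v} \<in> E})" by blast
  then have "card {u \<in> V. {u, v} \<in> E} \<le> card (?R \<union> ({a \<in> Vp (cl v). {a, v} \<in> E} \<union> {a \<in> Vp j. {a, v} \<in> E}))"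
    by (rule card_mono[rotated]) (use fV Vp_fin[OF i] Vp_fin[OF j(1)] in simp)
  also have "\<dots> \<le> card ?R + (card {a \<in> Vp (cl v). {a, v} \<in> E} + card {a \<in> Vp j. {a, v} \<in> E})"
    by (rule order.trans[OF card_Un_le add_left_mono[OF card_Un_le]])
  finally have 1: "card (touch E {v}) \<le> card ?R + (2 * (2*c+4) + card {a \<in> Vp j. {a, v} \<in> E})"
    using own[OF v] card_touch_singleton[OF E v] by linarith
  have "card (Vp (cl v) \<union> Vp j) = card (Vp (cl v)) + card (Vp j)"
    by (rule card_Un_disjoint[OF Vp_fin[OF i] Vp_fin[OF j(1)] Vp_disj[OF i j(1) j(2)[symmetric]]])
  moreover have "card ?R = card V - card (Vp (cl v) \<union> Vp j)"
    by (rule card_Diff_subset) (use Vp_fin[OF i] Vp_fin[OF j(1)] Vp_sub[OF i] Vp_sub[OF j(1)] in simp_all)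
  moreover have "card (Vp (cl v) \<union> Vp j) \<le> card V"
    by (rule card_mono[OF fV]) (use Vp_sub[OF i] Vp_sub[OF j(1)] in simp)
  ultimately have 2: "real (card ?R) = n - real (card (Vp (cl v))) - real (card (Vp j))" by linarith
  have 3: "real (card (touch E {v})) \<le> real (card ?R) + (2 * real (2*c+4) + real (card {a \<in> Vp j. {a, v} \<in> E}))"
    using 1 by linarith
  have "d \<le> r + (2 * x + m) \<Longrightarrow> r = a - vi - vj \<Longrightarrow> a - q - 2 \<le> d \<Longrightarrow> q - e \<le> vi \<Longrightarrow> x \<le> e \<Longrightarrow> vj - (3 * e + 2) \<le> m"
    for d r x m a vi vj q e :: real by linarith
  from this[OF 3 2 deg[OF v] size[OF i] c_small] show ?thesis .
qed

text \<open>The vertices of \<open>Y\<close> outside class \<open>j\<close> see nearly all of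
  \<open>Vp j\<close>, so failing to realise some pattern there costs at least a factor
  \<open>15/16\<close> for almost every vertex of the part, exponential in \<open>n / p\<close>.
  Criticality for the deletion of \<open>Y\<close> turns this into a small share of all fan-free
  orientations.\<close>

lemma few_not_rich:
  assumes Y: "Y \<subseteq> V" "card Y \<le> 4" "Y \<noteq> {}"
  shows "16 * card {S \<in> FF E. \<exists>j<p. {y \<in> Y. cl y \<noteq> j} \<noteq> {} \<and> \<not> rich E S {y \<in> Y. cl y \<noteq> j} (Vp j) (2*c+4)} \<le> card (FF E)"
proof -
  define Yj where "Yj = (\<lambda>j. {y \<in> Y. cl y \<noteq> j})"
  define N where "N = real (card (FF E))"
  have fY: "finite Y" using Y(1) fV finite_subset by blast
  have fYj: "finite (Yj j)" for j using fY unfolding Yj_def by simp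
  have Yj4: "card (Yj j) \<le> card Y" for j unfolding Yj_def by (rule card_mono[OF fY]) blast
  \<comment> \<open>The coefficient 29 is \<open>12 + 12 + 4 + 1\<close>: degrees, missing
    neighbours, witnesses, and \<open>b\<close>. The constant 12 is \<open>8 + 4\<close>: the
    missing neighbours of four vertices and the choice of the pattern.\<close>
  define \<gamma> where "\<gamma> = real (card Y) * (n - n / real p) + 29 * (\<eta> * n) + 12 - 2 / 25 * (n / real p - \<eta> * n)"
  have ft: "finite (touch E Y)" using fE unfolding touch_def by simp
  have each: "real (card {T. T \<subseteq> touch E Y \<and> Yj j \<noteq> {} \<and> \<not> rich E T (Yj j) (Vp j) (2*c+4)}) \<le> 2 powr \<gamma>" if j: "j < p" for j
  proof (cases "Yj j = {}")
    case True
    then show ?thesis by simp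
  next
    case False
    define k where "k = card (Yj j)"
    have k: "1 \<le> k" "k \<le> 4" "k \<le> card Y" unfolding k_def using False fYj[of j] Yj4[of j] Y(2) by (auto simp: Suc_le_eq card_gt_0_iff)
    have YV: "Yj j \<inter> Vp j = {}" unfolding Yj_def using Vp_cl[OF j] by blast
    have bsub: "between E (Yj j) (Vp j) \<subseteq> touch E Y" unfolding between_def touch_def Yj_def by blast
    have "card {T. T \<subseteq> touch E Y \<and> Yj j \<noteq> {} \<and> \<not> rich E T (Yj j) (Vp j) (2*c+4)} \<le>
       card {T. T \<subseteq> touch E Y \<and> \<not> rich E T (Yj j) (Vp j) (2*c+4)}" by (rule card_mono) (use ft in auto)
    also have "\<dots> \<le> 2 ^ (card (touch E Y) - card (between E (Yj j) (Vp j))) *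
       (2 ^ k * (b * (2 ^ (k * (2*c+4)) * (2 ^ k - 1) ^ card (Vp j))))"
      unfolding k_def
    proof (rule card_not_rich[OF ft _ bsub Vp_fin[OF j] fYj False YV bs(1)[OF j]])
      show "touch E Y \<subseteq> E" unfolding touch_def by blast
    qed
    finally have "real (card {T. T \<subseteq> touch E Y \<and> Yj j \<noteq> {} \<and> \<not> rich E T (Yj j) (Vp j) (2*c+4)}) \<le>
       real (2 ^ (card (touch E Y) - card (between E (Yj j) (Vp j))) * (2 ^ k * (b * (2 ^ (k * (2*c+4)) * (2 ^ k - 1) ^ card (Vp j)))))"
      by (rule of_nat_mono)
    also have "\<dots> = 2 powr real (card (touch E Y) - card (between E (Yj j) (Vp j))) * (2 powr real k *
       (real b * (2 powr (real k * real (2*c+4)) * (2 ^ k - 1) ^ card (Vp j))))"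
    proof -
      have "real (2 ^ k - 1) = 2 ^ k - 1" by (simp add: of_nat_diff)
      moreover have "(2::real) ^ (k * (2*c+4)) = 2 powr (real k * real (2*c+4))" by (simp add: powr_realpow[symmetric])
      ultimately show ?thesis by (simp only: of_nat_mult of_nat_power of_nat_numeral powr_realpow zero_less_numeral)
    qed
    also have "\<dots> \<le> 2 powr real (card (touch E Y) - card (between E (Yj j) (Vp j))) * (2 powr real k *
       (2 powr (\<eta> * n) * (2 powr (real k * real (2*c+4)) * 2 powr (real k * real (card (Vp j)) - 2 / 25 * real (card (Vp j))))))"
      by (intro mult_left_mono mult_mono bs(2) two_pow_minus_one_le k order.refl) auto
    also have "\<dots> = 2 powr (real (card (touch E Y) - card (between E (Yj j) (Vp j))) + (real k +
       (\<eta> * n + (real k * real (2*c+4) + (real k * real (card (Vp j)) - 2 / 25 * real (card (Vp j)))))))"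
      by (simp only: powr_add[symmetric])
    also have "\<dots> \<le> 2 powr \<gamma>"
    proof (rule powr_mono)
      have "card (between E (Yj j) (Vp j)) \<le> card (touch E Y)" by (rule card_mono[OF ft bsub])
      then have 1: "real (card (touch E Y) - card (between E (Yj j) (Vp j))) = real (card (touch E Y)) - real (card (between E (Yj j) (Vp j)))"
        by (rule of_nat_diff)
      have "real (card (touch E Y)) \<le> (\<Sum>y\<in>Y. real (card (touch E {y})))"
        using of_nat_mono[OF card_touch_le[OF fY fE], where ?'a = real] unfolding of_nat_sum .
      also have "\<dots> \<le> (\<Sum>y\<in>Y. n - n / real p + 3 * (\<eta> * n))" by (rule sum_mono) (use degree_upper Y(1) in blast)
      also have "\<dots> = real (card Y) * (n - n / real p) + real (card Y) * (3 * (\<eta> * n))" by (simp add: algebra_simps)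
      also have "real (card Y) * (3 * (\<eta> * n)) \<le> 4 * (3 * (\<eta> * n))"
        using Y(2) \<eta>(1) by (intro mult_right_mono) auto
      finally have 2: "real (card (touch E Y)) \<le> real (card Y) * (n - n / real p) + 12 * (\<eta> * n)" by simp
      have "real k * (real (card (Vp j)) - (3 * (\<eta> * n) + 2)) = (\<Sum>y\<in>Yj j. real (card (Vp j)) - (3 * (\<eta> * n) + 2))" unfolding k_def by simp
      also have "\<dots> \<le> (\<Sum>y\<in>Yj j. real (card {a \<in> Vp j. {a, y} \<in> E}))"
      proof (rule sum_mono)
        fix y assume "y \<in> Yj j"
        then have "y \<in> V" "j \<noteq> cl y" using Y(1) unfolding Yj_def by auto
        then show "real (card (Vp j)) - (3 * (\<eta> * n) + 2) \<le> real (card {a \<in> Vp j. {a, y} \<in> E})" by (rule neighbours_lower[OF _ j])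
      qed
      also have "\<dots> = real (card (between E (Yj j) (Vp j)))"
        unfolding card_between_eq[OF fYj Vp_fin[OF j] YV] of_nat_sum ..
      finally have 3: "real k * real (card (Vp j)) - real k * (3 * (\<eta> * n) + 2) \<le> real (card (between E (Yj j) (Vp j)))"
        by (simp add: right_diff_distrib)
      have 4: "real k * (3 * (\<eta> * n) + 2) \<le> 4 * (3 * (\<eta> * n) + 2)" using k(2) \<eta>(1) by (intro mult_right_mono) auto
      have "real k * real (2*c+4) \<le> 4 * real (2*c+4)" using k(2) by (intro mult_right_mono) auto
      also have "\<dots> \<le> 4 * (\<eta> * n)" using c_small by (intro mult_left_mono) auto
      finally have 5: "real k * real (2*c+4) \<le> 4 * (\<eta> * n)" .
      have 6: "real k \<le> 4" using k(2) by simp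
      show "real (card (touch E Y) - card (between E (Yj j) (Vp j))) + (real k +
       (\<eta> * n + (real k * real (2*c+4) + (real k * real (card (Vp j)) - 2 / 25 * real (card (Vp j)))))) \<le> \<gamma>"
      proof -
        have "t \<le> yq + 12 * e \<Longrightarrow> kv - ke \<le> bt \<Longrightarrow> ke \<le> 4 * (3 * e + 2) \<Longrightarrow> kc \<le> 4 * e \<Longrightarrow> k' \<le> 4 \<Longrightarrow> q - e \<le> v \<Longrightarrow>
          t - bt + (k' + (e + (kc + (kv - 2 / 25 * v)))) \<le> yq + 29 * e + 12 - 2 / 25 * (q - e)"
          for t yq e kv ke bt kc k' q v :: real by argo
        from this[OF 2 3 4 5 6 size[OF j]] show ?thesis unfolding \<gamma>_def 1 .
      qed
    qed simp
    finally show ?thesis .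
  qed
  have res: "rich E (S \<inter> touch E Y) (Yj j) (Vp j) (2*c+4) = rich E S (Yj j) (Vp j) (2*c+4)" for S j
    by (rule rich_restrict) (auto simp: between_def touch_def Yj_def)
  define Bad where "Bad = {S \<in> FF E. \<exists>j<p. Yj j \<noteq> {} \<and> \<not> rich E S (Yj j) (Vp j) (2*c+4)}"
  define P' where "P' = (\<lambda>T. \<exists>j<p. Yj j \<noteq> {} \<and> \<not> rich E T (Yj j) (Vp j) (2*c+4))"
  have "card Bad \<le> card (FF (del E Y)) * card {T. T \<subseteq> touch E Y \<and> P' T}"
    unfolding Bad_def by (rule card_FF_split[OF fE]) (simp add: P'_def res)
  then have 1: "real (card Bad) \<le> real (card (FF (del E Y))) * real (card {T. T \<subseteq> touch E Y \<and> P' T})"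
    unfolding of_nat_mult[symmetric] by (rule of_nat_mono)
  have "{T. T \<subseteq> touch E Y \<and> P' T} = (\<Union>j<p. {T. T \<subseteq> touch E Y \<and> Yj j \<noteq> {} \<and> \<not> rich E T (Yj j) (Vp j) (2*c+4)})"
    unfolding P'_def by auto
  then have "card {T. T \<subseteq> touch E Y \<and> P' T} \<le> (\<Sum>j<p. card {T. T \<subseteq> touch E Y \<and> Yj j \<noteq> {} \<and> \<not> rich E T (Yj j) (Vp j) (2*c+4)})"
    using card_UN_le[of "{..<p}" "\<lambda>j. {T. T \<subseteq> touch E Y \<and> Yj j \<noteq> {} \<and> \<not> rich E T (Yj j) (Vp j) (2*c+4)}"] by simp
  then have "real (card {T. T \<subseteq> touch E Y \<and> P' T}) \<le> (\<Sum>j<p. real (card {T. T \<subseteq> touch E Y \<and> Yj j \<noteq> {} \<and> \<not> rich E T (Yj j) (Vp j) (2*c+4)}))"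
    unfolding of_nat_sum[symmetric] by (rule of_nat_mono)
  also have "\<dots> \<le> (\<Sum>j<p. 2 powr \<gamma>)" by (rule sum_mono) (use each in blast)
  also have "\<dots> = real p * 2 powr \<gamma>" by simp
  also have "\<dots> \<le> 2 powr real p * 2 powr \<gamma>" by (intro mult_right_mono real_le_two_powr) simp
  finally have 2: "real (card {T. T \<subseteq> touch E Y \<and> P' T}) \<le> 2 powr real p * 2 powr \<gamma>" .
  have 3: "real (card (FF (del E Y))) \<le> 2 * N * 2 powr (- (2 * turan_density p * (real (card Y) * (n - real (card Y)))))"
    unfolding N_def by (rule crit4[unfolded crit_def, rule_format, OF Y(1,3,2)])
  have "real (card Bad) \<le> (2 * N * 2 powr (- (2 * turan_density p * (real (card Y) * (n - real (card Y)))))) * (2 powr real p * 2 powr \<gamma>)"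
    by (rule order.trans[OF 1 mult_mono[OF 3 2]]) (simp_all add: N_def)
  also have "\<dots> = N * (2 powr 1 * 2 powr (- (2 * turan_density p * (real (card Y) * (n - real (card Y))))) * (2 powr real p * 2 powr \<gamma>))" by simp
  also have "\<dots> = N * 2 powr (1 + - (2 * turan_density p * (real (card Y) * (n - real (card Y)))) + (real p + \<gamma>))"
    by (simp only: powr_add[symmetric])
  also have "\<dots> \<le> N * 2 powr (- 4)"
  proof (intro mult_left_mono powr_mono)
    have td: "2 * turan_density p * x = x - x / real p" for x
      unfolding turan_density_def using p2 by (simp add: field_simps)
    have e: "2 * turan_density p * (real (card Y) * (n - real (card Y))) =
       real (card Y) * (n - n / real p) - 2 * turan_density p * (real (card Y) * real (card Y))"
      unfolding td by (simp add: algebra_simps diff_divide_distrib)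
    have "real (card Y) * real (card Y) \<le> 4 * 4" using Y(2) by (intro mult_mono) auto
    moreover have "0 \<le> real (card Y) * real (card Y) / real p" by simp
    ultimately have 16: "2 * turan_density p * (real (card Y) * real (card Y)) \<le> 16" unfolding td by linarith
    \<comment> \<open>The gain \<open>2/25 * (n / p)\<close> exceeds \<open>29 * \<eta> * n\<close>,
      since \<open>\<eta> * n\<close> is at most \<open>n / p / 1000\<close>; the assumption
      \<open>large\<close> lets the difference absorb \<open>p\<close> and the constants.\<close>
    have a: "40 * (real p + 40) \<le> n / real p" "\<eta> * n \<le> n / real p / 1000"
      using large p_pos \<eta>n by (simp_all add: field_simps)
    show "1 + - (2 * turan_density p * (real (card Y) * (n - real (card Y)))) + (real p + \<gamma>) \<le> - 4"
    proof -
      have "40 * (p' + 40) \<le> q \<Longrightarrow> e \<le> q / 1000 \<Longrightarrow> t \<le> 16 \<Longrightarrow>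
         1 + - (yq - t) + (p' + (yq + 29 * e + 12 - 2 / 25 * (q - e))) \<le> - 4" if "0 \<le> p'" for p' q e t yq :: real using that by (simp add: algebra_simps)
      from this[OF _ a 16] show ?thesis unfolding \<gamma>_def e by simp
    qed
  qed (simp_all add: N_def)
  also have "\<dots> = N / 16" by (simp add: powr_minus)
  finally have "real (16 * card Bad) \<le> real (card (FF E))" unfolding N_def by simp
  then show ?thesis unfolding Bad_def Yj_def by (simp only: of_nat_le_iff)
qed

end

section \<open>Edges inside the classes\<close>

context near_turan
begin

definition good :: "nat set \<Rightarrow> nat set set \<Rightarrow> bool" where
  "good Y S \<longleftrightarrow> universal p c E S Vp \<and>
     (\<forall>j<p. {y \<in> Y. cl y \<noteq> j} \<noteq> {} \<longrightarrow> rich E S {y \<in> Y. cl y \<noteq> j} (Vp j) (2*c+4))"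

text \<open>Lack of universality and lack of richness each affect at most a sixteenth of
  \<open>FF E\<close>.\<close>

lemma many_good:
  assumes "Y \<subseteq> V" "card Y \<le> 4" "Y \<noteq> {}"
  shows "7 * card (FF E) \<le> 8 * card {S \<in> FF E. good Y S}"
proof -
  let ?N = "{S. S \<subseteq> E \<and> \<not> universal p c E S Vp}"
  let ?R = "{S \<in> FF E. \<exists>j<p. {y \<in> Y. cl y \<noteq> j} \<noteq> {} \<and> \<not> rich E S {y \<in> Y. cl y \<noteq> j} (Vp j) (2*c+4)}"
  let ?G = "{S \<in> FF E. good Y S}"
  have fin: "finite ?N" "finite ?R" "finite ?G" using fE by simp_all
  have sub: "FF E \<subseteq> ?N \<union> (?R \<union> ?G)"
  proof
    fix S assume S: "S \<in> FF E"
    then have "S \<subseteq> E" unfolding FF_def by simp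
    then show "S \<in> ?N \<union> (?R \<union> ?G)" using S unfolding good_def by blast
  qed
  have "card (FF E) \<le> card (?N \<union> (?R \<union> ?G))" by (rule card_mono[OF _ sub]) (use fin in simp)
  also have "\<dots> \<le> card ?N + (card ?R + card ?G)"
    by (rule order.trans[OF card_Un_le add_left_mono[OF card_Un_le]])
  finally show ?thesis using nonuniv few_not_rich[OF assms] by linarith
qed

lemma ex_good:
  assumes "Y \<subseteq> V" "card Y \<le> 4" "Y \<noteq> {}"
  obtains S where "S \<in> FF E" "good Y S"
proof -
  have "0 < card (FF E)" using big by simp
  then have "0 < card {S \<in> FF E. good Y S}" using many_good[OF assms] by linarith
  then have "{S \<in> FF E. good Y S} \<noteq> {}" by (metis card.empty less_irrefl)
  then show ?thesis using that by blast
qed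

lemma host: "good Y S \<Longrightarrow> universal_host p A c E S Vp"
  by unfold_locales (use Vp_fin Vp_card Vp_disj in \<open>simp_all add: good_def\<close>)

lemma good_rich:
  assumes "good Y S" "j < p" "Z \<subseteq> Y" "Z \<noteq> {}" "\<And>z. z \<in> Z \<Longrightarrow> cl z \<noteq> j"
  shows "rich E S Z (Vp j) (2*c+4)"
proof (rule rich_subset)
  have sub: "Z \<subseteq> {y \<in> Y. cl y \<noteq> j}" using assms(3,5) by blast
  then show "Z \<subseteq> {y \<in> Y. cl y \<noteq> j}" .
  have "{y \<in> Y. cl y \<noteq> j} \<noteq> {}" using sub assms(4) by blast
  then show "rich E S {y \<in> Y. cl y \<noteq> j} (Vp j) (2*c+4)" using assms(1,2) unfolding good_def by simp
qed (rule Vp_fin[OF assms(2)])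

definition inner :: "nat \<Rightarrow> nat \<Rightarrow> bool" where
  "inner x y \<longleftrightarrow> {x, y} \<in> E \<and> cl x = cl y"

lemma inner_V: "inner x y \<Longrightarrow> x \<in> V \<and> y \<in> V \<and> x \<noteq> y"
proof -
  assume "inner x y"
  then have e: "{x, y} \<in> E" unfolding inner_def by blast
  obtain a d where ad: "{x, y} = {a, d}" "a \<in> V" "d \<in> V" "a \<noteq> d" by (rule edges_onE[OF subsetD[OF E e]])
  then show ?thesis by (auto simp: doubleton_eq_iff)
qed

lemma no_inner_star:
  assumes "inner x y" "inner x z" "y \<noteq> z"
  shows False
proof -
  have V: "{x, y, z} \<subseteq> V" using inner_V assms by blast
  obtain S where S: "S \<in> FF E" "good {x, y, z} S"
    by (rule ex_good[OF V]) (auto simp: card_insert_if)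
  interpret h: universal_host p A c E S Vp by (rule host[OF S(2)])
  have "fan_in E S"
  proof (rule h.star_fan)
    show "distinct [x, y, z]" using inner_V[OF assms(1)] inner_V[OF assms(2)] assms(3) by simp
    show "cl x < p" using cl V by blast
    show "{x, y} \<in> E" "{x, z} \<in> E" using assms unfolding inner_def by blast+
    show "rich E S {x, y, z} (Vp j) (2*c+4)" if "j < p" "j \<noteq> cl x" for j
      by (rule good_rich[OF S(2) that(1)]) (use assms that in \<open>auto simp: inner_def\<close>)
  qed
  then show False using S(1) unfolding FF_def by blast
qed

lemma no_inner_matching:
  assumes "inner x y" "inner z w" "distinct [x, y, z, w]" "j < p" "j \<noteq> cl x" "j \<noteq> cl z"
  shows False
proof -
  have V: "{x, y, z, w} \<subseteq> V" using inner_V assms by blast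
  obtain S where S: "S \<in> FF E" "good {x, y, z, w} S"
    by (rule ex_good[OF V]) (auto simp: card_insert_if)
  interpret h: universal_host p A c E S Vp by (rule host[OF S(2)])
  have cxy: "cl y = cl x" "cl w = cl z" using assms(1,2) unfolding inner_def by simp_all
  have "fan_in E S"
  proof (rule h.matching_fan[OF assms(3) _ _ assms(4-6)])
    show "cl x < p" "cl z < p" using cl V by blast+
    show "{x, y} \<in> E" "{z, w} \<in> E" using assms unfolding inner_def by blast+
    show "rich E S {x, y, z, w} (Vp j) (2*c+4)"
      by (rule good_rich[OF S(2) assms(4)]) (use assms(5,6) cxy in auto)
    show "rich E S {x, y} (Vp l) (2*c+4)" if "l < p" "l \<noteq> cl x" for l
      by (rule good_rich[OF S(2) that(1)]) (use that(2) cxy in auto)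
    show "rich E S {z, w} (Vp l) (2*c+4)" if "l < p" "l \<noteq> cl z" for l
      by (rule good_rich[OF S(2) that(1)]) (use that(2) cxy in auto)
  qed
  then show False using S(1) unfolding FF_def by blast
qed

text \<open>In the case \<open>p = 2\<close> with one inner edge in each part, the two inner edges span a \<open>K\<^sub>4\<close>,
  and only 24 of its 64 orientations avoid completing a fan centred at one of its vertices.\<close>

lemma inner_pair_two_parts:
  assumes p: "p = 2" and xy: "inner x y" and zw: "inner z w" and d: "distinct [x, y, z, w]" and c2: "cl x \<noteq> cl z"
    and cross: "{x, z} \<in> E" "{x, w} \<in> E" "{y, z} \<in> E" "{y, w} \<in> E"
  shows "8 * card {S \<in> FF E. good {x, y, z, w} S} \<le> 3 * 2 ^ card E"
proof -
  have V: "x \<in> V" "y \<in> V" "z \<in> V" "w \<in> V" using inner_V xy zw by blast+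
  have cxy: "cl y = cl x" "cl w = cl z" using xy zw unfolding inner_def by simp_all
  have cp: "cl x < p" "cl z < p" using cl V by blast+
  have ed: "{x, y} \<in> E" "{z, w} \<in> E" using xy zw unfolding inner_def by blast+
  have ne: "x \<noteq> y" "x \<noteq> z" "x \<noteq> w" "y \<noteq> z" "y \<noteq> w" "z \<noteq> w" using d by auto
  have blk0: "blk p 0 = {1, 2}" using p by auto
  have "\<exists>v\<in>{1, 2}. (v, 0) \<in> A" "\<exists>v\<in>{1, 2}. (0, v) \<in> A"
    unfolding blk0[symmetric] by (rule A_in, simp) (rule A_out, simp)
  then obtain a a' where a: "a \<in> {1, 2}" "(a, 0) \<in> A" and a': "a' \<in> {1, 2}" "(0, a') \<in> A" by blast
  have "a \<noteq> a'" using a a' A_orient[OF A_adj[OF a(2)]] by blast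
  then have aa: "{a, a'} = {1, 2}" using a(1) a'(1) by auto
  have adj: "fan_adj p a a'"
  proof -
    have "a \<in> insert 0 (blk p 0)" "a' \<in> insert 0 (blk p 0)" using a(1) a'(1) p by auto
    then show ?thesis unfolding fan_adj_def using \<open>a \<noteq> a'\<close> by (intro conjI exI[of _ 0]) auto
  qed
  \<comment> \<open>Distinguishes whether the triangle of the first block is transitive or cyclic:
    its third arc goes along or against the path from \<open>a\<close> through the centre to
    \<open>a'\<close>.\<close>
  define ab where "ab = ((a, a') \<in> A)"
  have ba: "(a', a) \<in> A \<longleftrightarrow> \<not> ab" unfolding ab_def using A_orient[OF adj] by blast
  define E6 where "E6 = {{x, y}, {z, w}, {x, z}, {x, w}, {y, z}, {y, w}}"
  have E6: "E6 \<subseteq> E" unfolding E6_def using ed cross by blast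
  have c6: "card E6 = 6" unfolding E6_def using ne by (simp add: doubleton_eq_iff)
  define bits where "bits = (\<lambda>S. (arc E S x y, arc E S z w, arc E S x z, arc E S x w, arc E S y z, arc E S y w))"
  have arcE: "arc E S u v \<longleftrightarrow> ({u, v} \<in> S \<longleftrightarrow> u < v)" if "{u, v} \<in> E" "u \<noteq> v" for S u v
    unfolding arc_def using that by simp
  have inj: "inj_on bits (Pow E6)"
  proof (rule inj_onI)
    fix S T assume ST: "S \<in> Pow E6" "T \<in> Pow E6" "bits S = bits T"
    have "{x, y} \<in> S \<longleftrightarrow> {x, y} \<in> T" "{z, w} \<in> S \<longleftrightarrow> {z, w} \<in> T" "{x, z} \<in> S \<longleftrightarrow> {x, z} \<in> T"
      "{x, w} \<in> S \<longleftrightarrow> {x, w} \<in> T" "{y, z} \<in> S \<longleftrightarrow> {y, z} \<in> T" "{y, w} \<in> S \<longleftrightarrow> {y, w} \<in> T"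
      using ST(3) unfolding bits_def prod.inject
        arcE[OF ed(1) ne(1)] arcE[OF ed(2) ne(6)] arcE[OF cross(1) ne(2)] arcE[OF cross(2) ne(3)] arcE[OF cross(3) ne(4)] arcE[OF cross(4) ne(5)]
      by argo+
    then have "e \<in> S \<longleftrightarrow> e \<in> T" if "e \<in> E6" for e using that unfolding E6_def by blast
    then show "S = T" using ST(1,2) by blast
  qed
  have bits_res: "bits (S \<inter> E6) = bits S" for S
    unfolding bits_def prod.inject
      arcE[OF ed(1) ne(1)] arcE[OF ed(2) ne(6)] arcE[OF cross(1) ne(2)] arcE[OF cross(2) ne(3)] arcE[OF cross(3) ne(4)] arcE[OF cross(4) ne(5)]
    by (simp add: E6_def)
  have four: "four_bits ab (bits S)" if S: "S \<in> FF E" "good {x, y, z, w} S" for S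
  proof -
    interpret h: universal_host p A c E S Vp by (rule host[OF S(2)])
    have free: "\<not> fan_in E S" using S(1) unfolding FF_def by blast
    have tri: "\<not> (arc E S u x' \<and> arc E S x' v \<and> (if ab then arc E S u v else arc E S v u))"
      if t: "distinct [x', y', u, v]" "{x', y'} \<in> E" "i < p" "{x', y'} \<subseteq> {x, y, z, w}" "cl x' \<noteq> i" "cl y' \<noteq> i" for x' y' u v i
    proof
      assume arcs: "arc E S u x' \<and> arc E S x' v \<and> (if ab then arc E S u v else arc E S v u)"
      have "rich E S {x', y'} (Vp i) (2*c+4)"
        by (rule good_rich[OF S(2) t(3,4)]) (use t(5,6) in auto)
      moreover have "(a, a') \<in> A \<Longrightarrow> arc E S u v" "(a', a) \<in> A \<Longrightarrow> arc E S v u"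
        using arcs ba unfolding ab_def by simp_all
      ultimately have "fan_in E S"
        using h.triangle_fan[OF p t(1) t(3)[unfolded p] t(2) _ aa a(2) a'(2)] arcs by blast
      then show False using free by blast
    qed
    have rev: "arc E S y x \<longleftrightarrow> \<not> arc E S x y" "arc E S w z \<longleftrightarrow> \<not> arc E S z w" "arc E S z x \<longleftrightarrow> \<not> arc E S x z"
      "arc E S w x \<longleftrightarrow> \<not> arc E S x w" "arc E S z y \<longleftrightarrow> \<not> arc E S y z" "arc E S w y \<longleftrightarrow> \<not> arc E S y w"
      using arc_cases[OF ed(1) ne(1), of S] arc_cases[OF ed(2) ne(6), of S] arc_cases[OF cross(1) ne(2), of S]
        arc_cases[OF cross(2) ne(3), of S] arc_cases[OF cross(3) ne(4), of S] arc_cases[OF cross(4) ne(5), of S] by blast+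
    have edr: "{y, x} \<in> E" "{w, z} \<in> E" using ed by (simp_all add: insert_commute)
    have side: "cl x \<noteq> cl z" "cl y \<noteq> cl z" "cl z \<noteq> cl x" "cl w \<noteq> cl x" using c2 cxy by simp_all
    note tz = tri[OF _ _ cp(2)] and tx = tri[OF _ _ cp(1)]
    have dd: "distinct [x, y, z, w]" "distinct [x, y, w, z]" "distinct [y, x, z, w]" "distinct [y, x, w, z]"
      "distinct [z, w, x, y]" "distinct [z, w, y, x]" "distinct [w, z, x, y]" "distinct [w, z, y, x]"
      using ne by simp_all
    have in4: "{x, y} \<subseteq> {x, y, z, w}" "{y, x} \<subseteq> {x, y, z, w}" "{z, w} \<subseteq> {x, y, z, w}" "{w, z} \<subseteq> {x, y, z, w}" by simp_all
    \<comment> \<open>Together with \<open>t'\<close> these are eight configurations: each of the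
      four vertices as centre, with both directions of the path through it.\<close>
    note t = tz[OF dd(1) ed(1) in4(1) side(1,2)] tz[OF dd(2) ed(1) in4(1) side(1,2)]
      tz[OF dd(3) edr(1) in4(2) side(2,1)] tz[OF dd(4) edr(1) in4(2) side(2,1)]
    note t' = tx[OF dd(5) ed(2) in4(3) side(3,4)] tx[OF dd(6) ed(2) in4(3) side(3,4)]
      tx[OF dd(7) edr(2) in4(4) side(4,3)] tx[OF dd(8) edr(2) in4(4) side(4,3)]
    show ?thesis unfolding four_bits_def bits_def prod.case
      using t[unfolded rev] t'[unfolded rev] by (cases ab; simp; blast?)
  qed
  have fE6: "finite E6" unfolding E6_def by simp
  let ?T = "{T \<in> Pow E6. four_bits ab (bits T)}"
  have "card ?T = card (bits ` ?T)" by (rule card_image[symmetric], rule inj_on_subset[OF inj]) blast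
  also have "\<dots> \<le> card {t. four_bits ab t}" by (rule card_mono) auto
  also have "\<dots> \<le> 24" by (rule card_four_bits)
  finally have T: "card ?T \<le> 24" .
  \<comment> \<open>Only the trace on the six edges is restricted; the other
    \<open>card E - 6\<close> edges count fully.\<close>
  have "card {S \<in> FF E. good {x, y, z, w} S} \<le> card ?T * card (Pow (E - E6))"
  proof (rule card_le_split[where ?E1.0 = E6 and ?E2.0 = "E - E6"])
    fix S assume S: "S \<in> {S \<in> FF E. good {x, y, z, w} S}"
    then have SE: "S \<subseteq> E" unfolding FF_def by simp
    then show "S \<subseteq> E6 \<union> (E - E6)" by blast
    have "four_bits ab (bits (S \<inter> E6))" unfolding bits_res by (rule four) (use S in simp_all)
    then show "S \<inter> E6 \<in> ?T" by simp
    show "S \<inter> (E - E6) \<in> Pow (E - E6)" by blast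
  qed (use fE fE6 in simp_all)
  also have "\<dots> \<le> 24 * 2 ^ (card E - 6)"
    using T fE fE6 E6 c6 by (simp add: card_Pow card_Diff_subset)
  finally have "8 * card {S \<in> FF E. good {x, y, z, w} S} \<le> 3 * (2 ^ 6 * 2 ^ (card E - 6))" by simp
  also have "2 ^ 6 * 2 ^ (card E - 6) = (2::nat) ^ (6 + (card E - 6))" by (simp only: power_add)
  also have "6 + (card E - 6) = card E" using card_mono[OF fE E6] c6 by simp
  finally show ?thesis .
qed

text \<open>More than \<open>2 ^ (t + 1)\<close> orientations, with \<open>t\<close> the Turan
  number, force \<open>t + 2\<close> edges, of which at most \<open>t\<close> cross the classes; so
  two inner edges exist. Excluding stars and matchings leaves \<open>p = 2\<close> and one inner
  edge in each class. Equality then holds in the edge count, all crossing edges are present, and the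
  inner edges span a \<open>K_4\<close>. At least \<open>7/8\<close> of \<open>FF E\<close> but at
  most \<open>3/8 * 2 ^ card E\<close> orientations would be good, a contradiction.\<close>

theorem contradiction: False
proof -
  define multi where "multi = {{u, v} | u v. u \<in> V \<and> v \<in> V \<and> cl u \<noteq> cl v}"
  define I where "I = {e \<in> E. \<exists>x y. e = {x, y} \<and> inner x y}"
  have fI: "finite I" using fE unfolding I_def by simp
  have m_card: "card multi \<le> turan_num (card V) p"
    unfolding multi_def by (rule multipartite_card_le_turan[OF _ fV cl]) (use p2 in simp_all)
  have fm: "finite multi" unfolding multi_def
    by (rule finite_subset[of _ "(\<lambda>(u, v). {u, v}) ` (V \<times> V)"]) (use fV in auto)
  have crossm: "E - I \<subseteq> multi"
  proof
    fix e assume e: "e \<in> E - I"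
    obtain u v where uv: "e = {u, v}" "u \<in> V" "v \<in> V" "u \<noteq> v" by (rule edges_onE[OF subsetD[OF E DiffD1[OF e]]])
    have "cl u \<noteq> cl v" using e uv(1) unfolding I_def inner_def by blast
    then show "e \<in> multi" using uv unfolding multi_def by blast
  qed
  have cE: "card E = card I + card (E - I)"
  proof -
    have "I \<subseteq> E" unfolding I_def by blast
    then show ?thesis using card_Diff_subset[OF fI] card_mono[OF fE] by simp
  qed
  have "card (FF E) \<le> card (Pow E)" by (rule card_mono) (use fE in \<open>auto simp: FF_def\<close>)
  then have "2 ^ (turan_num (card V) p + 1) < (2::nat) ^ card E" using big fE by (simp add: card_Pow)
  then have "turan_num (card V) p + 1 < card E" by (rule power_less_imp_less_exp[rotated]) simp
  then have E2: "turan_num (card V) p + 2 \<le> card E" by simp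
  have cm: "card (E - I) \<le> card multi" by (rule card_mono[OF fm crossm])
  then have I2: "2 \<le> card I" using E2 cE m_card by linarith
  have sym: "inner x y \<Longrightarrow> inner y x" for x y unfolding inner_def by (simp add: insert_commute)
  have disj: "distinct [x, y, z, w]" if "inner x y" "inner z w" "{x, y} \<noteq> {z, w}" for x y z w
  proof -
    have "x \<noteq> y" "z \<noteq> w" using inner_V that by blast+
    moreover have "x \<noteq> z"
    proof
      assume "x = z"
      then show False using no_inner_star[of x y w] that by blast
    qed
    moreover have "x \<noteq> w"
    proof
      assume "x = w"
      then show False using no_inner_star[of x y z] sym[OF that(2)] that by (auto simp: insert_commute)
    qed
    moreover have "y \<noteq> z"
    proof
      assume "y = z"
      then show False using no_inner_star[of y x w] sym[OF that(1)] that by (auto simp: insert_commute)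
    qed
    moreover have "y \<noteq> w"
    proof
      assume "y = w"
      then show False using no_inner_star[of y x z] sym[OF that(1)] sym[OF that(2)] that by (auto simp: insert_commute)
    qed
    ultimately show ?thesis by simp
  qed
  have far: "p = 2 \<and> cl x \<noteq> cl z" if "inner x y" "inner z w" "{x, y} \<noteq> {z, w}" for x y z w
  proof (rule ccontr)
    assume no: "\<not> (p = 2 \<and> cl x \<noteq> cl z)"
    have "\<exists>j<p. j \<noteq> cl x \<and> j \<noteq> cl z"
    proof (rule ccontr)
      assume "\<not> ?thesis"
      then have "{..<p} \<subseteq> {cl x, cl z}" by blast
      then have "card {..<p} \<le> card {cl x, cl z}" by (rule card_mono[rotated]) simp
      then have "p \<le> card {cl x, cl z}" by simp
      then show False using no p2 by (cases "cl x = cl z") auto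
    qed
    then show False using no_inner_matching[OF that(1,2) disj[OF that]] by blast
  qed
  obtain e1 e2 where e12: "e1 \<in> I" "e2 \<in> I" "e1 \<noteq> e2"
  proof -
    have "\<not> is_singleton I" "I \<noteq> {}" using I2 by (auto simp: is_singleton_altdef)
    then show ?thesis using that by (metis is_singletonI')
  qed
  obtain x y where xy: "e1 = {x, y}" "inner x y" using e12(1) unfolding I_def by blast
  obtain z w where zw: "e2 = {z, w}" "inner z w" using e12(2) unfolding I_def by blast
  have p: "p = 2" "cl x \<noteq> cl z" using far[OF xy(2) zw(2)] e12(3) xy(1) zw(1) by simp_all
  have I_eq: "I = {e1, e2}"
  proof (rule ccontr)
    assume "I \<noteq> {e1, e2}"
    then obtain e where e: "e \<in> I" "e \<noteq> e1" "e \<noteq> e2" using e12 by blast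
    then obtain s t where st: "e = {s, t}" "inner s t" unfolding I_def by blast
    have "cl s \<noteq> cl x" "cl s \<noteq> cl z"
      using far[OF st(2) xy(2)] far[OF st(2) zw(2)] e(2,3) st(1) xy(1) zw(1) by simp_all
    moreover have "cl s < 2" "cl x < 2" "cl z < 2" using cl inner_V xy(2) zw(2) st(2) p(1) by blast+
    ultimately show False using p(2) by linarith
  qed
  then have "card I = 2" using e12(3) by simp
  then have eq: "card E = turan_num (card V) p + 2" "card multi \<le> card (E - I)" using E2 cE m_card cm by linarith+
  then have multiE: "E - I = multi" using card_seteq[OF fm crossm] by blast
  have V: "x \<in> V" "y \<in> V" "z \<in> V" "w \<in> V" using inner_V xy zw by blast+
  have cxy: "cl y = cl x" "cl w = cl z" using xy(2) zw(2) unfolding inner_def by simp_all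
  have crossE: "{u, v} \<in> E" if "u \<in> V" "v \<in> V" "cl u \<noteq> cl v" for u v
  proof -
    have "{u, v} \<in> multi" using that unfolding multi_def by blast
    then show ?thesis using multiE by blast
  qed
  have d: "distinct [x, y, z, w]" using disj[OF xy(2) zw(2)] e12(3) xy(1) zw(1) by simp
  have "8 * card {S \<in> FF E. good {x, y, z, w} S} \<le> 3 * 2 ^ card E"
    by (rule inner_pair_two_parts[OF p(1) xy(2) zw(2) d p(2)]) (use crossE V cxy p(2) in auto)
  moreover have "7 * card (FF E) \<le> 8 * card {S \<in> FF E. good {x, y, z, w} S}"
    by (rule many_good) (use V in \<open>auto simp: card_insert_if\<close>)
  ultimately have "7 * card (FF E) \<le> 3 * 2 ^ card E" by linarith
  also have "\<dots> = 6 * 2 ^ (turan_num (card V) p + 1)" unfolding eq(1) by simp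
  finally show False using big by linarith
qed

end

section \<open>The upper bound\<close>

lemma turan_num_mono:
  assumes "p > 0" "m \<le> n"
  shows "turan_num m p \<le> turan_num n p"
proof (rule lift_Suc_mono_le[OF _ assms(2)])
  show "turan_num k p \<le> turan_num (Suc k) p" for k unfolding turan_num_Suc[OF assms(1)] by (rule le_add1)
qed

text \<open>Linear-size version of the estimate for dense vertices: two parts of size at least
  \<open>w\<close> contribute only their witnesses, so at most \<open>n - 2 * w\<close> edges at
  \<open>u\<close> are free.\<close>

lemma card_not_rich_twice_powr:
  assumes fE: "finite E" and E: "E \<subseteq> edges_on V" "finite V" "u \<in> V" and p: "p \<ge> 1"
    and W: "\<And>i. i < p \<Longrightarrow> W i \<subseteq> V" "\<And>i. i < p \<Longrightarrow> u \<notin> W i"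
    and Wd: "\<And>i j. i < p \<Longrightarrow> j < p \<Longrightarrow> i \<noteq> j \<Longrightarrow> W i \<inter> W j = {}"
    and size: "\<And>i. i < p \<Longrightarrow> w \<le> real (card (W i))"
    and b: "\<And>i. i < p \<Longrightarrow> card (small_subsets (W i) c) \<le> b" "real b \<le> 2 powr e" "real c \<le> e" and pos: "0 \<le> real (card V) - 2 * w"
  shows "real (card {S. S \<subseteq> touch E {u} \<and> (\<exists>i<p. \<exists>j<p. i \<noteq> j \<and> \<not> rich E S {u} (W i) c \<and> \<not> rich E S {u} (W j) c)})
     \<le> 2 powr (2 * real p + (real (card V) - 2 * w) + 2 + 4 * e)"
proof -
  define R where "R = nat \<lfloor>real (card V) - 2 * w\<rfloor>"
  have fW: "finite (W i)" if "i < p" for i using W(1)[OF that] E(2) by (rule finite_subset)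
  have ft: "finite (touch E {u})" "touch E {u} \<subseteq> E" using fE unfolding touch_def by auto
  have "card {S. S \<subseteq> touch E {u} \<and> (\<exists>i<p. \<exists>j<p. i \<noteq> j \<and> \<not> rich E S {u} (W i) c \<and> \<not> rich E S {u} (W j) c)}
     \<le> p\<^sup>2 * (2 ^ R * (2 * (b * 2 ^ c))\<^sup>2)"
  proof (rule card_not_rich_twice[OF ft fW W(2) _ Wd b(1)])
    show "between E {u} (W i) \<subseteq> touch E {u}" for i unfolding between_def touch_def by blast
    fix i j assume ij: "i < p" "j < p" "i \<noteq> j"
    let ?X = "V - (W i \<union> W j)"
    have "touch E {u} - between E {u} (W i) - between E {u} (W j) \<subseteq> (\<lambda>a. {u, a}) ` ?X"
    proof
      fix f assume f: "f \<in> touch E {u} - between E {u} (W i) - between E {u} (W j)"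
      then have fE': "f \<in> E" "u \<in> f" unfolding touch_def by auto
      obtain a d where ad: "f = {a, d}" "a \<in> V" "d \<in> V" "a \<noteq> d" by (rule edges_onE[OF subsetD[OF E(1) fE'(1)]])
      then obtain a where a: "f = {u, a}" "a \<in> V" using fE'(2) by (metis doubleton_eq_iff insertE singletonD)
      have "a \<notin> W i" "a \<notin> W j" using f a(1) fE'(1) unfolding between_def by blast+
      then show "f \<in> (\<lambda>a. {u, a}) ` ?X" using a by blast
    qed
    then have "card (touch E {u} - between E {u} (W i) - between E {u} (W j)) \<le> card ((\<lambda>a. {u, a}) ` ?X)"
      by (rule card_mono[rotated]) (use E(2) in simp)
    also have "\<dots> \<le> card ?X" by (rule card_image_le) (use E(2) in simp)
    also have "card ?X = card V - card (W i \<union> W j)"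
      by (rule card_Diff_subset) (use fW ij W(1) in auto)
    also have "card (W i \<union> W j) = card (W i) + card (W j)" by (rule card_Un_disjoint[OF fW[OF ij(1)] fW[OF ij(2)] Wd[OF ij]])
    also have "card V - (card (W i) + card (W j)) \<le> R"
    proof -
      have "real (card V) - real (card (W i) + card (W j)) \<le> real (card V) - 2 * w"
        using size[OF ij(1)] size[OF ij(2)] by simp
      then have "real (card V - (card (W i) + card (W j))) \<le> real (card V) - 2 * w" using pos by linarith
      then show ?thesis unfolding R_def by (rule le_nat_floor)
    qed
    finally show "card (touch E {u} - between E {u} (W i) - between E {u} (W j)) \<le> R" .
  qed
  then have "real (card {S. S \<subseteq> touch E {u} \<and> (\<exists>i<p. \<exists>j<p. i \<noteq> j \<and> \<not> rich E S {u} (W i) c \<and> \<not> rich E S {u} (W j) c)})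
     \<le> real (p\<^sup>2 * (2 ^ R * (2 * (b * 2 ^ c))\<^sup>2))" by (rule of_nat_mono)
  also have "\<dots> = real p * real p * (2 powr real R * ((2 * (real b * 2 powr real c)) * (2 * (real b * 2 powr real c))))"
    by (simp add: power2_eq_square powr_realpow)
  also have "\<dots> \<le> 2 powr real p * 2 powr real p * (2 powr (real (card V) - 2 * w) *
     ((2 powr 1 * (2 powr e * 2 powr e)) * (2 powr 1 * (2 powr e * 2 powr e))))"
  proof -
    have "real R \<le> real (card V) - 2 * w" unfolding R_def using pos by linarith
    then have "2 powr real R \<le> 2 powr (real (card V) - 2 * w)" by (rule powr_mono) simp
    moreover have "2 powr real c \<le> 2 powr e" using b(3) by (rule powr_mono) simp
    ultimately show ?thesis using b(2) by (intro mult_mono real_le_two_powr) auto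
  qed
  also have "\<dots> = 2 powr (real p + real p + ((real (card V) - 2 * w) + ((1 + (e + e)) + (1 + (e + e)))))"
    by (simp only: powr_add[symmetric])
  also have "real p + real p + ((real (card V) - 2 * w) + ((1 + (e + e)) + (1 + (e + e)))) = 2 * real p + (real (card V) - 2 * w) + 2 + 4 * e" by simp
  finally show ?thesis .
qed

section \<open>The bound for large critical graphs\<close>

context anti_fan
begin

text \<open>Putting \<open>v\<close> back multiplies the count by at most 2 per edge, so criticality
  for a single vertex forces a large degree. The loss of 2 comes from the slack factor and from
  \<open>n - 1\<close> in place of \<open>n\<close>.\<close>

lemma crit_degree:
  assumes fV: "finite V" and E: "E \<subseteq> edges_on V" and cr: "crit 1 V E" and N: "card (FF E) > 0" and v: "v \<in> V"
  shows "real (card V) - real (card V) / real p - 2 \<le> real (card (touch E {v}))"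
proof -
  have fE: "finite E" by (rule finite_subset[OF E finite_edges_on[OF fV]])
  define N where "N = real (card (FF E))"
  define d where "d = real (card (touch E {v}))"
  have "card {S \<in> FF E. True} \<le> card (FF (del E {v})) * card {T. T \<subseteq> touch E {v} \<and> True}"
    by (rule card_FF_split[OF fE]) simp
  also have "card {T. T \<subseteq> touch E {v} \<and> True} = 2 ^ card (touch E {v})"
    using card_Pow[of "touch E {v}"] fE unfolding touch_def Pow_def by simp
  finally have "N \<le> real (card (FF (del E {v})) * 2 ^ card (touch E {v}))" unfolding N_def by (intro of_nat_mono) simp
  then have 1: "N \<le> real (card (FF (del E {v}))) * 2 powr d" unfolding d_def by (simp add: powr_realpow)
  have 2: "real (card (FF (del E {v}))) \<le> 2 * N * 2 powr (- (2 * turan_density p * (real (card {v}) * (real (card V) - real (card {v})))))"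
    unfolding N_def by (rule cr[unfolded crit_def, rule_format]) (use v in auto)
  have "N * 1 \<le> N * (2 powr 1 * 2 powr (- (2 * turan_density p * (real (card V) - 1))) * 2 powr d)"
    using order.trans[OF 1 mult_right_mono[OF 2]] by (simp add: mult_ac)
  then have "1 \<le> 2 powr 1 * 2 powr (- (2 * turan_density p * (real (card V) - 1))) * 2 powr d"
    using N unfolding N_def by (simp only: mult_le_cancel_left_pos of_nat_0_less_iff)
  also have "\<dots> = 2 powr (1 + - (2 * turan_density p * (real (card V) - 1)) + d)" by (simp only: powr_add[symmetric])
  finally have "2 powr 0 \<le> 2 powr (1 + - (2 * turan_density p * (real (card V) - 1)) + d)" by simp
  then have "0 \<le> 1 + - (2 * turan_density p * (real (card V) - 1)) + d" by (subst (asm) powr_le_cancel_iff) auto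
  moreover have "2 * turan_density p * (real (card V) - 1) = real (card V) - real (card V) / real p - 1 + 1 / real p"
    unfolding turan_density_def using p2 by (simp add: field_simps)
  moreover have "0 \<le> 1 / real p" by simp
  ultimately show ?thesis unfolding d_def by linarith
qed

text \<open>The minimum degree forces the classes of the nearly multipartite structure to have size
  close to \<open>n / p\<close>, and leaves few missing pairs between them. Hence almost all
  orientations are universal with parts of linear size, and each exceptional vertex can be assigned
  to a part in which it has few neighbours. A counterexample thus fulfils \<open>near_turan\<close>,
  which is contradictory.\<close>

lemma critical_upper_bound:
  "\<exists>C n0. \<forall>V E. finite V \<longrightarrow> n0 \<le> card V \<longrightarrow> E \<subseteq> edges_on V \<longrightarrow> crit C V E \<longrightarrow>
     card (FF E) \<le> 2 ^ (turan_num (card V) p + 1)"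
proof -
  have p0: "real p \<ge> 2" and p1: "p \<ge> 1" using p2 by simp_all
  define \<eta> where "\<eta> = 1 / (1000 * real p)"
  have \<eta>: "\<eta> > 0" unfolding \<eta>_def using p0 by simp
  obtain \<kappa>0 where \<kappa>0: "\<kappa>0 > 0" "\<And>(A::nat set) n c. finite A \<Longrightarrow> card A \<le> n \<Longrightarrow> real c \<le> \<kappa>0 * real n \<Longrightarrow>
     real (card (small_subsets A c)) \<le> 2 powr (\<eta> * real n)" using card_small_subsets[OF \<eta>] by blast
  define \<kappa> where "\<kappa> = min \<kappa>0 \<eta>"
  have \<kappa>: "\<kappa> > 0" "\<kappa> \<le> \<kappa>0" "\<kappa> \<le> \<eta>" unfolding \<kappa>_def using \<kappa>0 \<eta> by auto
  define \<kappa>' where "\<kappa>' = \<kappa> / 8 / (4 * real p)"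
  define \<xi> where "\<xi> = pattern_rate p"
  have \<kappa>'0: "\<kappa>' > 0" and \<xi>0: "\<xi> > 0" unfolding \<kappa>'_def \<xi>_def using \<kappa> p0 pattern_rate(1)[OF p1] by auto
  \<comment> \<open>\<open>\<epsilon> * n\<^sup>2\<close> bounds the surplus of edges over the Turan
    number and \<open>3 * \<epsilon> * n\<^sup>2\<close> the missing pairs, each of which spoils at
    most one transversal. The choice keeps their joint cost below half of the saving
    \<open>\<xi> * \<kappa>'\<^sup>2 * n\<^sup>2\<close>.\<close>
  define \<epsilon> where "\<epsilon> = min (\<eta> / 4) (\<xi> * \<kappa>'\<^sup>2 / (2 * (1 + 3 * \<xi>)))"
  have \<epsilon>: "\<epsilon> > 0" "4 * \<epsilon> \<le> \<eta>" unfolding \<epsilon>_def using \<eta> \<kappa>'0 \<xi>0 by auto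
  have \<epsilon>\<xi>: "\<epsilon> * (1 + 3 * \<xi>) \<le> \<xi> * \<kappa>'\<^sup>2 / 2"
  proof -
    have "\<epsilon> * (1 + 3 * \<xi>) \<le> \<xi> * \<kappa>'\<^sup>2 / (2 * (1 + 3 * \<xi>)) * (1 + 3 * \<xi>)" unfolding \<epsilon>_def using \<xi>0 by (intro mult_right_mono) auto
    also have "\<dots> = \<xi> * \<kappa>'\<^sup>2 / 2" using \<xi>0 by (simp add: field_simps)
    finally show ?thesis .
  qed
  obtain C1 n1 where near: "\<forall>V E. finite V \<longrightarrow> n1 \<le> card V \<longrightarrow> E \<subseteq> edges_on V \<longrightarrow>
     2 powr (turan_density p * (real (card V) * (real (card V) - 1))) \<le> real (card (FF E)) \<longrightarrow> crit C1 V E \<longrightarrow>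
     (\<exists>U cl. U \<subseteq> V \<and> real (card U) \<le> \<epsilon> * real (card V) \<and> (\<forall>v\<in>V - U. cl v < p) \<and>
        (\<forall>u\<in>V - U. \<forall>v\<in>V - U. {u, v} \<in> E \<longrightarrow> cl u \<noteq> cl v))" using nearly_multipartite[OF \<epsilon>(1)] by (elim exE)
  have "\<xi> * \<kappa>'\<^sup>2 / 2 > 0" using \<xi>0 \<kappa>'0 by simp
  then obtain n2 where n2: "\<And>n::nat. n \<ge> n2 \<Longrightarrow> 2 * real p * real n + (4 * real p * real p + 4) < \<xi> * \<kappa>'\<^sup>2 / 2 * (real n)\<^sup>2"
    using quadratic_dominates by blast
  define n0 where "n0 = n1 + n2 + nat \<lceil>8 / \<kappa>\<rceil> + nat \<lceil>4 * real p / (\<kappa> / 8)\<rceil> + nat \<lceil>(2 * real p + 2) / \<epsilon>\<rceil> + nat \<lceil>40 * real p * (real p + 40)\<rceil>"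
  have "card (FF E) \<le> 2 ^ (turan_num (card V) p + 1)"
    if fV: "finite V" and nn: "n0 \<le> card V" and E: "E \<subseteq> edges_on V" and cr: "crit (C1 + 4) V E" for V E
  proof (rule ccontr)
    assume "\<not> ?thesis"
    then have big: "2 ^ (turan_num (card V) p + 1) < card (FF E)" by simp
    define n where "n = real (card V)"
    have fE: "finite E" by (rule finite_subset[OF E finite_edges_on[OF fV]])
    have N0: "card (FF E) > 0" using big by simp
    have l1: "n1 \<le> card V" "n2 \<le> card V" using nn unfolding n0_def by simp_all
    have "8 / \<kappa> \<le> n" "4 * real p / (\<kappa> / 8) \<le> n" "(2 * real p + 2) / \<epsilon> \<le> n" and large: "40 * real p * (real p + 40) \<le> n"
      using nn unfolding n0_def n_def by linarith+
    then have l2: "8 \<le> \<kappa> * n" "4 * real p \<le> \<kappa> / 8 * n" "2 * real p + 2 \<le> \<epsilon> * n"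
      using \<kappa>(1) \<epsilon>(1) by (simp_all add: field_simps)
    have n_pos: "n > 0" using large p0 by (meson less_le_trans mult_pos_pos zero_less_numeral add_pos_pos less_le_trans)
    have q_large: "40 * (real p + 40) \<le> n / real p" using large p0 by (simp add: field_simps)
    have \<eta>n: "\<eta> * n = n / real p / 1000" unfolding \<eta>_def by simp
    have "real (2 ^ (turan_num (card V) p + 1)) < real (card (FF E))" using big by (simp only: of_nat_less_iff)
    then have bigr: "2 powr (real (turan_num (card V) p) + 1) < real (card (FF E))" by (simp add: powr_add powr_realpow)
    have "turan_density p * (n * (n - 1)) \<le> real (turan_num (card V) p) + 1"
      using turan_num_lower[of p "card V"] p1 unfolding n_def by simp
    then have "2 powr (turan_density p * (n * (n - 1))) \<le> 2 powr (real (turan_num (card V) p) + 1)" by (rule powr_mono) simp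
    then have "2 powr (turan_density p * (real (card V) * (real (card V) - 1))) \<le> real (card (FF E))" using bigr unfolding n_def by linarith
    from near[rule_format, OF fV l1(1) E this crit_mono[OF cr]]
    obtain U cl0 where U0: "U \<subseteq> V \<and> real (card U) \<le> \<epsilon> * real (card V) \<and> (\<forall>v\<in>V - U. cl0 v < p) \<and>
        (\<forall>u\<in>V - U. \<forall>v\<in>V - U. {u, v} \<in> E \<longrightarrow> cl0 u \<noteq> cl0 v)" by auto
    have U: "U \<subseteq> V" "real (card U) \<le> \<epsilon> * n" "\<And>v. v \<in> V - U \<Longrightarrow> cl0 v < p"
      "\<And>u v. u \<in> V - U \<Longrightarrow> v \<in> V - U \<Longrightarrow> {u, v} \<in> E \<Longrightarrow> cl0 u \<noteq> cl0 v" using U0 unfolding n_def by blast+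
    have fU: "finite U" using U(1) fV finite_subset by blast
    define Vp where "Vp = (\<lambda>i. {v \<in> V - U. cl0 v = i})"
    have Vp_sub: "Vp i \<subseteq> V" for i unfolding Vp_def by blast
    have Vp_fin: "finite (Vp i)" for i using Vp_sub fV finite_subset by blast
    have Vp_disj: "i \<noteq> j \<Longrightarrow> Vp i \<inter> Vp j = {}" for i j unfolding Vp_def by blast
    have deg: "n - n / real p - 2 \<le> real (card {u \<in> V. {u, v} \<in> E})" if "v \<in> V" for v
      using crit_degree[OF fV E crit_mono[OF cr] N0 that] unfolding n_def card_touch_singleton[OF E that] by simp
    have out: "card {u \<in> V. {u, v} \<in> E} \<le> card (V - Vp i)" if "v \<in> Vp i" for v i
    proof (rule card_mono)
      show "{u \<in> V. {u, v} \<in> E} \<subseteq> V - Vp i"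
      proof
        fix u assume u: "u \<in> {u \<in> V. {u, v} \<in> E}"
        have "u \<notin> Vp i"
        proof
          assume "u \<in> Vp i"
          then show False using U(4)[of u v] u that unfolding Vp_def by simp
        qed
        then show "u \<in> V - Vp i" using u by simp
      qed
    qed (use fV in simp)
    have Vp_out: "real (card (V - Vp i)) = n - real (card (Vp i))" for i
      using card_Diff_subset[OF Vp_fin Vp_sub, of i] card_mono[OF fV Vp_sub, of i] unfolding n_def by (simp add: of_nat_diff)
    \<comment> \<open>A vertex of \<open>Vp i\<close> has no neighbour in \<open>Vp i\<close>, so
      its degree bounds the size of the class.\<close>
    have upper: "real (card (Vp i)) \<le> n / real p + 2" for i
    proof (cases "Vp i = {}")
      case True
      then show ?thesis using n_pos by simp
    next
      case False
      then obtain v where v: "v \<in> Vp i" by blast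
      have "v \<in> V" using v Vp_sub by blast
      from deg[OF this] out[OF v] Vp_out[of i] show ?thesis by linarith
    qed
    \<comment> \<open>The other classes hold at most \<open>(p - 1) * (n / p + 2)\<close> vertices
      and \<open>U\<close> at most \<open>\<epsilon> * n\<close>; the second
      \<open>\<epsilon> * n\<close> absorbs the rounding terms.\<close>
    have lower: "n / real p - 2 * (\<epsilon> * n) \<le> real (card (Vp i))" if i: "i < p" for i
    proof -
      have "V - U = (\<Union>j<p. Vp j)" unfolding Vp_def using U(3) by blast
      then have "card (V - U) \<le> (\<Sum>j<p. card (Vp j))" using card_UN_le[of "{..<p}" Vp] by simp
      also have "\<dots> = card (Vp i) + (\<Sum>j\<in>{..<p} - {i}. card (Vp j))" by (rule sum.remove) (use i in simp_all)
      finally have "real (card (V - U)) \<le> real (card (Vp i)) + (\<Sum>j\<in>{..<p} - {i}. real (card (Vp j)))"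
        unfolding of_nat_sum[symmetric] of_nat_add[symmetric] by (rule of_nat_mono)
      also have "(\<Sum>j\<in>{..<p} - {i}. real (card (Vp j))) \<le> (\<Sum>j\<in>{..<p} - {i}. n / real p + 2)" by (rule sum_mono) (rule upper)
      also have "\<dots> = (real p - 1) * (n / real p + 2)" using i by (simp add: card_Diff_subset of_nat_diff)
      also have "\<dots> = n - n / real p + 2 * real p - 2" using p0 by (simp add: field_simps)
      finally have "real (card (V - U)) \<le> real (card (Vp i)) + (n - n / real p + 2 * real p - 2)" by simp
      moreover have "real (card (V - U)) = n - real (card U)"
        using card_Diff_subset[OF fU U(1)] card_mono[OF fV U(1)] unfolding n_def by (simp add: of_nat_diff)
      ultimately show ?thesis using U(2) l2(3) by linarith
    qed
    define c where "c = nat \<lceil>\<kappa> / 8 * n\<rceil>"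
    have c1: "\<kappa> / 8 * real (card V) \<le> real c" unfolding c_def n_def by linarith
    have "0 \<le> \<kappa> / 8 * n" using \<kappa>(1) n_pos by simp
    then have "real c \<le> \<kappa> / 8 * n + 1" unfolding c_def by linarith
    then have c2: "real (2*c+4) \<le> \<kappa> * n" using l2(1) by simp
    have "\<kappa> * n \<le> \<kappa>0 * n" "\<kappa> * n \<le> \<eta> * n" using \<kappa> n_pos by (auto intro: mult_right_mono)
    then have c3: "real (2*c+4) \<le> \<kappa>0 * n" "real (2*c+4) \<le> \<eta> * n" using c2 by linarith+
    define b where "b = nat \<lfloor>2 powr (\<eta> * n)\<rfloor>"
    have b: "real b \<le> 2 powr (\<eta> * n)" unfolding b_def by simp
    have sb: "card (small_subsets (Vp i) (2*c+4)) \<le> b" for i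
      unfolding b_def by (rule le_nat_floor) (use \<kappa>0(2)[OF Vp_fin card_mono[OF fV Vp_sub]] c3(1) in \<open>simp add: n_def\<close>)
    have e\<eta>: "4 * (\<epsilon> * n) \<le> \<eta> * n" using mult_right_mono[OF \<epsilon>(2), of n] n_pos by simp
    have \<epsilon>n0: "0 \<le> \<epsilon> * n" using \<epsilon>(1) n_pos by simp
    have size: "n / real p - \<eta> * n \<le> real (card (Vp i))" if "i < p" for i using lower[OF that] e\<eta> \<epsilon>n0 by linarith
    have Vp_card: "2 * c \<le> card (Vp i)" if "i < p" for i
    proof -
      have "real (2 * c) \<le> real (card (Vp i))" using size[OF that] c3(2) \<eta>n q_large p0 by simp
      then show ?thesis by (simp only: of_nat_le_iff)
    qed
    \<comment> \<open>The absent pairs between different classes; minimum degree and class size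
      leave each vertex at most \<open>3 * \<epsilon> * n\<close> of them.\<close>
    define Mis where "Mis = (\<Union>v\<in>V - U. (\<lambda>a. {v, a}) ` {a \<in> V - U. cl0 a \<noteq> cl0 v \<and> {v, a} \<notin> E})"
    have miss: "real (card {a \<in> V - U. cl0 a \<noteq> cl0 v \<and> {v, a} \<notin> E}) \<le> 3 * (\<epsilon> * n)" if v: "v \<in> V - U" for v
    proof -
      let ?i = "cl0 v"
      have vV: "v \<in> Vp ?i" "v \<in> V" using v unfolding Vp_def by simp_all
      let ?A = "{a \<in> V - U. cl0 a \<noteq> cl0 v \<and> {v, a} \<notin> E}" and ?B = "{u \<in> V. {u, v} \<in> E}"
      have "?A \<inter> ?B = {}" by (auto simp: insert_commute)
      then have "card ?A + card ?B = card (?A \<union> ?B)" using fV by (simp add: card_Un_disjoint)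
      also have "\<dots> \<le> card (V - Vp ?i)"
      proof (rule card_mono)
        show "?A \<union> ?B \<subseteq> V - Vp ?i"
        proof
          fix a assume "a \<in> ?A \<union> ?B"
          then show "a \<in> V - Vp ?i" using U(4)[of a v] v unfolding Vp_def by auto
        qed
      qed (use fV in simp)
      finally have "real (card ?A) + real (card ?B) \<le> n - real (card (Vp ?i))" using Vp_out[of ?i] by linarith
      then show ?thesis using deg[OF vV(2)] lower[OF U(3)[OF v]] l2(3) p0 by linarith
    qed
    have fMis: "finite Mis" unfolding Mis_def using fV by simp
    define M where "M = nat \<lfloor>3 * (\<epsilon> * n) * n\<rfloor>"
    have M1: "real M \<le> 3 * (\<epsilon> * n) * n" unfolding M_def using \<epsilon>n0 n_pos by simp
    have M2: "card Mis \<le> M"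
    proof -
      have "card Mis \<le> (\<Sum>v\<in>V - U. card ((\<lambda>a. {v, a}) ` {a \<in> V - U. cl0 a \<noteq> cl0 v \<and> {v, a} \<notin> E}))"
        unfolding Mis_def by (rule card_UN_le) (use fV in simp)
      also have "\<dots> \<le> (\<Sum>v\<in>V - U. card {a \<in> V - U. cl0 a \<noteq> cl0 v \<and> {v, a} \<notin> E})"
        by (rule sum_mono, rule card_image_le) (use fV in simp)
      finally have "real (card Mis) \<le> (\<Sum>v\<in>V - U. real (card {a \<in> V - U. cl0 a \<noteq> cl0 v \<and> {v, a} \<notin> E}))"
        unfolding of_nat_sum[symmetric] by (rule of_nat_mono)
      also have "\<dots> \<le> (\<Sum>v\<in>V - U. 3 * (\<epsilon> * n))" by (rule sum_mono) (rule miss)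
      also have "\<dots> = real (card (V - U)) * (3 * (\<epsilon> * n))" by simp
      also have "\<dots> \<le> n * (3 * (\<epsilon> * n))"
        using card_mono[OF fV, of "V - U"] \<epsilon>n0 unfolding n_def by (intro mult_right_mono) auto
      finally show ?thesis unfolding M_def by (intro le_nat_floor) (simp add: mult.commute)
    qed
    \<comment> \<open>The edges avoiding \<open>U\<close> form a \<open>p\<close>-partite graph, and
      at most \<open>card U * n\<close> edges meet \<open>U\<close>.\<close>
    have cardE: "real (card E) \<le> real (turan_num (card V) p) + \<epsilon> * n * n"
    proof -
      define multi where "multi = {{u, v} | u v. u \<in> V - U \<and> v \<in> V - U \<and> cl0 u \<noteq> cl0 v}"
      have fm: "finite multi" unfolding multi_def
        by (rule finite_subset[of _ "(\<lambda>(u, v). {u, v}) ` (V \<times> V)"]) (use fV in auto)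
      have ft: "finite (touch E U)" using fE unfolding touch_def by simp
      have "E \<subseteq> multi \<union> touch E U"
      proof
        fix e assume e: "e \<in> E"
        obtain u v where uv: "e = {u, v}" "u \<in> V" "v \<in> V" "u \<noteq> v" by (rule edges_onE[OF subsetD[OF E e]])
        show "e \<in> multi \<union> touch E U"
        proof (cases "u \<in> U \<or> v \<in> U")
          case True
          then show ?thesis using e uv(1) unfolding touch_def by auto
        next
          case False
          then have "cl0 u \<noteq> cl0 v" using U(4)[of u v] uv e by simp
          then show ?thesis using False uv unfolding multi_def by blast
        qed
      qed
      then have "card E \<le> card (multi \<union> touch E U)" by (rule card_mono[rotated]) (use fm ft in simp)
      also have "\<dots> \<le> card multi + card (touch E U)" by (rule card_Un_le)
      also have "card multi \<le> turan_num (card (V - U)) p" unfolding multi_def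
        by (rule multipartite_card_le_turan) (use p1 fV U(3) in auto)
      also have "\<dots> \<le> turan_num (card V) p" by (rule turan_num_mono) (use p1 card_mono[OF fV, of "V - U"] in auto)
      also have "card (touch E U) \<le> (\<Sum>u\<in>U. card (touch E {u}))" by (rule card_touch_le[OF fU fE])
      also have "\<dots> \<le> (\<Sum>u\<in>U. card V)"
      proof (rule sum_mono)
        fix u assume "u \<in> U"
        then have "u \<in> V" using U(1) by blast
        then show "card (touch E {u}) \<le> card V" using card_touch_singleton[OF E] card_mono[OF fV, of "{x \<in> V. {x, u} \<in> E}"] by simp
      qed
      finally have "card E \<le> turan_num (card V) p + card U * card V" by simp
      then have "real (card E) \<le> real (turan_num (card V) p) + real (card U) * n"
        unfolding n_def of_nat_mult[symmetric] of_nat_add[symmetric] by (rule of_nat_mono)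
      also have "real (card U) * n \<le> \<epsilon> * n * n" using U(2) n_pos by (intro mult_right_mono) auto
      finally show ?thesis by simp
    qed
    have m: "\<kappa>' * n \<le> real (c div (2*p))" unfolding \<kappa>'_def n_def
      by (rule div_ge_real[OF c1 p1]) (use \<kappa>(1) l2(2) in \<open>simp_all add: n_def\<close>)
    have nonuniv: "16 * card {S. S \<subseteq> E \<and> \<not> universal p c E S Vp} \<le> card (FF E)"
    proof -
      have "real (card {S. S \<subseteq> E \<and> \<not> universal p c E S Vp}) \<le>
        2 powr (real (2*p*card V + 4*p^2) + real (card E) - pattern_rate p * (real ((c div (2*p))^2) - real M))"
      proof (rule card_nonuniversal_powr[OF p1 fE Vp_fin card_mono[OF fV Vp_sub] fMis M2])
        fix i j u v assume ij: "i \<noteq> j" "u \<in> Vp i" "v \<in> Vp j" "{u, v} \<notin> E"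
        have "v \<in> {a \<in> V - U. cl0 a \<noteq> cl0 u \<and> {u, a} \<notin> E}" "u \<in> V - U" using ij unfolding Vp_def by auto
        then show "{u, v} \<in> Mis" unfolding Mis_def by blast
      qed
      also have "\<dots> \<le> 2 powr (real (turan_num (card V) p) + 1 + - 4)"
      proof (rule powr_mono)
        have "(\<kappa>' * n)\<^sup>2 \<le> (real (c div (2*p)))\<^sup>2" using m \<kappa>'0 n_pos by (intro power_mono) auto
        then have 1: "\<xi> * (\<kappa>' * n)\<^sup>2 \<le> \<xi> * real ((c div (2*p))\<^sup>2)" unfolding of_nat_power using \<xi>0 by (intro mult_left_mono) auto
        have 2: "\<xi> * (\<kappa>' * n)\<^sup>2 = \<xi> * \<kappa>'\<^sup>2 * n\<^sup>2" by (simp add: power_mult_distrib)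
        have 3: "\<xi> * real M \<le> \<xi> * (3 * (\<epsilon> * n) * n)" using M1 \<xi>0 by (intro mult_left_mono) auto
        have 4: "\<epsilon> * (1 + 3 * \<xi>) * n\<^sup>2 \<le> \<xi> * \<kappa>'\<^sup>2 / 2 * n\<^sup>2" using \<epsilon>\<xi> by (intro mult_right_mono) auto
        have 5: "\<epsilon> * (1 + 3 * \<xi>) * n\<^sup>2 = \<epsilon> * n * n + \<xi> * (3 * (\<epsilon> * n) * n)" by (simp add: power2_eq_square algebra_simps)
        have 6: "2 * real p * n + (4 * real p * real p + 4) < \<xi> * \<kappa>'\<^sup>2 / 2 * n\<^sup>2" using n2[OF l1(2)] unfolding n_def .
        have 7: "real (2*p*card V + 4*p^2) = 2 * real p * n + 4 * real p * real p" unfolding n_def by (simp add: power2_eq_square)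
        have fin: "a1 + eE - (x1 - x2) \<le> t + 1 + - 4" if "x0 \<le> x1" "x2 \<le> y2" "z = en + y2" "z \<le> x0 / 2" "a1 + 4 < x0 / 2" "eE \<le> t + en"
          for a1 eE x1 x2 t x0 y2 z en :: real using that by linarith
        show "real (2*p*card V + 4*p^2) + real (card E) - pattern_rate p * (real ((c div (2*p))^2) - real M) \<le> real (turan_num (card V) p) + 1 + - 4"
          unfolding \<xi>_def[symmetric] right_diff_distrib 7
          by (rule fin[OF 1[unfolded 2] 3 5]) (use 4 6 cardE in simp_all)
      qed simp
      also have "\<dots> = 2 powr (real (turan_num (card V) p) + 1) / 16" unfolding powr_add by (simp add: powr_minus)
      finally have "real (16 * card {S. S \<subseteq> E \<and> \<not> universal p c E S Vp}) \<le> real (card (FF E))" using bigr by simp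
      then show ?thesis by (simp only: of_nat_le_iff)
    qed
    \<comment> \<open>A vertex dense to all parts would have two nearly determined stars in every
      universal fan-free orientation. By criticality these orientations would make up at most half
      of \<open>FF E\<close>, while at most a sixteenth is non-universal.\<close>
    have dense_no: "\<exists>i<p. card {a \<in> Vp i. {a, u} \<in> E} \<le> 2 * (2*c+4)" if u: "u \<in> U" for u
    proof (rule ccontr)
      assume "\<not> ?thesis"
      then have d: "2 * (2*c+4) \<le> card {a \<in> Vp i. {a, u} \<in> E}" if "i < p" for i using that by (meson less_imp_le not_le)
      have uV: "u \<in> V" using u U(1) by blast
      have uVp: "u \<notin> Vp i" for i using u unfolding Vp_def by simp
      define P' where "P' = (\<lambda>T. \<exists>i<p. \<exists>j<p. i \<noteq> j \<and> \<not> rich E T {u} (Vp i) (2*c+4) \<and> \<not> rich E T {u} (Vp j) (2*c+4))"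
      have res: "rich E (S \<inter> touch E {u}) {u} (Vp i) (2*c+4) = rich E S {u} (Vp i) (2*c+4)" for S i
        by (rule rich_restrict) (auto simp: between_def touch_def)
      have "card {S \<in> FF E. universal p c E S Vp} \<le> card (FF (del E {u})) * card {T. T \<subseteq> touch E {u} \<and> P' T}"
      proof (rule card_FF_split[OF fE])
        fix S assume S: "S \<in> FF E" "universal p c E S Vp"
        interpret h: universal_host p A c E S Vp
          by unfold_locales (use S(2) Vp_fin Vp_card Vp_disj in simp_all)
        have "\<not> fan_in E S" using S(1) unfolding FF_def by blast
        from h.ex_two_not_rich[OF this uVp d] show "P' (S \<inter> touch E {u})" unfolding P'_def res .
      qed
      then have 1: "real (card {S \<in> FF E. universal p c E S Vp}) \<le> real (card (FF (del E {u}))) * real (card {T. T \<subseteq> touch E {u} \<and> P' T})"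
        unfolding of_nat_mult[symmetric] by (rule of_nat_mono)
      define N where "N = real (card (FF E))"
      have 2: "real (card (FF (del E {u}))) \<le> 2 * N * 2 powr (- (2 * turan_density p * (real (card {u}) * (n - real (card {u})))))"
        unfolding N_def n_def by (rule cr[unfolded crit_def, rule_format]) (use uV in auto)
      have w0: "0 \<le> n - 2 * (n / real p - 2 * (\<epsilon> * n))"
      proof -
        have "n / real p \<le> n / 2" using p0 n_pos by (intro divide_left_mono) auto
        moreover have "q \<le> m / 2 \<Longrightarrow> 0 \<le> e \<Longrightarrow> 0 \<le> m - 2 * (q - 2 * e)" for q m e :: real by (argo | (simp add: field_simps))
        ultimately show ?thesis using \<epsilon>n0 by blast
      qed
      have 3: "real (card {T. T \<subseteq> touch E {u} \<and> P' T}) \<le> 2 powr (2 * real p + (real (card V) - 2 * (n / real p - 2 * (\<epsilon> * n))) + 2 + 4 * (\<eta> * n))"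
        unfolding P'_def
        by (rule card_not_rich_twice_powr[OF fE E fV uV p1 Vp_sub uVp Vp_disj lower sb b c3(2)]) (use w0 in \<open>simp_all add: n_def\<close>)
      have "real (card {S \<in> FF E. universal p c E S Vp}) \<le>
         (2 * N * 2 powr (- (2 * turan_density p * (real (card {u}) * (n - real (card {u})))))) *
         2 powr (2 * real p + (real (card V) - 2 * (n / real p - 2 * (\<epsilon> * n))) + 2 + 4 * (\<eta> * n))"
        by (rule order.trans[OF 1 mult_mono[OF 2 3]]) (simp_all add: N_def)
      also have "\<dots> = N * (2 powr 1 * 2 powr (- (2 * turan_density p * (n - 1))) *
         2 powr (2 * real p + (n - 2 * (n / real p - 2 * (\<epsilon> * n))) + 2 + 4 * (\<eta> * n)))" unfolding n_def by simp
      also have "\<dots> = N * 2 powr (1 + - (2 * turan_density p * (n - 1)) + (2 * real p + (n - 2 * (n / real p - 2 * (\<epsilon> * n))) + 2 + 4 * (\<eta> * n)))"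
        by (simp only: powr_add[symmetric])
      also have "\<dots> \<le> N * 2 powr (- 1)"
      proof (intro mult_left_mono powr_mono)
        have td: "2 * turan_density p * (n - 1) = n - n / real p - 1 + 1 / real p"
          unfolding turan_density_def using p0 by (simp add: field_simps)
        have fin: "1 + - (n - q - 1 + r) + (2 * p' + (n - 2 * (q - 2 * e)) + 2 + 4 * h) \<le> - 1"
          if "0 \<le> r" "40 * (p' + 40) \<le> q" "h = q / 1000" "4 * e \<le> h" "0 \<le> p'" for q r p' e h :: real using that by (argo | (simp add: field_simps))
        show "1 + - (2 * turan_density p * (n - 1)) + (2 * real p + (n - 2 * (n / real p - 2 * (\<epsilon> * n))) + 2 + 4 * (\<eta> * n)) \<le> - 1"
          unfolding td by (rule fin[OF _ q_large \<eta>n e\<eta>]) simp_all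
      qed (simp_all add: N_def)
      finally have half: "2 * real (card {S \<in> FF E. universal p c E S Vp}) \<le> N" by (simp add: powr_minus)
      have "FF E \<subseteq> {S. S \<subseteq> E \<and> \<not> universal p c E S Vp} \<union> {S \<in> FF E. universal p c E S Vp}" unfolding FF_def by blast
      then have "card (FF E) \<le> card ({S. S \<subseteq> E \<and> \<not> universal p c E S Vp} \<union> {S \<in> FF E. universal p c E S Vp})"
        by (rule card_mono[rotated]) (use fE in simp)
      also have "\<dots> \<le> card {S. S \<subseteq> E \<and> \<not> universal p c E S Vp} + card {S \<in> FF E. universal p c E S Vp}" by (rule card_Un_le)
      finally have "N \<le> real (card {S. S \<subseteq> E \<and> \<not> universal p c E S Vp}) + real (card {S \<in> FF E. universal p c E S Vp})" unfolding N_def by linarith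
      moreover have "16 * real (card {S. S \<subseteq> E \<and> \<not> universal p c E S Vp}) \<le> N" using nonuniv unfolding N_def by linarith
      ultimately show False using half N0 unfolding N_def by linarith
    qed
    define cl where "cl = (\<lambda>v. if v \<in> U then SOME i. i < p \<and> card {a \<in> Vp i. {a, v} \<in> E} \<le> 2 * (2*c+4) else cl0 v)"
    have clU: "cl v < p \<and> card {a \<in> Vp (cl v). {a, v} \<in> E} \<le> 2 * (2*c+4)" if v: "v \<in> U" for v
    proof -
      have "\<exists>i. i < p \<and> card {a \<in> Vp i. {a, v} \<in> E} \<le> 2 * (2*c+4)" using dense_no[OF v] by blast
      from someI_ex[OF this] show ?thesis unfolding cl_def using v by simp
    qed
    have clV: "cl v < p \<and> card {a \<in> Vp (cl v). {a, v} \<in> E} \<le> 2 * (2*c+4)" if v: "v \<in> V" for v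
    proof (cases "v \<in> U")
      case False
      have "{a \<in> Vp (cl0 v). {a, v} \<in> E} = {}"
      proof (rule equals0I)
        fix a assume "a \<in> {a \<in> Vp (cl0 v). {a, v} \<in> E}"
        then show False using U(4)[of a v] v False unfolding Vp_def by simp
      qed
      then have "card {a \<in> Vp (cl0 v). {a, v} \<in> E} = 0" by (simp only: card.empty)
      then show ?thesis using U(3)[of v] v False unfolding cl_def by simp
    qed (rule clU)
    interpret near_turan p A V E Vp cl c b \<eta>
    proof
      show "finite V" "E \<subseteq> edges_on V" by (rule fV, rule E)
      show "Vp i \<subseteq> V" for i by (rule Vp_sub)
      show "cl v = i" if "i < p" "v \<in> Vp i" for i v using that unfolding cl_def Vp_def by simp
      show "cl v < p" "card {a \<in> Vp (cl v). {a, v} \<in> E} \<le> 2 * (2*c+4)" if "v \<in> V" for v using clV[OF that] by simp_all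
      show "real (card V) / real p - \<eta> * real (card V) \<le> real (card (Vp i))" if "i < p" for i using size[OF that] unfolding n_def .
      show "real (card V) - real (card V) / real p - 2 \<le> real (card (touch E {v}))" if "v \<in> V" for v
        using deg[OF that] unfolding n_def card_touch_singleton[OF E that] .
      show "real (2*c+4) \<le> \<eta> * real (card V)" using c3(2) unfolding n_def .
      show "card (small_subsets (Vp i) (2*c+4)) \<le> b" for i by (rule sb)
      show "real b \<le> 2 powr (\<eta> * real (card V))" using b unfolding n_def .
      show "0 \<le> \<eta>" "\<eta> \<le> 1 / (1000 * real p)" using \<eta> unfolding \<eta>_def by simp_all
      show "40 * real p * (real p + 40) \<le> real (card V)" using large unfolding n_def .
      show "crit 4 V E" by (rule crit_mono[OF cr]) simp
      show "16 * card {S. S \<subseteq> E \<and> \<not> universal p c E S Vp} \<le> card (FF E)" by (rule nonuniv)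
      show "2 ^ (turan_num (card V) p + 1) < card (FF E)" by (rule big)
    qed
    show False by (rule contradiction)
  qed
  then show ?thesis by (intro exI[of _ "C1 + 4"] exI[of _ n0]) simp
qed

end

section \<open>Progressive induction\<close>

context anti_fan
begin

lemma del_subset: "E \<subseteq> edges_on V \<Longrightarrow> del E X \<subseteq> edges_on (V - X)"
proof
  fix e assume "E \<subseteq> edges_on V" "e \<in> del E X"
  then have e: "e \<in> edges_on V" "e \<inter> X = {}" unfolding del_def by auto
  obtain a b where ab: "e = {a, b}" "a \<in> V" "b \<in> V" "a \<noteq> b" by (rule edges_onE[OF e(1)])
  then have "a \<in> V - X" "b \<in> V - X" using e(2) by auto
  then show "e \<in> edges_on (V - X)" using ab unfolding edges_on_def by blast
qed

text \<open>Progressive induction: as long as the bound fails, some boundedly large vertex set can be removed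
  so that the ratio of the number of fan-free orientations to \<open>2 ^ turan_num n p\<close> at least doubles.
  This can happen only boundedly often, as the ratio is bounded on small vertex sets.\<close>

lemma progressive_bound:
  assumes C: "C \<ge> 1"
    and crit: "\<And>V E. finite V \<Longrightarrow> n0 \<le> card V \<Longrightarrow> E \<subseteq> edges_on V \<Longrightarrow> crit C V E \<Longrightarrow> card (FF E) \<le> 2 ^ (turan_num (card V) p + 1)"
    and "finite V" "n0 \<le> card V" "E \<subseteq> edges_on V" "2 ^ (turan_num (card V) p + 1) < card (FF E)"
  shows "real (card (FF E)) * 2 powr ((real (card V) - real n0) / real C) \<le> 2 powr (real (turan_num (card V) p) + (real n0)\<^sup>2)"
  using assms(3-6)
proof (induction "card V" arbitrary: V E rule: less_induct)
  case less
  have p1: "p > 0" using p2 by simp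
  define n where "n = card V"
  define N where "N = real (card (FF E))"
  have "\<not> crit C V E" using crit[OF less.prems(1-3)] less.prems(4) by linarith
  then obtain X where X: "X \<subseteq> V" "X \<noteq> {}" "card X \<le> C"
    "\<not> real (card (FF (del E X))) \<le> 2 * N * 2 powr (- (2 * turan_density p * (real (card X) * (real n - real (card X)))))"
    unfolding crit_def N_def n_def by blast
  define h where "h = card X"
  define N' where "N' = real (card (FF (del E X)))"
  define t where "t = real (turan_num n p)"
  define t' where "t' = real (turan_num (n - h) p)"
  have fX: "finite X" using X(1) less.prems(1) finite_subset by blast
  have h: "1 \<le> h" "h \<le> C" "h \<le> n" unfolding h_def n_def using X fX card_mono[OF less.prems(1) X(1)] by (auto simp: Suc_le_eq card_gt_0_iff)
  have cV: "card (V - X) = n - h" unfolding n_def h_def by (rule card_Diff_subset[OF fX X(1)])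
  have dE: "del E X \<subseteq> edges_on (V - X)" by (rule del_subset[OF less.prems(3)])
  have fV': "finite (V - X)" using less.prems(1) by simp
  have diff: "2 * turan_density p * (real h * (real n - real h)) \<le> t - t'"
    unfolding t_def t'_def by (rule turan_num_difference[OF p1 h(3)])
  have N0: "N \<ge> 0" unfolding N_def by simp
  have "2 * N * 2 powr (- (t - t')) \<le> 2 * N * 2 powr (- (2 * turan_density p * (real h * (real n - real h))))"
    using diff N0 by (intro mult_left_mono powr_mono) auto
  also have "\<dots> < N'" using X(4) unfolding N'_def h_def by simp
  finally have gain: "2 * N * 2 powr (- (t - t')) < N'" .
  have up: "2 * N \<le> N' * 2 powr (t - t')"
  proof -
    have "2 * N * 2 powr (- (t - t')) * 2 powr (t - t') \<le> N' * 2 powr (t - t')" by (intro mult_right_mono less_imp_le[OF gain]) simp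
    also have "2 * N * 2 powr (- (t - t')) * 2 powr (t - t') = 2 * N * 2 powr (- (t - t') + (t - t'))"
      by (simp only: powr_add mult.assoc)
    finally show ?thesis by simp
  qed
  \<comment> \<open>One deletion removes at most \<open>C\<close> vertices, so
    \<open>(n - n0) / C\<close> counts the doublings guaranteed before fewer than \<open>n0\<close>
    vertices remain.\<close>
  have hC: "real h / real C \<le> 1" using h C by simp
  have step: "N * 2 powr ((real n - real n0) / real C) \<le> 2 powr (t + (real n0)\<^sup>2)"
    if x: "N' * 2 powr x \<le> 2 powr (t' + (real n0)\<^sup>2)" "(real n - real n0) / real C \<le> x + 1" for x
  proof -
    have "2 * N * 2 powr x \<le> N' * 2 powr (t - t') * 2 powr x" by (rule mult_right_mono[OF up]) simp
    also have "\<dots> = N' * 2 powr x * 2 powr (t - t')" by simp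
    also have "\<dots> \<le> 2 powr (t' + (real n0)\<^sup>2) * 2 powr (t - t')" by (rule mult_right_mono[OF x(1)]) simp
    also have "\<dots> = 2 powr (t' + (real n0)\<^sup>2 + (t - t'))" by (simp only: powr_add)
    also have "t' + (real n0)\<^sup>2 + (t - t') = t + (real n0)\<^sup>2" by simp
    finally have 1: "2 * N * 2 powr x \<le> 2 powr (t + (real n0)\<^sup>2)" .
    have "N * 2 powr ((real n - real n0) / real C) \<le> N * 2 powr (x + 1)" using x(2) N0 by (intro mult_left_mono powr_mono) auto
    also have "\<dots> = 2 * N * 2 powr x" by (simp add: powr_add)
    finally show ?thesis using 1 by linarith
  qed
  show ?case
  proof (cases "n0 \<le> n - h")
    case True
    have "real (2 ^ (turan_num (card V) p + 1)) < N" unfolding N_def using less.prems(4) by (simp only: of_nat_less_iff)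
    then have "2 * 2 powr t < N" unfolding t_def n_def by (simp add: powr_realpow)
    then have "2 * (2 * 2 powr t) * 2 powr (- (t - t')) < 2 * N * 2 powr (- (t - t'))" by simp
    also have "\<dots> < N'" by (rule gain)
    also have "2 * (2 * 2 powr t) * 2 powr (- (t - t')) = 4 * 2 powr t'" by (simp add: powr_add[symmetric] mult.assoc)
    finally have "4 * 2 powr t' < N'" .
    moreover have "real (2 ^ (turan_num (n - h) p + 1)) = 2 * 2 powr t'" unfolding t'_def by (simp add: powr_realpow)
    moreover have "0 < 2 powr t'" by simp
    ultimately have "real (2 ^ (turan_num (n - h) p + 1)) < N'" by linarith
    then have big': "2 ^ (turan_num (card (V - X)) p + 1) < card (FF (del E X))" unfolding N'_def cV by (simp only: of_nat_less_iff)
    have lt: "card (V - X) < card V" unfolding cV using h unfolding n_def by linarith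
    have "N' * 2 powr ((real (n - h) - real n0) / real C) \<le> 2 powr (t' + (real n0)\<^sup>2)"
      using less.hyps[OF lt fV' _ dE big'] True unfolding N'_def t'_def cV by simp
    moreover have "(real n - real n0) / real C \<le> (real (n - h) - real n0) / real C + 1"
      using hC h(3) by (simp add: of_nat_diff diff_divide_distrib)
    ultimately show ?thesis unfolding N_def[symmetric] n_def[symmetric] t_def[symmetric] by (rule step)
  next
    case False
    \<comment> \<open>With fewer than \<open>n0\<close> vertices left the descent ends in the
      trivial bound \<open>2 ^ n0\<^sup>2\<close>.\<close>
    have "card (FF (del E X)) \<le> card (Pow (edges_on (V - X)))"
      by (rule card_mono) (use fV' dE in \<open>auto simp: FF_def\<close>)
    also have "\<dots> = 2 ^ card (edges_on (V - X))" using fV' by (simp add: card_Pow)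
    also have "\<dots> \<le> 2 ^ n0\<^sup>2"
    proof (rule power_increasing)
      have "card (edges_on (V - X)) \<le> (n - h)\<^sup>2" using card_edges_on_le[OF fV'] unfolding cV .
      also have "\<dots> \<le> n0\<^sup>2" using False by (intro power_mono) auto
      finally show "card (edges_on (V - X)) \<le> n0\<^sup>2" .
    qed simp
    finally have "N' \<le> real (2 ^ n0\<^sup>2)" unfolding N'_def by (rule of_nat_mono)
    also have "\<dots> = 2 powr (real n0)\<^sup>2" by (simp add: powr_realpow[symmetric])
    also have "\<dots> \<le> 2 powr (t' + (real n0)\<^sup>2)" by (rule powr_mono) (simp_all add: t'_def)
    finally have "N' * 2 powr 0 \<le> 2 powr (t' + (real n0)\<^sup>2)" by simp
    moreover have "(real n - real n0) / real C \<le> 0 + 1"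
    proof -
      have "real n - real n0 \<le> real h" using False by linarith
      then have "(real n - real n0) / real C \<le> real h / real C" by (rule divide_right_mono) simp
      then show ?thesis using hC by linarith
    qed
    ultimately show ?thesis unfolding N_def[symmetric] n_def[symmetric] t_def[symmetric] by (rule step)
  qed
qed

text \<open>The number of guaranteed doublings grows linearly in \<open>n\<close>, whereas the ratio
  reached at the end is at most \<open>2 ^ n0\<^sup>2\<close>; so no counterexample is
  large.\<close>

theorem fan_free_orientations_bound:
  "\<exists>n1. \<forall>V E. finite V \<longrightarrow> n1 \<le> card V \<longrightarrow> E \<subseteq> edges_on V \<longrightarrow> card (FF E) \<le> 2 ^ (turan_num (card V) p + 1)"
proof -
  obtain C0 n0 where C0: "\<forall>V E. finite V \<longrightarrow> n0 \<le> card V \<longrightarrow> E \<subseteq> edges_on V \<longrightarrow> crit C0 V E \<longrightarrow>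
     card (FF E) \<le> 2 ^ (turan_num (card V) p + 1)" using critical_upper_bound by (elim exE)
  define C where "C = Suc C0"
  have crit: "card (FF E) \<le> 2 ^ (turan_num (card V) p + 1)"
    if "finite V" "n0 \<le> card V" "E \<subseteq> edges_on V" "crit C V E" for V E
    using C0 that(1-3) crit_mono[OF that(4), of C0] unfolding C_def by simp
  \<comment> \<open>Enough vertices for \<open>n0\<^sup>2\<close> doublings, each using up at most
    \<open>C\<close> vertices.\<close>
  define n1 where "n1 = n0 + C * n0\<^sup>2"
  have "card (FF E) \<le> 2 ^ (turan_num (card V) p + 1)" if V: "finite V" "n1 \<le> card V" "E \<subseteq> edges_on V" for V E
  proof (rule ccontr)
    assume "\<not> ?thesis"
    then have big: "2 ^ (turan_num (card V) p + 1) < card (FF E)" by simp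
    have n: "n0 \<le> card V" "real n0 + real C * (real n0)\<^sup>2 \<le> real (card V)"
    proof -
      show "n0 \<le> card V" using V(2) unfolding n1_def by linarith
      show "real n0 + real C * (real n0)\<^sup>2 \<le> real (card V)" using of_nat_mono[OF V(2), where ?'a = real] unfolding n1_def by simp
    qed
    have C1: "C \<ge> 1" unfolding C_def by simp
    let ?N = "real (card (FF E))" and ?t = "real (turan_num (card V) p)"
    have 1: "?N * 2 powr ((real (card V) - real n0) / real C) \<le> 2 powr (?t + (real n0)\<^sup>2)"
      by (rule progressive_bound[OF C1 crit V(1) n(1) V(3) big])
    have "real (2 ^ (turan_num (card V) p + 1)) < ?N" using big by (simp only: of_nat_less_iff)
    then have 2: "2 * 2 powr ?t < ?N" by (simp add: powr_realpow)
    have "(real n0)\<^sup>2 \<le> (real (card V) - real n0) / real C" using n(2) C1 by (simp add: field_simps)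
    then have "2 powr (real n0)\<^sup>2 \<le> 2 powr ((real (card V) - real n0) / real C)" by (rule powr_mono) simp
    then have "(2 * 2 powr ?t) * 2 powr (real n0)\<^sup>2 \<le> ?N * 2 powr ((real (card V) - real n0) / real C)"
      using 2 by (intro mult_mono) auto
    also note 1
    finally have "2 * (2 powr ?t * 2 powr (real n0)\<^sup>2) \<le> 2 powr ?t * 2 powr (real n0)\<^sup>2" by (simp add: powr_add)
    moreover have "0 < 2 powr ?t * 2 powr (real n0)\<^sup>2" by simp
    ultimately show False by linarith
  qed
  then show ?thesis by blast
qed

end

section \<open>Counting orientations of graphs\<close>

lemma fan_block_eq: "fan_block (Suc p) a = blk p a"
  unfolding fan_block_def by auto

lemma fan_vertices_eq: "fan_vertices 2 (Suc p) = {..2*p}"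
  unfolding fan_vertices_def by auto

lemma fan_edges_eq: "fan_edges 2 (Suc p) = {{u, v} | u v. fan_adj p u v}"
  unfolding fan_edges_def fan_adj_def fan_block_eq by auto

lemma fan_adj_sym: "fan_adj p u v \<Longrightarrow> fan_adj p v u"
  unfolding fan_adj_def by auto

lemma fan_edge_iff: "{u, v} \<in> fan_edges 2 (Suc p) \<longleftrightarrow> fan_adj p u v"
proof
  assume "{u, v} \<in> fan_edges 2 (Suc p)"
  then obtain a b where ab: "{u, v} = {a, b}" "fan_adj p a b" unfolding fan_edges_eq by blast
  then have "u = a \<and> v = b \<or> u = b \<and> v = a" by (simp only: doubleton_eq_iff)
  then show "fan_adj p u v" using ab(2) fan_adj_sym[OF ab(2)] by blast
next
  assume "fan_adj p u v"
  then show "{u, v} \<in> fan_edges 2 (Suc p)" unfolding fan_edges_eq by blast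
qed

text \<open>Each block together with the centre is one of the cliques quantified over in
  \<open>anti_directed\<close>; the witnesses differ from the centre because there are no
  loops.\<close>

lemma anti_directed_anti_fan:
  assumes "2 \<le> p" "anti_directed 2 (Suc p) A"
  shows "anti_fan p A"
proof
  have or: "is_orientation (fan_edges 2 (Suc p)) A"
    and cliques: "\<And>S. S \<subseteq> fan_vertices 2 (Suc p) \<Longrightarrow> card S = Suc p \<Longrightarrow>
      (\<And>u v. u \<in> S \<Longrightarrow> v \<in> S \<Longrightarrow> u \<noteq> v \<Longrightarrow> {u, v} \<in> fan_edges 2 (Suc p)) \<Longrightarrow>
      (\<exists>v\<in>S. (v, 0) \<in> A) \<and> (\<exists>v\<in>S. (0, v) \<in> A)"
    using assms(2) unfolding anti_directed_def by blast+
  show "2 \<le> p" by (rule assms(1))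
  show adj: "fan_adj p x y" if "(x, y) \<in> A" for x y
  proof -
    have "{x, y} \<in> fan_edges 2 (Suc p)" using or that unfolding is_orientation_def by auto
    then show ?thesis unfolding fan_edge_iff .
  qed
  show "(x, y) \<in> A \<longleftrightarrow> (y, x) \<notin> A" if "fan_adj p x y" for x y
  proof -
    have "x \<noteq> y" "{x, y} \<in> fan_edges 2 (Suc p)" using that fan_edge_iff unfolding fan_adj_def by auto
    then show ?thesis using or unfolding is_orientation_def by blast
  qed
  have both: "(\<exists>v\<in>insert 0 (blk p a). (v, 0) \<in> A) \<and> (\<exists>v\<in>insert 0 (blk p a). (0, v) \<in> A)" if a: "a < 2" for a
  proof (rule cliques)
    have "a = 0 \<or> a = 1" using a by auto
    then show "insert 0 (blk p a) \<subseteq> fan_vertices 2 (Suc p)" unfolding fan_vertices_eq by auto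
    show "card (insert 0 (blk p a)) = Suc p" by (subst card_insert_disjoint) auto
    show "{u, v} \<in> fan_edges 2 (Suc p)" if "u \<in> insert 0 (blk p a)" "v \<in> insert 0 (blk p a)" "u \<noteq> v" for u v
      unfolding fan_edge_iff fan_adj_def using that a by blast
  qed
  have irr: "(0, 0) \<notin> A" using adj[of 0 0] unfolding fan_adj_def by blast
  show "\<exists>v\<in>blk p a. (v, 0) \<in> A" if "a < 2" for a using both[OF that] irr by blast
  show "\<exists>v\<in>blk p a. (0, v) \<in> A" if "a < 2" for a using both[OF that] irr by blast
qed

text \<open>A copy of \<open>K_2\<close> is a single edge at the centre, which would have to point
  both ways. This disposes of \<open>r = 2\<close>.\<close>

lemma not_anti_directed_2: "\<not> anti_directed 2 2 A"
proof
  assume ad: "anti_directed 2 2 A"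
  have eq: "fan_edges 2 2 = {{u, v} | u v. fan_adj 1 u v}" using fan_edges_eq[of 1] by (simp add: numeral_2_eq_2)
  have e: "{0, 1} \<in> fan_edges 2 2" "{1, 0} \<in> fan_edges 2 2"
    using fan_edge_iff[of 0 1 1] fan_edge_iff[of 1 0 1] by (auto simp: numeral_2_eq_2 fan_adj_def)
  have or: "is_orientation (fan_edges 2 2) A" using ad unfolding anti_directed_def by blast
  have "\<forall>S. S \<subseteq> fan_vertices 2 2 \<and> card S = 2 \<and> (\<forall>u\<in>S. \<forall>v\<in>S. u \<noteq> v \<longrightarrow> {u, v} \<in> fan_edges 2 2) \<longrightarrow>
          (\<exists>v\<in>S. (v, 0) \<in> A) \<and> (\<exists>v\<in>S. (0, v) \<in> A)" using ad unfolding anti_directed_def by blast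
  from this[rule_format, of "{0, 1}"] have "(\<exists>v\<in>{0, 1}. (v, 0) \<in> A) \<and> (\<exists>v\<in>{0, 1}. (0, v) \<in> A)"
    using e by (auto simp: fan_vertices_def)
  moreover have "(0, 0) \<notin> A" using or unfolding is_orientation_def by blast
  ultimately have "(1, 0) \<in> A" "(0, 1) \<in> A" by auto
  moreover have "(0, 1) \<in> A \<longleftrightarrow> (1, 0) \<notin> A"
    using or e(1) unfolding is_orientation_def by (metis zero_neq_one)
  ultimately show False by blast
qed

lemma all_edges_eq: "all_edges n = edges_on {..<n}"
  unfolding all_edges_def edges_on_def by auto

lemma finite_all_edges: "finite (all_edges n)"
  unfolding all_edges_eq by simp

lemma orientation_eq_iff:
  assumes "is_orientation E Or" "is_orientation E Or'" "\<And>u v. u < v \<Longrightarrow> (u, v) \<in> Or \<longleftrightarrow> (u, v) \<in> Or'"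
  shows "Or = (Or' :: (nat \<times> nat) set)"
proof -
  have half: "O1 \<subseteq> O2" if o1: "is_orientation E O1" and o2: "is_orientation E O2"
    and e: "\<And>u v. u < v \<Longrightarrow> (u, v) \<in> O1 \<longleftrightarrow> (u, v) \<in> O2" for O1 O2 :: "(nat \<times> nat) set"
  proof
    fix x assume x: "x \<in> O1"
    obtain u v where uv: "x = (u, v)" by force
    have E: "{u, v} \<in> E" "u \<noteq> v" using o1 x uv unfolding is_orientation_def by blast+
    show "x \<in> O2"
    proof (cases "u < v")
      case True
      then show ?thesis using e x uv by blast
    next
      case False
      then have "v < u" using E(2) by simp
      have "(v, u) \<notin> O1" using o1 E x uv unfolding is_orientation_def by blast
      then have "(v, u) \<notin> O2" using e[OF \<open>v < u\<close>] by blast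
      then show ?thesis using o2 E uv unfolding is_orientation_def by blast
    qed
  qed
  show ?thesis using half[OF assms(1,2,3)] half[OF assms(2,1)] assms(3) by blast
qed

definition arcs_of :: "nat set set \<Rightarrow> nat set set \<Rightarrow> (nat \<times> nat) set" where
  "arcs_of E S = {(u, v). arc E S u v}"

lemma is_orientation_arcs_of: "is_orientation E (arcs_of E S)"
  unfolding is_orientation_def arcs_of_def using arc_cases[of _ _ E S] by (auto simp: arc_def)

lemma inj_arcs_of:
  assumes "E \<subseteq> edges_on V"
  shows "inj_on (arcs_of E) (Pow E)"
proof (rule inj_onI)
  fix S T assume ST: "S \<in> Pow E" "T \<in> Pow E" "arcs_of E S = arcs_of E T"
  have "e \<in> S \<longleftrightarrow> e \<in> T" if e: "e \<in> E" for e
  proof -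
    obtain a b where ab: "e = {a, b}" "a \<in> V" "b \<in> V" "a \<noteq> b" by (rule edges_onE[OF subsetD[OF assms e]])
    have "(a, b) \<in> arcs_of E S \<longleftrightarrow> (a, b) \<in> arcs_of E T" using ST(3) by simp
    then show ?thesis using e ab unfolding arcs_of_def arc_def by auto
  qed
  then show "S = T" using ST by blast
qed

section \<open>Passage between orientations and edge sets\<close>

context anti_fan
begin

text \<open>Recording the upward edges is injective on orientations, and a fan found through this
  encoding is a copy in the original orientation.\<close>

lemma card_orientations_le:
  assumes E: "E \<subseteq> all_edges n"
  shows "card {Or. is_orientation E Or \<and> \<not> contains_dicopy n (fan_vertices 2 (Suc p), A) Or} \<le> card (FF E)"
proof -
  let ?O = "{Or. is_orientation E Or \<and> \<not> contains_dicopy n (fan_vertices 2 (Suc p), A) Or}"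
  define bits where "bits = (\<lambda>Or :: (nat \<times> nat) set. {e \<in> E. \<exists>u v. e = {u, v} \<and> u < v \<and> (u, v) \<in> Or})"
  have fE: "finite E" by (rule finite_subset[OF E finite_all_edges])
  have mem: "{u, v} \<in> bits Or \<longleftrightarrow> (u, v) \<in> Or" if "is_orientation E Or" "u < v" for Or u v
  proof
    assume "{u, v} \<in> bits Or"
    then obtain a b where ab: "{u, v} = {a, b}" "a < b" "(a, b) \<in> Or" unfolding bits_def by blast
    have "u = a \<and> v = b \<or> u = b \<and> v = a" using ab(1) by (simp only: doubleton_eq_iff)
    then have "u = a \<and> v = b" using ab(2) that(2) by linarith
    then show "(u, v) \<in> Or" using ab(3) by simp
  next
    assume "(u, v) \<in> Or"
    moreover from this have "{u, v} \<in> E" using that(1) unfolding is_orientation_def by blast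
    ultimately show "{u, v} \<in> bits Or" unfolding bits_def using that(2) by blast
  qed
  have arc_mem: "(u, v) \<in> Or" if o: "is_orientation E Or" and a: "arc E (bits Or) u v" for Or u v
  proof (cases "u < v")
    case True
    then show ?thesis using mem[OF o True] a unfolding arc_def by blast
  next
    case False
    then have vu: "v < u" using a unfolding arc_def by simp
    have "{v, u} \<notin> bits Or" using a False unfolding arc_def by (simp add: insert_commute)
    then have "(v, u) \<notin> Or" using mem[OF o vu] by blast
    then show ?thesis using o a unfolding arc_def is_orientation_def by blast
  qed
  have "inj_on bits ?O"
  proof (rule inj_onI)
    fix Or Or' assume o: "Or \<in> ?O" "Or' \<in> ?O" "bits Or = bits Or'"
    have io: "is_orientation E Or" "is_orientation E Or'" using o by simp_all
    show "Or = Or'"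
    proof (rule orientation_eq_iff[OF io])
      fix u v :: nat assume "u < v"
      then show "(u, v) \<in> Or \<longleftrightarrow> (u, v) \<in> Or'" using mem[OF io(1)] mem[OF io(2)] o(3) by metis
    qed
  qed
  moreover have "bits ` ?O \<subseteq> FF E"
  proof
    fix S assume "S \<in> bits ` ?O"
    then obtain Or where Or: "is_orientation E Or" "\<not> contains_dicopy n (fan_vertices 2 (Suc p), A) Or" "S = bits Or" by blast
    have "\<not> fan_in E S"
    proof
      assume "fan_in E S"
      then obtain f where f: "inj_on f {..2*p}" "\<And>x y. (x, y) \<in> A \<Longrightarrow> arc E S (f x) (f y)" unfolding fan_in_def by blast
      \<comment> \<open>A copy must lie below \<open>n\<close>, and \<open>fan_in\<close> does not
        bound the images. Every fan vertex has a neighbour, so its image lies on an edge of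
        \<open>E\<close> and hence below \<open>n\<close>.\<close>
      have range: "f x < n" if x: "x \<in> {..2*p}" for x
      proof -
        have "\<exists>y. fan_adj p x y"
        proof (cases "x = 0")
          case True
          have "fan_adj p 0 1" unfolding fan_adj_def using p2 by (intro conjI exI[of _ 0]) auto
          then show ?thesis using True by blast
        next
          case False
          then have "x \<in> blk p 0 \<or> x \<in> blk p 1" using x by auto
          then have "\<exists>a<2. x \<in> blk p a" by (metis one_less_numeral_iff pos2 semiring_norm(76))
          then have "fan_adj p x 0" unfolding fan_adj_def using False by blast
          then show ?thesis by blast
        qed
        then obtain y where y: "fan_adj p x y" by blast
        then have "(x, y) \<in> A \<or> (y, x) \<in> A" using A_orient by blast
        then have "{f x, f y} \<in> E" using f(2)[of x y] f(2)[of y x] unfolding arc_def by (auto simp: insert_commute)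
        then have "{f x, f y} \<in> edges_on {..<n}" using E unfolding all_edges_eq by blast
        then obtain a b where "{f x, f y} = {a, b}" "a \<in> {..<n}" "b \<in> {..<n}" "a \<noteq> b" by (rule edges_onE)
        then show ?thesis by (auto simp: doubleton_eq_iff)
      qed
      have "contains_dicopy n (fan_vertices 2 (Suc p), A) Or"
        unfolding contains_dicopy_def fst_conv snd_conv fan_vertices_eq
      proof (intro exI[of _ f] conjI f(1))
        show "f ` {..2*p} \<subseteq> {..<n}" using range by blast
        show "\<forall>(x, y)\<in>A. (f x, f y) \<in> Or" using arc_mem[OF Or(1)] f(2) Or(3) by blast
      qed
      then show False using Or(2) by blast
    qed
    then show "S \<in> FF E" unfolding FF_def Or(3) bits_def by blast
  qed
  ultimately show ?thesis using card_inj_on_le finite_FF[OF fE] by blast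
qed

text \<open>A directed copy of the fan has an undirected copy underneath, so all
  \<open>2 ^ card E\<close> orientations of a fan-free graph count.\<close>

lemma card_orientations_ge:
  assumes E: "E \<subseteq> all_edges n" and free: "\<not> contains_copy n (fan 2 (Suc p)) E"
  shows "2 ^ card E \<le> card {Or. is_orientation E Or \<and> \<not> contains_dicopy n (fan_vertices 2 (Suc p), A) Or}"
proof -
  let ?O = "{Or. is_orientation E Or \<and> \<not> contains_dicopy n (fan_vertices 2 (Suc p), A) Or}"
  have fE: "finite E" by (rule finite_subset[OF E finite_all_edges])
  have nodi: "\<not> contains_dicopy n (fan_vertices 2 (Suc p), A) Or" if o: "is_orientation E Or" for Or
  proof
    assume "contains_dicopy n (fan_vertices 2 (Suc p), A) Or"
    then obtain f where f: "inj_on f (fan_vertices 2 (Suc p))" "f ` fan_vertices 2 (Suc p) \<subseteq> {..<n}" "\<forall>(x, y)\<in>A. (f x, f y) \<in> Or"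
      unfolding contains_dicopy_def by auto
    have "f ` e \<in> E" if e: "e \<in> fan_edges 2 (Suc p)" for e
    proof -
      obtain u v where uv: "e = {u, v}" "fan_adj p u v" using e unfolding fan_edges_eq by blast
      then have "(u, v) \<in> A \<or> (v, u) \<in> A" using A_orient by blast
      then have "(f u, f v) \<in> Or \<or> (f v, f u) \<in> Or" using f(3) by blast
      then have "{f u, f v} \<in> E \<or> {f v, f u} \<in> E" using o unfolding is_orientation_def by blast
      then show ?thesis unfolding uv(1) by (simp add: insert_commute)
    qed
    then have "contains_copy n (fan 2 (Suc p)) E" unfolding contains_copy_def fan_def using f by auto
    then show False using free by blast
  qed
  have "finite {Or. is_orientation E Or}"
  proof (rule finite_subset)
    show "{Or. is_orientation E Or} \<subseteq> Pow ({..<n} \<times> {..<n})"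
    proof (intro subsetI PowI)
      fix Or x assume o: "Or \<in> {Or. is_orientation E Or}" and x: "x \<in> Or"
      obtain u v where uv: "x = (u, v)" by force
      have "{u, v} \<in> E" using o x uv unfolding is_orientation_def by blast
      then have "{u, v} \<in> edges_on {..<n}" using E unfolding all_edges_eq by blast
      then obtain a b where "{u, v} = {a, b}" "a \<in> {..<n}" "b \<in> {..<n}" "a \<noteq> b" by (rule edges_onE)
      then show "x \<in> {..<n} \<times> {..<n}" using uv by (auto simp: doubleton_eq_iff)
    qed
  qed simp
  then have fO: "finite ?O" by (rule rev_finite_subset) blast
  have "arcs_of E ` Pow E \<subseteq> ?O" using nodi is_orientation_arcs_of by blast
  then have "card (arcs_of E ` Pow E) \<le> card ?O" by (rule card_mono[OF fO])
  also have "card (arcs_of E ` Pow E) = card (Pow E)" by (rule card_image[OF inj_arcs_of[OF E[unfolded all_edges_eq]]])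
  finally show ?thesis using fE by (simp add: card_Pow)
qed

end

text \<open>The extra edge \<open>{0, p}\<close> joins two vertices of the same residue modulo
  \<open>p\<close>. A clique on \<open>p + 1\<close> vertices has two vertices of equal residue and
  so contains this edge; the two blocks of a fan share only the centre and cannot both contain
  it.\<close>

lemma turan_plus_edge_fan_free:
  assumes p: "2 \<le> p" and n: "p < n"
  shows "\<exists>E\<subseteq>all_edges n. card E = turan_num n p + 1 \<and> \<not> contains_copy n (fan 2 (Suc p)) E"
proof -
  define T where "T = {{u, v} | u v. u < n \<and> v < n \<and> u mod p \<noteq> v mod p}"
  define E where "E = insert {0, p} T"
  have Tsub: "T \<subseteq> all_edges n"
  proof
    fix e assume "e \<in> T"
    then obtain u v where "e = {u, v}" "u < n" "v < n" "u mod p \<noteq> v mod p" unfolding T_def by blast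
    moreover from this have "u \<noteq> v" by blast
    ultimately show "e \<in> all_edges n" unfolding all_edges_def by blast
  qed
  have e0: "{0, p} \<in> all_edges n" unfolding all_edges_def using p n
    by (intro CollectI exI[of _ 0] exI[of _ p]) simp
  have Tmod: "u mod p \<noteq> v mod p" if "{u, v} \<in> T" for u v
  proof -
    obtain a b where ab: "{u, v} = {a, b}" "a mod p \<noteq> b mod p" using \<open>{u, v} \<in> T\<close> unfolding T_def by blast
    have "u = a \<and> v = b \<or> u = b \<and> v = a" using ab(1) by (simp only: doubleton_eq_iff)
    then show ?thesis using ab(2) by metis
  qed
  have "{0, p} \<notin> T" using Tmod[of 0 p] by auto
  then have cE: "card E = turan_num n p + 1"
    unfolding E_def turan_num_def T_def[symmetric] using finite_subset[OF Tsub finite_all_edges] by simp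
  have "\<not> contains_copy n (fan 2 (Suc p)) E"
  proof
    assume "contains_copy n (fan 2 (Suc p)) E"
    then obtain f where f: "inj_on f {..2*p}" "\<And>e. e \<in> fan_edges 2 (Suc p) \<Longrightarrow> f ` e \<in> E"
      unfolding contains_copy_def fan_def fst_conv snd_conv fan_vertices_eq by blast
    have "\<exists>x\<in>insert 0 (blk p a). \<exists>y\<in>insert 0 (blk p a). x \<noteq> y \<and> {f x, f y} = {0, p}" if a: "a < 2" for a
    proof -
      let ?B = "insert 0 (blk p a)"
      have "card ?B = Suc p" by (subst card_insert_disjoint) auto
      moreover have "(\<lambda>x. f x mod p) ` ?B \<subseteq> {..<p}" using p by auto
      then have "card ((\<lambda>x. f x mod p) ` ?B) \<le> p" using card_mono[of "{..<p}"] by fastforce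
      ultimately have "\<not> inj_on (\<lambda>x. f x mod p) ?B" using card_image[of "\<lambda>x. f x mod p" ?B] by linarith
      then obtain x y where xy: "x \<in> ?B" "y \<in> ?B" "x \<noteq> y" "f x mod p = f y mod p" unfolding inj_on_def by blast
      have "fan_adj p x y" unfolding fan_adj_def using xy a by blast
      then have "f ` {x, y} \<in> E" by (intro f(2)) (simp add: fan_edge_iff)
      then have "{f x, f y} \<in> E" by simp
      then have dis: "{f x, f y} = {0, p} \<or> {f x, f y} \<in> T" unfolding E_def insert_iff .
      have nT: "{f x, f y} \<notin> T"
      proof
        assume "{f x, f y} \<in> T"
        from Tmod[OF this] show False using xy(4) by simp
      qed
      have "{f x, f y} = {0, p}" by (rule disjE[OF dis]) (assumption, rule notE[OF nT])
      then show ?thesis using xy by blast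
    qed
    note ex = this
    have one_less_two_nat: "(1::nat) < 2" by simp
    obtain x y where xy: "x \<in> insert 0 (blk p 0)" "y \<in> insert 0 (blk p 0)" "x \<noteq> y" "{f x, f y} = {0, p}"
      using ex[OF pos2] by blast
    obtain z w where zw: "z \<in> insert 0 (blk p 1)" "w \<in> insert 0 (blk p 1)" "z \<noteq> w" "{f z, f w} = {0, p}"
      using ex[OF one_less_two_nat] by blast
    have "f ` {x, y} = f ` {z, w}" using xy(4) zw(4) by simp
    moreover have "{x, y} \<subseteq> {..2*p}" "{z, w} \<subseteq> {..2*p}" using xy(1,2) zw(1,2) by auto
    ultimately have "{x, y} = {z, w}" using inj_on_image_eq_iff[OF f(1)] by blast
    then have "x \<in> {z, w}" "y \<in> {z, w}" by auto
    then have "x = 0" "y = 0" using xy(1,2) zw(1,2) by auto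
    then show False using xy(3) by simp
  qed
  then show ?thesis using Tsub e0 cE unfolding E_def by blast
qed

text \<open>A sandwich, with \<open>t\<close> the Turan number: the Turan graph with an extra edge
  gives that the extremal number is at least \<open>t + 1\<close>, the orientations of an extremal
  graph give \<open>2 ^ ex \<le> D\<close>, and the bound on fan-free orientations gives
  \<open>D \<le> 2 ^ (t + 1)\<close>. The extremal number itself is thus obtained from counting
  orientations.\<close>

theorem mainTheorem4:
  fixes r :: nat and A :: "(nat \<times> nat) set"
  assumes "r \<ge> 2"
    and "anti_directed 2 r A"
  shows "\<exists>N. \<forall>n \<ge> N.
           D n (fan_vertices 2 r, A) = 2 ^ ex n (fan 2 r) \<and>
           ex n (fan 2 r) = turan_num n (r - 1) + 1"
proof -
  define p where "p = r - 1"
  have "r \<noteq> 2" using not_anti_directed_2 assms(2) by metis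
  then have r: "r = Suc p" and p: "2 \<le> p" unfolding p_def using assms(1) by auto
  interpret anti_fan p A by (rule anti_directed_anti_fan[OF p]) (use assms(2) r in simp)
  obtain n1 where n1: "\<forall>V E. finite V \<longrightarrow> n1 \<le> card V \<longrightarrow> E \<subseteq> edges_on V \<longrightarrow> card (FF E) \<le> 2 ^ (turan_num (card V) p + 1)"
    using fan_free_orientations_bound by (elim exE)
  show ?thesis
  \<comment> \<open>\<open>Suc p\<close> guarantees \<open>p < n\<close>, so that the vertex
    \<open>p\<close> of the extra edge exists.\<close>
  proof (intro exI[of _ "n1 + Suc p"] allI impI)
    fix n assume n: "n1 + Suc p \<le> n"
    let ?O = "\<lambda>E. {Or. is_orientation E Or \<and> \<not> contains_dicopy n (fan_vertices 2 r, A) Or}"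
    let ?t = "turan_num n p + 1"
    define DS where "DS = {card (?O E) | E. E \<subseteq> all_edges n}"
    define XS where "XS = {card E | E. E \<subseteq> all_edges n \<and> \<not> contains_copy n (fan 2 r) E}"
    have DS: "D n (fan_vertices 2 r, A) = Max DS" unfolding D_def DS_def ..
    have XS: "ex n (fan 2 r) = Max XS" unfolding ex_def XS_def ..
    have fD: "finite DS"
    proof (rule finite_subset)
      show "DS \<subseteq> (\<lambda>E. card (?O E)) ` Pow (all_edges n)" unfolding DS_def by blast
    qed (use finite_all_edges in simp)
    have fX: "finite XS"
    proof (rule finite_subset)
      show "XS \<subseteq> card ` Pow (all_edges n)" unfolding XS_def by blast
    qed (use finite_all_edges in simp)
    obtain E0 where E0: "E0 \<subseteq> all_edges n" "card E0 = ?t" "\<not> contains_copy n (fan 2 (Suc p)) E0"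
      using turan_plus_edge_fan_free[OF p] n by (metis Suc_le_lessD add_leD2)
    have tX: "?t \<in> XS" unfolding XS_def r using E0 by (metis (mono_tags, lifting) mem_Collect_eq)
    have D_le: "d \<le> 2 ^ ?t" if "d \<in> DS" for d
    proof -
      obtain E where E: "d = card (?O E)" "E \<subseteq> all_edges n" using \<open>d \<in> DS\<close> unfolding DS_def by blast
      have "d \<le> card (FF E)" unfolding E(1) r by (rule card_orientations_le[OF E(2)])
      also have "\<dots> \<le> 2 ^ (turan_num (card {..<n}) p + 1)"
        by (rule n1[rule_format]) (use E(2) n in \<open>simp_all add: all_edges_eq\<close>)
      finally show ?thesis by simp
    qed
    have X_D: "\<exists>d\<in>DS. 2 ^ x \<le> d" if x: "x \<in> XS" for x
    proof -
      obtain E where E: "x = card E" "E \<subseteq> all_edges n" "\<not> contains_copy n (fan 2 (Suc p)) E" using x unfolding XS_def r by blast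
      have "2 ^ x \<le> card (?O E)" unfolding E(1) r by (rule card_orientations_ge[OF E(2,3)])
      moreover have "card (?O E) \<in> DS" unfolding DS_def using E(2) by blast
      ultimately show ?thesis by blast
    qed
    have X_le: "x \<le> ?t" if x: "x \<in> XS" for x
    proof -
      obtain d where "d \<in> DS" "2 ^ x \<le> d" using X_D[OF x] by blast
      then have "(2::nat) ^ x \<le> 2 ^ ?t" using D_le by (meson order.trans)
      then show ?thesis by (simp only: power_increasing_iff one_less_numeral_iff semiring_norm)
    qed
    have ex: "ex n (fan 2 r) = ?t" unfolding XS by (rule Max_eqI[OF fX X_le tX])
    obtain d where d: "d \<in> DS" "2 ^ ?t \<le> d" using X_D[OF tX] by blast
    then have tD: "2 ^ ?t \<in> DS" using D_le[OF d(1)] by simp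
    have "D n (fan_vertices 2 r, A) = 2 ^ ?t" unfolding DS by (rule Max_eqI[OF fD D_le tD])
    then show "D n (fan_vertices 2 r, A) = 2 ^ ex n (fan 2 r) \<and> ex n (fan 2 r) = turan_num n (r - 1) + 1"
      unfolding ex p_def by simp
  qed
qed

end
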